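(* For any multi-index $m=(m_1,\dots,m_n)$ of positive integers, $$\langle\!\langle m\rangle\!\rangle=\sum_{\alpha\in\Pi_n}(-1)^{\ell(\alpha)-1}(\ell(\alpha)-2)!\sum_{d}\frac{1}{d!}\prod_{k=1}^{\ell(\alpha)}|m_{\alpha_k}|!\ \mathfrak{z}\big(|m_{\alpha_k}|-|\alpha_k|-d_k+1\big),$$ where $|m_{\alpha_k}|=\sum_{i\in\alpha_k}m_i$, $d!=\prod_k d_k!$, and the inner summation is over all $\ell(\alpha)$-tuples $d=(d_1,\dots,d_{\ell(\alpha)})$ of nonnegative integers such that $\sum_k d_k=\ell(\alpha)-2$ and $d_k\equiv 1+|m_{\alpha_k}|-|\alpha_k|\pmod 2$ for $k=1,\dots,\ell(\alpha)$. The term of the sum corresponding to the one-block partition $\alpha$ (for which $\ell(\alpha)=1$) is to be understood as $|m|!\,\mathfrak{z}(|m|-n+2)$, where $|m|=\sum_i m_i$.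
   Context: $\Pi_n$ is the set of set partitions of $\{1,\dots,n\}$; $\ell(\alpha)$ is the number of blocks $\alpha_1,\dots,\alpha_{\ell(\alpha)}$ of $\alpha$ and $|\alpha_k|$ is the size of a block. For an integer $k$, $$\mathfrak{z}(k)=\begin{cases}(2-2^{2-k})\,\zeta(k), & k\text{ even},\\ 0,& k\text{ odd},\end{cases}$$ with $\zeta$ the Riemann zeta function (so $\mathfrak{z}(0)=1$ and $\mathfrak{z}(k)=0$ for $k<0$). For a partition $\lambda=(\lambda_1\ge\lambda_2\ge\dots)$ and $k\ge1$ put $p_k(\lambda)=\sum_{i=1}^\infty[(\lambda_i-i+\frac12)^k-(-i+\frac12)^k]+(1-2^{-k})\zeta(-k)$. For polynomials $F,F_1,\dots,F_s$ in the $p_k$ and $|q|<1$, $$\langle F\rangle_q=\prod_{n\ge1}(1-q^n)\sum_\lambda q^{|\lambda|}F(\lambda),\qquad \langle F_1|\cdots|F_s\rangle_q=\sum_{\alpha\in\Pi_s}(-1)^{\ell(\alpha)-1}(\ell(\alpha)-1)!\prod_{k=1}^{\ell(\alpha)}\Big\langle\prod_{i\in\alpha_k}F_i\Big\rangle_q,$$ the first sum being over all partitions $\lambda$. Setting $q=e^{-h}$, as $h\to+0$ these quantities equal a polynomial in $h^{-1}$ plus an exponentially small error $O(e^{-\mathrm{const}/h}/h^{\mathrm{const}})$; $\langle F_1|\cdots|F_s\rangle_h$ denotes that polynomial. The elementary cumulant $\langle\!\langle m\rangle\!\rangle=\langle\!\langle m_1,\dots,m_n\rangle\!\rangle$ is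 defined as the coefficient in $$\langle p_{m_1}|\cdots|p_{m_n}\rangle_h=\frac{\langle\!\langle m\rangle\!\rangle}{h^{|m|+1}}+\dots,$$ where the dots stand for terms of lower degree in $h^{-1}$. *)

theory Defs
  imports
    "HOL-Complex_Analysis.Complex_Analysis"
    "HOL-Computational_Algebra.Polynomial"
    "HOL-Library.Disjoint_Sets"
    "HOL-Library.FuncSet"
    "HOL-Library.Landau_Symbols"
    "HOL-Number_Theory.Cong"
begin

text \<open>
  The Riemann zeta function, as the analytic continuation of its Dirichlet series.
  The two conditions determine it everywhere except at the pole \<open>1\<close>,
  where it is never evaluated below.
\<close>

definition zeta :: "complex \<Rightarrow> complex" where
  "zeta = (SOME f. f holomorphic_on - {1} \<and>
     (\<forall>s. Re s > 1 \<longrightarrow> (\<lambda>n. 1 / of_nat (Suc n) powr s) sums f s))"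

text \<open>\<open>\<zeta>(k)\<close> is real for every integer \<open>k \<noteq> 1\<close>, so taking the real part only changes the type.\<close>

definition zeta_int :: "int \<Rightarrow> real" where
  "zeta_int k = Re (zeta (of_int k))"

definition zfrak :: "int \<Rightarrow> real" where
  "zfrak k = (if even k then (2 - 2 powi (2 - k)) * zeta_int k else 0)"

definition set_partitions :: "nat \<Rightarrow> nat set set set" where
  "set_partitions n = {\<alpha>. partition_on {1..n} \<alpha>}"

text \<open>
  A partition \<open>\<lambda>\<^sub>1 \<ge> \<lambda>\<^sub>2 \<ge> \<dots>\<close> is a weakly decreasing, finitely supported sequence.
  Sequences start at index 0, so that \<open>\<lambda>\<^sub>i\<close> is \<open>lam (i - 1)\<close>;
  hence \<open>- i + 1/2\<close> turns into \<open>- real i - 1/2\<close> in \<open>p\<close> below.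
\<close>

definition partitions :: "(nat \<Rightarrow> nat) set" where
  "partitions = {lam. antimono lam \<and> finite {i. lam i \<noteq> 0}}"

definition psize :: "(nat \<Rightarrow> nat) \<Rightarrow> nat" where
  "psize lam = (\<Sum>i | lam i \<noteq> 0. lam i)"

definition p :: "nat \<Rightarrow> (nat \<Rightarrow> nat) \<Rightarrow> real" where
  "p k lam = (\<Sum>i. (real (lam i) - real i - 1/2) ^ k - (- real i - 1/2) ^ k)
     + (1 - 2 powi (- int k)) * zeta_int (- int k)"

definition q_bracket :: "((nat \<Rightarrow> nat) \<Rightarrow> real) \<Rightarrow> real \<Rightarrow> real" where
  "q_bracket F q = (\<Prod>n. 1 - q ^ Suc n) * (\<Sum>\<^sub>\<infinity>lam\<in>partitions. q ^ psize lam * F lam)"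

text \<open>The connected bracket \<open>\<langle>F\<^sub>1 | \<dots> | F\<^sub>s\<rangle>\<^sub>q\<close>; only the values of \<open>F\<close> at \<open>1, \<dots>, s\<close> matter.\<close>

definition connected_q_bracket ::
    "nat \<Rightarrow> (nat \<Rightarrow> (nat \<Rightarrow> nat) \<Rightarrow> real) \<Rightarrow> real \<Rightarrow> real" where
  "connected_q_bracket s F q =
     (\<Sum>\<alpha>\<in>set_partitions s. (-1) ^ (card \<alpha> - 1) * fact (card \<alpha> - 1) *
        (\<Prod>B\<in>\<alpha>. q_bracket (\<lambda>lam. \<Prod>i\<in>B. F i lam) q))"

text \<open>
  \<open>\<langle>F\<^sub>1 | \<dots> | F\<^sub>s\<rangle>\<^sub>h\<close> as a polynomial in the indeterminate \<open>h\<^sup>-\<^sup>1\<close>. An exponentially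
  small error tells different polynomials in \<open>1 / h\<close> apart, so there is at most one such \<open>P\<close>.
\<close>

definition connected_h_bracket ::
    "nat \<Rightarrow> (nat \<Rightarrow> (nat \<Rightarrow> nat) \<Rightarrow> real) \<Rightarrow> real poly" where
  "connected_h_bracket s F = (THE P. \<exists>c>0. \<exists>C.
     (\<lambda>h. connected_q_bracket s F (exp (- h)) - poly P (1 / h))
       \<in> O[at_right 0](\<lambda>h. exp (- c / h) / h powr C))"

definition elementary_cumulant :: "nat \<Rightarrow> (nat \<Rightarrow> nat) \<Rightarrow> real" where
  "elementary_cumulant n m =
     coeff (connected_h_bracket n (\<lambda>i. p (m i))) ((\<Sum>i=1..n. m i) + 1)"

end

theory Submission
  imports Defs "HOL-Real_Asymp.Real_Asymp"
begin

text \<open>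
  Write a partition as a neutral set of particles and holes on the half-integers. The bracket then is the
  charge-zero Fourier coefficient, over \<open>\<theta> \<in> [-\<pi>, \<pi>]\<close>, of a product over independent sites, in which the moments of
  the \<open>p\<^sub>k\<close> are exponentials over set partitions of derivatives of Fermi-Dirac sums at \<open>y = \<i> \<theta>\<close>.
  The generating function of these sums is periodic in \<open>y\<close> up to an exponential factor and extends to a wide
  strip, so its non-constant Fourier modes are exponentially small: near \<open>\<theta> = 0\<close> each sum equals an explicit polynomial
  in \<open>y\<close> with coefficients \<open>zfrak k\<close>, and the weight is the Gaussian of variance \<open>h\<close>; far from \<open>\<theta> = 0\<close> everything is negligible.
  The connected brackets thus become Gaussian cumulants. Gaussian integration by parts exhibits them as polynomials
  in \<open>h\<close> divided by a power of \<open>h\<close>, and evaluating the resulting recursion at \<open>h = 0\<close> gives the sum over set partitions.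
\<close>

section \<open>Exponential and logarithm over set partitions\<close>

text \<open>Three obstacles shape the proof. The zeta constants in \<open>p\<close> are values of a
  function chosen by \<open>SOME\<close>, so an entire function representing it is built, and its
  values at the nonpositive integers are read off as Bernoulli numbers. Their role is structural:
  the boundary term left when the summation index is shifted is absorbed exactly by these constants,
  and only so is the generating function quasi-periodic. Limits come late: each algebraic identity
  is proved for the sites in a finite window, divided by the window's partition function at \<theta>
  = 0, and then passed to the limit by dominated convergence; the normalisation cancels because a
  bracket is a ratio of two such integrals. Finally, moments and cumulants are functions of finite
  index sets, multiplied like power series in variables of square zero, so exponential and logarithm
  are finite sums over set partitions, and the cumulants come out of a terminating recursion. The
  degree bound in h that this recursion provides is what makes the answer a polynomial in 1 / h with
  top power |m| + 1.\<close>

definition sconv :: "('i set \<Rightarrow> 'a::comm_ring_1) \<Rightarrow> ('i set \<Rightarrow> 'a) \<Rightarrow> 'i set \<Rightarrow> 'a" where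
  "sconv f g B = (\<Sum>A\<in>Pow B. f A * g (B - A))"

definition sone :: "'i set \<Rightarrow> 'a::comm_ring_1" where
  "sone B = (if B = {} then 1 else 0)"

text \<open>A set function is read as a power series in one variable per index with all squares
  zero, f(B) being the coefficient of the product of the variables in B. Then \<open>sconv\<close>
  is the product, \<open>sone\<close> the unit, and \<open>pexp\<close> the exponential of a series
  without constant term: the factor 1 / l! is used up by listing the l blocks without order.\<close>

definition pexp :: "('i set \<Rightarrow> 'a::comm_ring_1) \<Rightarrow> 'i set \<Rightarrow> 'a" where
  "pexp \<kappa> B = (\<Sum>\<pi> | partition_on B \<pi>. \<Prod>C\<in>\<pi>. \<kappa> C)"

text \<open>The logarithm of a series with constant term 1, where (- 1)^(l - 1) / l has become (-
  1)^(l - 1) (l - 1)! for unordered blocks. \<open>connected_q_bracket\<close> is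
  \<open>plog\<close> of the brackets. The value at the empty set is 1, which does no harm because
  blocks are nonempty.\<close>

definition plog :: "('i set \<Rightarrow> 'a::{comm_ring_1,ring_char_0}) \<Rightarrow> 'i set \<Rightarrow> 'a" where
  "plog \<mu> B = (\<Sum>\<pi> | partition_on B \<pi>. (- 1) ^ (card \<pi> - 1) * fact (card \<pi> - 1) * (\<Prod>C\<in>\<pi>. \<mu> C))"

text \<open>A partition of \<open>insert a B\<close> is determined by the block
  \<open>insert a A\<close> of \<open>a\<close> and a partition of what remains. In power series
  terms this is differentiation in the variable of \<open>a\<close>; the recursions that add one
  index to a set rest on it.\<close>

lemma sum_partition_on_insert:
  assumes B: "finite B" and a: "a \<notin> B"
  shows "(\<Sum>\<pi> | partition_on (insert a B) \<pi>. \<Phi> \<pi>) =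
    (\<Sum>A\<in>Pow B. \<Sum>\<pi> | partition_on (B - A) \<pi>. \<Phi> (insert (insert a A) \<pi>))"
proof -
  have fin: "finite {\<pi>. partition_on (B - A) \<pi>}" for A
    using B by (intro finitely_many_partition_on) auto
  have block: "\<exists>C\<in>\<pi>. a \<in> C" if "partition_on (insert a B) \<pi>" for \<pi>
    using partition_onD1[OF that] by auto
  define blk where "blk \<pi> = (THE C. C \<in> \<pi> \<and> a \<in> C)" for \<pi> :: "'a set set"
  have blk_eq: "blk \<pi> = C" if "partition_on D \<pi>" "C \<in> \<pi>" "a \<in> C" for \<pi> C D
    unfolding blk_def using that partition_onD2[OF that(1)]
    by (intro the_equality) (auto simp: disjoint_def)
  have nin: "insert a A \<notin> \<pi>" if "partition_on (B - A) \<pi>" for A \<pi>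
    using partition_onD1[OF that] a by auto
  have "(\<Sum>A\<in>Pow B. \<Sum>\<pi> | partition_on (B - A) \<pi>. \<Phi> (insert (insert a A) \<pi>))
     = (\<Sum>(A, \<pi>)\<in>(SIGMA A:Pow B. {\<pi>. partition_on (B - A) \<pi>}). \<Phi> (insert (insert a A) \<pi>))"
    using B fin by (intro sum.Sigma) auto
  also have "\<dots> = (\<Sum>\<pi> | partition_on (insert a B) \<pi>. \<Phi> \<pi>)"
  proof -
    have 1: "partition_on (insert a B) (insert (insert a A) \<pi>) \<and> blk (insert (insert a A) \<pi>) = insert a A
        \<and> insert (insert a A) \<pi> - {insert a A} = \<pi> \<and> insert a A - {a} = A"
      if A: "A \<subseteq> B" and p: "partition_on (B - A) \<pi>" for A \<pi>
    proof -
      have dis: "disjnt (insert a A) (\<Union>\<pi>)"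
        using partition_onD1[OF p] a by (auto simp: disjnt_def)
      have *: "partition_on (insert a B) (insert (insert a A) \<pi>)"
        using p A a by (subst partition_on_insert) (use dis in \<open>auto simp: insert_Diff_if\<close>)
      have "blk (insert (insert a A) \<pi>) = insert a A"
        by (rule blk_eq[OF *]) auto
      then show ?thesis using * nin[OF p] A a by auto
    qed
    have 2: "insert (insert a (blk \<pi> - {a})) (\<pi> - {blk \<pi>}) = \<pi> \<and> blk \<pi> - {a} \<subseteq> B
        \<and> partition_on (B - (blk \<pi> - {a})) (\<pi> - {blk \<pi>})"
      if p: "partition_on (insert a B) \<pi>" for \<pi>
    proof -
      obtain C where C: "C \<in> \<pi>" "a \<in> C" using block[OF p] by blast
      have b: "blk \<pi> = C" by (rule blk_eq[OF p C])
      have sub: "C \<subseteq> insert a B" using partition_onD1[OF p] C by auto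
      have dis: "disjnt C (\<Union>(\<pi> - {C}))"
        using partition_onD2[OF p] C by (auto simp: disjoint_def disjnt_def)
      have "partition_on (insert a B - C) (\<pi> - {C})"
        using partition_on_insert[OF dis, of "insert a B"] p C by (simp add: insert_absorb)
      moreover have "insert a B - C = B - (C - {a})" using C a by auto
      ultimately show ?thesis
        unfolding b using sub C by (auto simp: insert_absorb)
    qed
    show ?thesis
      apply (rule sum.reindex_bij_witness[where
        i = "\<lambda>\<pi>. (blk \<pi> - {a}, \<pi> - {blk \<pi>})" and j = "\<lambda>x. insert (insert a (fst x)) (snd x)"])
      subgoal for x using 1[of "fst x" "snd x"] by (cases x) auto
      subgoal for x using 1[of "fst x" "snd x"] by (cases x) auto
      subgoal for x using 2[of x] by auto
      subgoal for x using 2[of x] by auto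
      subgoal for x by (cases x) auto
      done
  qed
  finally show ?thesis by simp
qed

text \<open>Marking one block and then removing it: a partition with a marked block is the same as a
  nonempty A and a partition of \<open>B - A\<close>. It turns Leibniz sums over blocks into
  convolutions.\<close>

lemma sum_partition_on_marked:
  assumes B: "finite B"
  shows "(\<Sum>\<pi> | partition_on B \<pi>. \<Sum>A\<in>\<pi>. \<Phi> A (\<pi> - {A})) =
    (\<Sum>A\<in>Pow B - {{}}. \<Sum>\<pi> | partition_on (B - A) \<pi>. \<Phi> A \<pi>)"
proof -
  have fin: "finite {\<pi>. partition_on (B - A) \<pi>}" for A
    using B by (intro finitely_many_partition_on) auto
  have fin': "finite {\<pi>. partition_on B \<pi>}"
    using B by (intro finitely_many_partition_on) auto
  have "(\<Sum>\<pi> | partition_on B \<pi>. \<Sum>A\<in>\<pi>. \<Phi> A (\<pi> - {A}))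
     = (\<Sum>(\<pi>, A)\<in>(SIGMA \<pi>:{\<pi>. partition_on B \<pi>}. \<pi>). \<Phi> A (\<pi> - {A}))"
    using fin' B finite_elements by (intro sum.Sigma) blast+
  also have "\<dots> = (\<Sum>(A, \<pi>)\<in>(SIGMA A:Pow B - {{}}. {\<pi>. partition_on (B - A) \<pi>}). \<Phi> A \<pi>)"
  proof -
    have 1: "insert A (\<pi> - {A}) = \<pi> \<and> A \<subseteq> B \<and> A \<noteq> {} \<and> partition_on (B - A) (\<pi> - {A})"
      if p: "partition_on B \<pi>" and A: "A \<in> \<pi>" for A \<pi>
    proof -
      have dis: "disjnt A (\<Union>(\<pi> - {A}))"
        using partition_onD2[OF p] A by (auto simp: disjoint_def disjnt_def)
      have "partition_on (B - A) (\<pi> - {A})"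
        using partition_on_insert[OF dis, of B] p A by (simp add: insert_absorb)
      then show ?thesis
        using p A by (auto simp: partition_on_def)
    qed
    have 2: "insert A \<pi> - {A} = \<pi> \<and> partition_on B (insert A \<pi>)"
      if A: "A \<subseteq> B" "A \<noteq> {}" and p: "partition_on (B - A) \<pi>" for A \<pi>
    proof -
      have dis: "disjnt A (\<Union>\<pi>)"
        using partition_onD1[OF p] by (auto simp: disjnt_def)
      have *: "partition_on B (insert A \<pi>)"
        using p A by (subst partition_on_insert[OF dis]) auto
      have "A \<notin> \<pi>" using dis A by (auto simp: disjnt_def)
      then show ?thesis using * by auto
    qed
    show ?thesis
      apply (rule sum.reindex_bij_witness[where
        i = "\<lambda>x. (insert (fst x) (snd x), fst x)" and j = "\<lambda>x. (snd x, fst x - {snd x})"])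
      subgoal for x using 1[of "fst x" "snd x"] by (cases x) auto
      subgoal for x using 1[of "fst x" "snd x"] by (cases x) auto
      subgoal for x using 2[of "fst x" "snd x"] by (cases x) auto
      subgoal for x using 2[of "fst x" "snd x"] by (cases x) auto
      subgoal for x by (cases x) auto
      done
  qed
  also have "\<dots> = (\<Sum>A\<in>Pow B - {{}}. \<Sum>\<pi> | partition_on (B - A) \<pi>. \<Phi> A \<pi>)"
    using B fin by (intro sum.Sigma[symmetric]) auto
  finally show ?thesis .
qed

text \<open>Both sides run over all ways to cut B into three labelled pieces; the piece
  \<open>D - A\<close> of the left side is E on the right.\<close>

lemma sum_Pow_nested:
  assumes B: "finite B"
  shows "(\<Sum>D\<in>Pow B. \<Sum>A\<in>Pow D. \<Psi> A (D - A) (B - D)) =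
    (\<Sum>A\<in>Pow B. \<Sum>E\<in>Pow (B - A). \<Psi> A E (B - A - E))"
proof -
  have "(\<Sum>D\<in>Pow B. \<Sum>A\<in>Pow D. \<Psi> A (D - A) (B - D)) =
      (\<Sum>(D, A)\<in>(SIGMA D:Pow B. Pow D). \<Psi> A (D - A) (B - D))"
    using B by (intro sum.Sigma) (auto intro: finite_subset)
  also have "\<dots> = (\<Sum>(A, E)\<in>(SIGMA A:Pow B. Pow (B - A)). \<Psi> A E (B - A - E))"
  proof -
    have 1: "A \<union> (D - A) = D \<and> B - A - (D - A) = B - D \<and> A \<subseteq> B \<and> D - A \<subseteq> B - A" if "D \<subseteq> B" "A \<subseteq> D" for A D
      using that by auto
    have 2: "A \<union> E - A = E \<and> A \<union> E \<subseteq> B \<and> A \<subseteq> A \<union> E" if "A \<subseteq> B" "E \<subseteq> B - A" for A E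
      using that by auto
    show ?thesis
      apply (rule sum.reindex_bij_witness[where i = "\<lambda>x. (fst x \<union> snd x, fst x)" and j = "\<lambda>x. (snd x, fst x - snd x)"])
      subgoal for x using 1[of "fst x" "snd x"] by (cases x) auto
      subgoal for x using 1[of "fst x" "snd x"] by (cases x) auto
      subgoal for x using 2[of "fst x" "snd x"] by (cases x) auto
      subgoal for x using 2[of "fst x" "snd x"] by (cases x) auto
      subgoal for x using 1[of "fst x" "snd x"] by (cases x) auto
      done
  qed
  also have "\<dots> = (\<Sum>A\<in>Pow B. \<Sum>E\<in>Pow (B - A). \<Psi> A E (B - A - E))"
    using B by (intro sum.Sigma[symmetric]) auto
  finally show ?thesis .
qed

lemma sconv_cong:
  assumes "\<And>A. A \<subseteq> B \<Longrightarrow> f A = f' A" "\<And>A. A \<subseteq> B \<Longrightarrow> g A = g' A"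
  shows "sconv f g B = sconv f' g' B"
  unfolding sconv_def by (intro sum.cong refl arg_cong2[where f = "(*)"]) (auto intro: assms)

lemma sconv_assoc:
  assumes "finite B"
  shows "sconv (sconv f g) k B = sconv f (sconv g k) B"
  using sum_Pow_nested[OF assms, of "\<lambda>A E F. f A * g E * k F"]
  by (simp add: sconv_def sum_distrib_left sum_distrib_right mult.assoc)

lemma sconv_commute: "sconv f g B = sconv g f B"
  unfolding sconv_def
  by (rule sum.reindex_bij_witness[where i = "\<lambda>A. B - A" and j = "\<lambda>A. B - A"])
     (auto simp: double_diff mult.commute)

lemma sconv_sone_right: "finite B \<Longrightarrow> sconv f sone B = f B"
proof -
  assume B: "finite B"
  have "sconv f sone B = (\<Sum>A\<in>Pow B. if A = B then f A else 0)"
    unfolding sconv_def by (intro sum.cong) (auto simp: sone_def)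
  then show ?thesis using B by simp
qed

lemma sconv_sone_left: "finite B \<Longrightarrow> sconv sone f B = f B"
  by (subst sconv_commute) (rule sconv_sone_right)

text \<open>The Leibniz rule: composing with \<open>insert a\<close> is the derivative in the
  variable of \<open>a\<close>.\<close>

lemma sconv_insert:
  assumes B: "finite B" "a \<notin> B"
  shows "sconv f g (insert a B) = sconv (\<lambda>A. f (insert a A)) g B + sconv f (\<lambda>A. g (insert a A)) B"
proof -
  have "sconv f g (insert a B) = (\<Sum>A\<in>Pow B. f A * g (insert a B - A)) + (\<Sum>A\<in>insert a ` Pow B. f A * g (insert a B - A))"
    unfolding sconv_def Pow_insert using B by (intro sum.union_disjoint) auto
  also have "(\<Sum>A\<in>Pow B. f A * g (insert a B - A)) = sconv f (\<lambda>A. g (insert a A)) B"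
    unfolding sconv_def using B by (intro sum.cong refl arg_cong2[where f = "(*)"] arg_cong[where f = g]) auto
  also have "(\<Sum>A\<in>insert a ` Pow B. f A * g (insert a B - A)) = (\<Sum>A\<in>Pow B. f (insert a A) * g (insert a B - insert a A))"
    using B by (subst sum.reindex) (auto simp: inj_on_def)
  also have "\<dots> = sconv (\<lambda>A. f (insert a A)) g B"
    unfolding sconv_def using B by (intro sum.cong refl arg_cong2[where f = "(*)"] arg_cong[where f = g]) auto
  finally show ?thesis by (simp add: add.commute)
qed

lemma pexp_empty [simp]: "pexp \<kappa> {} = 1"
  by (simp add: pexp_def partition_on_empty)

text \<open>The derivative of exp(\<kappa>) is \<kappa>' exp(\<kappa>); \<kappa>' belongs to the
  block of \<open>a\<close>.\<close>

lemma pexp_insert: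
  assumes B: "finite B" "a \<notin> B"
  shows "pexp \<kappa> (insert a B) = sconv (\<lambda>A. \<kappa> (insert a A)) (pexp \<kappa>) B"
proof -
  have "(\<Prod>C\<in>insert (insert a A) \<pi>. \<kappa> C) = \<kappa> (insert a A) * (\<Prod>C\<in>\<pi>. \<kappa> C)"
    if "partition_on (B - A) \<pi>" for A \<pi>
    using that B finite_elements[OF _ that] by (subst prod.insert) (auto dest: partition_onD1)
  then show ?thesis
    unfolding pexp_def sconv_def sum_partition_on_insert[OF B]
    by (auto simp: sum_distrib_left intro!: sum.cong)
qed

lemma pexp_cong:
  assumes "\<And>A. A \<subseteq> B \<Longrightarrow> A \<noteq> {} \<Longrightarrow> \<kappa> A = \<kappa>' A"
  shows "pexp \<kappa> B = pexp \<kappa>' B"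
  unfolding pexp_def
  by (intro sum.cong prod.cong refl assms) (auto simp: partition_on_def)

lemma plog_cong:
  assumes "\<And>A. A \<subseteq> B \<Longrightarrow> A \<noteq> {} \<Longrightarrow> \<kappa> A = \<kappa>' A"
  shows "plog \<kappa> B = plog \<kappa>' B"
  unfolding plog_def
  by (intro sum.cong prod.cong refl assms arg_cong2[where f = "(*)"]) (auto simp: partition_on_def)

text \<open>Both sides satisfy the same differential equation in the variable of some
  \<open>a\<close>, which determines them by induction on B.\<close>

lemma pexp_add:
  assumes "finite B"
  shows "pexp (\<lambda>C. \<kappa> C + \<kappa>' C) B = sconv (pexp \<kappa>) (pexp \<kappa>') B"
  using assms
proof (induction B rule: finite_psubset_induct)
  case (psubset B)
  show ?case
  proof (cases "B = {}")
    case True then show ?thesis by (simp add: sconv_def)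
  next
    case False
    then obtain a where "a \<in> B" by blast
    define D where "D = B - {a}"
    have D: "finite D" "a \<notin> D" "B = insert a D" and DB: "D \<subset> B"
      using psubset \<open>a \<in> B\<close> by (auto simp: D_def)
    let ?d = "\<lambda>f A. f (insert a A)"
    have fA: "finite A" if "A \<subseteq> D" for A using D(1) that finite_subset by blast
    have "pexp (\<lambda>C. \<kappa> C + \<kappa>' C) B = sconv (\<lambda>A. \<kappa> (insert a A) + \<kappa>' (insert a A)) (pexp (\<lambda>C. \<kappa> C + \<kappa>' C)) D"
      unfolding D(3) by (rule pexp_insert) fact+
    also have "\<dots> = sconv (\<lambda>A. \<kappa> (insert a A) + \<kappa>' (insert a A)) (sconv (pexp \<kappa>) (pexp \<kappa>')) D"
      using DB by (intro sconv_cong psubset.IH refl) auto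
    also have "\<dots> = sconv (?d \<kappa>) (sconv (pexp \<kappa>) (pexp \<kappa>')) D + sconv (?d \<kappa>') (sconv (pexp \<kappa>) (pexp \<kappa>')) D"
      by (simp add: sconv_def[of _ "sconv _ _"] distrib_right sum.distrib)
    also have "sconv (?d \<kappa>) (sconv (pexp \<kappa>) (pexp \<kappa>')) D = sconv (sconv (?d \<kappa>) (pexp \<kappa>)) (pexp \<kappa>') D"
      by (rule sconv_assoc[symmetric]) fact
    also have "\<dots> = sconv (?d (pexp \<kappa>)) (pexp \<kappa>') D"
      using D fA by (intro sconv_cong refl pexp_insert[symmetric]) auto
    also have "sconv (?d \<kappa>') (sconv (pexp \<kappa>) (pexp \<kappa>')) D = sconv (sconv (pexp \<kappa>) (pexp \<kappa>')) (?d \<kappa>') D"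
      by (rule sconv_commute)
    also have "\<dots> = sconv (pexp \<kappa>) (sconv (pexp \<kappa>') (?d \<kappa>')) D"
      by (rule sconv_assoc) fact
    also have "\<dots> = sconv (pexp \<kappa>) (?d (pexp \<kappa>')) D"
      using D fA by (intro sconv_cong refl) (subst sconv_commute, rule pexp_insert[symmetric], auto)
    finally show ?thesis
      unfolding D(3) by (simp add: sconv_insert[OF D(1,2)])
  qed
qed

lemma pexp_zero: "finite B \<Longrightarrow> pexp (\<lambda>_. 0) B = sone B"
proof (cases "B = {}")
  case False
  assume B: "finite B"
  obtain a where "a \<in> B" using False by blast
  then have "pexp (\<lambda>_. 0) (insert a (B - {a})) = (0::'b)"
    using B by (subst pexp_insert) (auto simp: sconv_def)
  then show ?thesis using \<open>a \<in> B\<close> False by (simp add: insert_absorb sone_def)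
qed (simp add: sone_def)

lemma sconv_pexp_uminus:
  assumes "finite B"
  shows "sconv (pexp \<kappa>) (pexp (\<lambda>C. - \<kappa> C)) B = sone B"
  using pexp_add[OF assms, of \<kappa> "\<lambda>C. - \<kappa> C"] pexp_zero[OF assms, where 'b = 'b] by simp

text \<open>The differential form \<mu>' = (log \<mu>)' \<mu> of the logarithm. It follows from (log
  \<mu>)' = \<mu>' / \<mu> once the inverse of \<mu> is known as a sum over partitions.\<close>

lemma plog_insert:
  fixes \<mu> :: "'i set \<Rightarrow> 'a::{comm_ring_1,ring_char_0}"
  assumes B: "finite B" "a \<notin> B" and one: "\<mu> {} = 1"
  shows "\<mu> (insert a B) = sconv (\<lambda>A. plog \<mu> (insert a A)) \<mu> B"
proof -
  define w :: "nat \<Rightarrow> 'a" where "w l = (- 1) ^ (l - 1) * fact (l - 1)" for l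
  \<comment> \<open>U is 1 / \<mu> as a geometric series: \<open>w (l + 1)\<close> is (- 1)^l l!,
    the coefficient of u^l in 1 / (1 + u) times the l! orders of the blocks.\<close>
  define U :: "'i set \<Rightarrow> 'a" where
    "U D = (\<Sum>\<pi> | partition_on D \<pi>. w (card \<pi> + 1) * (\<Prod>C\<in>\<pi>. \<mu> C))" for D
  have fA: "finite A" if "A \<subseteq> B" for A using B that finite_subset by blast
  have w_rec: "w (l + 1) + of_nat l * w l = 0" if "l \<ge> 1" for l
    using that by (cases l) (auto simp: w_def algebra_simps)
  have plog_U: "plog \<mu> (insert a A) = sconv (\<lambda>A. \<mu> (insert a A)) U A" if A: "A \<subseteq> B" for A
  proof -
    have aA: "a \<notin> A" using A B by auto
    have "(\<Prod>C\<in>insert (insert a A') \<pi>. \<mu> C) = \<mu> (insert a A') * (\<Prod>C\<in>\<pi>. \<mu> C)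
        \<and> card (insert (insert a A') \<pi>) = card \<pi> + 1"
      if "partition_on (A - A') \<pi>" for A' \<pi>
      using that aA fA[OF A] finite_elements[OF _ that]
      by (subst prod.insert; (subst card_insert_disjoint)?) (auto dest: partition_onD1)
    then show ?thesis
      unfolding plog_def U_def sconv_def sum_partition_on_insert[OF fA[OF A] aA]
      by (auto simp: sum_distrib_left w_def mult_ac intro!: sum.cong)
  qed
  have U_conv: "sconv U \<mu> D = sone D" if D: "D \<subseteq> B" for D
  proof -
    have fD: "finite D" using fA[OF D] .
    have "sconv U \<mu> D = sconv \<mu> U D" by (rule sconv_commute)
    \<comment> \<open>The empty E gives U itself, a nonempty E is a marked block of a partition, and
      \<open>w_rec\<close> makes the two contributions cancel.\<close>
    also have "\<dots> = \<mu> {} * U D + (\<Sum>E\<in>Pow D - {{}}. \<mu> E * U (D - E))"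
      unfolding sconv_def using fD by (subst sum.remove[of _ "{}"]) auto
    also have "(\<Sum>E\<in>Pow D - {{}}. \<mu> E * U (D - E)) =
       (\<Sum>E\<in>Pow D - {{}}. \<Sum>\<pi> | partition_on (D - E) \<pi>. \<mu> E * (w (card \<pi> + 1) * (\<Prod>C\<in>\<pi>. \<mu> C)))"
      by (simp add: U_def sum_distrib_left)
    also have "\<dots> = (\<Sum>\<pi> | partition_on D \<pi>. \<Sum>E\<in>\<pi>. \<mu> E * (w (card (\<pi> - {E}) + 1) * (\<Prod>C\<in>\<pi> - {E}. \<mu> C)))"
      by (rule sum_partition_on_marked[symmetric]) fact
    also have "\<dots> = (\<Sum>\<pi> | partition_on D \<pi>. of_nat (card \<pi>) * w (card \<pi>) * (\<Prod>C\<in>\<pi>. \<mu> C))"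
    proof (intro sum.cong refl)
      fix \<pi> assume "\<pi> \<in> {\<pi>. partition_on D \<pi>}"
      then have fp: "finite \<pi>" using finite_elements[OF fD] by auto
      have "(\<Sum>E\<in>\<pi>. \<mu> E * (w (card (\<pi> - {E}) + 1) * (\<Prod>C\<in>\<pi> - {E}. \<mu> C))) = (\<Sum>E\<in>\<pi>. w (card \<pi>) * (\<Prod>C\<in>\<pi>. \<mu> C))"
      proof (intro sum.cong refl)
        fix E assume E: "E \<in> \<pi>"
        then have "card (\<pi> - {E}) + 1 = card \<pi>" using fp by (metis Suc_eq_plus1 card.remove)
        then show "\<mu> E * (w (card (\<pi> - {E}) + 1) * (\<Prod>C\<in>\<pi> - {E}. \<mu> C)) = w (card \<pi>) * (\<Prod>C\<in>\<pi>. \<mu> C)"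
          by (simp add: prod.remove[OF fp E] mult_ac)
      qed
      then show "(\<Sum>E\<in>\<pi>. \<mu> E * (w (card (\<pi> - {E}) + 1) * (\<Prod>C\<in>\<pi> - {E}. \<mu> C))) = of_nat (card \<pi>) * w (card \<pi>) * (\<Prod>C\<in>\<pi>. \<mu> C)"
        by (simp add: mult.assoc)
    qed
    also have "\<mu> {} * U D + \<dots> = (\<Sum>\<pi> | partition_on D \<pi>. (w (card \<pi> + 1) + of_nat (card \<pi>) * w (card \<pi>)) * (\<Prod>C\<in>\<pi>. \<mu> C))"
      by (simp add: one U_def sum.distrib distrib_right)
    also have "\<dots> = sone D"
    proof (cases "D = {}")
      case True then show ?thesis by (simp add: partition_on_empty sone_def w_def)
    next
      case False
      have "(w (card \<pi> + 1) + of_nat (card \<pi>) * w (card \<pi>)) = 0" if "partition_on D \<pi>" for \<pi>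
      proof (rule w_rec)
        have "\<pi> \<noteq> {}" using that False by (auto simp: partition_on_def)
        then show "card \<pi> \<ge> 1" using finite_elements[OF fD that] by (simp add: Suc_le_eq card_gt_0_iff)
      qed
      then show ?thesis using False by (simp add: sone_def)
    qed
    finally show ?thesis .
  qed
  have "sconv (\<lambda>A. plog \<mu> (insert a A)) \<mu> B = sconv (sconv (\<lambda>A. \<mu> (insert a A)) U) \<mu> B"
    by (intro sconv_cong plog_U refl)
  also have "\<dots> = sconv (\<lambda>A. \<mu> (insert a A)) (sconv U \<mu>) B"
    by (rule sconv_assoc) fact
  also have "\<dots> = sconv (\<lambda>A. \<mu> (insert a A)) sone B"
    by (intro sconv_cong U_conv refl)
  also have "\<dots> = \<mu> (insert a B)" by (rule sconv_sone_right) fact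
  finally show ?thesis by simp
qed

lemma pexp_plog:
  assumes "finite B" "\<mu> {} = 1"
  shows "pexp (plog \<mu>) B = \<mu> B"
  using assms(1)
proof (induction B rule: finite_psubset_induct)
  case (psubset B)
  show ?case
  proof (cases "B = {}")
    case False
    then obtain a where "a \<in> B" by blast
    define D where "D = B - {a}"
    have D: "finite D" "a \<notin> D" "B = insert a D" and DB: "D \<subset> B"
      using psubset \<open>a \<in> B\<close> by (auto simp: D_def)
    have "pexp (plog \<mu>) B = sconv (\<lambda>A. plog \<mu> (insert a A)) (pexp (plog \<mu>)) D"
      unfolding D(3) by (rule pexp_insert) fact+
    also have "\<dots> = sconv (\<lambda>A. plog \<mu> (insert a A)) \<mu> D"
      using DB by (intro sconv_cong psubset.IH refl) auto
    also have "\<dots> = \<mu> B" unfolding D(3) by (rule plog_insert[symmetric]) fact+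
    finally show ?thesis .
  qed (simp add: assms)
qed

lemma prod_partition_on:
  fixes s :: "'i \<Rightarrow> 'a::comm_monoid_mult"
  assumes "finite B" "partition_on B \<pi>"
  shows "(\<Prod>C\<in>\<pi>. \<Prod>i\<in>C. s i) = (\<Prod>i\<in>B. s i)"
proof -
  have "(\<Prod>i\<in>\<Union>\<pi>. s i) = (\<Prod>C\<in>\<pi>. \<Prod>i\<in>C. s i)"
    by (subst prod.Union_disjoint) (use assms partition_onD2[OF assms(2)] partition_onD1[OF assms(2)] in \<open>auto simp: disjoint_def intro: finite_subset\<close>)
  then show ?thesis using partition_onD1[OF assms(2)] by simp
qed

lemma pexp_scale:
  assumes "finite B"
  shows "pexp (\<lambda>C. (\<Prod>i\<in>C. s i) * \<kappa> C) B = (\<Prod>i\<in>B. s i) * pexp \<kappa> B"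
  unfolding pexp_def sum_distrib_left
  by (intro sum.cong refl) (simp add: prod.distrib prod_partition_on[OF assms])

lemma plog_scale:
  assumes "finite B"
  shows "plog (\<lambda>C. (\<Prod>i\<in>C. s i) * \<kappa> C) B = (\<Prod>i\<in>B. s i) * plog \<kappa> B"
  unfolding plog_def sum_distrib_left
  by (intro sum.cong refl) (simp add: prod.distrib prod_partition_on[OF assms] mult_ac)

section \<open>Gaussian moments and their cumulants\<close>

lemma pderiv_sum_poly:
  fixes f :: "'b \<Rightarrow> 'a::idom poly"
  shows "pderiv (\<Sum>x\<in>A. f x) = (\<Sum>x\<in>A. pderiv (f x))"
  by (induction A rule: infinite_finite_induct) (auto simp: pderiv_add)

lemma smult_sum_poly:
  fixes f :: "'b \<Rightarrow> real poly"
  shows "smult c (\<Sum>x\<in>A. f x) = (\<Sum>x\<in>A. smult c (f x))"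
  by (induction A rule: infinite_finite_induct) (auto simp: smult_add_right)

text \<open>The moments of \<i> \<theta> rather than of \<theta>, whence the minus sign. They are
  polynomials in h and make sense for every real h.\<close>

fun gauss_moment :: "real \<Rightarrow> nat \<Rightarrow> real" where
  "gauss_moment h 0 = 1"
| "gauss_moment h (Suc 0) = 0"
| "gauss_moment h (Suc (Suc j)) = - h * real (Suc j) * gauss_moment h j"

definition gauss_mean :: "real \<Rightarrow> real poly \<Rightarrow> real" where
  "gauss_mean h \<phi> = (\<Sum>i\<le>degree \<phi>. coeff \<phi> i * gauss_moment h i)"

lemma gauss_mean_altdef: "degree \<phi> \<le> n \<Longrightarrow> gauss_mean h \<phi> = (\<Sum>i\<le>n. coeff \<phi> i * gauss_moment h i)"
  unfolding gauss_mean_def by (intro sum.mono_neutral_left) (auto simp: coeff_eq_0)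

lemma gauss_mean_add: "gauss_mean h (\<phi> + \<psi>) = gauss_mean h \<phi> + gauss_mean h \<psi>"
proof -
  define n where "n = max (degree \<phi>) (degree \<psi>)"
  have "degree (\<phi> + \<psi>) \<le> n" "degree \<phi> \<le> n" "degree \<psi> \<le> n"
    by (auto simp: n_def degree_add_le_max)
  then show ?thesis by (simp add: gauss_mean_altdef[of _ n] sum.distrib distrib_right)
qed

lemma gauss_mean_smult: "gauss_mean h (smult c \<phi>) = c * gauss_mean h \<phi>"
  by (simp add: gauss_mean_altdef[OF degree_smult_le] gauss_mean_def[of h \<phi>] sum_distrib_left mult.assoc)

lemma gauss_mean_0 [simp]: "gauss_mean h 0 = 0"
  by (simp add: gauss_mean_def)

lemma gauss_mean_1 [simp]: "gauss_mean h 1 = 1"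
  by (simp add: gauss_mean_def)

lemma gauss_mean_sum: "gauss_mean h (\<Sum>x\<in>A. f x) = (\<Sum>x\<in>A. gauss_mean h (f x))"
  by (induction A rule: infinite_finite_induct) (auto simp: gauss_mean_add)

text \<open>Gaussian integration by parts: the variable is \<open>\<i>\<theta>\<close> with \<open>\<theta>\<close> normal of variance \<open>h\<close>.\<close>

lemma gauss_mean_pCons_0: "gauss_mean h (pCons 0 \<phi>) = - h * gauss_mean h (pderiv \<phi>)"
proof -
  define n where "n = degree \<phi>"
  have d1: "degree (pCons 0 \<phi>) \<le> Suc n" unfolding n_def by (rule degree_pCons_le)
  have d2: "degree (pderiv \<phi>) \<le> n" by (simp add: n_def degree_pderiv)
  have "gauss_mean h (pCons 0 \<phi>) = (\<Sum>i\<le>n. coeff \<phi> i * gauss_moment h (Suc i))"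
    by (subst gauss_mean_altdef[OF d1], subst sum.atMost_Suc_shift) simp
  also have "\<dots> = (\<Sum>i\<le>Suc n. coeff \<phi> i * gauss_moment h (Suc i))"
    by (simp add: n_def coeff_eq_0)
  also have "\<dots> = (\<Sum>i\<le>n. coeff \<phi> (Suc i) * gauss_moment h (Suc (Suc i)))"
    by (subst sum.atMost_Suc_shift) simp
  also have "\<dots> = - h * gauss_mean h (pderiv \<phi>)"
    by (subst gauss_mean_altdef[OF d2]) (auto simp: coeff_pderiv sum_distrib_left intro!: sum.cong)
  finally show ?thesis .
qed

text \<open>The product rule in the polynomial variable, as opposed to \<open>pexp_insert\<close>,
  which differentiates in an index variable: each block may be the one that is
  differentiated.\<close>

lemma pderiv_pexp:
  fixes \<kappa> :: "'i set \<Rightarrow> 'a::idom poly"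
  assumes B: "finite B"
  shows "pderiv (pexp \<kappa> B) = (\<Sum>A\<in>Pow B - {{}}. pderiv (\<kappa> A) * pexp \<kappa> (B - A))"
proof -
  have "pderiv (pexp \<kappa> B) = (\<Sum>\<pi> | partition_on B \<pi>. \<Sum>A\<in>\<pi>. pderiv (\<kappa> A) * (\<Prod>C\<in>\<pi> - {A}. \<kappa> C))"
    unfolding pexp_def pderiv_sum_poly pderiv_prod by (simp only: mult.commute)
  also have "\<dots> = (\<Sum>A\<in>Pow B - {{}}. pderiv (\<kappa> A) * pexp \<kappa> (B - A))"
    unfolding sum_partition_on_marked[OF B, of "\<lambda>A \<pi>. pderiv (\<kappa> A) * (\<Prod>C\<in>\<pi>. \<kappa> C)"]
    by (simp add: pexp_def sum_distrib_left)
  finally show ?thesis .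
qed

text \<open>The coefficients of exp(g / h), where g collects the polynomials g(C). The exponent
  carries exactly 1 / h, so that the factor h produced by an integration by parts cancels when the
  derivative hits the exponential.\<close>

definition tilt :: "('i set \<Rightarrow> real poly) \<Rightarrow> real \<Rightarrow> 'i set \<Rightarrow> real poly" where
  "tilt g h = pexp (\<lambda>C. smult (1 / h) (g C))"

definition gauss_mu :: "('i set \<Rightarrow> real poly) \<Rightarrow> real \<Rightarrow> 'i set \<Rightarrow> real" where
  "gauss_mu g h B = gauss_mean h (tilt g h B)"

text \<open>\<open>tilted_mean\<close> is the mean of \<open>\<phi>\<close> in the tilted Gaussian measure, normalised so that \<open>tilted_mean g h 1 B = sone B\<close>.
  Each step of its recursion \<open>tilted_mean_shift\<close> comes from one Gaussian integration by parts, so no negative powers of \<open>h\<close> survive.\<close>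

definition tilted_mean :: "('i set \<Rightarrow> real poly) \<Rightarrow> real \<Rightarrow> real poly \<Rightarrow> 'i set \<Rightarrow> real" where
  "tilted_mean g h \<phi> B = sconv (\<lambda>A. gauss_mean h (\<phi> * tilt g h A)) (pexp (\<lambda>C. - plog (gauss_mu g h) C)) B"

lemma tilt_empty [simp]: "tilt g h {} = 1"
  by (simp add: tilt_def)

lemma gauss_mu_empty [simp]: "gauss_mu g h {} = 1"
  by (simp add: gauss_mu_def)

lemma sconv_gauss_mu_inverse:
  assumes "finite B"
  shows "sconv (gauss_mu g h) (pexp (\<lambda>C. - plog (gauss_mu g h) C)) B = sone B"
proof -
  have "sconv (gauss_mu g h) (pexp (\<lambda>C. - plog (gauss_mu g h) C)) B
      = sconv (pexp (plog (gauss_mu g h))) (pexp (\<lambda>C. - plog (gauss_mu g h) C)) B"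
    using assms by (intro sconv_cong refl pexp_plog[symmetric]) (auto intro: finite_subset)
  then show ?thesis using sconv_pexp_uminus[OF assms] by simp
qed

lemma tilted_mean_1: "finite B \<Longrightarrow> tilted_mean g h 1 B = sone B"
  using sconv_gauss_mu_inverse[of B g h] by (simp add: tilted_mean_def gauss_mu_def[abs_def])

lemma tilted_mean_add: "tilted_mean g h (\<phi> + \<psi>) B = tilted_mean g h \<phi> B + tilted_mean g h \<psi> B"
  by (simp add: tilted_mean_def sconv_def distrib_right gauss_mean_add sum.distrib)

lemma tilted_mean_smult: "tilted_mean g h (smult c \<phi>) B = c * tilted_mean g h \<phi> B"
  by (simp add: tilted_mean_def sconv_def gauss_mean_smult sum_distrib_left mult.assoc)

lemma tilted_mean_pCons: "finite B \<Longrightarrow> tilted_mean g h (pCons c \<psi>) B = c * sone B + tilted_mean g h (pCons 0 \<psi>) B"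
proof -
  assume B: "finite B"
  have "pCons c \<psi> = smult c 1 + pCons 0 \<psi>" by (simp add: one_pCons)
  then show ?thesis by (simp only: tilted_mean_add tilted_mean_smult tilted_mean_1[OF B])
qed

text \<open>Integration by parts of y \<phi> exp(g / h) leaves - h \<phi>' and - \<phi> g', the
  latter free of h. In the sum A is nonempty, so only smaller index sets occur there, while the
  first term has a polynomial of lower degree.\<close>

lemma tilted_mean_shift:
  assumes B: "finite B" and h: "h \<noteq> 0"
  shows "tilted_mean g h (pCons 0 \<phi>) B =
    - h * tilted_mean g h (pderiv \<phi>) B - (\<Sum>A\<in>Pow B - {{}}. tilted_mean g h (\<phi> * pderiv (g A)) (B - A))"
proof -
  let ?e = "tilt g h" and ?k = "pexp (\<lambda>C. - plog (gauss_mu g h) C)"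
  \<comment> \<open>The value 0 at the empty A lets the sum run over all subsets, the form required
    by \<open>sum_Pow_nested\<close>.\<close>
  define F where "F A E = (if A = {} then 0 else gauss_mean h (\<phi> * pderiv (g A) * ?e E))" for A E
  have e: "gauss_mean h (pCons 0 \<phi> * ?e D) = - h * gauss_mean h (pderiv \<phi> * ?e D) - (\<Sum>A\<in>Pow D. F A (D - A))"
    if D: "D \<subseteq> B" for D
  proof -
    have fD: "finite D" using B D finite_subset by blast
    have "gauss_mean h (pCons 0 \<phi> * ?e D) = gauss_mean h (pCons 0 (\<phi> * ?e D))" by simp
    also have "\<dots> = - h * (gauss_mean h (pderiv \<phi> * ?e D) + gauss_mean h (\<phi> * pderiv (?e D)))"
      by (simp only: gauss_mean_pCons_0 pderiv_mult gauss_mean_add) (simp add: mult_ac add.commute)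
    also have "\<phi> * pderiv (?e D) = smult (1 / h) (\<Sum>A\<in>Pow D - {{}}. \<phi> * pderiv (g A) * ?e (D - A))"
      unfolding tilt_def pderiv_pexp[OF fD]
      by (simp only: pderiv_smult smult_sum_poly sum_distrib_left mult_smult_left mult_smult_right mult.assoc)
    also have "gauss_mean h \<dots> = (1 / h) * (\<Sum>A\<in>Pow D - {{}}. F A (D - A))"
      by (simp add: gauss_mean_smult gauss_mean_sum F_def)
    also have "(\<Sum>A\<in>Pow D - {{}}. F A (D - A)) = (\<Sum>A\<in>Pow D. F A (D - A))"
      using fD by (intro sum.mono_neutral_left) (auto simp: F_def)
    finally show ?thesis using h by (simp add: distrib_left)
  qed
  have "tilted_mean g h (pCons 0 \<phi>) B = (\<Sum>D\<in>Pow B. (- h * gauss_mean h (pderiv \<phi> * ?e D) - (\<Sum>A\<in>Pow D. F A (D - A))) * ?k (B - D))"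
    unfolding tilted_mean_def sconv_def by (intro sum.cong refl) (auto simp: e simp del: mult_pCons_left)
  also have "\<dots> = - h * tilted_mean g h (pderiv \<phi>) B - (\<Sum>D\<in>Pow B. \<Sum>A\<in>Pow D. F A (D - A) * ?k (B - D))"
    by (simp add: tilted_mean_def sconv_def sum_distrib_left sum_distrib_right left_diff_distrib sum_subtractf mult.assoc sum_negf)
  also have "(\<Sum>D\<in>Pow B. \<Sum>A\<in>Pow D. F A (D - A) * ?k (B - D)) = (\<Sum>A\<in>Pow B. \<Sum>E\<in>Pow (B - A). F A E * ?k (B - A - E))"
    by (rule sum_Pow_nested[OF B, of "\<lambda>A E F'. F A E * ?k F'"])
  also have "\<dots> = (\<Sum>A\<in>Pow B - {{}}. \<Sum>E\<in>Pow (B - A). F A E * ?k (B - A - E))"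
    using B by (intro sum.mono_neutral_right) (auto simp: F_def)
  also have "\<dots> = (\<Sum>A\<in>Pow B - {{}}. tilted_mean g h (\<phi> * pderiv (g A)) (B - A))"
    unfolding tilted_mean_def sconv_def by (intro sum.cong refl) (auto simp: F_def)
  finally show ?thesis .
qed

text \<open>h times the logarithmic derivative in the variable of \<open>a\<close>: differentiating
  the mean of exp(g / h) brings down g' / h, and division by the mean turns this into tilted means
  of the coefficients containing \<open>a\<close>.\<close>

lemma plog_gauss_mu_insert:
  assumes B: "finite B" "a \<notin> B" and h: "h \<noteq> 0"
  shows "h * plog (gauss_mu g h) (insert a B) = (\<Sum>A\<in>Pow B. tilted_mean g h (g (insert a A)) (B - A))"
proof -
  let ?e = "tilt g h" and ?k = "pexp (\<lambda>C. - plog (gauss_mu g h) C)" and ?l = "\<lambda>A. plog (gauss_mu g h) (insert a A)"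
  have fA: "finite A" if "A \<subseteq> B" for A using B that finite_subset by blast
  have d: "h * gauss_mu g h (insert a D) = (\<Sum>A\<in>Pow D. gauss_mean h (g (insert a A) * ?e (D - A)))" if "D \<subseteq> B" for D
  proof -
    have "gauss_mu g h (insert a D) = gauss_mean h (sconv (\<lambda>A. smult (1 / h) (g (insert a A))) ?e D)"
      unfolding gauss_mu_def tilt_def using that B fA[OF that] by (subst pexp_insert) auto
    also have "\<dots> = (1 / h) * (\<Sum>A\<in>Pow D. gauss_mean h (g (insert a A) * ?e (D - A)))"
      unfolding sconv_def by (simp add: gauss_mean_smult gauss_mean_sum sum_distrib_left)
    finally show ?thesis using h by simp
  qed
  have "?l B = sconv ?l sone B" by (rule sconv_sone_right[symmetric]) fact
  also have "\<dots> = sconv ?l (sconv (gauss_mu g h) ?k) B"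
    by (intro sconv_cong refl sconv_gauss_mu_inverse[symmetric] fA)
  also have "\<dots> = sconv (sconv ?l (gauss_mu g h)) ?k B" by (rule sconv_assoc[symmetric]) fact
  also have "\<dots> = sconv (\<lambda>D. gauss_mu g h (insert a D)) ?k B"
    using B fA by (intro sconv_cong refl plog_insert[symmetric]) auto
  finally have "h * ?l B = (\<Sum>D\<in>Pow B. (h * gauss_mu g h (insert a D)) * ?k (B - D))"
    by (simp add: sconv_def sum_distrib_left mult.assoc)
  also have "\<dots> = (\<Sum>D\<in>Pow B. \<Sum>A\<in>Pow D. gauss_mean h (g (insert a A) * ?e (D - A)) * ?k (B - D))"
    by (intro sum.cong refl) (auto simp: d sum_distrib_right)
  also have "\<dots> = (\<Sum>A\<in>Pow B. \<Sum>E\<in>Pow (B - A). gauss_mean h (g (insert a A) * ?e E) * ?k (B - A - E))"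
    by (rule sum_Pow_nested[OF B(1), of "\<lambda>A E F'. gauss_mean h (g (insert a A) * ?e E) * ?k F'"])
  finally show ?thesis by (simp add: tilted_mean_def sconv_def)
qed

text \<open>The value at \<open>h = 0\<close> of the recursion for \<open>tilted_mean\<close>, solved in closed form: a Lagrange inversion formula.\<close>

definition vertex_term :: "('i set \<Rightarrow> real poly) \<Rightarrow> 'i set set \<Rightarrow> real poly \<Rightarrow> real" where
  "vertex_term g S \<phi> = (if S = {} then coeff \<phi> 0
     else fact (card S - 1) * coeff (pderiv \<phi> * (\<Prod>A\<in>S. pderiv (g A))) (card S - 1))"

text \<open>Formally, as h tends to 0 the weight exp(y^2 / (2 h) + g / h) concentrates at the root
  of y + g'(y) = 0. Lagrange's formula gives the value of \<phi> there as the sum of (- 1)^l / l!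
  times the derivative of order l - 1 of \<phi>' g'^l at 0; the 1 / l! is again absorbed by
  unordered blocks.\<close>

definition tree_limit :: "('i set \<Rightarrow> real poly) \<Rightarrow> real poly \<Rightarrow> 'i set \<Rightarrow> real" where
  "tree_limit g \<phi> B = (\<Sum>\<beta> | partition_on B \<beta>. (- 1) ^ card \<beta> * vertex_term g \<beta> \<phi>)"

text \<open>The product rule: in the sum over the distinguished A, the product P of all derivatives
  of g is differentiated once, and \<psi>' P is collected \<open>card S\<close> times. Since (y
  \<psi>)' = \<psi> + y \<psi>', comparing coefficients gives the claim.\<close>

lemma vertex_term_shift:
  assumes S: "finite S" "S \<noteq> {}"
  shows "vertex_term g S (pCons 0 \<psi>) = (\<Sum>A\<in>S. vertex_term g (S - {A}) (\<psi> * pderiv (g A)))"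
proof (cases "card S = 1")
  case True
  then obtain A where "S = {A}" by (auto simp: card_1_singleton_iff)
  then show ?thesis by (simp add: vertex_term_def pderiv_pCons coeff_mult_0)
next
  case False
  define l where "l = card S - 2"
  have l: "card S = Suc (Suc l)" using False S by (cases "card S"; cases "card S - 1") (auto simp: l_def)
  let ?f = "\<lambda>A. pderiv (g A)" and ?P = "\<Prod>A\<in>S. pderiv (g A)"
  have "(\<Sum>A\<in>S. vertex_term g (S - {A}) (\<psi> * ?f A)) = (\<Sum>A\<in>S. fact l * coeff (pderiv (\<psi> * ?f A) * (\<Prod>A\<in>S - {A}. ?f A)) l)"
  proof (intro sum.cong refl)
    fix A assume A: "A \<in> S"
    then have c: "card (S - {A}) = Suc l" using S l by simp
    have "S - {A} \<noteq> {}"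
    proof
      assume "S - {A} = {}"
      then have "card (S - {A}) = 0" by (simp only: card.empty)
      with c show False by linarith
    qed
    then show "vertex_term g (S - {A}) (\<psi> * ?f A) = fact l * coeff (pderiv (\<psi> * ?f A) * (\<Prod>A\<in>S - {A}. ?f A)) l"
      unfolding vertex_term_def c by simp
  qed
  also have "\<dots> = fact l * coeff (\<Sum>A\<in>S. pderiv (\<psi> * ?f A) * (\<Prod>A\<in>S - {A}. ?f A)) l"
    by (simp add: coeff_sum sum_distrib_left)
  also have "(\<Sum>A\<in>S. pderiv (\<psi> * ?f A) * (\<Prod>A\<in>S - {A}. ?f A)) = (\<Sum>A\<in>S. pderiv \<psi> * ?P + \<psi> * ((\<Prod>A\<in>S - {A}. ?f A) * pderiv (?f A)))"
    using S by (intro sum.cong refl) (simp add: pderiv_mult prod.remove[of S] algebra_simps)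
  also have "\<dots> = of_nat (card S) * (pderiv \<psi> * ?P) + \<psi> * pderiv ?P"
    by (simp add: sum.distrib pderiv_prod sum_distrib_left)
  also have "\<dots> = of_nat (Suc l) * (pderiv \<psi> * ?P) + pderiv (\<psi> * ?P)"
    unfolding l by (simp add: pderiv_mult algebra_simps)
  also have "coeff \<dots> l = real (Suc l) * (coeff (pderiv \<psi> * ?P) l + coeff (\<psi> * ?P) (Suc l))"
    by (simp add: coeff_pderiv of_nat_poly distrib_left)
  also have "fact l * \<dots> = fact (Suc l) * coeff ((\<psi> + pCons 0 (pderiv \<psi>)) * ?P) (Suc l)"
    by (simp add: algebra_simps)
  also have "\<dots> = vertex_term g S (pCons 0 \<psi>)"
    using S l by (simp add: vertex_term_def pderiv_pCons)
  finally show ?thesis by simp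
qed

lemma tree_limit_const: "finite B \<Longrightarrow> tree_limit g [:c:] B = c * sone B"
proof (cases "B = {}")
  case False
  assume B: "finite B"
  have "vertex_term g \<beta> [:c:] = 0" if "partition_on B \<beta>" for \<beta>
    using that False by (auto simp: vertex_term_def partition_on_def pderiv_pCons)
  then show ?thesis using False by (simp add: tree_limit_def sone_def)
qed (simp add: tree_limit_def partition_on_empty vertex_term_def sone_def)

lemma vertex_term_add: "vertex_term g S (\<phi> + \<psi>) = vertex_term g S \<phi> + vertex_term g S \<psi>"
  by (simp add: vertex_term_def pderiv_add distrib_right distrib_left)

lemma tree_limit_add: "tree_limit g (\<phi> + \<psi>) B = tree_limit g \<phi> B + tree_limit g \<psi> B"
  by (simp add: tree_limit_def vertex_term_add distrib_left sum.distrib)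

lemma tree_limit_pCons: "finite B \<Longrightarrow> tree_limit g (pCons c \<psi>) B = c * sone B + tree_limit g (pCons 0 \<psi>) B"
proof -
  assume B: "finite B"
  have "pCons c \<psi> = [:c:] + pCons 0 \<psi>" by simp
  then show ?thesis by (simp only: tree_limit_add tree_limit_const[OF B])
qed

text \<open>The recursion \<open>tilted_mean_shift\<close> with its term in h deleted, which
  identifies the constant coefficients in \<open>tilted_mean_poly\<close>.\<close>

lemma tree_limit_shift:
  assumes B: "finite B"
  shows "tree_limit g (pCons 0 \<psi>) B = - (\<Sum>A\<in>Pow B - {{}}. tree_limit g (\<psi> * pderiv (g A)) (B - A))"
proof -
  have "tree_limit g (pCons 0 \<psi>) B = (\<Sum>\<beta> | partition_on B \<beta>. \<Sum>A\<in>\<beta>. (- 1) ^ Suc (card (\<beta> - {A})) * vertex_term g (\<beta> - {A}) (\<psi> * pderiv (g A)))"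
    unfolding tree_limit_def
  proof (intro sum.cong refl)
    fix \<beta> assume "\<beta> \<in> {\<beta>. partition_on B \<beta>}"
    then have f: "finite \<beta>" using finite_elements[OF B] by auto
    show "(- 1) ^ card \<beta> * vertex_term g \<beta> (pCons 0 \<psi>) = (\<Sum>A\<in>\<beta>. (- 1) ^ Suc (card (\<beta> - {A})) * vertex_term g (\<beta> - {A}) (\<psi> * pderiv (g A)))"
    proof (cases "\<beta> = {}")
      case False
      have "(\<Sum>A\<in>\<beta>. (- 1) ^ Suc (card (\<beta> - {A})) * vertex_term g (\<beta> - {A}) (\<psi> * pderiv (g A)))
          = (\<Sum>A\<in>\<beta>. (- 1) ^ card \<beta> * vertex_term g (\<beta> - {A}) (\<psi> * pderiv (g A)))"
        using f by (intro sum.cong refl) (metis card.remove)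
      then show ?thesis using vertex_term_shift[OF f False] by (simp add: sum_distrib_left)
    qed (simp add: vertex_term_def)
  qed
  also have "\<dots> = (\<Sum>A\<in>Pow B - {{}}. \<Sum>\<beta> | partition_on (B - A) \<beta>. (- 1) ^ Suc (card \<beta>) * vertex_term g \<beta> (\<psi> * pderiv (g A)))"
    by (rule sum_partition_on_marked[OF B, of "\<lambda>A \<beta>. (- 1) ^ Suc (card \<beta>) * vertex_term g \<beta> (\<psi> * pderiv (g A))"])
  also have "\<dots> = - (\<Sum>A\<in>Pow B - {{}}. tree_limit g (\<psi> * pderiv (g A)) (B - A))"
    by (simp add: tree_limit_def sum_negf)
  finally show ?thesis .
qed

text \<open>Induction on B and, inside, on the degree of \<phi>: each term of
  \<open>tilted_mean_shift\<close> shrinks one of them. The derivative of g(A) has degree at most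
  the sum of m over A, so the degree bound is additive over the removed sets.\<close>

lemma tilted_mean_poly:
  fixes g :: "'i set \<Rightarrow> real poly" and m :: "'i \<Rightarrow> nat"
  assumes B: "finite B"
    and deg: "\<And>A. A \<subseteq> B \<Longrightarrow> A \<noteq> {} \<Longrightarrow> degree (g A) \<le> Suc (\<Sum>i\<in>A. m i)"
  shows "\<exists>w. (\<forall>h. h \<noteq> 0 \<longrightarrow> tilted_mean g h \<phi> B = poly w h) \<and> coeff w 0 = tree_limit g \<phi> B \<and>
           degree w \<le> degree \<phi> + (\<Sum>i\<in>B. m i)"
  using B deg
proof (induction B arbitrary: \<phi> rule: finite_psubset_induct)
  case (psubset B)
  note IH = psubset.IH and B = psubset.hyps and degB = psubset.prems
  let ?m = "\<lambda>A. \<Sum>i\<in>A. m i"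
  show ?case
  proof (induction "degree \<phi>" arbitrary: \<phi> rule: less_induct)
    case less
    obtain c \<psi> where \<phi>: "\<phi> = pCons c \<psi>" by (cases \<phi>)
    show ?case
    proof (cases "\<psi> = 0")
      case True
      have 1: "tree_limit g \<phi> B = c * sone B"
        unfolding \<phi> True using B by (rule tree_limit_const)
      have "tilted_mean g h (smult c 1) B = c * sone B" for h
        by (simp only: tilted_mean_smult tilted_mean_1[OF B])
      then have "tilted_mean g h \<phi> B = c * sone B" for h
        unfolding \<phi> True by simp
      note 2 = this
      show ?thesis
      proof (rule exI[of _ "[:c * sone B:]"], intro conjI allI impI)
        show "tilted_mean g h \<phi> B = poly [:c * sone B:] h" for h by (simp only: 2 poly_pCons poly_0 mult_zero_right add_0_right)
        show "coeff [:c * sone B:] 0 = tree_limit g \<phi> B" by (simp only: 1 coeff_pCons_0)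
        show "degree [:c * sone B:] \<le> degree \<phi> + (\<Sum>i\<in>B. m i)" by (simp only: degree_pCons_0)
      qed
    next
      case False
      then have d\<phi>: "degree \<phi> = Suc (degree \<psi>)" by (simp add: \<phi>)
      obtain w1 where w1: "\<And>h. h \<noteq> 0 \<Longrightarrow> tilted_mean g h (pderiv \<psi>) B = poly w1 h"
          "degree w1 \<le> degree \<psi> + ?m B"
      proof -
        have "degree (pderiv \<psi>) < degree \<phi>" by (simp add: d\<phi> degree_pderiv)
        from less[OF this] obtain w where "\<forall>h. h \<noteq> 0 \<longrightarrow> tilted_mean g h (pderiv \<psi>) B = poly w h"
          "degree w \<le> degree (pderiv \<psi>) + ?m B" by blast
        moreover have "degree (pderiv \<psi>) \<le> degree \<psi>" by (simp add: degree_pderiv)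
        ultimately show ?thesis by (intro that[of w]) auto
      qed
      have "\<exists>w. (\<forall>h. h \<noteq> 0 \<longrightarrow> tilted_mean g h (\<psi> * pderiv (g A)) (B - A) = poly w h)
          \<and> coeff w 0 = tree_limit g (\<psi> * pderiv (g A)) (B - A) \<and> degree w \<le> degree \<psi> + ?m B"
        if A: "A \<in> Pow B - {{}}" for A
      proof -
        have "B - A \<subset> B" using A by auto
        moreover have "degree (g C) \<le> Suc (?m C)" if "C \<subseteq> B - A" "C \<noteq> {}" for C
          using that by (intro degB) auto
        ultimately obtain w where
          w: "\<forall>h. h \<noteq> 0 \<longrightarrow> tilted_mean g h (\<psi> * pderiv (g A)) (B - A) = poly w h"
           "coeff w 0 = tree_limit g (\<psi> * pderiv (g A)) (B - A)" "degree w \<le> degree (\<psi> * pderiv (g A)) + ?m (B - A)"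
          using IH[of "B - A" "\<psi> * pderiv (g A)"] by blast
        have "degree (pderiv (g A)) \<le> ?m A" using degB[of A] A by (simp add: degree_pderiv)
        then have "degree (\<psi> * pderiv (g A)) \<le> degree \<psi> + ?m A"
          using degree_mult_le[of \<psi> "pderiv (g A)"] by linarith
        moreover have "?m A + ?m (B - A) = ?m B"
          using A B by (subst add.commute, intro sum.subset_diff[symmetric]) auto
        ultimately show ?thesis using w by (intro exI[of _ w]) auto
      qed
      then obtain w where w: "\<And>A h. A \<in> Pow B - {{}} \<Longrightarrow> h \<noteq> 0 \<Longrightarrow> tilted_mean g h (\<psi> * pderiv (g A)) (B - A) = poly (w A) h"
          "\<And>A. A \<in> Pow B - {{}} \<Longrightarrow> coeff (w A) 0 = tree_limit g (\<psi> * pderiv (g A)) (B - A)"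
          "\<And>A. A \<in> Pow B - {{}} \<Longrightarrow> degree (w A) \<le> degree \<psi> + ?m B"
        by metis
      define W where "W = [:c * sone B:] + (- pCons 0 w1 - (\<Sum>A\<in>Pow B - {{}}. w A))"
      have "tilted_mean g h \<phi> B = poly W h" if "h \<noteq> 0" for h
      proof -
        have "tilted_mean g h \<phi> B = c * sone B + (- h * tilted_mean g h (pderiv \<psi>) B - (\<Sum>A\<in>Pow B - {{}}. tilted_mean g h (\<psi> * pderiv (g A)) (B - A)))"
          by (simp only: \<phi> tilted_mean_pCons[OF B, of g h c \<psi>] tilted_mean_shift[OF B that])
        also have "\<dots> = poly W h"
          unfolding W_def using w(1)[OF _ that] w1(1)[OF that] by (simp add: poly_sum)
        finally show ?thesis .
      qed
      moreover have "coeff W 0 = tree_limit g \<phi> B"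
      proof -
        have "tree_limit g \<phi> B = c * sone B + - (\<Sum>A\<in>Pow B - {{}}. tree_limit g (\<psi> * pderiv (g A)) (B - A))"
          by (simp only: \<phi> tree_limit_pCons[OF B, of g c \<psi>] tree_limit_shift[OF B])
        then show ?thesis unfolding W_def using w(2) by (simp add: coeff_sum)
      qed
      moreover have "degree W \<le> degree \<phi> + ?m B"
        unfolding W_def
      proof (intro degree_add_le degree_diff_le degree_sum_le)
        show "degree (- pCons 0 w1) \<le> degree \<phi> + ?m B"
          using w1(2) degree_pCons_le[of 0 w1] by (simp add: d\<phi>)
        show "finite (Pow B - {{}})" using B by auto
        fix A assume "A \<in> Pow B - {{}}"
        from w(3)[OF this] show "degree (w A) \<le> degree \<phi> + ?m B" by (simp add: d\<phi>)
      qed auto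
      ultimately show ?thesis by blast
    qed
  qed
qed

text \<open>For an arbitrary index \<open>a\<close>, the polynomial of the block of \<open>a\<close>
  plays the role of \<phi>, and the remaining blocks come from \<open>tree_limit\<close>. As \<phi>'
  joins the product, the block of \<open>a\<close> is no longer distinguished, except when it is the
  only one.\<close>

lemma plog_gauss_mu_poly:
  fixes g :: "'i set \<Rightarrow> real poly" and m :: "'i \<Rightarrow> nat"
  assumes B: "finite B" "B \<noteq> {}"
    and deg: "\<And>A. A \<subseteq> B \<Longrightarrow> A \<noteq> {} \<Longrightarrow> degree (g A) \<le> Suc (\<Sum>i\<in>A. m i)"
  shows "\<exists>w. (\<forall>h. h \<noteq> 0 \<longrightarrow> h * plog (gauss_mu g h) B = poly w h) \<and> degree w \<le> Suc (\<Sum>i\<in>B. m i) \<and>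
     coeff w 0 = (\<Sum>\<alpha> | partition_on B \<alpha>. if card \<alpha> = 1 then coeff (g B) 0
        else (- 1) ^ (card \<alpha> - 1) * (fact (card \<alpha> - 2) * coeff (\<Prod>C\<in>\<alpha>. pderiv (g C)) (card \<alpha> - 2)))"
proof -
  let ?m = "\<lambda>A. \<Sum>i\<in>A. m i"
  obtain a where "a \<in> B" using B by blast
  define D where "D = B - {a}"
  have D: "finite D" "a \<notin> D" "B = insert a D" using B \<open>a \<in> B\<close> by (auto simp: D_def)
  have "\<exists>w. (\<forall>h. h \<noteq> 0 \<longrightarrow> tilted_mean g h (g (insert a A)) (D - A) = poly w h)
          \<and> coeff w 0 = tree_limit g (g (insert a A)) (D - A) \<and> degree w \<le> Suc (?m B)" if A: "A \<in> Pow D" for A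
  proof -
    have "degree (g C) \<le> Suc (?m C)" if "C \<subseteq> D - A" "C \<noteq> {}" for C
      using that D by (intro deg) auto
    then obtain w where
      w: "\<forall>h. h \<noteq> 0 \<longrightarrow> tilted_mean g h (g (insert a A)) (D - A) = poly w h"
       "coeff w 0 = tree_limit g (g (insert a A)) (D - A)" "degree w \<le> degree (g (insert a A)) + ?m (D - A)"
      using tilted_mean_poly[of "D - A" g m "g (insert a A)"] D(1) by blast
    have "degree (g (insert a A)) \<le> Suc (?m (insert a A))" using A D by (intro deg) auto
    moreover have "?m (insert a A) + ?m (D - A) = ?m B"
    proof -
      have "B - insert a A = D - A" using D by auto
      moreover have "?m B = ?m (B - insert a A) + ?m (insert a A)" using A D by (intro sum.subset_diff) auto
      ultimately show ?thesis by simp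
    qed
    ultimately show ?thesis using w by (intro exI[of _ w]) auto
  qed
  then obtain w where w: "\<And>A h. A \<in> Pow D \<Longrightarrow> h \<noteq> 0 \<Longrightarrow> tilted_mean g h (g (insert a A)) (D - A) = poly (w A) h"
      "\<And>A. A \<in> Pow D \<Longrightarrow> coeff (w A) 0 = tree_limit g (g (insert a A)) (D - A)"
      "\<And>A. A \<in> Pow D \<Longrightarrow> degree (w A) \<le> Suc (?m B)"
    by metis
  define W where "W = (\<Sum>A\<in>Pow D. w A)"
  have "h * plog (gauss_mu g h) B = poly W h" if "h \<noteq> 0" for h
    unfolding D(3) plog_gauss_mu_insert[OF D(1,2) that] W_def using w(1)[OF _ that] by (simp add: poly_sum)
  moreover have "degree W \<le> Suc (?m B)" unfolding W_def using D w(3) by (intro degree_sum_le) auto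
  moreover have "coeff W 0 = (\<Sum>\<alpha> | partition_on B \<alpha>. if card \<alpha> = 1 then coeff (g B) 0
        else (- 1) ^ (card \<alpha> - 1) * (fact (card \<alpha> - 2) * coeff (\<Prod>C\<in>\<alpha>. pderiv (g C)) (card \<alpha> - 2)))"
  proof -
    have "coeff W 0 = (\<Sum>A\<in>Pow D. \<Sum>\<beta> | partition_on (D - A) \<beta>. (- 1) ^ card \<beta> * vertex_term g \<beta> (g (insert a A)))"
      unfolding W_def using w(2) by (simp add: coeff_sum tree_limit_def)
    also have "\<dots> = (\<Sum>A\<in>Pow D. \<Sum>\<beta> | partition_on (D - A) \<beta>.
       (\<lambda>\<alpha>. if card \<alpha> = 1 then coeff (g B) 0
        else (- 1) ^ (card \<alpha> - 1) * (fact (card \<alpha> - 2) * coeff (\<Prod>C\<in>\<alpha>. pderiv (g C)) (card \<alpha> - 2))) (insert (insert a A) \<beta>))"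
    proof (intro sum.cong refl)
      fix A \<beta> assume A: "A \<in> Pow D" and "\<beta> \<in> {\<beta>. partition_on (D - A) \<beta>}"
      then have p: "partition_on (D - A) \<beta>" by simp
      have f: "finite \<beta>" using finite_elements[OF _ p] D by auto
      have n: "insert a A \<notin> \<beta>" using partition_onD1[OF p] D by auto
      have c: "card (insert (insert a A) \<beta>) = Suc (card \<beta>)" using f n by simp
      show "(- 1) ^ card \<beta> * vertex_term g \<beta> (g (insert a A)) = (\<lambda>\<alpha>. if card \<alpha> = 1 then coeff (g B) 0
        else (- 1) ^ (card \<alpha> - 1) * (fact (card \<alpha> - 2) * coeff (\<Prod>C\<in>\<alpha>. pderiv (g C)) (card \<alpha> - 2))) (insert (insert a A) \<beta>)"
      \<comment> \<open>If no block is left, the block of \<open>a\<close> is all of B, and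
        \<open>vertex_term\<close> falls back to the value of g(B) at 0.\<close>
      proof (cases "\<beta> = {}")
        case True
        then have "D - A = {}" using p by (simp add: partition_on_def)
        then have "insert a A = B" using A D by auto
        then show ?thesis by (simp add: True vertex_term_def)
      next
        case False
        then have "card \<beta> \<noteq> 0" using f by simp
        then show ?thesis using False f n by (simp add: vertex_term_def c)
      qed
    qed
    also have "\<dots> = (\<Sum>\<alpha> | partition_on B \<alpha>. if card \<alpha> = 1 then coeff (g B) 0
        else (- 1) ^ (card \<alpha> - 1) * (fact (card \<alpha> - 2) * coeff (\<Prod>C\<in>\<alpha>. pderiv (g C)) (card \<alpha> - 2)))"
      unfolding D(3) by (rule sum_partition_on_insert[OF D(1,2), symmetric])
    finally show ?thesis .
  qed
  ultimately show ?thesis by blast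
qed

section \<open>Coefficients of products of polynomials\<close>

lemma finite_PiE_sum:
  assumes "finite S"
  shows "finite {d \<in> S \<rightarrow>\<^sub>E (UNIV :: nat set). sum d S = k}"
proof (rule finite_subset)
  show "{d \<in> S \<rightarrow>\<^sub>E UNIV. sum d S = k} \<subseteq> S \<rightarrow>\<^sub>E {..k}"
    using assms by (auto simp: PiE_def Pi_def intro: member_le_sum)
  show "finite (S \<rightarrow>\<^sub>E {..k})" using assms by (intro finite_PiE) auto
qed

lemma coeff_prod_PiE:
  fixes f :: "'b \<Rightarrow> 'a::comm_semiring_1 poly"
  assumes "finite S"
  shows "coeff (\<Prod>x\<in>S. f x) k = (\<Sum>d | d \<in> S \<rightarrow>\<^sub>E UNIV \<and> sum d S = k. \<Prod>x\<in>S. coeff (f x) (d x))"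
  using assms
proof (induction S arbitrary: k rule: finite_induct)
  case empty
  have "{d :: 'b \<Rightarrow> nat. d = (\<lambda>x. undefined) \<and> 0 = k} = (if k = 0 then {\<lambda>x. undefined} else {})" by auto
  then show ?case by auto
next
  case (insert a S)
  note fin = finite_PiE_sum[OF insert.hyps(1)]
  have "coeff (\<Prod>x\<in>insert a S. f x) k = (\<Sum>i\<le>k. \<Sum>d | d \<in> S \<rightarrow>\<^sub>E UNIV \<and> sum d S = k - i. coeff (f a) i * (\<Prod>x\<in>S. coeff (f x) (d x)))"
    using insert by (simp add: coeff_mult sum_distrib_left)
  also have "\<dots> = (\<Sum>(i, d)\<in>(SIGMA i:{..k}. {d \<in> S \<rightarrow>\<^sub>E UNIV. sum d S = k - i}). coeff (f a) i * (\<Prod>x\<in>S. coeff (f x) (d x)))"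
    using fin by (intro sum.Sigma) auto
  also have "\<dots> = (\<Sum>d | d \<in> insert a S \<rightarrow>\<^sub>E UNIV \<and> sum d (insert a S) = k. \<Prod>x\<in>insert a S. coeff (f x) (d x))"
  proof (rule sum.reindex_bij_witness[where i = "\<lambda>d. (d a, d(a := undefined))" and j = "\<lambda>x. (snd x)(a := fst x)"])
    fix x assume x: "x \<in> (SIGMA i:{..k}. {d \<in> S \<rightarrow>\<^sub>E UNIV. sum d S = k - i})"
    then have e: "snd x a = undefined" "fst x \<le> k" "sum (snd x) S = k - fst x" "snd x \<in> S \<rightarrow>\<^sub>E UNIV"
      using insert.hyps by (auto simp: PiE_def extensional_def)
    have s: "sum ((snd x)(a := fst x)) S = sum (snd x) S"
      using insert.hyps by (intro sum.cong) auto
    have pr: "(\<Prod>y\<in>S. coeff (f y) (((snd x)(a := fst x)) y)) = (\<Prod>y\<in>S. coeff (f y) (snd x y))"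
      using insert.hyps by (intro prod.cong) auto
    show "(((snd x)(a := fst x)) a, ((snd x)(a := fst x))(a := undefined)) = x"
      using e by (cases x) (auto simp: fun_upd_idem)
    show "(snd x)(a := fst x) \<in> {d. d \<in> insert a S \<rightarrow>\<^sub>E UNIV \<and> sum d (insert a S) = k}"
      using e s insert.hyps by (auto simp: PiE_def extensional_def)
    show "(\<Prod>y\<in>insert a S. coeff (f y) (((snd x)(a := fst x)) y)) = (case x of (i, d) \<Rightarrow> coeff (f a) i * (\<Prod>x\<in>S. coeff (f x) (d x)))"
      using insert.hyps pr by (cases x) simp
  next
    fix d assume d: "d \<in> {d. d \<in> insert a S \<rightarrow>\<^sub>E UNIV \<and> sum d (insert a S) = k}"
    have s: "sum (d(a := undefined)) S = sum d S"
      using insert.hyps by (intro sum.cong) auto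
    show "(snd (d a, d(a := undefined)))(a := fst (d a, d(a := undefined))) = d" by simp
    show "(d a, d(a := undefined)) \<in> (SIGMA i:{..k}. {d \<in> S \<rightarrow>\<^sub>E UNIV. sum d S = k - i})"
      using d s insert.hyps by (auto simp: PiE_def extensional_def)
  qed
  finally show ?case .
qed

section \<open>The zeta function at the negative integers\<close>

text \<open>A local Weierstrass test in which finitely many terms may escape the majorant.
  Convergence of derivatives is recorded as well, because the cumulants of higher order are
  derivatives of the sums.\<close>

lemma holomorphic_on_suminf:
  fixes f :: "nat \<Rightarrow> complex \<Rightarrow> complex"
  assumes S: "open S" and hol: "\<And>n. f n holomorphic_on S"
    and bnd: "\<And>x. x \<in> S \<Longrightarrow> \<exists>d M N. d > 0 \<and> summable M \<and> (\<forall>n\<ge>N. \<forall>z\<in>cball x d \<inter> S. norm (f n z) \<le> M n)"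
  shows "(\<lambda>z. \<Sum>n. f n z) holomorphic_on S"
    and "\<And>x r. x \<in> S \<Longrightarrow> (\<lambda>N. (deriv ^^ r) (\<lambda>z. \<Sum>n<N. f n z) x) \<longlonglongrightarrow> (deriv ^^ r) (\<lambda>z. \<Sum>n. f n z) x"
proof -
  have ul: "\<exists>d. 0 < d \<and> cball x d \<subseteq> S \<and> uniform_limit (cball x d) (\<lambda>N z. \<Sum>n<N. f n z) (\<lambda>z. \<Sum>n. f n z) sequentially"
    if x: "x \<in> S" for x
  proof -
    obtain d M N where d: "d > 0" "summable M" "\<forall>n\<ge>N. \<forall>z\<in>cball x d \<inter> S. norm (f n z) \<le> M n"
      using bnd[OF x] by blast
    obtain e where e: "e > 0" "cball x e \<subseteq> S" using S x open_contains_cball by blast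
    have "uniform_limit (cball x (min d e)) (\<lambda>N z. \<Sum>n<N. f n z) (\<lambda>z. \<Sum>n. f n z) sequentially"
    proof (rule Weierstrass_m_test_ev)
      show "\<forall>\<^sub>F n in sequentially. \<forall>z\<in>cball x (min d e). norm (f n z) \<le> M n"
        using d(3) e by (auto simp: eventually_sequentially intro!: exI[of _ N])
    qed fact
    then show ?thesis using d e by (intro exI[of _ "min d e"]) auto
  qed
  show "(\<lambda>z. \<Sum>n. f n z) holomorphic_on S"
    by (rule holomorphic_uniform_sequence[OF S _ ul]) (auto intro!: holomorphic_on_sum hol)
  fix x r assume x: "x \<in> S"
  obtain d where d: "0 < d" "cball x d \<subseteq> S" "uniform_limit (cball x d) (\<lambda>N z. \<Sum>n<N. f n z) (\<lambda>z. \<Sum>n. f n z) sequentially"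
    using ul[OF x] by blast
  show "(\<lambda>N. (deriv ^^ r) (\<lambda>z. \<Sum>n<N. f n z) x) \<longlonglongrightarrow> (deriv ^^ r) (\<lambda>z. \<Sum>n. f n z) x"
  proof (rule higher_deriv_complex_uniform_limit)
    show "uniform_limit (ball x d) (\<lambda>N z. \<Sum>n<N. f n z) (\<lambda>z. \<Sum>n. f n z) sequentially"
      using d(3) by (rule uniform_limit_on_subset) auto
    show "\<forall>\<^sub>F N in sequentially. (\<lambda>z. \<Sum>n<N. f n z) holomorphic_on ball x d"
      using hol d(2) by (intro always_eventually allI holomorphic_on_sum) (metis ball_subset_cball holomorphic_on_subset)
  qed (use d in auto)
qed

text \<open>This is \<zeta>(s) - 1 for Re s > 1. Without the term 1 it decays like 2^(- Re s), fast
  enough to be multiplied by binomial coefficients and summed over shifts of s.\<close>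

definition ztail :: "complex \<Rightarrow> complex" where
  "ztail s = (\<Sum>n. 1 / of_nat (n + 2) powr s)"

lemma norm_powr_nat: "norm (1 / of_nat (Suc n) powr s :: complex) = real (Suc n) powr (- Re s)"
  by (subst norm_divide, subst norm_powr_real_powr) (auto simp: powr_minus divide_inverse)

lemma summable_nat_powr: "\<sigma> > 1 \<Longrightarrow> summable (\<lambda>n. real (n + 2) powr (- \<sigma>))"
  using summable_ignore_initial_segment[of "\<lambda>n. real n powr (- \<sigma>)" 2]
  by (simp add: summable_real_powr_iff)

lemma summable_ztail:
  assumes "Re s > 1"
  shows "summable (\<lambda>n. norm (1 / of_nat (n + 2) powr s :: complex))"
  using summable_nat_powr[OF assms] norm_powr_nat[of "Suc _" s]
  by (simp del: of_nat_Suc of_nat_add)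

lemma holomorphic_ztail: "ztail holomorphic_on {s. Re s > 1}"
  unfolding ztail_def[abs_def]
proof (rule holomorphic_on_suminf(1))
  show "open {s. Re s > 1}" by (rule open_halfspace_Re_gt)
  show "(\<lambda>s. 1 / of_nat (n + 2) powr s) holomorphic_on {s. Re s > 1}" for n
  proof -
    have "of_nat (n + 2) \<noteq> (0 :: complex)" by (simp only: of_nat_eq_0_iff)
    then show ?thesis by (intro holomorphic_intros) (auto simp del: of_nat_add)
  qed
  fix x :: complex assume x: "x \<in> {s. Re s > 1}"
  define d where "d = (Re x - 1) / 2"
  have d: "d > 0" using x by (simp add: d_def)
  show "\<exists>d M N. d > 0 \<and> summable M \<and> (\<forall>n\<ge>N. \<forall>z\<in>cball x d \<inter> {s. Re s > 1}. norm (1 / of_nat (n + 2) powr z) \<le> M n)"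
  proof (intro exI conjI allI impI ballI)
    show "d > 0" by fact
    show "summable (\<lambda>n. real (n + 2) powr (- (1 + d)))" using d by (intro summable_nat_powr) auto
    fix n :: nat and z assume "z \<in> cball x d \<inter> {s. Re s > 1}"
    then have "\<bar>Re x - Re z\<bar> \<le> d" using abs_Re_le_cmod[of "x - z"] by (simp add: dist_norm)
    moreover have "Re x = 1 + 2 * d" by (simp add: d_def field_simps)
    ultimately have "Re z \<ge> 1 + d" by linarith
    then show "norm (1 / of_nat (n + 2) powr z :: complex) \<le> real (n + 2) powr (- (1 + d))"
      using norm_powr_nat[of "Suc n" z] by (simp del: of_nat_Suc of_nat_add add: powr_mono)
  qed
qed

text \<open>Comparison with the exponent 2: as (n + 2) / 2 is at least 1, its power - Re s is at
  most its power - 2. The bound on partial sums is uniform in their length, as the exchange of limit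
  and sum in \<open>ztail_functional\<close> requires.\<close>

lemma ztail_bound:
  obtains K where "K \<ge> 0" "\<And>s N. Re s \<ge> 2 \<Longrightarrow> norm (\<Sum>n<N. 1 / of_nat (n + 2) powr s) \<le> K * 2 powr (- Re s)"
    "\<And>s. Re s \<ge> 2 \<Longrightarrow> norm (ztail s) \<le> K * 2 powr (- Re s)"
proof -
  define K where "K = (\<Sum>n. 4 * real (n + 2) powr (- 2))"
  have sK: "summable (\<lambda>n. 4 * real (n + 2) powr (- 2))" by (intro summable_mult summable_nat_powr) auto
  have b: "norm (1 / of_nat (n + 2) powr s :: complex) \<le> 4 * real (n + 2) powr (- 2) * 2 powr (- Re s)" if "Re s \<ge> 2" for n s
  proof -
    have "norm (1 / of_nat (n + 2) powr s :: complex) = real (n + 2) powr (- Re s)"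
      using norm_powr_nat[of "Suc n" s] by (simp del: of_nat_Suc of_nat_add)
    also have "\<dots> = (real (n + 2) / 2) powr (- Re s) * 2 powr (- Re s)"
    proof -
      have e: "real (n + 2) / 2 * 2 = real (n + 2)" by simp
      have "(real (n + 2) / 2 * 2) powr (- Re s) = (real (n + 2) / 2) powr (- Re s) * 2 powr (- Re s)"
        by (rule powr_mult)
      then show ?thesis by (simp only: e)
    qed
    also have "(real (n + 2) / 2) powr (- Re s) \<le> (real (n + 2) / 2) powr (- 2)"
      using that by (intro powr_mono) auto
    also have "\<dots> = 4 * real (n + 2) powr (- 2)"
      by (subst powr_divide) (auto simp: powr_minus divide_simps)
    finally show ?thesis by (simp add: mult_right_mono)
  qed
  have fin: "norm (\<Sum>n<N. 1 / of_nat (n + 2) powr s :: complex) \<le> K * 2 powr (- Re s)" if "Re s \<ge> 2" for s N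
  proof -
    have "norm (\<Sum>n<N. 1 / of_nat (n + 2) powr s :: complex) \<le> (\<Sum>n<N. 4 * real (n + 2) powr (- 2) * 2 powr (- Re s))"
      by (intro sum_norm_le b that)
    also have "\<dots> = (\<Sum>n<N. 4 * real (n + 2) powr (- 2)) * 2 powr (- Re s)"
      by (simp add: sum_distrib_right)
    also have "\<dots> \<le> K * 2 powr (- Re s)"
      unfolding K_def by (intro mult_right_mono sum_le_suminf sK) auto
    finally show ?thesis .
  qed
  have "norm (ztail s) \<le> K * 2 powr (- Re s)" if s: "Re s \<ge> 2" for s
  proof -
    have "(\<lambda>N. norm (\<Sum>n<N. 1 / of_nat (n + 2) powr s :: complex)) \<longlonglongrightarrow> norm (ztail s)"
      unfolding ztail_def using s by (intro tendsto_norm summable_LIMSEQ summable_norm_cancel[OF summable_ztail]) auto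
    then show ?thesis by (rule LIMSEQ_le_const2) (use fin[OF s] in auto)
  qed
  moreover have "K \<ge> 0" unfolding K_def by (intro suminf_nonneg sK) auto
  ultimately show ?thesis using that fin by blast
qed

lemma norm_pochhammer_le: "norm (pochhammer (z::complex) n) \<le> pochhammer (norm z) n"
proof (induction n)
  case (Suc n)
  have "norm (pochhammer z n * (z + of_nat n)) \<le> pochhammer (norm z) n * (norm z + real n)"
    unfolding norm_mult by (intro mult_mono Suc order_trans[OF norm_triangle_ineq]) (auto simp: pochhammer_prod prod_nonneg)
  then show ?case by (simp add: pochhammer_Suc)
qed auto

lemma pochhammer_nonneg_real: "0 \<le> a \<Longrightarrow> 0 \<le> pochhammer (a::real) n"
  by (simp add: pochhammer_prod prod_nonneg)

lemma pochhammer_mono_real: "0 \<le> a \<Longrightarrow> a \<le> b \<Longrightarrow> pochhammer (a::real) n \<le> pochhammer b n"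
proof (induction n)
  case (Suc n)
  then show ?case unfolding pochhammer_Suc by (intro mult_mono) (auto simp: pochhammer_prod intro!: prod_nonneg)
qed auto

text \<open>The binomial series of 1 - x to the power - R.\<close>

lemma summable_pochhammer: "\<bar>x\<bar> < 1 \<Longrightarrow> summable (\<lambda>n. pochhammer (R::real) n / fact n * x ^ n)"
proof -
  assume "\<bar>x\<bar> < 1"
  then have "(\<lambda>n. (- R gchoose n) * (- x) ^ n) sums (1 + (- x)) powr (- R)"
    by (intro gen_binomial_real) auto
  moreover have "(- R gchoose n) * (- x) ^ n = pochhammer R n / fact n * x ^ n" for n
    by (subst gbinomial_pochhammer, subst power_minus) simp
  ultimately show ?thesis by (simp add: sums_iff)
qed

text \<open>The binomial series of 1 - 1 / n to the power 1 - s, multiplied by n to the power 1 - s,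
  with the two leading terms moved to the other side. The series converges because 1 / n <
  1.\<close>

lemma powr_pred_expansion:
  assumes "n \<ge> (2::nat)"
  shows "(\<lambda>i. pochhammer (s - 1) (i + 2) / fact (i + 2) * (1 / of_nat n powr (s + of_nat i + 1))) sums
    (of_nat (n - 1) powr (1 - s) - of_nat n powr (1 - s) - (s - 1) * (1 / of_nat n powr s) :: complex)"
proof -
  have nz: "(of_nat n :: complex) \<noteq> 0" using assms by auto
  have "(\<lambda>j. ((1 - s) gchoose j) * (- 1 / of_nat n) ^ j) sums (1 + (- 1 / of_nat n)) powr (1 - s)"
    using assms by (intro gen_binomial_complex) (simp add: norm_divide)
  also have "(\<lambda>j. ((1 - s) gchoose j) * (- 1 / of_nat n) ^ j) = (\<lambda>j. pochhammer (s - 1) j / fact j * (1 / of_nat n) ^ j)"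
  proof
    fix j
    have "(- 1 / of_nat n) ^ j = (- 1) ^ j * (1 / of_nat n :: complex) ^ j"
      by (simp flip: power_mult_distrib)
    then show "((1 - s) gchoose j) * (- 1 / of_nat n) ^ j = pochhammer (s - 1) j / fact j * (1 / of_nat n) ^ j"
      by (simp add: gbinomial_pochhammer flip: power_mult_distrib mult.assoc)
  qed
  finally have "(\<lambda>j. of_nat n powr (1 - s) * (pochhammer (s - 1) j / fact j * (1 / of_nat n) ^ j)) sums
      (of_nat n powr (1 - s) * (1 + (- 1 / of_nat n)) powr (1 - s))"
    by (rule sums_mult)
  also have "of_nat n powr (1 - s) * (1 + (- 1 / of_nat n)) powr (1 - s) = (of_nat n * (1 + (- 1 / of_nat n))) powr (1 - s)"
  proof (rule powr_times_real[symmetric])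
    have *: "1 + - 1 / of_nat n = complex_of_real (1 - 1 / real n)" by simp
    show "(1 + - 1 / of_nat n :: complex) \<in> \<real>" unfolding * by (rule Reals_of_real)
    show "0 \<le> Re (1 + - 1 / of_nat n)" unfolding * Re_complex_of_real using assms by (simp add: field_simps)
  qed auto
  also have "of_nat n * (1 + (- 1 / of_nat n)) = (of_nat (n - 1) :: complex)"
    using assms nz by (simp add: of_nat_diff field_simps)
  finally have A: "(\<lambda>j. of_nat n powr (1 - s) * (pochhammer (s - 1) j / fact j * (1 / of_nat n) ^ j)) sums of_nat (n - 1) powr (1 - s)" .
  have t: "of_nat n powr (1 - s) * (1 / of_nat n) ^ (i + 1) = 1 / of_nat n powr (s + of_nat i)" for i
  proof -
    have "of_nat n powr (s + of_nat i) * of_nat n powr (1 - s) = of_nat n powr (of_nat (i + 1))"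
      by (subst powr_add[symmetric]) (simp add: add.commute)
    also have "\<dots> = (of_nat n :: complex) ^ (i + 1)" using nz by (subst powr_nat') auto
    finally show ?thesis using nz by (simp add: power_one_over field_simps del: power_Suc of_nat_Suc)
  qed
  have "(\<lambda>i. of_nat n powr (1 - s) * (pochhammer (s - 1) (i + 2) / fact (i + 2) * (1 / of_nat n) ^ (i + 2))) sums
     (of_nat (n - 1) powr (1 - s) - (\<Sum>j<2. of_nat n powr (1 - s) * (pochhammer (s - 1) j / fact j * (1 / of_nat n) ^ j)))"
    using A by (rule sums_split_initial_segment)
  also have "(\<Sum>j<2. of_nat n powr (1 - s) * (pochhammer (s - 1) j / fact j * (1 / of_nat n) ^ j)) =
      of_nat n powr (1 - s) + (s - 1) * (of_nat n powr (1 - s) * (1 / of_nat n) ^ (0 + 1))"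
    by (simp add: numeral_2_eq_2)
  also have "of_nat n powr (1 - s) * (1 / of_nat n) ^ (0 + 1) = 1 / of_nat n powr s"
    using t[of 0] by simp
  also have "(\<lambda>i. of_nat n powr (1 - s) * (pochhammer (s - 1) (i + 2) / fact (i + 2) * (1 / of_nat n) ^ (i + 2))) =
     (\<lambda>i. pochhammer (s - 1) (i + 2) / fact (i + 2) * (1 / of_nat n powr (s + of_nat i + 1)))"
  proof
    fix i
    show "of_nat n powr (1 - s) * (pochhammer (s - 1) (i + 2) / fact (i + 2) * (1 / of_nat n) ^ (i + 2)) =
      pochhammer (s - 1) (i + 2) / fact (i + 2) * (1 / of_nat n powr (s + of_nat i + 1))"
    proof -
      have "i + 2 = (i + 1) + 1" "s + of_nat i + 1 = s + of_nat (i + 1)" by simp_all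
      then have "of_nat n powr (1 - s) * (1 / of_nat n) ^ (i + 2) = 1 / of_nat n powr (s + of_nat i + 1)"
        using t[of "i + 1"] by (simp only:)
      then show ?thesis by (simp only: mult.left_commute[of "of_nat n powr (1 - s)"])
    qed
  qed
  finally show ?thesis by (simp add: algebra_simps)
qed

lemma half_powr: "2 powr (- real i) = (1/2 :: real) ^ i"
proof -
  have "2 powr (- real i) = inverse ((2::real) ^ i)"
    by (subst powr_minus, subst powr_realpow) auto
  then show ?thesis by (simp add: power_one_over inverse_eq_divide)
qed

text \<open>Summed over n, the differences in \<open>powr_pred_expansion\<close> telescope to 1. The
  remainder is a double series over n and i, whose order is exchanged by Tannery's theorem with the
  geometric decay from \<open>ztail_bound\<close>.\<close>

lemma ztail_functional:
  assumes s: "Re s > 1"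
  shows "(s - 1) * ztail s = 1 - (\<Sum>i. pochhammer (s - 1) (i + 2) / fact (i + 2) * ztail (s + of_nat i + 1))"
proof -
  define coef where "coef i = pochhammer (s - 1) (i + 2) / fact (i + 2)" for i
  obtain K where K: "K \<ge> 0" "\<And>s N. Re s \<ge> 2 \<Longrightarrow> norm (\<Sum>n<N. 1 / of_nat (n + 2) powr s) \<le> K * 2 powr (- Re s)"
    by (rule ztail_bound) blast
  have fin: "(\<Sum>i. coef i * (\<Sum>n<N. 1 / of_nat (n + 2) powr (s + of_nat i + 1))) =
     1 - of_nat (N + 1) powr (1 - s) - (s - 1) * (\<Sum>n<N. 1 / of_nat (n + 2) powr s)" for N
  proof -
    have "(\<lambda>i. \<Sum>n<N. coef i * (1 / of_nat (n + 2) powr (s + of_nat i + 1))) sums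
      (\<Sum>n<N. of_nat (n + 2 - 1) powr (1 - s) - of_nat (n + 2) powr (1 - s) - (s - 1) * (1 / of_nat (n + 2) powr s))"
      unfolding coef_def by (intro sums_sum powr_pred_expansion) auto
    also have "(\<lambda>i. \<Sum>n<N. coef i * (1 / of_nat (n + 2) powr (s + of_nat i + 1))) =
        (\<lambda>i. coef i * (\<Sum>n<N. 1 / of_nat (n + 2) powr (s + of_nat i + 1)))"
      by (simp add: sum_distrib_left)
    also have "(\<Sum>n<N. of_nat (n + 2 - 1) powr (1 - s) - of_nat (n + 2) powr (1 - s) - (s - 1) * (1 / of_nat (n + 2) powr s)) =
       (\<Sum>n<N. of_nat (n + 1) powr (1 - s) - of_nat (Suc n + 1) powr (1 - s)) - (s - 1) * (\<Sum>n<N. 1 / of_nat (n + 2) powr s)"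
      by (simp add: sum_subtractf sum_distrib_left)
    also have "(\<Sum>n<N. of_nat (n + 1) powr (1 - s) - of_nat (Suc n + 1) powr (1 - s)) = 1 - of_nat (N + 1) powr (1 - s)"
      using sum_lessThan_telescope'[of "\<lambda>n. of_nat (n + 1) powr (1 - s)" N] by simp
    finally show ?thesis by (simp add: sums_iff)
  qed
  have lim0: "(\<lambda>N. of_nat (N + 1) powr (1 - s)) \<longlonglongrightarrow> 0"
  proof (rule tendsto_norm_zero_cancel)
    have *: "norm (of_nat (N + 1) powr (1 - s) :: complex) = real (N + 1) powr (1 - Re s)" for N
      by (subst norm_powr_real_powr) auto
    have "(\<lambda>N. real (N + 1) powr (1 - Re s)) \<longlonglongrightarrow> 0"
      using s by (intro tendsto_neg_powr filterlim_real_sequentially filterlim_compose[OF filterlim_real_sequentially] filterlim_add_const_nat_at_top) auto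
    then show "(\<lambda>N. norm (of_nat (N + 1) powr (1 - s) :: complex)) \<longlonglongrightarrow> 0" unfolding * .
  qed
  have limz: "(\<lambda>N. \<Sum>n<N. 1 / of_nat (n + 2) powr s') \<longlonglongrightarrow> ztail s'" if "Re s' > 1" for s'
    unfolding ztail_def by (intro summable_LIMSEQ summable_norm_cancel[OF summable_ztail] that)
  have "(\<lambda>N. \<Sum>i. coef i * (\<Sum>n<N. 1 / of_nat (n + 2) powr (s + of_nat i + 1))) \<longlonglongrightarrow> (\<Sum>i. coef i * ztail (s + of_nat i + 1))"
  proof (rule tannerys_theorem[THEN conjunct2, THEN conjunct2])
    show "(\<lambda>N. coef i * (\<Sum>n<N. 1 / of_nat (n + 2) powr (s + of_nat i + 1))) \<longlonglongrightarrow> coef i * ztail (s + of_nat i + 1)" for i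
      using s by (intro tendsto_intros limz) auto
    \<comment> \<open>The factor 4 pays for writing the geometric factor as (1/2)^(i + 2), which
      matches the index of the Pochhammer symbol.\<close>
    let ?M = "\<lambda>i. K * 4 * (pochhammer (norm (s - 1)) (i + 2) / fact (i + 2) * (1/2) ^ (i + 2))"
    show "summable ?M"
      using summable_ignore_initial_segment[OF summable_pochhammer[of "1/2" "norm (s - 1)"], of 2]
      by (intro summable_mult) simp
    show "\<forall>\<^sub>F (i, N) in at_top \<times>\<^sub>F sequentially. norm (coef i * (\<Sum>n<N. 1 / of_nat (n + 2) powr (s + of_nat i + 1))) \<le> ?M i"
    proof (rule always_eventually, clarify)
      fix i N
      have c: "norm (coef i) \<le> pochhammer (norm (s - 1)) (i + 2) / fact (i + 2)"
        unfolding coef_def norm_divide using norm_pochhammer_le[of "s - 1" "i + 2"] by (simp add: divide_right_mono del: fact_Suc)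
      have "norm (\<Sum>n<N. 1 / of_nat (n + 2) powr (s + of_nat i + 1) :: complex) \<le> K * 2 powr (- Re (s + of_nat i + 1))"
        using s by (intro K) auto
      also have "\<dots> \<le> K * 2 powr (- real i)" using s K by (intro mult_left_mono powr_mono) auto
      also have "2 powr (- real i) = (4::real) * (1/2) ^ (i + 2)"
        using half_powr[of i] by simp
      finally have "norm (\<Sum>n<N. 1 / of_nat (n + 2) powr (s + of_nat i + 1) :: complex) \<le> K * (4 * (1/2) ^ (i + 2))" .
      then have "norm (coef i) * norm (\<Sum>n<N. 1 / of_nat (n + 2) powr (s + of_nat i + 1) :: complex)
          \<le> pochhammer (norm (s - 1)) (i + 2) / fact (i + 2) * (K * (4 * (1/2) ^ (i + 2)))"
        by (intro mult_mono c norm_ge_zero divide_nonneg_nonneg pochhammer_nonneg_real fact_ge_zero)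
      then show "norm (coef i * (\<Sum>n<N. 1 / of_nat (n + 2) powr (s + of_nat i + 1))) \<le> ?M i"
        by (simp only: norm_mult mult_ac)
    qed
  qed auto
  then have "(\<lambda>N. 1 - of_nat (N + 1) powr (1 - s) - (s - 1) * (\<Sum>n<N. 1 / of_nat (n + 2) powr s)) \<longlonglongrightarrow> (\<Sum>i. coef i * ztail (s + of_nat i + 1))"
    unfolding fin .
  moreover have "(\<lambda>N. 1 - of_nat (N + 1) powr (1 - s) - (s - 1) * (\<Sum>n<N. 1 / of_nat (n + 2) powr s)) \<longlonglongrightarrow> 1 - 0 - (s - 1) * ztail s"
    by (intro tendsto_intros lim0 limz s)
  ultimately have "1 - 0 - (s - 1) * ztail s = (\<Sum>i. coef i * ztail (s + of_nat i + 1))"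
    using LIMSEQ_unique by blast
  then show ?thesis by (simp add: coef_def algebra_simps)
qed

text \<open>\<open>(s - 1) (\<zeta>(s) - 1)\<close>, continued one unit to the left at a time:
  expand each term of the telescoping sum \<open>\<Sum>n\<ge>2. (n - 1) powr (1 - s) - n powr (1 - s) = 1\<close> in powers of \<open>1 / n\<close>.\<close>

primrec zcont :: "nat \<Rightarrow> complex \<Rightarrow> complex" where
  "zcont 0 s = (s - 1) * ztail s"
| "zcont (Suc N) s = 1 - (\<Sum>i. pochhammer (s - 1) (i + 1) / fact (i + 2) * zcont N (s + of_nat i + 1))"

text \<open>The last factor s + i of \<open>pochhammer (s - 1) (i + 2)\<close> is contained in
  \<open>zcont N (s + of_nat i + 1)\<close>, which is why the recursion has only i + 1 factors. So
  the case N = 0 is \<open>ztail_functional\<close>, and the induction step is termwise.\<close>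

lemma zcont_Suc: "Re s > 1 - real N \<Longrightarrow> zcont (Suc N) s = zcont N s"
proof (induction N arbitrary: s)
  case 0
  have "pochhammer (s - 1) (i + 1) / fact (i + 2) * zcont 0 (s + of_nat i + 1) =
      pochhammer (s - 1) (i + 2) / fact (i + 2) * ztail (s + of_nat i + 1)" for i
  proof -
    have "pochhammer (s - 1) (i + 2) = pochhammer (s - 1) (i + 1) * (s + of_nat i)"
      using pochhammer_Suc[of "s - 1" "i + 1"] by (simp add: algebra_simps)
    then show ?thesis by (simp only: zcont.simps) (simp add: mult_ac del: fact_Suc)
  qed
  then show ?case using ztail_functional[of s] 0 by (simp only: zcont.simps(2)[of 0] zcont.simps(1)[of s])
next
  case (Suc N)
  have "zcont (Suc N) (s + of_nat i + 1) = zcont N (s + of_nat i + 1)" for i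
    by (rule Suc.IH) (use Suc.prems in simp)
  then show ?case by (simp only: zcont.simps(2)[of "Suc N"] zcont.simps(2)[of N])
qed

lemma zcont_le:
  assumes "Re s > 1 - real N" "N \<le> M"
  shows "zcont M s = zcont N s"
  using assms(2)
proof (induction M rule: dec_induct)
  case (step M)
  have "zcont (Suc M) s = zcont M s" using step assms by (intro zcont_Suc) auto
  then show ?case using step by simp
qed auto

text \<open>Near a given point only finitely many shifted arguments lie to the left of Re = 2. For
  the others \<open>zcont N\<close> is \<open>zcont 0\<close>, whose geometric decay beats the
  Pochhammer symbols.\<close>

lemma holomorphic_zcont: "zcont N holomorphic_on {s. Re s > 1 - real N}"
proof (induction N)
  case 0
  show ?case using holomorphic_ztail by (auto intro!: holomorphic_intros)
next
  case (Suc N)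
  let ?S = "{s. Re s > 1 - real (Suc N)}"
  obtain K where K: "K \<ge> 0" "\<And>s. Re s \<ge> 2 \<Longrightarrow> norm (ztail s) \<le> K * 2 powr (- Re s)"
    by (rule ztail_bound) blast
  have "(\<lambda>s. \<Sum>i. pochhammer (s - 1) (i + 1) / fact (i + 2) * zcont N (s + of_nat i + 1)) holomorphic_on ?S"
  proof (rule holomorphic_on_suminf(1))
    show "open ?S" by (rule open_halfspace_Re_gt)
    show "(\<lambda>s. pochhammer (s - 1) (i + 1) / fact (i + 2) * zcont N (s + of_nat i + 1)) holomorphic_on ?S" for i
    proof -
      have h1: "(\<lambda>s. pochhammer (s - 1) (i + 1)) holomorphic_on ?S"
        unfolding pochhammer_prod by (intro holomorphic_intros)
      have h2: "(\<lambda>s. zcont N (s + of_nat i + 1)) holomorphic_on ?S"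
      proof -
        have "zcont N \<circ> (\<lambda>s. s + of_nat i + 1) holomorphic_on ?S"
          by (rule holomorphic_on_compose_gen[OF _ Suc.IH]) (auto intro!: holomorphic_intros)
        then show ?thesis by (simp only: o_def)
      qed
      show ?thesis by (intro holomorphic_on_mult holomorphic_on_divide h1 h2 holomorphic_on_const) (rule fact_nonzero)
    qed
    fix x assume "x \<in> ?S"
    define R where "R = norm x + 2"
    let ?M = "\<lambda>i. K * 2 powr (R + 1) * (pochhammer R (i + 2) / fact (i + 2) * (1/2) ^ (i + 2))"
    show "\<exists>d M N'. d > 0 \<and> summable M \<and> (\<forall>i\<ge>N'. \<forall>z\<in>cball x d \<inter> ?S.
        norm (pochhammer (z - 1) (i + 1) / fact (i + 2) * zcont N (z + of_nat i + 1)) \<le> M i)"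
    proof (intro exI conjI allI impI ballI)
      show "(1::real) > 0" by simp
      show "summable ?M"
        using summable_ignore_initial_segment[OF summable_pochhammer[of "1/2" R], of 2]
        by (intro summable_mult) simp
      fix i z assume i: "i \<ge> nat \<lceil>R\<rceil> + 1" and z: "z \<in> cball x 1 \<inter> ?S"
      have nz: "norm z \<le> R - 1" using z norm_triangle_sub[of z x] by (simp add: R_def dist_norm norm_minus_commute)
      then have n1: "norm (z - 1) \<le> R" using norm_triangle_ineq4[of z 1] by simp
      have iR: "real i \<ge> R + 1" using i by linarith
      have Rez: "Re z \<ge> 1 - R" using nz abs_Re_le_cmod[of z] by linarith
      have "zcont N (z + of_nat i + 1) = zcont 0 (z + of_nat i + 1)"
        using iR Rez by (intro zcont_le) auto
      also have "\<dots> = (z + of_nat i) * ztail (z + of_nat i + 1)" by simp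
      finally have "norm (zcont N (z + of_nat i + 1)) = norm (z + of_nat i) * norm (ztail (z + of_nat i + 1))"
        by (simp only: norm_mult)
      also have "\<dots> \<le> (R + real (i + 1)) * (K * 2 powr (- Re (z + of_nat i + 1)))"
      proof (intro mult_mono K)
        show "norm (z + of_nat i) \<le> R + real (i + 1)"
          using nz norm_triangle_ineq[of z "of_nat i"] by simp
      qed (use iR Rez in \<open>auto simp: R_def\<close>)
      also have "\<dots> \<le> (R + real (i + 1)) * (K * 2 powr (R - 1 - real i))"
        using K Rez iR by (intro mult_left_mono powr_mono) (auto simp: R_def)
      also have "2 powr (R - 1 - real i) = 2 powr (R + 1) * (1/2) ^ (i + 2)"
      proof -
        have "2 powr (R - 1 - real i) = 2 powr (R + 1) * 2 powr (- real (i + 2))"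
          by (subst powr_add[symmetric]) (simp add: algebra_simps)
        also have "2 powr (- real (i + 2)) = (1/2 :: real) ^ (i + 2)"
          by (rule half_powr)
        finally show ?thesis .
      qed
      finally have zb: "norm (zcont N (z + of_nat i + 1)) \<le> (R + real (i + 1)) * (K * (2 powr (R + 1) * (1/2) ^ (i + 2)))" .
      have "norm (pochhammer (z - 1) (i + 1)) \<le> pochhammer R (i + 1)"
        using norm_pochhammer_le pochhammer_mono_real[OF _ n1] by (meson norm_ge_zero order_trans)
      then have "norm (pochhammer (z - 1) (i + 1) / fact (i + 2)) \<le> pochhammer R (i + 1) / fact (i + 2)"
        by (simp add: norm_divide divide_right_mono del: fact_Suc)
      then have "norm (pochhammer (z - 1) (i + 1) / fact (i + 2) * zcont N (z + of_nat i + 1)) \<le>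
         pochhammer R (i + 1) / fact (i + 2) * ((R + real (i + 1)) * (K * (2 powr (R + 1) * (1/2) ^ (i + 2))))"
        unfolding norm_mult by (intro mult_mono zb norm_ge_zero divide_nonneg_nonneg pochhammer_nonneg_real fact_ge_zero) (auto simp: R_def)
      also have "\<dots> = ?M i"
        using pochhammer_Suc[of R "i + 1"] by simp
      finally show "norm (pochhammer (z - 1) (i + 1) / fact (i + 2) * zcont N (z + of_nat i + 1)) \<le> ?M i" .
    qed
  qed
  then show ?case by (auto intro!: holomorphic_intros)
qed

text \<open>The entire function (s - 1) (\<zeta>(s) - 1). The number N of steps depends on s and is
  chosen so that Re s > 1 - N; by \<open>zcont_le\<close> every larger number gives the same
  value.\<close>

definition zent :: "complex \<Rightarrow> complex" where
  "zent s = zcont (nat \<lceil>2 - Re s\<rceil>) s"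

lemma zent_eq: "Re s > 1 - real N \<Longrightarrow> zent s = zcont N s"
proof -
  assume N: "Re s > 1 - real N"
  let ?M = "nat \<lceil>2 - Re s\<rceil>"
  have M: "Re s > 1 - real ?M" by linarith
  show ?thesis
    using zcont_le[OF N, of "max N ?M"] zcont_le[OF M, of "max N ?M"] by (simp add: zent_def)
qed

lemma zent_rec: "zent s = 1 - (\<Sum>i. pochhammer (s - 1) (i + 1) / fact (i + 2) * zent (s + of_nat i + 1))"
proof -
  let ?N = "nat \<lceil>2 - Re s\<rceil>"
  have N: "Re s > 1 - real ?N" by linarith
  have "zent s = zcont (Suc ?N) s" using N by (intro zent_eq) auto
  moreover have "zent (s + of_nat i + 1) = zcont ?N (s + of_nat i + 1)" for i
    using N by (intro zent_eq) auto
  ultimately show ?thesis by simp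
qed

lemma holomorphic_zent: "zent holomorphic_on UNIV"
  unfolding holomorphic_on_def
proof
  fix s :: complex
  let ?N = "nat \<lceil>2 - Re s\<rceil>"
  let ?S = "{z. Re z > 1 - real ?N}"
  have S: "open ?S" "s \<in> ?S" by (rule open_halfspace_Re_gt) (simp, linarith)
  have "zent holomorphic_on ?S"
    by (rule holomorphic_transform[OF holomorphic_zcont]) (simp add: zent_eq)
  then show "zent field_differentiable at s within UNIV"
    using S holomorphic_on_imp_differentiable_at by blast
qed

lemma zent_sums:
  assumes "Re s > 1"
  shows "(\<lambda>n. 1 / of_nat (Suc n) powr s) sums (1 + zent s / (s - 1))"
proof -
  have "(\<lambda>n. 1 / of_nat (Suc (Suc n)) powr s) sums ztail s"
    using summable_sums[OF summable_norm_cancel[OF summable_ztail[OF assms]]] unfolding ztail_def add_2_eq_Suc' .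
  then have "(\<lambda>n. 1 / of_nat (Suc n) powr s) sums (ztail s + 1 / of_nat (Suc 0) powr s)"
    using sums_Suc_iff[of "\<lambda>n. 1 / of_nat (Suc n) powr s" "ztail s"] by blast
  moreover have "zent s = (s - 1) * ztail s" using assms zent_eq[of 0 s] by simp
  moreover have "s \<noteq> 1" using assms by auto
  ultimately show ?thesis by (simp add: add.commute)
qed

text \<open>The function built above is a witness, so the choice in the definition of
  \<open>zeta\<close> is not vacuous.\<close>

lemma zeta_spec: "zeta holomorphic_on - {1}"
  "Re s > 1 \<Longrightarrow> (\<lambda>n. 1 / of_nat (Suc n) powr s) sums zeta s"
proof -
  have "\<exists>f. f holomorphic_on - {1} \<and> (\<forall>s. Re s > 1 \<longrightarrow> (\<lambda>n. 1 / of_nat (Suc n) powr s) sums f s)"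
  proof (intro exI[of _ "\<lambda>s. 1 + zent s / (s - 1)"] conjI allI impI zent_sums)
    show "(\<lambda>s. 1 + zent s / (s - 1)) holomorphic_on - {1}"
      by (intro holomorphic_intros holomorphic_on_subset[OF holomorphic_zent]) auto
  qed
  from someI_ex[OF this, folded zeta_def]
  show "zeta holomorphic_on - {1}" "Re s > 1 \<Longrightarrow> (\<lambda>n. 1 / of_nat (Suc n) powr s) sums zeta s" by auto
qed

text \<open>The identity theorem: both sides agree for Re s > 1, and the plane without the point 1
  is connected. Hence the choice made by \<open>SOME\<close> is determined away from the
  pole.\<close>

lemma zeta_eq_zent:
  assumes "s \<noteq> 1"
  shows "zeta s = 1 + zent s / (s - 1)"
proof (rule analytic_continuation_open[where s = "{s. Re s > 1}" and s' = "- {1}" and f = zeta and g = "\<lambda>s. 1 + zent s / (s - 1)"])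
  show "open {s. Re s > 1}" by (rule open_halfspace_Re_gt)
  show "{s. Re s > 1} \<noteq> {}" by (auto intro!: exI[of _ 2])
  show "connected (- {1::complex})" by (rule connected_punctured_universe) simp
  show "zeta holomorphic_on - {1}" by (rule zeta_spec)
  show "(\<lambda>s. 1 + zent s / (s - 1)) holomorphic_on - {1}"
    by (intro holomorphic_intros holomorphic_on_subset[OF holomorphic_zent]) auto
  show "zeta z = 1 + zent z / (z - 1)" if "z \<in> {s. Re s > 1}" for z
    using zeta_spec(2)[of z] zent_sums[of z] that sums_unique2 by auto
qed (use assms in auto)

section \<open>Bernoulli numbers, with generating series t / (e^t - 1), and zeta values at the
  nonpositive integers\<close>

definition bern :: "real fps" where
  "bern = inverse (Abs_fps (\<lambda>n. 1 / fact (Suc n)))"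

lemma bern_mult_E: "bern * Abs_fps (\<lambda>n. 1 / fact (Suc n)) = 1"
  unfolding bern_def by (intro inverse_mult_eq_1) simp

lemma bern_mult: "bern * (fps_exp 1 - 1) = fps_X"
proof -
  have "fps_exp 1 - 1 = fps_X * Abs_fps (\<lambda>n. 1 / fact (Suc n) :: real)"
  proof (rule fps_ext)
    fix n show "fps_nth (fps_exp 1 - 1) n = fps_nth (fps_X * Abs_fps (\<lambda>n. 1 / fact (Suc n) :: real)) n"
      by (cases n) (simp_all add: fps_X_mult_nth del: fact_Suc)
  qed
  then have "bern * (fps_exp 1 - 1) = fps_X * (bern * Abs_fps (\<lambda>n. 1 / fact (Suc n)))"
    by (simp only: mult_ac)
  then show ?thesis by (simp only: bern_mult_E mult_1_right)
qed

lemma bern_0: "fps_nth bern 0 = 1"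
  by (simp add: bern_def)

lemma bern_1: "fps_nth bern 1 = - 1 / 2"
proof -
  have "fps_nth (bern * Abs_fps (\<lambda>n. 1 / fact (Suc n))) 1 = 0" by (simp only: bern_mult_E) simp
  then show ?thesis by (simp add: fps_mult_nth bern_0)
qed

text \<open>At - t the series t / (e^t - 1) becomes t e^t / (e^t - 1), which exceeds it by t; hence
  the odd coefficients beyond the first vanish.\<close>

lemma bern_uminus: "bern oo (fps_const (- 1) * fps_X) = bern + fps_X"
proof -
  let ?L = "fps_const (- 1) * fps_X :: real fps"
  have nz: "fps_nth ?L 0 = 0" by simp
  have "(bern * (fps_exp 1 - 1)) oo ?L = fps_X oo ?L" by (simp only: bern_mult)
  then have "(bern oo ?L) * ((fps_exp 1 oo ?L) - 1) = ?L"
    by (simp only: fps_compose_mult_distrib[OF nz] fps_compose_sub_distrib fps_compose_1 fps_X_fps_compose_startby0[OF nz])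
  then have *: "(bern oo ?L) * (fps_exp (- 1) - 1) = ?L"
    by (simp only: fps_exp_compose_linear mult_1_right)
  have e: "fps_exp 1 * fps_exp (- 1) = (1 :: real fps)"
    using fps_exp_add_mult[of "1::real" "- 1"] by simp
  define C where "C = bern oo ?L"
  have L: "?L = - fps_X" by (simp flip: fps_const_neg)
  have s: "C * (fps_exp (- 1) - 1) = - fps_X" using * by (simp only: C_def L)
  have "C * (fps_exp 1 * fps_exp (- 1)) - C * fps_exp 1 = C * (fps_exp (- 1) - 1) * fps_exp 1"
    by (simp add: algebra_simps)
  also have "\<dots> = - (fps_X * fps_exp 1)" by (simp only: s mult_minus_left)
  finally have "C - C * fps_exp 1 = - (fps_X * fps_exp 1)" by (simp only: e mult_1_right)
  then have "(bern oo ?L) * (fps_exp 1 - 1) = fps_X * fps_exp 1"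
    by (simp add: C_def[symmetric] right_diff_distrib) (metis minus_diff_eq minus_minus)
  also have "\<dots> = (bern + fps_X) * (fps_exp 1 - 1)"
    by (simp only: distrib_right bern_mult) (simp add: algebra_simps)
  finally show ?thesis
  proof (rule mult_right_cancel[THEN iffD1, rotated])
    have "fps_nth (fps_exp 1 - 1 :: real fps) 1 \<noteq> 0" by simp
    then show "fps_exp 1 - 1 \<noteq> (0 :: real fps)" by (metis fps_zero_nth)
  qed
qed

lemma bern_odd_eq_0: "odd n \<Longrightarrow> n \<noteq> 1 \<Longrightarrow> fps_nth bern n = 0"
proof -
  assume n: "odd n" "n \<noteq> 1"
  have "fps_nth (bern oo (fps_const (- 1) * fps_X)) n = (- 1) ^ n * fps_nth bern n"
    by (subst fps_nth_compose_linear) simp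
  then show ?thesis unfolding bern_uminus using n by (simp add: fps_X_def)
qed

lemma pochhammer_minus_nat:
  "j \<le> k \<Longrightarrow> pochhammer (- of_nat k) j * fact (k - j) = ((- 1) ^ j * fact k :: complex)"
proof (induction j)
  case (Suc j)
  have e: "k - j = Suc (k - Suc j)" using Suc.prems by simp
  have "pochhammer (- of_nat k) (Suc j) * fact (k - Suc j) = - (pochhammer (- of_nat k) j * (of_nat (k - j) * fact (k - Suc j)) :: complex)"
    using Suc.prems by (simp add: pochhammer_Suc of_nat_diff algebra_simps)
  also have "of_nat (k - j) * fact (k - Suc j) = (fact (k - j) :: complex)"
    unfolding e by simp
  also have "pochhammer (- of_nat k) j * fact (k - j) = ((- 1) ^ j * fact k :: complex)"
    using Suc by simp
  finally show ?case by simp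
qed auto

text \<open>At s = 1 - k the Pochhammer symbols vanish for i at least k, so \<open>zent_rec\<close>
  is a finite recursion, solved by a generating series. The factor e^(- t) reflects that the
  Dirichlet series starts at n = 2: t e^(- t) / (e^t - 1) is the sum of t e^(- n t) over n at least
  2.\<close>

lemma zent_one_minus_nat:
  "zent (1 - of_nat k) = of_real ((- 1) ^ k * fact k * fps_nth (bern * fps_exp (- 1)) k)"
proof (induction k rule: less_induct)
  case (less k)
  define U where "U = bern * fps_exp (- 1)"
  \<comment> \<open>The recursion in generating form: (e^t - 1) / t times U is e^(- t).\<close>
  have U: "(\<Sum>i<k. fps_nth U (k - (i + 1)) / fact (i + 2)) = (- 1) ^ k / fact k - fps_nth U k"
  proof -
    have "Abs_fps (\<lambda>n. 1 / fact (Suc n)) * U = (bern * Abs_fps (\<lambda>n. 1 / fact (Suc n))) * fps_exp (- 1)"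
      by (simp only: U_def mult_ac)
    then have "Abs_fps (\<lambda>n. 1 / fact (Suc n)) * U = fps_exp (- 1)" by (simp only: bern_mult_E mult_1_left)
    then have "fps_nth (Abs_fps (\<lambda>n. 1 / fact (Suc n)) * U) k = fps_nth (fps_exp (- 1)) k" by (rule arg_cong)
    then have "(\<Sum>i=0..k. 1 / fact (Suc i) * fps_nth U (k - i)) = (- 1) ^ k / fact k"
      by (simp only: fps_mult_nth fps_nth_Abs_fps fps_exp_nth of_nat_fact)
    moreover have "(\<Sum>i=0..k. 1 / fact (Suc i) * fps_nth U (k - i)) = fps_nth U k + (\<Sum>i<k. fps_nth U (k - (i + 1)) / fact (i + 2))"
      by (simp only: atLeast0AtMost sum.atMost_shift) simp
    ultimately show ?thesis by simp
  qed
  let ?t = "\<lambda>i. pochhammer (1 - of_nat k - 1) (i + 1) / fact (i + 2) * zent (1 - of_nat k + of_nat i + 1)"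
  have "?t i = 0" if "i \<notin> {..<k}" for i
  proof -
    have "pochhammer (- of_nat k :: complex) (i + 1) = 0"
      using that by (subst pochhammer_of_nat_eq_0_iff) auto
    then show ?thesis by simp
  qed
  then have "(\<Sum>i. ?t i) = (\<Sum>i<k. ?t i)" by (intro suminf_finite) auto
  also have "\<dots> = (\<Sum>i<k. of_real ((- 1) ^ k * fact k * (fps_nth U (k - (i + 1)) / fact (i + 2))))"
  proof (intro sum.cong refl)
    fix i assume "i \<in> {..<k}"
    then have i: "i + 1 \<le> k" by auto
    have p: "pochhammer (- of_nat k :: complex) (i + 1) = (- 1) ^ (i + 1) * fact k / fact (k - (i + 1))"
      using pochhammer_minus_nat[OF i] by (simp add: field_simps)
    have z: "zent (1 - of_nat k + of_nat i + 1) = zent (1 - of_nat (k - (i + 1)))"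
      using i by (simp add: of_nat_diff algebra_simps)
    have s: "(- 1) ^ (i + 1) * (- 1) ^ (k - (i + 1)) = ((- 1) ^ k :: complex)"
      using i by (simp only: power_add[symmetric] le_add_diff_inverse)
    have "?t i = (- 1) ^ (i + 1) * fact k / fact (k - (i + 1)) / fact (i + 2) *
       of_real ((- 1) ^ (k - (i + 1)) * fact (k - (i + 1)) * fps_nth U (k - (i + 1)))"
      unfolding z using less.IH[of "k - (i + 1)"] i p by (simp add: U_def)
    also have "\<dots> = ((- 1) ^ (i + 1) * (- 1) ^ (k - (i + 1))) * fact k * (of_real (fps_nth U (k - (i + 1))) / fact (i + 2))"
      by (simp add: field_simps del: fact_Suc power_Suc)
    also have "\<dots> = of_real ((- 1) ^ k * fact k * (fps_nth U (k - (i + 1)) / fact (i + 2)))"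
      unfolding s by (simp del: fact_Suc power_Suc)
    finally show "?t i = of_real ((- 1) ^ k * fact k * (fps_nth U (k - (i + 1)) / fact (i + 2)))" .
  qed
  also have "\<dots> = of_real ((- 1) ^ k * fact k * (\<Sum>i<k. fps_nth U (k - (i + 1)) / fact (i + 2)))"
    by (simp only: of_real_sum sum_distrib_left)
  also have "(- 1) ^ k * fact k * (\<Sum>i<k. fps_nth U (k - (i + 1)) / fact (i + 2)) = 1 - (- 1) ^ k * fact k * fps_nth U k"
    unfolding U by (simp add: algebra_simps)
  finally have "(\<Sum>i. ?t i) = of_real (1 - (- 1) ^ k * fact k * fps_nth U k)" .
  then show ?case using zent_rec[of "1 - of_nat k"] by (simp add: U_def)
qed

lemma zeta_minus_nat: "zeta (- of_nat m) = of_real ((- 1) ^ m * fact m * fps_nth bern (Suc m))"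
proof -
  define U where "U = bern * fps_exp (- 1)"
  have "U = bern - fps_X * fps_exp (- 1)"
  proof -
    have e: "fps_exp 1 * fps_exp (- 1) = (1 :: real fps)"
      using fps_exp_add_mult[of "1::real" "- 1"] by simp
    have "bern * (fps_exp 1 - 1) * fps_exp (- 1) = fps_X * fps_exp (- 1)" by (simp only: bern_mult)
    moreover have "bern * (fps_exp 1 - 1) * fps_exp (- 1) = bern * (fps_exp 1 * fps_exp (- 1)) - U"
      by (simp add: U_def algebra_simps)
    ultimately have "bern - U = fps_X * fps_exp (- 1)" by (simp only: e mult_1_right)
    then show ?thesis by (simp only: diff_eq_eq eq_diff_eq add.commute)
  qed
  then have U: "fps_nth U (Suc m) = fps_nth bern (Suc m) - (- 1) ^ m / fact m" by (simp add: fps_X_mult_nth)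
  have nz: "(- of_nat m :: complex) \<noteq> 1"
  proof
    assume "(- of_nat m :: complex) = 1"
    then have "Re (- of_nat m) = Re 1" by (rule arg_cong)
    then show False by simp
  qed
  have nz': "(of_nat (Suc m) :: complex) \<noteq> 0" by (simp only: of_nat_eq_0_iff)
  have "zeta (- of_nat m) = 1 + zent (1 - of_nat (Suc m)) / (- of_nat m - 1)"
    using zeta_eq_zent[OF nz] by simp
  also have "\<dots> = 1 - of_real ((- 1) ^ Suc m * fact (Suc m) * fps_nth U (Suc m)) / of_nat (Suc m)"
  proof -
    have "- of_nat m - 1 = - (of_nat (Suc m) :: complex)" by simp
    then show ?thesis unfolding zent_one_minus_nat U_def by (simp only: divide_minus_right) simp
  qed
  also have "\<dots> = of_real (1 + (- 1) ^ m * fact m * fps_nth U (Suc m))"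
    using nz' by (simp add: field_simps)
  also have "1 + (- 1) ^ m * fact m * fps_nth U (Suc m) = (- 1) ^ m * fact m * fps_nth bern (Suc m)"
    unfolding U by (simp add: algebra_simps)
  finally show ?thesis .
qed

lemma zeta_int_minus: "zeta_int (- int m) = (- 1) ^ m * fact m * fps_nth bern (Suc m)"
  using zeta_minus_nat[of m] by (simp add: zeta_int_def)

text \<open>The zeta-regularised value of the sum of (- i + 1/2)^m over i at least 1, the vacuum sum
  that \<open>p\<close> subtracts term by term.\<close>

definition pconst :: "nat \<Rightarrow> real" where
  "pconst m = (1 - 2 powi (- int m)) * zeta_int (- int m)"

lemma pconst_0: "pconst 0 = 0"
  by (simp add: pconst_def)

text \<open>With B(t) = t / (e^t - 1), the factor 1 - 2^(- m) makes the first series equal to 2 B(t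
  / 2) - B(t), that is, t e^(t/2) / (e^t - 1). The right side will reappear as the boundary term of
  the shifted Fermi-Dirac sums.\<close>

lemma pconst_fps:
  "(1 + fps_X * Abs_fps (\<lambda>m. pconst m / fact m)) * (fps_exp 1 - 1) = fps_X * fps_exp (1 / 2)"
proof -
  let ?L = "fps_const (1 / 2) * fps_X :: real fps"
  let ?B = "bern oo ?L"
  have "1 + fps_X * Abs_fps (\<lambda>m. pconst m / fact m) = 2 * ?B - bern"
  proof (rule fps_ext)
    fix k
    show "fps_nth (1 + fps_X * Abs_fps (\<lambda>m. pconst m / fact m)) k = fps_nth (2 * ?B - bern) k"
    proof (cases k)
      case 0
      then show ?thesis by (simp add: fps_nth_compose_linear bern_0 numeral_fps_const)
    next
      case (Suc m)
      have "pconst m / fact m = (1 - 1 / 2 ^ m) * ((- 1) ^ m * fps_nth bern (Suc m))"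
        by (simp add: pconst_def zeta_int_minus power_int_minus power_int_of_nat divide_inverse)
      also have "\<dots> = - (1 - 1 / 2 ^ m) * fps_nth bern (Suc m)"
      proof (cases "even m")
        case True
        then show ?thesis by (cases "m = 0") (auto simp: bern_odd_eq_0)
      qed (auto simp: algebra_simps)
      also have "\<dots> = 2 * ((1 / 2) ^ Suc m * fps_nth bern (Suc m)) - fps_nth bern (Suc m)"
        by (simp add: power_one_over field_simps)
      finally show ?thesis by (simp add: Suc fps_X_mult_nth fps_nth_compose_linear numeral_fps_const)
    qed
  qed
  moreover have "(2 * ?B) * (fps_exp 1 - 1) = fps_X * fps_exp (1 / 2) + fps_X"
  proof -
    have nz: "fps_nth ?L 0 = 0" by simp
  have "(bern * (fps_exp 1 - 1)) oo ?L = fps_X oo ?L" by (simp only: bern_mult)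
    then have "?B * ((fps_exp 1 oo ?L) - 1) = ?L"
      by (simp only: fps_compose_mult_distrib[OF nz] fps_compose_sub_distrib fps_compose_1 fps_X_fps_compose_startby0[OF nz])
    then have *: "?B * (fps_exp (1 / 2) - 1) = ?L"
      by (simp only: fps_exp_compose_linear mult_1_right)
    have e: "fps_exp (1 / 2) * fps_exp (1 / 2) = (fps_exp 1 :: real fps)"
      using fps_exp_add_mult[of "1/2::real" "1/2"] by simp
    have "(2 * ?B) * (fps_exp 1 - 1) = 2 * (?B * (fps_exp (1 / 2) - 1)) * (fps_exp (1 / 2) + 1)"
      by (simp only: e[symmetric]) (simp add: algebra_simps)
    also have "\<dots> = (2 * ?L) * (fps_exp (1 / 2) + 1)" by (simp only: *)
    also have "2 * ?L = fps_X" by (simp add: numeral_fps_const flip: mult.assoc)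
    finally show ?thesis by (simp add: distrib_left)
  qed
  ultimately show ?thesis by (simp add: left_diff_distrib bern_mult)
qed

section \<open>Values of zfrak\<close>

lemma zfrak_0: "zfrak 0 = 1"
  using zeta_int_minus[of 0] bern_1 by (simp add: zfrak_def)

text \<open>The trivial zeros of the zeta function, seen as vanishing odd Bernoulli
  coefficients.\<close>

lemma zfrak_neg: "k < 0 \<Longrightarrow> zfrak k = 0"
proof -
  assume k: "k < 0"
  define m where "m = nat (- k)"
  have km: "k = - int m" and m: "m > 0" using k by (auto simp: m_def)
  show ?thesis
  proof (cases "even k")
    case True
    then have "even m" by (simp add: km)
    then have "fps_nth bern (Suc m) = 0" using m by (intro bern_odd_eq_0) auto
    then show ?thesis by (simp add: zfrak_def km zeta_int_minus)
  qed (simp add: zfrak_def)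
qed

lemma zfrak_odd: "odd k \<Longrightarrow> zfrak k = 0"
  by (simp add: zfrak_def)

text \<open>Twice the alternating zeta series: subtracting twice the terms with even denominator
  from \<zeta>(k) leaves (1 - 2^(1 - k)) \<zeta>(k), with k = m + 1.\<close>

lemma zfrak_sums:
  assumes "odd m"
  shows "(\<lambda>n. 2 * (- 1) ^ n / real (Suc n) ^ Suc m) sums zfrak (int m + 1)"
proof -
  have m: "m \<ge> 1" using assms by (cases m) auto
  let ?k = "Suc m"
  let ?b = "\<lambda>n. 1 / real (Suc n) ^ ?k"
  define Z where "Z = zeta_int (int m + 1)"
  have b: "?b sums Z"
  proof -
    have "(\<lambda>n. 1 / of_nat (Suc n) powr (of_nat ?k :: complex)) sums zeta (of_nat ?k)"
      by (rule zeta_spec(2)) (use m in auto)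
    then have "(\<lambda>n. Re (1 / of_nat (Suc n) powr (of_nat ?k :: complex))) sums Re (zeta (of_nat ?k))"
      by (rule sums_Re)
    moreover have "Re (1 / of_nat (Suc n) powr (of_nat ?k :: complex)) = ?b n" for n
    proof -
      have "(of_nat (Suc n) :: complex) powr of_nat ?k = of_real (real (Suc n) ^ ?k)"
        by (subst powr_nat') auto
      then have "1 / (of_nat (Suc n) :: complex) powr of_nat ?k = of_real (?b n)"
        by (simp only: of_real_divide of_real_1)
      then show ?thesis by (simp only: Re_complex_of_real)
    qed
    ultimately show ?thesis by (simp add: Z_def zeta_int_def add.commute)
  qed
  let ?f = "\<lambda>n. if odd n then 2 * ?b n else 0"
  have "(\<lambda>j. ?f (2 * j + 1)) sums (2 / 2 ^ ?k * Z)"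
  proof -
    have "?f (2 * j + 1) = 2 / 2 ^ ?k * ?b j" for j
    proof -
      have "real (Suc (2 * j + 1)) ^ ?k = 2 ^ ?k * real (Suc j) ^ ?k"
        by (subst power_mult_distrib[symmetric]) (simp add: algebra_simps)
      then show ?thesis by simp
    qed
    then show ?thesis using sums_mult[OF b, of "2 / 2 ^ ?k"] by simp
  qed
  then have "?f sums (2 / 2 ^ ?k * Z)"
  proof (subst (asm) sums_mono_reindex)
    show "?f n = 0" if "n \<notin> range (\<lambda>j. 2 * j + 1)" for n
      using that by (cases "even n") (auto elim!: oddE)
  qed (auto simp: strict_mono_def)
  then have "(\<lambda>n. 2 * (?b n - ?f n)) sums (2 * (Z - 2 / 2 ^ ?k * Z))"
    by (intro sums_mult sums_diff b)
  moreover have "2 * (?b n - ?f n) = 2 * (- 1) ^ n / real (Suc n) ^ ?k" for n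
    by (cases "even n") auto
  moreover have "2 * (Z - 2 / 2 ^ ?k * Z) = zfrak (int m + 1)"
  proof -
    have "2 - (int m + 1) = 2 - int ?k" by simp
    then have "2 powi (2 - (int m + 1)) = (4::real) / 2 ^ ?k"
      by (simp only:) (subst power_int_diff, simp_all add: power_int_of_nat del: power_Suc of_nat_Suc)
    then show ?thesis using assms by (simp add: zfrak_def Z_def algebra_simps)
  qed
  ultimately show ?thesis by simp
qed

section \<open>Fermi-Dirac sums\<close>

definition fermi :: "complex \<Rightarrow> complex" where
  "fermi u = 1 / (exp u + 1)"

definition half_odd :: "nat \<Rightarrow> real" where
  "half_odd j = real j + 1 / 2"

lemma half_odd_pos: "half_odd j > 0" and half_odd_ge: "half_odd j \<ge> 1 / 2" and half_odd_Suc: "half_odd (Suc j) = half_odd j + 1"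
  by (auto simp: half_odd_def)

text \<open>The half-width 2 pi / 3 of the strip lies below pi, the height of the poles of
  \<open>fermi\<close>, and above 2, the height of the lines used for the Fourier bound.\<close>

lemma cos_ge_minus_half: "\<bar>\<phi>\<bar> \<le> 2 * pi / 3 \<Longrightarrow> cos \<phi> \<ge> - 1 / 2"
proof -
  assume "\<bar>\<phi>\<bar> \<le> 2 * pi / 3"
  then have "cos (2 * pi / 3) \<le> cos \<bar>\<phi>\<bar>" by (intro cos_monotone_0_pi_le) auto
  moreover have "cos (2 * pi / 3) = - 1 / 2"
    using cos_120 by simp
  ultimately show ?thesis by simp
qed

lemma norm_exp_plus_1_strip:
  assumes "\<bar>Im u\<bar> \<le> 2 * pi / 3"
  shows "norm (exp u + 1) \<ge> exp (Re u) / 2"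
proof -
  have "(exp (Re u) / 2)\<^sup>2 \<le> (norm (exp u + 1))\<^sup>2"
  proof -
    let ?r = "exp (Re u)"
    have "(norm (exp u + 1))\<^sup>2 = (?r * cos (Im u) + 1)\<^sup>2 + (?r * sin (Im u))\<^sup>2"
      by (simp add: cmod_power2 Re_exp Im_exp)
    also have "\<dots> = ?r\<^sup>2 * ((sin (Im u))\<^sup>2 + (cos (Im u))\<^sup>2) + 2 * ?r * cos (Im u) + 1"
    proof -
      have "(r * c + 1)\<^sup>2 + (r * s)\<^sup>2 = r\<^sup>2 * (s\<^sup>2 + c\<^sup>2) + 2 * r * c + 1" for r c s :: real
        by (simp add: power2_eq_square algebra_simps)
      then show ?thesis .
    qed
    also have "\<dots> = ?r\<^sup>2 + 2 * ?r * cos (Im u) + 1" by simp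
    also have "\<dots> \<ge> ?r\<^sup>2 + 2 * ?r * (- 1 / 2) + 1"
      using cos_ge_minus_half[OF assms] by (intro add_mono mult_left_mono) auto
    finally have "(norm (exp u + 1))\<^sup>2 \<ge> ?r\<^sup>2 - ?r + 1" by simp
    moreover have "?r\<^sup>2 - ?r + 1 = (?r / 2)\<^sup>2 + (?r / 2 - 1)\<^sup>2 + ?r\<^sup>2 / 2"
      by (simp add: power2_eq_square field_simps)
    ultimately show ?thesis
      by (smt (verit) zero_le_power2 divide_nonneg_nonneg)
  qed
  then show ?thesis using power2_le_imp_le norm_ge_zero by blast
qed

lemma exp_plus_1_strip_nz: "\<bar>Im u\<bar> \<le> 2 * pi / 3 \<Longrightarrow> exp u + 1 \<noteq> 0"
  using norm_exp_plus_1_strip[of u] by (smt (verit) divide_pos_pos exp_gt_zero norm_zero)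

lemma norm_fermi_strip: "\<bar>Im u\<bar> \<le> 2 * pi / 3 \<Longrightarrow> norm (fermi u) \<le> 2 * exp (- Re u)"
proof -
  assume u: "\<bar>Im u\<bar> \<le> 2 * pi / 3"
  have "norm (fermi u) = 1 / norm (exp u + 1)" by (simp add: fermi_def norm_divide)
  also have "\<dots> \<le> 1 / (exp (Re u) / 2)"
    using norm_exp_plus_1_strip[OF u] by (intro divide_left_mono) (auto simp: exp_plus_1_strip_nz[OF u])
  finally show ?thesis by (simp add: exp_minus field_simps)
qed

text \<open>To the right of the imaginary axis there is no pole at any height. The price is the
  factor 1 - exp(- \<delta>), which costs one power of h when \<delta> is of size h.\<close>

lemma norm_exp_plus_1_right:
  assumes "\<delta> > 0" "Re u \<ge> \<delta>"
  shows "norm (exp u + 1) \<ge> exp (Re u) * (1 - exp (- \<delta>))" "exp u + 1 \<noteq> 0"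
proof -
  have "exp (Re u) * (1 - exp (- \<delta>)) \<le> exp (Re u) * (1 - exp (- Re u))"
    using assms by (intro mult_left_mono) auto
  also have "\<dots> = norm (exp u) - norm (1::complex)" by (simp add: right_diff_distrib exp_minus)
  also have "\<dots> \<le> norm (exp u + 1)" using norm_triangle_ineq2[of "exp u" "- 1"] by simp
  finally show *: "norm (exp u + 1) \<ge> exp (Re u) * (1 - exp (- \<delta>))" .
  have "exp (Re u) * (1 - exp (- \<delta>)) > 0" using assms by simp
  with * show "exp u + 1 \<noteq> 0" by auto
qed

lemma norm_fermi_right:
  assumes "\<delta> > 0" "Re u \<ge> \<delta>"
  shows "norm (fermi u) \<le> exp (- Re u) / (1 - exp (- \<delta>))"
proof -
  have p: "exp (Re u) * (1 - exp (- \<delta>)) > 0" using assms by simp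
  have "norm (fermi u) = 1 / norm (exp u + 1)" by (simp add: fermi_def norm_divide)
  also have "\<dots> \<le> 1 / (exp (Re u) * (1 - exp (- \<delta>)))"
    using norm_exp_plus_1_right[OF assms] p assms by (intro divide_left_mono mult_pos_pos) auto
  finally show ?thesis by (simp add: exp_minus field_simps)
qed

lemma fermi_minus: "exp u + 1 \<noteq> 0 \<Longrightarrow> fermi (- u) + fermi u = 1"
proof -
  assume u: "exp u + 1 \<noteq> 0"
  have "exp (- u) + 1 = (exp u + 1) / exp u" by (simp add: exp_minus field_simps)
  then show ?thesis using u by (simp add: fermi_def add_divide_distrib[symmetric])
qed

lemma power_fact_le_exp: "0 \<le> x \<Longrightarrow> x ^ m / fact m \<le> exp (x::real)"
proof -
  assume x: "0 \<le> x"
  have "(\<Sum>n\<in>{m}. inverse (fact n) * x ^ n) \<le> (\<Sum>n. inverse (fact n) * x ^ n)"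
    using x by (intro sum_le_suminf summable_exp) auto
  then show ?thesis by (simp add: exp_def field_simps)
qed

text \<open>Half of the exponential pays for the power, by a single term of the exponential
  series.\<close>

lemma power_exp_le:
  fixes x :: real
  assumes "x \<ge> 0" "h > 0"
  shows "x ^ m * exp (- h * x) \<le> fact m * (2 / h) ^ m * exp (- h * x / 2)"
proof -
  have "(h * x / 2) ^ m / fact m \<le> exp (h * x / 2)"
    using assms by (intro power_fact_le_exp) auto
  then have "x ^ m \<le> fact m * (2 / h) ^ m * exp (h * x / 2)"
    using assms by (simp add: power_divide power_mult_distrib field_simps)
  then have "x ^ m * exp (- h * x) \<le> fact m * (2 / h) ^ m * exp (h * x / 2) * exp (- h * x)"
    by (intro mult_right_mono) auto
  also have "\<dots> = fact m * (2 / h) ^ m * (exp (h * x / 2) * exp (- h * x))" by simp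
  also have "exp (h * x / 2) * exp (- h * x) = exp (- h * x / 2)"
    by (subst exp_add[symmetric]) (simp add: field_simps)
  finally show ?thesis .
qed

lemma exp_half_odd_geom: "exp (- h * half_odd j) = exp (- h / 2) * exp (- h) ^ j"
  by (simp add: half_odd_def exp_of_nat_mult[symmetric] exp_add[symmetric] field_simps)

lemma summable_exp_half_odd: "h > 0 \<Longrightarrow> summable (\<lambda>j. exp (- h * half_odd j))"
  unfolding exp_half_odd_geom by (intro summable_mult summable_geometric) auto

lemma one_minus_exp_ge: "0 < h \<Longrightarrow> h \<le> 1 \<Longrightarrow> 1 - exp (- h) \<ge> h / (2::real)"
proof -
  assume h: "0 < h" "h \<le> 1"
  have "1 + h \<le> exp h" by (rule exp_ge_add_one_self)
  then have "exp (- h) \<le> 1 / (1 + h)" using h by (simp add: exp_minus field_simps)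
  moreover have "1 - 1 / (1 + h) \<ge> h / 2"
  proof -
    have "h / 2 * (1 + h) \<le> h / 2 * 2" using h by (intro mult_left_mono) auto
    then show ?thesis using h by (simp add: field_simps)
  qed
  ultimately show ?thesis by linarith
qed

lemma suminf_exp_half_odd_le: "0 < h \<Longrightarrow> h \<le> 1 \<Longrightarrow> (\<Sum>j. exp (- h * half_odd j)) \<le> 2 / h"
proof -
  assume h: "0 < h" "h \<le> 1"
  have "(\<Sum>j. exp (- h * half_odd j)) = exp (- h / 2) * (1 / (1 - exp (- h)))"
    unfolding exp_half_odd_geom using h by (subst suminf_mult) (auto simp: suminf_geometric)
  also have "\<dots> \<le> 1 * (1 / (h / 2))"
    using h one_minus_exp_ge[OF h] by (intro mult_mono divide_left_mono) auto
  finally show ?thesis by simp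
qed

lemma summable_power_exp_half_odd:
  assumes h: "h > 0" and c: "c \<ge> 0"
  shows "summable (\<lambda>j. (half_odd j + c) ^ m * exp (- h * half_odd j))"
proof (rule summable_comparison_test')
  show "summable (\<lambda>j. exp (h * c) * (fact m * (2 / h) ^ m * exp (- (h / 2) * half_odd j)))"
    using h by (intro summable_mult summable_exp_half_odd) auto
  fix j :: nat
  have k: "half_odd j + c \<ge> 0" using half_odd_pos[of j] c by simp
  have "(half_odd j + c) ^ m * exp (- h * half_odd j) = exp (h * c) * ((half_odd j + c) ^ m * exp (- h * (half_odd j + c)))"
    by (simp add: exp_add[symmetric] algebra_simps)
  also have "\<dots> \<le> exp (h * c) * (fact m * (2 / h) ^ m * exp (- h * (half_odd j + c) / 2))"
    by (intro mult_left_mono power_exp_le k h) auto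
  also have "\<dots> \<le> exp (h * c) * (fact m * (2 / h) ^ m * exp (- (h / 2) * half_odd j))"
    using h c by (intro mult_left_mono) (auto simp: field_simps)
  finally show "norm ((half_odd j + c) ^ m * exp (- h * half_odd j)) \<le> exp (h * c) * (fact m * (2 / h) ^ m * exp (- (h / 2) * half_odd j))"
    using k by simp
qed

lemma suminf_power_exp_half_odd_le:
  assumes h: "0 < h" "h \<le> 1"
  shows "(\<Sum>j. half_odd j ^ m * exp (- h * half_odd j)) \<le> fact m * 2 ^ (m + 2) / h ^ (m + 1)"
proof -
  have "(\<Sum>j. half_odd j ^ m * exp (- h * half_odd j)) \<le> (\<Sum>j. fact m * (2 / h) ^ m * exp (- (h / 2) * half_odd j))"
  proof (rule suminf_le)
    show "summable (\<lambda>j. half_odd j ^ m * exp (- h * half_odd j))" using summable_power_exp_half_odd[of h 0 m] h by simp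
    show "summable (\<lambda>j. fact m * (2 / h) ^ m * exp (- (h / 2) * half_odd j))"
      using h by (intro summable_mult summable_exp_half_odd) auto
    show "half_odd j ^ m * exp (- h * half_odd j) \<le> fact m * (2 / h) ^ m * exp (- (h / 2) * half_odd j)" for j
      using power_exp_le[of "half_odd j" h m] half_odd_pos[of j] h by simp
  qed
  also have "\<dots> = fact m * (2 / h) ^ m * (\<Sum>j. exp (- (h / 2) * half_odd j))"
    using h by (intro suminf_mult summable_exp_half_odd) auto
  also have "\<dots> \<le> fact m * (2 / h) ^ m * (2 / (h / 2))"
    using h suminf_exp_half_odd_le[of "h / 2"] by (intro mult_left_mono) auto
  also have "\<dots> = fact m * 2 ^ (m + 2) / h ^ (m + 1)"
    using h by (simp add: power_divide field_simps)
  finally show ?thesis .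
qed

lemma norm_power_fermi_le:
  assumes "Re y + h * half_odd j \<ge> \<delta>" "\<delta> > 0"
  shows "norm ((of_real (half_odd j) + c) ^ m * fermi (of_real (h * half_odd j) + y)) \<le>
     exp (- Re y) / (1 - exp (- \<delta>)) * ((half_odd j + norm c) ^ m * exp (- h * half_odd j))"
proof -
  have "norm (of_real (half_odd j) + c) \<le> half_odd j + norm c"
    using norm_triangle_ineq[of "of_real (half_odd j)" c] half_odd_pos[of j] by simp
  then have "norm ((of_real (half_odd j) + c) ^ m * fermi (of_real (h * half_odd j) + y)) \<le>
      (half_odd j + norm c) ^ m * (exp (- Re (of_real (h * half_odd j) + y)) / (1 - exp (- \<delta>)))"
    unfolding norm_mult norm_power using assms by (intro mult_mono power_mono norm_fermi_right) (auto simp: add.commute half_odd_pos less_imp_le)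
  also have "exp (- Re (of_real (h * half_odd j) + y)) = exp (- Re y) * exp (- h * half_odd j)"
    by (simp add: exp_add[symmetric])
  finally show ?thesis by (simp add: mult_ac)
qed

lemma eventually_half_odd_large: "h > 0 \<Longrightarrow> eventually (\<lambda>j. C \<le> h * half_odd j) sequentially"
proof -
  assume h: "h > 0"
  have "filterlim (\<lambda>j. h * (1 / 2 + real j)) at_top sequentially"
    by (intro filterlim_tendsto_pos_mult_at_top[OF tendsto_const h] filterlim_tendsto_add_at_top[OF tendsto_const] filterlim_real_sequentially)
  then show ?thesis unfolding filterlim_at_top half_odd_def by (simp add: add.commute)
qed

lemma summable_power_fermi:
  assumes h: "h > 0"
  shows "summable (\<lambda>j. norm ((of_real (half_odd j) + c) ^ m * fermi (of_real (h * half_odd j) + y)))"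
proof (rule summable_comparison_test_ev)
  show "summable (\<lambda>j. exp (- Re y) / (1 - exp (- 1)) * ((half_odd j + norm c) ^ m * exp (- h * half_odd j)))"
    using h by (intro summable_mult summable_power_exp_half_odd) auto
  show "\<forall>\<^sub>F j in sequentially. norm (norm ((of_real (half_odd j) + c) ^ m * fermi (of_real (h * half_odd j) + y))) \<le>
      exp (- Re y) / (1 - exp (- 1)) * ((half_odd j + norm c) ^ m * exp (- h * half_odd j))"
    using eventually_half_odd_large[OF h, of "1 - Re y"]
  proof eventually_elim
    case (elim j)
    then have "Re y + h * half_odd j \<ge> 1" by simp
    from norm_power_fermi_le[OF this] show ?case by simp
  qed
qed

text \<open>The mean contribution of level j to the power sum: a particle at
  \<open>half_odd j\<close> is present with probability \<open>fermi\<close> at h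
  \<open>half_odd j\<close> - y, a hole at - \<open>half_odd j\<close> with \<open>fermi\<close> at
  h \<open>half_odd j\<close> + y. So y is a chemical potential for the charge.\<close>

definition gterm :: "real \<Rightarrow> nat \<Rightarrow> nat \<Rightarrow> complex \<Rightarrow> complex" where
  "gterm h m j y = of_real (half_odd j) ^ m * fermi (of_real (h * half_odd j) - y)
     - (- of_real (half_odd j)) ^ m * fermi (of_real (h * half_odd j) + y)"

text \<open>The constant is put into the term j = 0, so that the whole sum is one series of
  holomorphic functions.\<close>

definition fterm :: "real \<Rightarrow> nat \<Rightarrow> nat \<Rightarrow> complex \<Rightarrow> complex" where
  "fterm h m j y = gterm h m j y + (if j = 0 then of_real (pconst m) else 0)"

definition fsum :: "real \<Rightarrow> nat \<Rightarrow> complex \<Rightarrow> complex" where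
  "fsum h m y = (\<Sum>j. fterm h m j y)"

text \<open>The poles of the terms are at \<open>\<plusminus> h (j + 1/2) + \<i> \<pi> (2 l + 1)\<close>; \<open>fdom h\<close> avoids them.\<close>

definition fdom :: "real \<Rightarrow> complex set" where
  "fdom h = {y. \<bar>Im y\<bar> < 2 * pi / 3} \<union> {y. \<bar>Re y\<bar> < h / 2}"

lemma summable_gterm:
  assumes "h > 0"
  shows "summable (\<lambda>j. norm (gterm h m j y))"
proof (rule summable_comparison_test')
  show "summable (\<lambda>j. norm ((of_real (half_odd j) + 0) ^ m * fermi (of_real (h * half_odd j) + - y))
      + norm ((of_real (half_odd j) + 0) ^ m * fermi (of_real (h * half_odd j) + y)))"
    by (intro summable_add summable_power_fermi assms)
  show "norm (norm (gterm h m j y)) \<le> norm ((of_real (half_odd j) + 0) ^ m * fermi (of_real (h * half_odd j) + - y))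
      + norm ((of_real (half_odd j) + 0) ^ m * fermi (of_real (h * half_odd j) + y))" for j
    unfolding gterm_def real_norm_def abs_norm_cancel by (rule order_trans[OF norm_triangle_ineq4]) (simp add: norm_mult norm_power)
qed

lemma sums_const_head: "(\<lambda>j::nat. if j = 0 then c else 0) sums (c :: complex)"
  using sums_single[of 0 "\<lambda>_. c"] by simp

lemma fsum_eq: "h > 0 \<Longrightarrow> fsum h m y = of_real (pconst m) + (\<Sum>j. gterm h m j y)"
  unfolding fsum_def fterm_def
  using sums_add[OF summable_sums[OF summable_norm_cancel[OF summable_gterm]] sums_const_head]
  by (simp add: sums_iff add.commute)

lemma fterm_sum: "(\<Sum>j<Suc N. fterm h m j y) = of_real (pconst m) + (\<Sum>j<Suc N. gterm h m j y)"
  by (simp add: fterm_def sum.distrib)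

lemma open_fdom: "open (fdom h)"
  unfolding fdom_def by (intro open_Un open_Collect_less continuous_intros)

lemma fdom_nz:
  assumes "y \<in> fdom h" "h > 0"
  shows "exp (of_real (h * half_odd j) - y) + 1 \<noteq> 0" "exp (of_real (h * half_odd j) + y) + 1 \<noteq> 0"
proof -
  show "exp (of_real (h * half_odd j) - y) + 1 \<noteq> 0"
    using assms(1) unfolding fdom_def
  proof
    assume "y \<in> {y. \<bar>Re y\<bar> < h / 2}"
    moreover have "h * half_odd j \<ge> h * (1 / 2)" using assms half_odd_ge by (intro mult_left_mono) auto
    ultimately have *: "Re (of_real (h * half_odd j) - y) > 0" by (simp add: abs_less_iff)
    show ?thesis by (rule norm_exp_plus_1_right(2)[OF * order_refl])
  qed (auto intro!: exp_plus_1_strip_nz)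
  show "exp (of_real (h * half_odd j) + y) + 1 \<noteq> 0"
    using assms(1) unfolding fdom_def
  proof
    assume "y \<in> {y. \<bar>Re y\<bar> < h / 2}"
    moreover have "h * half_odd j \<ge> h * (1 / 2)" using assms half_odd_ge by (intro mult_left_mono) auto
    ultimately have *: "Re (of_real (h * half_odd j) + y) > 0" by (simp add: abs_less_iff)
    show ?thesis by (rule norm_exp_plus_1_right(2)[OF * order_refl])
  qed (auto intro!: exp_plus_1_strip_nz)
qed

lemma holomorphic_gterm: "h > 0 \<Longrightarrow> gterm h m j holomorphic_on fdom h"
  unfolding gterm_def[abs_def] fermi_def by (intro holomorphic_intros) (use fdom_nz in auto)

lemma holomorphic_fterm: "h > 0 \<Longrightarrow> fterm h m j holomorphic_on fdom h"
  unfolding fterm_def[abs_def] by (intro holomorphic_on_add holomorphic_gterm holomorphic_on_const)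

lemma fsum_analytic:
  assumes h: "h > 0"
  shows "fsum h m holomorphic_on fdom h"
    and "y \<in> fdom h \<Longrightarrow> (\<lambda>N. (deriv ^^ r) (\<lambda>y. of_real (pconst m) + (\<Sum>j<N. gterm h m j y)) y)
           \<longlonglongrightarrow> (deriv ^^ r) (fsum h m) y"
proof -
  have b: "\<exists>d M N. d > 0 \<and> summable M \<and> (\<forall>n\<ge>N. \<forall>z\<in>cball x d \<inter> fdom h. norm (fterm h m n z) \<le> M n)"
    if x: "x \<in> fdom h" for x
  proof -
    let ?M = "\<lambda>j. 2 * (exp (\<bar>Re x\<bar> + 1) / (1 - exp (- 1)) * ((half_odd j + 0) ^ m * exp (- h * half_odd j)))"
    obtain N where N: "\<And>j. j \<ge> N \<Longrightarrow> \<bar>Re x\<bar> + 2 \<le> h * half_odd j"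
      using eventually_half_odd_large[OF h] unfolding eventually_sequentially by blast
    show ?thesis
    proof (intro exI conjI allI impI ballI)
      show "(1::real) > 0" by simp
      show "summable ?M" using h by (intro summable_mult summable_power_exp_half_odd) auto
      fix j z assume j: "j \<ge> Suc N" and z: "z \<in> cball x 1 \<inter> fdom h"
      have "\<bar>Re x - Re z\<bar> \<le> 1" using z abs_Re_le_cmod[of "x - z"] by (simp add: dist_norm)
      then have rz: "\<bar>Re z\<bar> \<le> \<bar>Re x\<bar> + 1" by linarith
      have 1: "norm ((of_real (half_odd j) + 0) ^ m * fermi (of_real (h * half_odd j) + w)) \<le>
          exp (\<bar>Re x\<bar> + 1) / (1 - exp (- 1)) * ((half_odd j + 0) ^ m * exp (- h * half_odd j))"
        if w: "\<bar>Re w\<bar> \<le> \<bar>Re x\<bar> + 1" for w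
      proof -
        have "Re w + h * half_odd j \<ge> 1" using N[of j] j w by simp
        from norm_power_fermi_le[OF this, of 0 m]
        have "norm ((of_real (half_odd j) + 0) ^ m * fermi (of_real (h * half_odd j) + w)) \<le>
            exp (- Re w) / (1 - exp (- 1)) * ((half_odd j + 0) ^ m * exp (- h * half_odd j))" by simp
        also have "\<dots> \<le> exp (\<bar>Re x\<bar> + 1) / (1 - exp (- 1)) * ((half_odd j + 0) ^ m * exp (- h * half_odd j))"
          using w half_odd_pos[of j] by (intro mult_right_mono divide_right_mono) auto
        finally show ?thesis .
      qed
      have "fterm h m j z = (of_real (half_odd j) + 0) ^ m * fermi (of_real (h * half_odd j) + - z)
        - (- 1) ^ m * ((of_real (half_odd j) + 0) ^ m * fermi (of_real (h * half_odd j) + z))"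
        using j by (simp add: fterm_def gterm_def power_minus[of "of_real (half_odd j)"])
      also have "norm \<dots> \<le> norm ((of_real (half_odd j) + 0) ^ m * fermi (of_real (h * half_odd j) + - z))
         + norm ((of_real (half_odd j) + 0) ^ m * fermi (of_real (h * half_odd j) + z))"
        by (rule order_trans[OF norm_triangle_ineq4]) (simp add: norm_mult norm_power)
      also have "\<dots> \<le> ?M j" using 1[of "- z"] 1[of z] rz by simp
      finally show "norm (fterm h m j z) \<le> ?M j" .
    qed
  qed
  note * = holomorphic_on_suminf[of "fdom h" "fterm h m", OF open_fdom holomorphic_fterm[OF h] b]
  show "fsum h m holomorphic_on fdom h" using *(1) unfolding fsum_def[abs_def] by blast
  assume y: "y \<in> fdom h"
  \<comment> \<open>The empty partial sum of \<open>fterm\<close> lacks the constant, so the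
    comparison with \<open>gterm\<close> starts at one term.\<close>
  have "(\<lambda>N. (deriv ^^ r) (\<lambda>y. \<Sum>j<Suc N. fterm h m j y) y) \<longlonglongrightarrow> (deriv ^^ r) (fsum h m) y"
    using LIMSEQ_Suc[OF *(2)[OF _ y, of r]] unfolding fsum_def[abs_def] by blast
  then have "(\<lambda>N. (deriv ^^ r) (\<lambda>y. of_real (pconst m) + (\<Sum>j<Suc N. gterm h m j y)) y) \<longlonglongrightarrow> (deriv ^^ r) (fsum h m) y"
    unfolding fterm_sum .
  then show "(\<lambda>N. (deriv ^^ r) (\<lambda>y. of_real (pconst m) + (\<Sum>j<N. gterm h m j y)) y) \<longlonglongrightarrow> (deriv ^^ r) (fsum h m) y"
    by (rule LIMSEQ_imp_Suc)
qed

lemma norm_gterm_le: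
  assumes "norm (fermi (of_real (h * half_odd j) - y)) \<le> B" "norm (fermi (of_real (h * half_odd j) + y)) \<le> B"
  shows "norm (gterm h m j y) \<le> 2 * half_odd j ^ m * B"
proof -
  have "norm (gterm h m j y) \<le> half_odd j ^ m * norm (fermi (of_real (h * half_odd j) - y)) + half_odd j ^ m * norm (fermi (of_real (h * half_odd j) + y))"
    unfolding gterm_def
    by (rule order_trans[OF norm_triangle_ineq4]) (simp add: norm_mult norm_power half_odd_pos less_imp_le)
  also have "\<dots> \<le> half_odd j ^ m * B + half_odd j ^ m * B"
    using assms half_odd_pos[of j] by (intro add_mono mult_left_mono) auto
  finally show ?thesis by (simp add: mult_ac)
qed

lemma norm_gterm_re_le:
  assumes h: "0 < h" "h \<le> 1" and y: "\<bar>Re y\<bar> \<le> h / 4"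
  shows "norm (gterm h m j y) \<le> 32 / h * (half_odd j ^ m * exp (- h * half_odd j))"
proof -
  have *: "norm (fermi (of_real (h * half_odd j) + w)) \<le> 16 / h * exp (- h * half_odd j)" if "\<bar>Re w\<bar> \<le> h / 4" for w
  proof -
    have "h * half_odd j \<ge> h * (1 / 2)" using h half_odd_ge by (intro mult_left_mono) auto
    then have "Re (of_real (h * half_odd j) + w) \<ge> h / 4" using that by simp
    then have "norm (fermi (of_real (h * half_odd j) + w)) \<le> exp (- Re (of_real (h * half_odd j) + w)) / (1 - exp (- (h / 4)))"
      using h by (intro norm_fermi_right) auto
    also have "exp (- Re (of_real (h * half_odd j) + w)) = exp (- Re w) * exp (- h * half_odd j)"
      by (simp add: exp_add[symmetric])
    also have "exp (- Re w) * exp (- h * half_odd j) / (1 - exp (- (h / 4))) \<le> 2 * exp (- h * half_odd j) / (h / 8)"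
    proof (intro frac_le mult_right_mono)
      have "exp (- Re w) \<le> exp (1/4)" using that h by simp
      also have "exp (1/4) \<le> (2::real)" using exp_bound_half[of "1/4::real"] by simp
      finally show "exp (- Re w) \<le> 2" .
      show "h / 8 \<le> 1 - exp (- (h / 4))" using one_minus_exp_ge[of "h / 4"] h by simp
    qed (use h in auto)
    finally show ?thesis by simp
  qed
  have "norm (gterm h m j y) \<le> 2 * half_odd j ^ m * (16 / h * exp (- h * half_odd j))"
    using *[of y] *[of "- y"] y by (intro norm_gterm_le) auto
  then show ?thesis by simp
qed

text \<open>Two regions: the wide strip near the real axis serves the Fourier bound, the thin
  vertical strip of unlimited height serves derivatives at every \<i> \<theta>. In the second region
  \<open>norm_fermi_right\<close> loses one power of h.\<close>

lemma fsum_bound: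
  obtains K where "K \<ge> 0"
    "\<And>h y. 0 < h \<Longrightarrow> h \<le> 1 \<Longrightarrow> \<bar>Im y\<bar> \<le> 2 * pi / 3 \<Longrightarrow> \<bar>Re y\<bar> \<le> h \<Longrightarrow> norm (fsum h m y) \<le> K / h ^ (m + 2)"
    "\<And>h y. 0 < h \<Longrightarrow> h \<le> 1 \<Longrightarrow> \<bar>Re y\<bar> \<le> h / 4 \<Longrightarrow> norm (fsum h m y) \<le> K / h ^ (m + 2)"
proof -
  define K where "K = \<bar>pconst m\<bar> + 32 * (fact m * 2 ^ (m + 2))"
  have main: "norm (fsum h m y) \<le> K / h ^ (m + 2)"
    if h: "0 < h" "h \<le> 1" and b: "\<And>j. norm (gterm h m j y) \<le> 32 / h * (half_odd j ^ m * exp (- h * half_odd j))" for h y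
  proof -
    have "norm (\<Sum>j. gterm h m j y) \<le> (\<Sum>j. norm (gterm h m j y))"
      by (rule summable_norm[OF summable_gterm]) fact
    also have "\<dots> \<le> (\<Sum>j. 32 / h * (half_odd j ^ m * exp (- h * half_odd j)))"
      using h summable_power_exp_half_odd[of h 0 m] by (intro suminf_le b summable_gterm summable_mult) auto
    also have "\<dots> = 32 / h * (\<Sum>j. half_odd j ^ m * exp (- h * half_odd j))"
      using h summable_power_exp_half_odd[of h 0 m] by (intro suminf_mult) auto
    also have "\<dots> \<le> 32 / h * (fact m * 2 ^ (m + 2) / h ^ (m + 1))"
      using h by (intro mult_left_mono suminf_power_exp_half_odd_le) auto
    also have "\<dots> = 32 * (fact m * 2 ^ (m + 2)) / h ^ (m + 2)" by simp
    finally have 1: "norm (\<Sum>j. gterm h m j y) \<le> 32 * (fact m * 2 ^ (m + 2)) / h ^ (m + 2)" .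
    have "\<bar>pconst m\<bar> * h ^ (m + 2) \<le> \<bar>pconst m\<bar> * 1"
      using h by (intro mult_left_mono power_le_one) auto
    then have 2: "\<bar>pconst m\<bar> \<le> \<bar>pconst m\<bar> / h ^ (m + 2)" using h by (simp add: field_simps)
    have "norm (fsum h m y) \<le> \<bar>pconst m\<bar> + norm (\<Sum>j. gterm h m j y)"
      unfolding fsum_eq[OF h(1)] by (rule order_trans[OF norm_triangle_ineq]) simp
    also have "\<dots> \<le> K / h ^ (m + 2)" unfolding K_def add_divide_distrib using 1 2 by (rule add_mono[rotated])
    finally show ?thesis .
  qed
  show ?thesis
  proof (rule that[of K])
    show "K \<ge> 0" by (simp add: K_def)
    fix h :: real and y assume h: "0 < h" "h \<le> 1"
    show "norm (fsum h m y) \<le> K / h ^ (m + 2)" if y: "\<bar>Im y\<bar> \<le> 2 * pi / 3" "\<bar>Re y\<bar> \<le> h"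
    proof (rule main[OF h])
      fix j
      have e: "exp h \<le> (4::real)"
        using h exp_le by (intro order_trans[of "exp h" "exp 1" 4]) auto
      have *: "norm (fermi (of_real (h * half_odd j) + w)) \<le> 2 * (4 * exp (- h * half_odd j))"
        if "\<bar>Im w\<bar> \<le> 2 * pi / 3" "\<bar>Re w\<bar> \<le> h" for w
      proof -
        have "norm (fermi (of_real (h * half_odd j) + w)) \<le> 2 * exp (- Re (of_real (h * half_odd j) + w))"
          using that by (intro norm_fermi_strip) auto
        also have "exp (- Re (of_real (h * half_odd j) + w)) = exp (- Re w) * exp (- h * half_odd j)"
          by (simp add: exp_add[symmetric])
        also have "exp (- Re w) \<le> exp h" using that by simp
        also have "exp h \<le> 4" by (rule e)
        finally show ?thesis by simp
      qed
      have "norm (gterm h m j y) \<le> 2 * half_odd j ^ m * (2 * (4 * exp (- h * half_odd j)))"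
        using *[of y] *[of "- y"] y by (intro norm_gterm_le) auto
      also have "\<dots> = 16 * (half_odd j ^ m * exp (- h * half_odd j))" by simp
      also have "\<dots> \<le> 32 / h * (half_odd j ^ m * exp (- h * half_odd j))"
        using h half_odd_pos[of j] by (intro mult_right_mono) (auto simp: field_simps)
      finally show "norm (gterm h m j y) \<le> 32 / h * (half_odd j ^ m * exp (- h * half_odd j))" .
    qed
    show "norm (fsum h m y) \<le> K / h ^ (m + 2)" if y: "\<bar>Re y\<bar> \<le> h / 4"
      by (rule main[OF h norm_gterm_re_le[OF h y]])
  qed
qed

section \<open>Exponentially small Fourier modes\<close>

text \<open>With q = exp(2 pi \<i> (z - y) / h) the function \<phi> = (E - E(y)) / (1 - q) is
  periodic with a removable singularity at y, so its integral d over a period is the same on the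
  lines Im z = - a and Im z = a. On the lower line |q| is large and d nearly 0; on the upper line q
  is small and d is nearly h (K - E(y)). Here K is the mean of E.\<close>

lemma periodic_strip:
  fixes E :: "complex \<Rightarrow> complex"
  assumes h: "0 < h" and b: "0 < b" and hol: "E holomorphic_on {z. \<bar>Im z\<bar> < b}"
    and per: "\<And>z. \<bar>Im z\<bar> < b \<Longrightarrow> E (z + of_real h) = E z"
  obtains K where "((\<lambda>x. E (of_real x)) has_integral (of_real h * K)) {- h / 2..h / 2}"
    "\<And>y a M r. \<bar>Im y\<bar> < a \<Longrightarrow> a < b \<Longrightarrow> \<bar>Re y\<bar> \<le> h / 2 \<Longrightarrow>
       (\<And>z. \<bar>Im z\<bar> \<le> a \<Longrightarrow> \<bar>Re z\<bar> \<le> h \<Longrightarrow> norm (E z) \<le> M) \<Longrightarrow>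
       r = exp (- 2 * pi * (a - \<bar>Im y\<bar>) / h) \<Longrightarrow> norm (E y - K) \<le> 4 * M * (r / (1 - r))"
proof -
  define S where "S = {z. \<bar>Im z\<bar> < b}"
  have S_alt: "S = {z. Im z < b} \<inter> {z. Im z > - b}" by (auto simp: S_def)
  have conS: "convex S" unfolding S_alt by (intro convex_Int convex_halfspace_Im_lt convex_halfspace_Im_gt)
  have opS: "open S" unfolding S_alt by (intro open_Int open_halfspace_Im_lt open_halfspace_Im_gt)
  obtain \<Phi> where \<Phi>': "\<And>z. z \<in> S \<Longrightarrow> (\<Phi> has_field_derivative E z) (at z within S)"
    by (rule holomorphic_convex_primitive'[OF conS opS hol[folded S_def]]) (rule that)
  have \<Phi>: "(\<Phi> has_field_derivative E z) (at z)" if "z \<in> S" for z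
    using \<Phi>'[OF that] by (simp only: at_within_open[OF that opS])
  \<comment> \<open>By periodicity the increment of a primitive over a period is constant; it is the
    integral of E along any horizontal line.\<close>
  have "\<exists>c. \<forall>z\<in>S. \<Phi> (z + of_real h) - \<Phi> z = c"
  proof (rule has_field_derivative_zero_constant[OF conS])
    fix z assume z: "z \<in> S"
    then have z': "z + of_real h \<in> S" by (simp add: S_def)
    have "((\<lambda>z. \<Phi> (z + of_real h) - \<Phi> z) has_field_derivative (E (z + of_real h) - E z)) (at z)"
      by (rule DERIV_diff[OF DERIV_shift[THEN iffD1, OF \<Phi>[OF z']] \<Phi>[OF z]])
    then show "((\<lambda>z. \<Phi> (z + of_real h) - \<Phi> z) has_field_derivative 0) (at z within S)"
      using per[of z] z by (simp add: S_def has_field_derivative_at_within)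
  qed
  then obtain c where c: "\<And>z. z \<in> S \<Longrightarrow> \<Phi> (z + of_real h) - \<Phi> z = c" by blast
  define K where "K = c / of_real h"
  have hK: "of_real h * K = c" using h by (simp add: K_def)
  show ?thesis
  proof (rule that[of K])
    have "((\<lambda>x. E (of_real x)) has_integral \<Phi> (of_real (h / 2)) - \<Phi> (of_real (- h / 2))) {- h / 2..h / 2}"
      using h by (intro fundamental_theorem_of_calculus has_vector_derivative_real_field \<Phi>) (auto simp: S_def b)
    moreover have "\<Phi> (of_real (h / 2)) - \<Phi> (of_real (- h / 2)) = c"
    proof -
      have "of_real (- h / 2) + of_real h = (of_real (h / 2) :: complex)"
        by (simp flip: of_real_add)
      then show ?thesis using c[of "of_real (- h / 2)"] by (simp add: S_def b)
    qed
    ultimately show "((\<lambda>x. E (of_real x)) has_integral (of_real h * K)) {- h / 2..h / 2}"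
      by (simp only: hK)
  next
    fix y a M r
    assume ya: "\<bar>Im y\<bar> < a" and ab: "a < b" and yh: "\<bar>Re y\<bar> \<le> h / 2"
      and M: "\<And>z. \<bar>Im z\<bar> \<le> a \<Longrightarrow> \<bar>Re z\<bar> \<le> h \<Longrightarrow> norm (E z) \<le> M"
      and r: "r = exp (- 2 * pi * (a - \<bar>Im y\<bar>) / h)"
    have r01: "0 < r" "r < 1" using ya h by (auto simp: r divide_neg_pos mult_neg_pos)
    define q where "q z = exp (2 * of_real pi * \<i> * (z - y) / of_real h)" for z
    define T where "T = S \<inter> {z. Re z < Re y + h} \<inter> {z. Re z > Re y - h}"
    have conT: "convex T" unfolding T_def by (intro convex_Int conS convex_halfspace_Re_lt convex_halfspace_Re_gt)
    have opT: "open T" unfolding T_def by (intro open_Int opS open_halfspace_Re_lt open_halfspace_Re_gt)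
    have yT: "y \<in> T" using ya ab h by (auto simp: T_def S_def)
    have qper: "q (z + of_real h) = q z" for z
    proof -
      have "2 * of_real pi * \<i> * (z + of_real h - y) / of_real h = 2 * of_real pi * \<i> * (z - y) / of_real h + 2 * of_real pi * \<i>"
        using h by (simp add: field_simps)
      then show ?thesis by (simp add: q_def exp_add)
    qed
    have qy: "q y = 1" by (simp add: q_def)
    have q1: "z = y" if zT: "z \<in> T" and q: "q z = 1" for z
    proof -
      obtain n :: int where "2 * of_real pi * \<i> * (z - y) / of_real h = of_int (2 * n) * of_real pi * \<i>"
        using q unfolding q_def exp_eq_1 by (auto simp: complex_eq_iff)
      then have "(2 * of_real pi * \<i>) * (z - y) = (2 * of_real pi * \<i>) * (of_int n * of_real h)"
        using h by (simp add: field_simps)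
      then have "z - y = of_int n * of_real h" by (subst (asm) mult_left_cancel) auto
      then have e: "z = y + of_real (of_int n * h)" by (simp add: algebra_simps)
      then have "\<bar>of_int n * h\<bar> < h" using zT by (auto simp: T_def abs_less_iff)
      then have "\<bar>of_int n\<bar> < (1::real)" using h by (simp add: abs_mult)
      then have "n = 0" by linarith
      with e show ?thesis by simp
    qed
    have holq: "q holomorphic_on T" unfolding q_def by (intro holomorphic_intros) (use h in auto)
    have holE: "E holomorphic_on T" by (rule holomorphic_on_subset[OF hol]) (auto simp: T_def S_def)
    have dq: "deriv q y = 2 * of_real pi * \<i> / of_real h"
    proof (rule DERIV_imp_deriv)
      show "(q has_field_derivative 2 * of_real pi * \<i> / of_real h) (at y)"
        unfolding q_def by (rule derivative_eq_intros refl | use h in simp)+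
    qed
    \<comment> \<open>Dividing two difference quotients removes the singularity. G has no zero in T,
      because q = 1 forces z - y to be a multiple of h and T has room for only one.\<close>
    define F where "F z = (if z = y then deriv E y else (E z - E y) / (z - y))" for z
    define G where "G z = (if z = y then deriv q y else (q z - q y) / (z - y))" for z
    have yi: "y \<in> interior T" using opT yT by (simp add: interior_open)
    have holF: "F holomorphic_on T" unfolding F_def by (rule pole_lemma[OF holE yi])
    have holG: "G holomorphic_on T" unfolding G_def by (rule pole_lemma[OF holq yi])
    have Gnz: "G z \<noteq> 0" if "z \<in> T" for z
    proof (cases "z = y")
      case True
      then show ?thesis using h by (simp add: G_def dq)
    next
      case False
      then have "q z \<noteq> 1" using q1[OF that] by blast
      with False show ?thesis by (simp add: G_def qy)
    qed
    define \<phi> where "\<phi> z = - F z / G z" for z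
    have hol\<phi>: "\<phi> holomorphic_on T" unfolding \<phi>_def by (intro holomorphic_intros holF holG Gnz)
    have \<phi>_eq: "\<phi> z = (E z - E y) / (1 - q z)" if "z \<noteq> y" for z
    proof -
      have nz: "z - y \<noteq> 0" using that by simp
      have "\<phi> z = - ((E z - E y) / (z - y)) / ((q z - 1) / (z - y))"
        using that by (simp only: \<phi>_def F_def G_def qy if_False)
      also have "\<dots> = - (E z - E y) / (q z - 1)" using nz by simp
      also have "q z - 1 = - (1 - q z)" by simp
      also have "- (E z - E y) / - (1 - q z) = (E z - E y) / (1 - q z)" by (rule minus_divide_divide)
      finally show ?thesis .
    qed
    obtain \<Psi> where \<Psi>': "\<And>z. z \<in> T \<Longrightarrow> (\<Psi> has_field_derivative \<phi> z) (at z within T)"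
      by (rule holomorphic_convex_primitive'[OF conT opT hol\<phi>]) (rule that)
    have \<Psi>: "(\<Psi> has_field_derivative \<phi> z) (at z)" if "z \<in> T" for z
      using \<Psi>'[OF that] by (simp only: at_within_open[OF that opT])
    \<comment> \<open>The left half of T: for z in it, both z and z + h lie in T and avoid y, so the
      increment of the primitive \<Psi> is constant.\<close>
    define T' where "T' = S \<inter> {z. Re z < Re y} \<inter> {z. Re z > Re y - h}"
    have conT': "convex T'" unfolding T'_def by (intro convex_Int conS convex_halfspace_Re_lt convex_halfspace_Re_gt)
    have T'T: "z \<in> T" "z + of_real h \<in> T" "z \<noteq> y" "z + of_real h \<noteq> y" if "z \<in> T'" for z
      using that h by (auto simp: T'_def T_def S_def)
    have "\<exists>d. \<forall>z\<in>T'. \<Psi> (z + of_real h) - \<Psi> z = d"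
    proof (rule has_field_derivative_zero_constant[OF conT'])
      fix z assume z: "z \<in> T'"
      have "((\<lambda>z. \<Psi> (z + of_real h) - \<Psi> z) has_field_derivative (\<phi> (z + of_real h) - \<phi> z)) (at z)"
        by (rule DERIV_diff[OF DERIV_shift[THEN iffD1, OF \<Psi>[OF T'T(2)[OF z]]] \<Psi>[OF T'T(1)[OF z]]])
      moreover have "\<phi> (z + of_real h) = \<phi> z"
        using T'T[OF z] per[of z] z by (simp add: \<phi>_eq qper T'_def S_def)
      ultimately show "((\<lambda>z. \<Psi> (z + of_real h) - \<Psi> z) has_field_derivative 0) (at z within T')"
        by (simp add: has_field_derivative_at_within)
    qed
    then obtain d where d: "\<And>z. z \<in> T' \<Longrightarrow> \<Psi> (z + of_real h) - \<Psi> z = d" by blast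
    \<comment> \<open>The mean value bound along a horizontal segment of length h centred at Re
      y.\<close>
    have seg: "norm (f (z + of_real h) - f z) \<le> B * h"
      if z: "z = Complex (Re y - h / 2) t" and t: "\<bar>t\<bar> < b"
        and f: "\<And>w. \<bar>Re w - Re y\<bar> \<le> h / 2 \<Longrightarrow> Im w = t \<Longrightarrow> (f has_field_derivative f' w) (at w) \<and> norm (f' w) \<le> B"
      for f f' B z t
    proof -
      have w: "\<bar>Re w - Re y\<bar> \<le> h / 2 \<and> Im w = t" if "w \<in> closed_segment z (z + of_real h)" for w
      proof -
        from that obtain u where u: "0 \<le> u" "u \<le> 1" "w = (1 - u) *\<^sub>R z + u *\<^sub>R (z + of_real h)"
          by (auto simp: in_segment)
        then have "w = z + of_real (u * h)" by (simp add: scaleR_conv_of_real algebra_simps)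
        moreover have "0 \<le> u * h" "u * h \<le> 1 * h" using u h by (auto intro: mult_right_mono)
        ultimately have e: "Re w - Re y = u * h - h / 2" "Im w = t" and le: "0 \<le> u * h" "u * h \<le> h"
          unfolding z by auto
        have "\<bar>u * h - h / 2\<bar> \<le> h / 2" unfolding abs_le_iff using le by (intro conjI; linarith)
        then show ?thesis by (simp only: e)
      qed
      have "norm (f (z + of_real h) - f z) \<le> B * norm (z + of_real h - z)"
      proof (rule field_differentiable_bound[where S = "closed_segment z (z + of_real h)" and f' = f'])
        fix w assume "w \<in> closed_segment z (z + of_real h)"
        from f[OF conjunct1[OF w[OF this]] conjunct2[OF w[OF this]]]
        show "(f has_field_derivative f' w) (at w within closed_segment z (z + of_real h))" "norm (f' w) \<le> B"
          by (simp_all add: has_field_derivative_at_within)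
      qed auto
      then show ?thesis using h by simp
    qed
    have inT: "w \<in> T \<and> w \<in> S \<and> w \<noteq> y \<and> norm (E w - E y) \<le> 2 * M"
      if "\<bar>Re w - Re y\<bar> \<le> h / 2" "\<bar>Im w\<bar> = a" for w
    proof -
      have 1: "\<bar>Re w\<bar> \<le> h" using that yh by linarith
      have "norm (E w - E y) \<le> norm (E w) + norm (E y)" by (rule norm_triangle_ineq4)
      also have "\<dots> \<le> M + M" using 1 that ya yh h by (intro add_mono M) auto
      finally have "norm (E w - E y) \<le> 2 * M" by simp
      moreover have "w \<noteq> y" using that ya by auto
      moreover have "Re w < Re y + h" "Re y - h < Re w" using that(1) h unfolding abs_le_iff by linarith+
      ultimately show ?thesis using that ab by (simp add: T_def S_def)
    qed
    have nq: "norm (q w) = exp (- 2 * pi * (Im w - Im y) / h)" for w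
      by (simp add: q_def)
    have a0: "a > 0" using ya by linarith
    have "norm (E y) \<le> M" using ya yh h by (intro M) auto
    then have M0: "M \<ge> 0" by (meson norm_ge_zero order_trans)
    have kb: "2 * pi * (a - \<bar>Im y\<bar>) / h \<le> 2 * pi * (a + Im y) / h"
      and kt: "2 * pi * (a - \<bar>Im y\<bar>) / h \<le> 2 * pi * (a - Im y) / h"
      using h by (intro divide_right_mono mult_left_mono; simp)+
    define B where "B = 2 * M * (r / (1 - r))"
    have bot: "norm d \<le> B * h"
    proof -
      define z where "z = Complex (Re y - h / 2) (- a)"
      have "norm (\<Psi> (z + of_real h) - \<Psi> z) \<le> B * h"
      proof (rule seg[OF z_def])
        show "\<bar>- a\<bar> < b" using ab a0 by simp
        fix w assume w: "\<bar>Re w - Re y\<bar> \<le> h / 2" "Im w = - a"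
        have wT: "w \<in> T" "w \<noteq> y" "norm (E w - E y) \<le> 2 * M" using inT[OF w(1)] w(2) a0 by auto
        have "1 / r = exp (2 * pi * (a - \<bar>Im y\<bar>) / h)" 
        proof -
          have "r = inverse (exp (2 * pi * (a - \<bar>Im y\<bar>) / h))" unfolding r by (simp flip: exp_minus)
          then show ?thesis by (simp only: inverse_eq_divide divide_divide_eq_right mult_1_left div_by_1)
        qed
        also have "\<dots> \<le> norm (q w)"
        proof -
          have "- 2 * pi * (- a - Im y) / h = 2 * pi * (a + Im y) / h" by (simp add: algebra_simps)
          then show ?thesis unfolding nq w(2) using kb by (simp only: exp_le_cancel_iff)
        qed
        finally have "1 / r \<le> norm (q w)" .
        then have "1 / r - 1 \<le> norm (1 - q w)" using norm_triangle_ineq3[of 1 "q w"] by simp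
        then have q: "(1 - r) / r \<le> norm (1 - q w)" using r01 by (simp add: diff_divide_distrib)
        have "norm (\<phi> w) \<le> 2 * M / ((1 - r) / r)"
          unfolding \<phi>_eq[OF wT(2)] norm_divide using wT(3) q r01 M0 by (intro frac_le) auto
        then show "(\<Psi> has_field_derivative \<phi> w) (at w) \<and> norm (\<phi> w) \<le> B"
          using \<Psi>[OF wT(1)] by (simp add: B_def)
      qed
      moreover have "z \<in> T'" using ab a0 h by (simp add: T'_def S_def z_def)
      ultimately show ?thesis using d by simp
    qed
    have top: "norm (d - (c - of_real h * E y)) \<le> B * h"
    proof -
      define z where "z = Complex (Re y - h / 2) a"
      \<comment> \<open>On the upper line \<phi> is compared with its limit E - E(y), whose integral
        over a period is c - h E(y).\<close>
      have "norm ((\<Psi> (z + of_real h) - (\<Phi> (z + of_real h) - E y * (z + of_real h))) - (\<Psi> z - (\<Phi> z - E y * z))) \<le> B * h"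
      proof (rule seg[OF z_def])
        show "\<bar>a\<bar> < b" using ab a0 by simp
        fix w assume w: "\<bar>Re w - Re y\<bar> \<le> h / 2" "Im w = a"
        have wT: "w \<in> T" "w \<in> S" "w \<noteq> y" "norm (E w - E y) \<le> 2 * M" using inT[OF w(1)] w(2) a0 by auto
        have q: "norm (q w) \<le> r"
          unfolding nq w(2) r using kt by simp
        then have q': "1 - r \<le> norm (1 - q w)" using norm_triangle_ineq2[of 1 "q w"] by simp
        then have "1 - q w \<noteq> 0" using r01 by auto
        then have "\<phi> w - (E w - E y) = (E w - E y) * q w / (1 - q w)"
          by (simp add: \<phi>_eq[OF wT(3)] field_simps)
        also have "norm \<dots> \<le> 2 * M * r / (1 - r)"
          unfolding norm_divide norm_mult using wT(4) q q' r01 M0 by (intro frac_le mult_mono mult_nonneg_nonneg) auto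
        finally have "norm (\<phi> w - (E w - E y)) \<le> B" by (simp add: B_def)
        moreover have "((\<lambda>z. \<Psi> z - (\<Phi> z - E y * z)) has_field_derivative (\<phi> w - (E w - E y))) (at w)"
          by (intro DERIV_diff \<Psi> \<Phi> wT DERIV_cmult_Id)
        ultimately show "((\<lambda>z. \<Psi> z - (\<Phi> z - E y * z)) has_field_derivative (\<phi> w - (E w - E y))) (at w) \<and> norm (\<phi> w - (E w - E y)) \<le> B"
          by blast
      qed
      moreover have "z \<in> T'" "z \<in> S" using ab a0 h by (simp_all add: T'_def S_def z_def)
      moreover have "(\<Psi> (z + of_real h) - (\<Phi> (z + of_real h) - E y * (z + of_real h))) - (\<Psi> z - (\<Phi> z - E y * z))
         = (\<Psi> (z + of_real h) - \<Psi> z) - ((\<Phi> (z + of_real h) - \<Phi> z) - of_real h * E y)" by (simp add: algebra_simps)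
      ultimately show ?thesis using d c by simp
    qed
    have "of_real h * (E y - K) = (d - (c - of_real h * E y)) - d"
      using hK by (simp add: algebra_simps)
    then have "h * norm (E y - K) = norm ((d - (c - of_real h * E y)) - d)"
      using h by (metis abs_of_pos norm_mult norm_of_real)
    also have "\<dots> \<le> B * h + B * h" by (rule order_trans[OF norm_triangle_ineq4]) (intro add_mono top bot)
    finally have "norm (E y - K) \<le> 2 * B" using h by (simp add: field_simps)
    then show "norm (E y - K) \<le> 4 * M * (r / (1 - r))" by (simp add: B_def)
  qed
qed

text \<open>Reindexing after the shift by h raises every position by one, and the binomial theorem
  expands the powers. One particle term at 1/2 is left over, and one hole term, whose position - 1/2
  moves to 1/2, is missing; together they give (1/2)^m because fermi(- u) + fermi(u) = 1.\<close>

lemma suminf_gterm_shift: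
  assumes h: "h > 0" and y: "\<bar>Im y\<bar> \<le> 2 * pi / 3"
  shows "(\<Sum>j. gterm h m j (y + of_real h)) =
    (\<Sum>i\<le>m. of_nat (m choose i) * (\<Sum>j. gterm h i j y)) + (1 / 2) ^ m"
proof -
  define a where "a j = of_real (half_odd j) ^ m * fermi (of_real (h * half_odd j) - (y + of_real h))" for j
  define b where "b j = (- of_real (half_odd j)) ^ m * fermi (of_real (h * half_odd j) + (y + of_real h))" for j
  define a' where "a' j = (of_real (half_odd j) + 1) ^ m * fermi (of_real (h * half_odd j) - y)" for j
  define b' where "b' j = (- of_real (half_odd j) + 1) ^ m * fermi (of_real (h * half_odd j) + y)" for j
  have aS: "a (Suc j) = a' j" for j
    by (simp add: a_def a'_def half_odd_Suc algebra_simps)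
  have bS: "b' (Suc j) = b j" for j
    by (simp add: b_def b'_def half_odd_Suc algebra_simps)
  have sa: "summable a"
  proof -
    have "a = (\<lambda>j. (of_real (half_odd j) + 0) ^ m * fermi (of_real (h * half_odd j) + - (y + of_real h)))"
      by (intro ext) (simp only: a_def add_0_right diff_conv_add_uminus)
    then show ?thesis
      using summable_norm_cancel[OF summable_power_fermi[OF h, of 0 m "- (y + of_real h)"]] by (simp only:)
  qed
  have sb': "summable b'"
  proof -
    have "b' = (\<lambda>j. (- 1) ^ m * ((of_real (half_odd j) + (- 1)) ^ m * fermi (of_real (h * half_odd j) + y)))"
    proof
      fix j
      have "(- of_real (half_odd j) + 1 :: complex) = (- 1) * (of_real (half_odd j) + (- 1))" by simp
      then show "b' j = (- 1) ^ m * ((of_real (half_odd j) + (- 1)) ^ m * fermi (of_real (h * half_odd j) + y))"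
        unfolding b'_def by (simp only: power_mult_distrib mult.assoc)
    qed
    then show ?thesis
      by (simp only:) (rule summable_mult[OF summable_norm_cancel[OF summable_power_fermi[OF h]]])
  qed
  have sa': "summable a'" using summable_Suc_iff[THEN iffD2, OF sa] by (simp only: aS)
  have sb: "summable b" using summable_Suc_iff[THEN iffD2, OF sb'] by (simp only: bS)
  have A: "suminf a = a 0 + suminf a'"
    using suminf_split_head[OF sa] by (simp add: aS)
  have B: "suminf b = suminf b' - b' 0"
    using suminf_split_head[OF sb'] by (simp add: bS)
  have k0: "half_odd 0 = 1 / 2" by (simp add: half_odd_def)
  have z: "a 0 + b' 0 = (1 / 2) ^ m"
  proof -
    let ?u = "of_real (h / 2) + y"
    have "exp ?u + 1 \<noteq> 0" by (rule exp_plus_1_strip_nz) (use y in simp)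
    then have f: "fermi (- ?u) + fermi ?u = 1" by (rule fermi_minus)
    have e: "of_real (h * half_odd 0) - (y + of_real h) = - ?u" by (simp add: k0 complex_eq_iff)
    have "a 0 = (1 / 2) ^ m * fermi (- ?u)" unfolding a_def e by (simp add: k0)
    moreover have "b' 0 = (1 / 2) ^ m * fermi ?u" unfolding b'_def by (simp add: k0)
    ultimately show ?thesis using f by (simp only: distrib_left[symmetric] mult_1_right)
  qed
  have g: "a' j - b' j = (\<Sum>i\<le>m. of_nat (m choose i) * gterm h i j y)" for j
    unfolding a'_def b'_def binomial_ring
    by (simp add: gterm_def right_diff_distrib sum_subtractf sum_distrib_right mult.assoc)
  have "(\<Sum>j. gterm h m j (y + of_real h)) = (\<Sum>j. a j - b j)"
    by (simp add: gterm_def a_def b_def)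
  also have "\<dots> = suminf a - suminf b" by (rule suminf_diff[symmetric]) fact+
  also have "\<dots> = (suminf a' - suminf b') + (a 0 + b' 0)" unfolding A B by simp
  also have "suminf a' - suminf b' = (\<Sum>j. a' j - b' j)" by (rule suminf_diff) fact+
  also have "\<dots> = (\<Sum>i\<le>m. \<Sum>j. of_nat (m choose i) * gterm h i j y)"
    unfolding g by (intro suminf_sum summable_mult summable_norm_cancel[OF summable_gterm] h)
  also have "\<dots> = (\<Sum>i\<le>m. of_nat (m choose i) * (\<Sum>j. gterm h i j y))"
    by (intro sum.cong refl suminf_mult summable_norm_cancel[OF summable_gterm] h)
  finally show ?thesis unfolding z .
qed

text \<open>By \<open>Chat_mult\<close> this is t e^(t/2) / (e^t - 1), that is, t / (2
  sinh(t/2)).\<close>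

definition Chat :: "complex fps" where
  "Chat = 1 + fps_X * Abs_fps (\<lambda>m. of_real (pconst m) / fact m)"

definition Shat :: "real \<Rightarrow> complex \<Rightarrow> complex fps" where
  "Shat h y = Abs_fps (\<lambda>m. (\<Sum>j. gterm h m j y) / fact m)"

definition Ahat :: "real \<Rightarrow> complex \<Rightarrow> complex fps" where
  "Ahat h y = 1 + fps_X * Abs_fps (\<lambda>m. fsum h m y / fact m)"

text \<open>Moving \<open>y\<close> by \<open>h\<close> shifts the summation index, which multiplies the generating function \<open>Ahat\<close> by \<open>exp t\<close>.
  So \<open>exp (- y t / h) Ahat\<close> is \<open>h\<close>-periodic in \<open>y\<close>, and only its mean is not exponentially small.\<close>

definition Ghat :: "nat \<Rightarrow> real \<Rightarrow> complex \<Rightarrow> complex" where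
  "Ghat n h y = fps_nth (fps_exp (- y / of_real h) * Ahat h y) n"

lemma Chat_mult: "Chat * (fps_exp 1 - 1) = fps_X * fps_exp (1 / 2)"
proof (rule fps_ext)
  fix n
  define f where "f = 1 + fps_X * Abs_fps (\<lambda>m. pconst m / fact m)"
  have c: "fps_nth Chat i = of_real (fps_nth f i)" for i
    unfolding Chat_def f_def by (cases i) (simp_all add: fps_X_mult_nth)
  have e: "fps_nth (fps_exp 1 - 1 :: complex fps) i = of_real (fps_nth (fps_exp 1 - 1) i)" for i
    by (cases i) simp_all
  have r: "fps_nth (fps_X * fps_exp (1 / 2) :: complex fps) n = of_real (fps_nth (fps_X * fps_exp (1 / 2)) n)"
    by (cases n) (simp_all add: fps_X_mult_nth)
  show "fps_nth (Chat * (fps_exp 1 - 1)) n = fps_nth (fps_X * fps_exp (1 / 2)) n"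
  proof -
    have "fps_nth (Chat * (fps_exp 1 - 1)) n = of_real (fps_nth (f * (fps_exp 1 - 1)) n)"
      by (simp only: fps_mult_nth c e of_real_sum of_real_mult)
    also have "f * (fps_exp 1 - 1) = fps_X * fps_exp (1 / 2)" by (simp only: f_def pconst_fps)
    finally show ?thesis by (simp only: r)
  qed
qed

lemma Ahat_eq: "h > 0 \<Longrightarrow> Ahat h y = Chat + fps_X * Shat h y"
proof (rule fps_ext)
  fix n assume h: "h > 0"
  show "fps_nth (Ahat h y) n = fps_nth (Chat + fps_X * Shat h y) n"
    by (cases n) (simp_all add: Ahat_def Chat_def Shat_def fps_X_mult_nth fsum_eq[OF h] add_divide_distrib)
qed

lemma Shat_shift:
  assumes h: "h > 0" and y: "\<bar>Im y\<bar> \<le> 2 * pi / 3"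
  shows "Shat h (y + of_real h) = fps_exp 1 * Shat h y + fps_exp (1 / 2)"
proof (rule fps_ext)
  fix m
  have "fps_nth (Shat h y * fps_exp 1) m = (\<Sum>i\<le>m. of_nat (m choose i) * (\<Sum>j. gterm h i j y)) / fact m"
    unfolding fps_mult_nth Shat_def sum_divide_distrib atLeast0AtMost
  proof (intro sum.cong refl)
    fix i assume i: "i \<in> {..m}"
    then have "of_nat (m choose i) = (fact m / (fact i * fact (m - i)) :: complex)"
      by (intro binomial_fact) auto
    then show "fps_nth (Abs_fps (\<lambda>m. (\<Sum>j. gterm h m j y) / fact m)) i * fps_nth (fps_exp 1) (m - i) =
       of_nat (m choose i) * (\<Sum>j. gterm h i j y) / fact m"
      by simp
  qed
  then show "fps_nth (Shat h (y + of_real h)) m = fps_nth (fps_exp 1 * Shat h y + fps_exp (1 / 2)) m"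
    unfolding fps_add_nth mult.commute[of "fps_exp 1"] Shat_def fps_nth_Abs_fps
    using suminf_gterm_shift[OF h y, of m] by (simp add: Shat_def add_divide_distrib)
qed

text \<open>The term t e^(t/2) coming from \<open>Shat_shift\<close> equals \<open>Chat\<close>
  times e^t - 1, so the constants of \<open>p\<close> are what makes the shift purely
  multiplicative.\<close>

lemma Ahat_shift:
  assumes h: "h > 0" and y: "\<bar>Im y\<bar> \<le> 2 * pi / 3"
  shows "Ahat h (y + of_real h) = fps_exp 1 * Ahat h y"
proof -
  have "Ahat h (y + of_real h) = Chat + fps_exp 1 * (fps_X * Shat h y) + fps_X * fps_exp (1 / 2)"
    unfolding Ahat_eq[OF h] Shat_shift[OF h y] by (simp add: algebra_simps)
  also have "\<dots> = Chat + fps_exp 1 * (fps_X * Shat h y) + Chat * (fps_exp 1 - 1)"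
    by (simp only: Chat_mult)
  also have "\<dots> = fps_exp 1 * Ahat h y"
    unfolding Ahat_eq[OF h] by (simp add: algebra_simps)
  finally show ?thesis .
qed

lemma Ghat_periodic:
  assumes h: "h > 0" and y: "\<bar>Im y\<bar> \<le> 2 * pi / 3"
  shows "Ghat n h (y + of_real h) = Ghat n h y"
proof -
  have "- (y + of_real h) / of_real h = - y / of_real h + - 1"
    using h by (simp add: field_simps)
  then have "fps_exp (- (y + of_real h) / of_real h) * Ahat h (y + of_real h)
      = fps_exp (- y / of_real h) * (fps_exp (- 1) * fps_exp 1) * Ahat h y"
    unfolding Ahat_shift[OF h y] by (simp only: fps_exp_add_mult mult.assoc)
  also have "fps_exp (- 1) * fps_exp 1 = (1 :: complex fps)"
    using fps_exp_add_mult[of "- 1 :: complex" 1] by simp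
  finally show ?thesis by (simp add: Ghat_def)
qed

lemma Ahat_nth: "fps_nth (Ahat h y) 0 = 1" "fps_nth (Ahat h y) (Suc m) = fsum h m y / fact m"
  by (simp_all add: Ahat_def fps_X_mult_nth)

lemma Ghat_sum: "Ghat n h y = (\<Sum>i=0..n. (- y / of_real h) ^ i / fact i * fps_nth (Ahat h y) (n - i))"
  by (simp add: Ghat_def fps_mult_nth)

lemma holomorphic_Ghat:
  assumes h: "h > 0"
  shows "Ghat n h holomorphic_on {y. \<bar>Im y\<bar> < 2 * pi / 3}"
proof -
  have "(\<lambda>y. fps_nth (Ahat h y) k) holomorphic_on {y. \<bar>Im y\<bar> < 2 * pi / 3}" for k
  proof (cases k)
    case (Suc m)
    have "fsum h m holomorphic_on {y. \<bar>Im y\<bar> < 2 * pi / 3}"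
      by (rule holomorphic_on_subset[OF fsum_analytic(1)[OF h]]) (auto simp: fdom_def)
    then show ?thesis unfolding Suc Ahat_nth by (intro holomorphic_intros) auto
  qed (simp add: Ahat_nth)
  then show ?thesis unfolding Ghat_sum[abs_def] using h by (intro holomorphic_intros) auto
qed

text \<open>Multiplying \<open>Ghat\<close> back by exp(y t / h) recovers \<open>Ahat\<close>;
  approximating each \<open>Ghat\<close> by a constant therefore yields a polynomial in y /
  h.\<close>

lemma fsum_Ghat:
  "fsum h m y = fact m * (\<Sum>i=0..Suc m. (y / of_real h) ^ i / fact i * Ghat (Suc m - i) h y)"
proof -
  define G where "G = fps_exp (- y / of_real h) * Ahat h y"
  have "fps_exp (y / of_real h) * G = (fps_exp (y / of_real h) * fps_exp (- y / of_real h)) * Ahat h y"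
    by (simp only: G_def mult.assoc)
  also have "fps_exp (y / of_real h) * fps_exp (- y / of_real h) = 1"
    using fps_exp_add_mult[of "y / of_real h" "- y / of_real h"] by simp
  finally have "Ahat h y = fps_exp (y / of_real h) * G" by simp
  then have "fsum h m y / fact m = fps_nth (fps_exp (y / of_real h) * G) (Suc m)"
    using Ahat_nth(2)[of h y m] by simp
  also have "\<dots> = (\<Sum>i=0..Suc m. (y / of_real h) ^ i / fact i * Ghat (Suc m - i) h y)"
    unfolding fps_mult_nth by (simp add: Ghat_def G_def)
  finally show ?thesis by (simp add: field_simps)
qed

section \<open>Fermi-Dirac integrals and the means of the periodic functions\<close>

primrec expprim :: "nat \<Rightarrow> real \<Rightarrow> real \<Rightarrow> real" where
  expprim_0: "expprim 0 c u = - exp (- c * u) / c"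
| expprim_Suc: "expprim (Suc m) c u = - (u ^ Suc m * exp (- c * u)) / c + real (Suc m) / c * expprim m c u"

lemma expprim_deriv: "c > 0 \<Longrightarrow> (expprim m c has_real_derivative u ^ m * exp (- c * u)) (at u within S)"
proof (induction m)
  case 0
  then show ?case unfolding expprim_0[abs_def] by (auto intro!: derivative_eq_intros)
next
  case (Suc m)
  have D1: "((\<lambda>u. u ^ Suc m) has_real_derivative real (Suc m) * u ^ m) (at u within S)"
    using DERIV_pow[of "Suc m" u S] by simp
  have D2: "((\<lambda>u. exp (- c * u)) has_real_derivative - c * exp (- c * u)) (at u within S)"
    by (auto intro!: derivative_eq_intros)
  have "((\<lambda>u. - (u ^ Suc m * exp (- c * u)) / c + real (Suc m) / c * expprim m c u) has_real_derivative
     - (real (Suc m) * u ^ m * exp (- c * u) + - c * exp (- c * u) * u ^ Suc m) / c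
     + real (Suc m) / c * (u ^ m * exp (- c * u))) (at u within S)"
    by (intro DERIV_add DERIV_cdivide DERIV_minus DERIV_mult DERIV_cmult D1 D2 Suc.IH Suc.prems)
  also have "- (real (Suc m) * u ^ m * exp (- c * u) + - c * exp (- c * u) * u ^ Suc m) / c
     + real (Suc m) / c * (u ^ m * exp (- c * u)) = u ^ Suc m * exp (- c * u)"
    using Suc.prems by (simp add: field_simps del: power_Suc)
  finally show ?case unfolding expprim_Suc[abs_def] .
qed

lemma expprim_at_0: "c > 0 \<Longrightarrow> expprim m c 0 = - fact m / c ^ Suc m"
  by (induction m) (simp_all add: expprim_0 expprim_Suc)

lemma expprim_nonpos: "c > 0 \<Longrightarrow> u \<ge> 0 \<Longrightarrow> expprim m c u \<le> 0"
proof (induction m)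
  case (Suc m)
  have "u ^ Suc m * exp (- c * u) / c \<ge> 0" using Suc.prems by (intro divide_nonneg_nonneg mult_nonneg_nonneg) auto
  moreover have "real (Suc m) / c * expprim m c u \<le> 0" using Suc by (intro mult_nonneg_nonpos) auto
  ultimately show ?case unfolding expprim_Suc by simp
qed (simp add: expprim_0)

lemma expprim_tendsto: "c > 0 \<Longrightarrow> (expprim m c \<longlongrightarrow> 0) at_top"
proof -
  assume c: "c > 0"
  have e: "((\<lambda>u. u ^ k * exp (- c * u)) \<longlongrightarrow> 0) at_top" for k
    using c by real_asymp
  show ?thesis
  proof (induction m)
    case 0
    have "((\<lambda>u. - (u ^ 0 * exp (- c * u)) / c) \<longlongrightarrow> - 0 / c) at_top"
      using c by (intro tendsto_intros e) auto
    then show ?case unfolding expprim_0[abs_def] by simp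
  next
    case (Suc m)
    have "((\<lambda>u. - (u ^ Suc m * exp (- c * u)) / c + real (Suc m) / c * expprim m c u) \<longlongrightarrow> - 0 / c + real (Suc m) / c * 0) at_top"
      using c by (intro tendsto_intros e Suc) auto
    then show ?case unfolding expprim_Suc[abs_def] by simp
  qed
qed

definition fd_density :: "nat \<Rightarrow> real \<Rightarrow> real" where
  "fd_density m u = u ^ m / (exp u + 1)"

lemma exp_plus_1_nz: "exp (u::real) + 1 \<noteq> 0"
  by (smt (verit) exp_gt_zero)

lemma continuous_on_fd_density: "continuous_on S (fd_density m)"
  unfolding fd_density_def[abs_def] by (intro continuous_intros) (auto simp: exp_plus_1_nz)

text \<open>A finite geometric sum with remainder, since at u = 0 the ratio - exp(- u) is - 1 and
  the infinite series diverges.\<close>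

lemma fd_density_expand:
  assumes "u \<ge> 0"
  shows "\<bar>fd_density m u - (\<Sum>r<R. (- 1) ^ r * (u ^ m * exp (- real (Suc r) * u)))\<bar> \<le> u ^ m * exp (- real R * u)"
proof -
  define x where "x = - exp (- u)"
  have x1: "x \<noteq> 1" unfolding x_def by (smt (verit) exp_gt_zero)
  have p: "(- 1) ^ r * exp (- real r * u) = x ^ r" for r
    unfolding x_def by (subst power_minus) (simp add: exp_of_nat_mult[symmetric])
  have "(\<Sum>r<R. (- 1) ^ r * (u ^ m * exp (- real (Suc r) * u))) = (\<Sum>r<R. u ^ m * exp (- u) * x ^ r)"
  proof (intro sum.cong refl)
    fix r
    have "exp (- real (Suc r) * u) = exp (- u) * exp (- real r * u)"
      by (simp add: exp_add[symmetric] algebra_simps)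
    then show "(- 1) ^ r * (u ^ m * exp (- real (Suc r) * u)) = u ^ m * exp (- u) * x ^ r"
      unfolding p[symmetric] by simp
  qed
  also have "\<dots> = u ^ m * exp (- u) * ((x ^ R - 1) / (x - 1))"
    using x1 by (simp add: sum_distrib_left[symmetric] geometric_sum)
  also have "\<dots> = u ^ m * ((1 - x ^ R) / (exp u + 1))"
  proof -
    have "exp (- u) / (x - 1) = - 1 / (exp u + 1)"
      using x1 exp_plus_1_nz[of u] unfolding x_def by (simp add: exp_minus field_simps)
    then have "exp (- u) * ((x ^ R - 1) / (x - 1)) = (x ^ R - 1) * (- 1 / (exp u + 1))"
      by (metis (no_types) mult.commute times_divide_eq_right)
    then have "u ^ m * (exp (- u) * ((x ^ R - 1) / (x - 1))) = u ^ m * ((x ^ R - 1) * (- 1 / (exp u + 1)))" by simp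
    moreover have "(x ^ R - 1) * (- 1 / (exp u + 1)) = (1 - x ^ R) / (exp u + 1)"
      by (simp add: diff_divide_distrib left_diff_distrib)
    ultimately show ?thesis by (simp only: mult.assoc)
  qed
  finally have "fd_density m u - (\<Sum>r<R. (- 1) ^ r * (u ^ m * exp (- real (Suc r) * u))) = u ^ m * (x ^ R / (exp u + 1))"
    by (simp add: fd_density_def diff_divide_distrib right_diff_distrib)
  also have "\<bar>\<dots>\<bar> = u ^ m * (exp (- real R * u) / (exp u + 1))"
  proof -
    have "\<bar>u ^ m\<bar> = u ^ m" using assms by simp
    moreover have "\<bar>x ^ R\<bar> = exp (- real R * u)" unfolding p[symmetric] by (simp add: abs_mult power_abs)
    moreover have "\<bar>exp u + 1\<bar> = exp u + 1" by (intro abs_of_pos add_pos_pos) auto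
    ultimately show ?thesis by (simp only: abs_mult abs_divide)
  qed
  also have "\<dots> \<le> u ^ m * (exp (- real R * u) / 1)"
    using assms by (intro mult_left_mono divide_left_mono) (auto intro: add_pos_pos)
  finally show ?thesis by simp
qed

lemma expprim_has_integral:
  "c > 0 \<Longrightarrow> L \<ge> 0 \<Longrightarrow> ((\<lambda>u. u ^ m * exp (- c * u)) has_integral (expprim m c L + fact m / c ^ Suc m)) {0..L}"
proof -
  assume c: "c > 0" and L: "L \<ge> 0"
  have "((\<lambda>u. u ^ m * exp (- c * u)) has_integral (expprim m c L - expprim m c 0)) {0..L}"
    using L expprim_deriv[OF c] by (intro fundamental_theorem_of_calculus) (auto simp: has_real_derivative_iff_has_vector_derivative)
  then show ?thesis by (simp add: expprim_at_0[OF c])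
qed

lemma fd_integral_bound:
  assumes "L \<ge> 0" "R > 0"
  shows "\<bar>integral {0..L} (fd_density m) - (\<Sum>r<R. (- 1) ^ r * (expprim m (real (Suc r)) L + fact m / real (Suc r) ^ Suc m))\<bar>
     \<le> fact m / real R ^ Suc m"
proof -
  let ?s = "\<lambda>u. \<Sum>r<R. (- 1) ^ r * (u ^ m * exp (- real (Suc r) * u))"
  have s: "(?s has_integral (\<Sum>r<R. (- 1) ^ r * (expprim m (real (Suc r)) L + fact m / real (Suc r) ^ Suc m))) {0..L}"
    using assms by (intro has_integral_sum has_integral_mult_right expprim_has_integral) auto
  have f: "(fd_density m has_integral integral {0..L} (fd_density m)) {0..L}"
    by (intro integrable_integral integrable_continuous_real continuous_on_fd_density)
  have d: "((\<lambda>u. fd_density m u - ?s u) has_integral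
     (integral {0..L} (fd_density m) - (\<Sum>r<R. (- 1) ^ r * (expprim m (real (Suc r)) L + fact m / real (Suc r) ^ Suc m)))) {0..L}"
    by (rule has_integral_diff[OF f s])
  have e: "((\<lambda>u. u ^ m * exp (- real R * u)) has_integral (expprim m (real R) L + fact m / real R ^ Suc m)) {0..L}"
    using assms by (intro expprim_has_integral) auto
  have "norm (integral {0..L} (fd_density m) - (\<Sum>r<R. (- 1) ^ r * (expprim m (real (Suc r)) L + fact m / real (Suc r) ^ Suc m)))
     \<le> expprim m (real R) L + fact m / real R ^ Suc m"
    using integral_norm_bound_integral[of "\<lambda>u. fd_density m u - ?s u" "{0..L}" "\<lambda>u. u ^ m * exp (- real R * u)"]
      d e fd_density_expand by (force simp: has_integral_iff)
  also have "\<dots> \<le> fact m / real R ^ Suc m" using expprim_nonpos[of "real R" L m] assms by simp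
  finally show ?thesis by simp
qed

text \<open>The integral over the half-line is m! times the alternating zeta value at m + 1, half of
  zfrak. The number R of expansion terms is fixed before N grows, so only finitely many
  \<open>expprim\<close> have to tend to 0.\<close>

lemma fd_integral_limit:
  assumes m: "odd m" and h: "h > 0"
  shows "(\<lambda>N. integral {0..h * real N} (fd_density m)) \<longlonglongrightarrow> fact m * zfrak (int m + 1) / 2"
proof (rule LIMSEQ_I)
  fix e :: real assume e: "e > 0"
  let ?Z = "fact m * zfrak (int m + 1) / 2"
  let ?P = "\<lambda>R. \<Sum>r<R. (- 1) ^ r * (fact m / real (Suc r) ^ Suc m)"
  have "(\<lambda>n. fact m / 2 * (2 * (- 1) ^ n / real (Suc n) ^ Suc m)) sums (fact m / 2 * zfrak (int m + 1))"
    by (intro sums_mult zfrak_sums m)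
  then have "(\<lambda>n. (- 1) ^ n * (fact m / real (Suc n) ^ Suc m)) sums ?Z" by (simp add: field_simps del: power_Suc of_nat_Suc)
  then have "(\<lambda>R. ?P R) \<longlonglongrightarrow> ?Z" by (simp only: sums_def)
  then obtain R1 where R1: "\<And>R. R \<ge> R1 \<Longrightarrow> \<bar>?P R - ?Z\<bar> < e / 3"
    using e unfolding LIMSEQ_iff real_norm_def by (meson divide_pos_pos zero_less_numeral)
  have "(\<lambda>R. fact m / real R ^ Suc m) \<longlonglongrightarrow> 0"
    by real_asymp
  then obtain R2 where R2: "\<And>R. R \<ge> R2 \<Longrightarrow> \<bar>fact m / real R ^ Suc m\<bar> < e / 3"
    using e unfolding LIMSEQ_iff real_norm_def diff_0_right by (meson divide_pos_pos zero_less_numeral)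
  define R where "R = Suc (max R1 R2)"
  have l: "(\<lambda>N. \<Sum>r<R. (- 1) ^ r * expprim m (real (Suc r)) (h * real N)) \<longlonglongrightarrow> (\<Sum>r<R. (- 1) ^ r * 0)"
  proof (intro tendsto_intros)
    fix r
    have fl: "filterlim (\<lambda>N. h * real N) at_top sequentially"
      by (rule filterlim_tendsto_pos_mult_at_top[OF tendsto_const h filterlim_real_sequentially])
    show "(\<lambda>N. expprim m (real (Suc r)) (h * real N)) \<longlonglongrightarrow> 0"
      by (rule filterlim_compose[OF expprim_tendsto fl]) simp
  qed
  then obtain N0 where N0: "\<And>N. N \<ge> N0 \<Longrightarrow> \<bar>\<Sum>r<R. (- 1) ^ r * expprim m (real (Suc r)) (h * real N)\<bar> < e / 3"
    using LIMSEQ_D[OF l, of "e / 3"] e by auto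
  show "\<exists>N0. \<forall>N\<ge>N0. norm (integral {0..h * real N} (fd_density m) - ?Z) < e"
  proof (intro exI allI impI)
    fix N assume N: "N \<ge> N0"
    have "\<bar>integral {0..h * real N} (fd_density m) - ((\<Sum>r<R. (- 1) ^ r * expprim m (real (Suc r)) (h * real N)) + ?P R)\<bar> \<le> fact m / real R ^ Suc m"
      using fd_integral_bound[of "h * real N" R m] h by (simp add: R_def sum.distrib distrib_left)
    moreover have "\<bar>?P R - ?Z\<bar> < e / 3" by (rule R1) (simp add: R_def)
    moreover have "\<bar>fact m / real R ^ Suc m\<bar> < e / 3" by (rule R2) (simp add: R_def)
    ultimately show "norm (integral {0..h * real N} (fd_density m) - ?Z) < e"
      using N0[OF N] unfolding real_norm_def by linarith
  qed
qed

lemma fd_primitive: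
  assumes "B > 0"
  obtains P where "\<And>u. 0 \<le> u \<Longrightarrow> u \<le> B \<Longrightarrow> (P has_real_derivative fd_density m u) (at u)"
    "\<And>L. 0 \<le> L \<Longrightarrow> L \<le> B \<Longrightarrow> P L - P 0 = integral {0..L} (fd_density m)"
proof -
  \<comment> \<open>The lower limit - 1 makes 0 an interior point, so the derivative is two-sided
    there.\<close>
  define P where "P u = integral {- 1..u} (fd_density m)" for u
  have D: "(P has_real_derivative fd_density m u) (at u)" if "0 \<le> u" "u \<le> B" for u
  proof -
    have "(P has_real_derivative fd_density m u) (at u within {- 1..B + 1})"
      unfolding P_def using that by (intro integral_has_real_derivative continuous_on_fd_density) auto
    moreover have "at u within {- 1..B + 1} = at u" using that by (intro at_within_interior) auto
    ultimately show ?thesis by simp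
  qed
  have "P L - P 0 = integral {0..L} (fd_density m)" if "0 \<le> L" "L \<le> B" for L
  proof -
    have "(fd_density m has_integral (P L - P 0)) {0..L}"
      using that D by (intro fundamental_theorem_of_calculus)
        (auto simp: has_real_derivative_iff_has_vector_derivative[symmetric] intro: has_field_derivative_at_within)
    then show ?thesis by (simp add: has_integral_iff)
  qed
  with D show ?thesis by (rule that)
qed

text \<open>What \<open>gterm\<close> becomes under the factor exp(- x t / h) of the generating
  function: positions are recentred by - x / h, so up to h^m the two parts depend only on h
  \<open>half_odd j\<close> - x and on h \<open>half_odd j\<close> + x.\<close>

definition shifted_term :: "real \<Rightarrow> nat \<Rightarrow> nat \<Rightarrow> real \<Rightarrow> complex" where
  "shifted_term h m j x = (of_real (half_odd j) - of_real x / of_real h) ^ m * fermi (of_real (h * half_odd j) - of_real x)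
     - (- of_real (half_odd j) - of_real x / of_real h) ^ m * fermi (of_real (h * half_odd j) + of_real x)"

lemma fermi_of_real: "fermi (of_real u) = of_real (1 / (exp u + 1))"
  by (simp add: fermi_def exp_of_real)

lemma shifted_term_real:
  assumes h: "h > 0"
  shows "shifted_term h m j x = of_real ((fd_density m (h * half_odd j - x) - (- 1) ^ m * fd_density m (h * half_odd j + x)) / h ^ m)"
proof -
  have 1: "(of_real (half_odd j) - of_real x / of_real h :: complex) = of_real ((h * half_odd j - x) / h)"
    using h by (simp add: field_simps)
  have 2: "(- of_real (half_odd j) - of_real x / of_real h :: complex) = of_real (- ((h * half_odd j + x) / h))"
    using h by (simp add: field_simps)
  have 3: "of_real (h * half_odd j) - of_real x = (of_real (h * half_odd j - x) :: complex)"
    "of_real (h * half_odd j) + of_real x = (of_real (h * half_odd j + x) :: complex)" by simp_all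
  have 4: "(- ((h * half_odd j + x) / h)) ^ m = (- 1) ^ m * ((h * half_odd j + x) / h) ^ m"
    by (rule power_minus)
  show ?thesis
    unfolding shifted_term_def 1 2 3 fermi_of_real of_real_power[symmetric] of_real_mult[symmetric] of_real_diff[symmetric] 4
    by (simp only: of_real_eq_iff fd_density_def power_divide) (simp add: diff_divide_distrib mult_ac)
qed

text \<open>As x runs over a period, h \<open>half_odd j\<close> - x and h \<open>half_odd j\<close>
  + x both sweep the interval from h j to h (j + 1), and these intervals tile the half-line.
  Particle and hole parts cancel for even m and add up for odd m.\<close>

lemma shifted_term_integral:
  assumes h: "h > 0"
  shows "\<exists>I. (\<forall>N. ((\<lambda>x. \<Sum>j<N. shifted_term h m j x) has_integral I N) {- h / 2..h / 2}) \<and>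
     I \<longlonglongrightarrow> of_real (h * (fact m * zfrak (int m + 1) / h ^ (m + 1)))"
proof -
  let ?c = "(1 - (- 1) ^ m) / h ^ m :: real"
  define I where "I N = (of_real (?c * integral {0..h * real N} (fd_density m)) :: complex)" for N
  have "((\<lambda>x. \<Sum>j<N. shifted_term h m j x) has_integral I N) {- h / 2..h / 2}" for N
  proof -
    have B: "h * real (Suc N) > 0" using h by simp
    obtain P where P: "\<And>u. 0 \<le> u \<Longrightarrow> u \<le> h * real (Suc N) \<Longrightarrow> (P has_real_derivative fd_density m u) (at u)"
      "\<And>L. 0 \<le> L \<Longrightarrow> L \<le> h * real (Suc N) \<Longrightarrow> P L - P 0 = integral {0..L} (fd_density m)"
      by (rule fd_primitive[OF B]) (rule that)
    have 1: "((\<lambda>x. shifted_term h m j x) has_integral of_real (?c * (P (h * real (Suc j)) - P (h * real j)))) {- h / 2..h / 2}"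
      if j: "j < N" for j
    proof -
      have r: "0 \<le> h * half_odd j - x \<and> h * half_odd j - x \<le> h * real (Suc N) \<and> 0 \<le> h * half_odd j + x \<and> h * half_odd j + x \<le> h * real (Suc N)"
        if x: "x \<in> {- h / 2..h / 2}" for x
      proof -
        have "h * half_odd j = h * real j + h / 2" by (simp add: half_odd_def algebra_simps)
        moreover have "h * real j \<ge> 0" using h by simp
        moreover have "h * real j + h \<le> h * real (Suc N)"
          using h j mult_left_mono[of "real (Suc j)" "real (Suc N)" h] by (simp add: algebra_simps)
        moreover have "- (h / 2) \<le> x" "x \<le> h / 2" using x by auto
        ultimately show ?thesis by (intro conjI) linarith+
      qed
      have d1: "((\<lambda>x. - P (h * half_odd j - x)) has_real_derivative fd_density m (h * half_odd j - x)) (at x within S)"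
        if x: "x \<in> {- h / 2..h / 2}" for x S
      proof -
        have "((\<lambda>x. P (h * half_odd j - x)) has_real_derivative fd_density m (h * half_odd j - x) * (0 - 1)) (at x within S)"
          by (rule DERIV_chain2[where f = P and g = "\<lambda>x. h * half_odd j - x", OF P(1)]) (use r[OF x] in \<open>auto intro!: derivative_eq_intros\<close>)
        from DERIV_minus[OF this] show ?thesis by simp
      qed
      have d2: "((\<lambda>x. P (h * half_odd j + x)) has_real_derivative fd_density m (h * half_odd j + x)) (at x within S)"
        if x: "x \<in> {- h / 2..h / 2}" for x S
      proof -
        have "((\<lambda>x. P (h * half_odd j + x)) has_real_derivative fd_density m (h * half_odd j + x) * (0 + 1)) (at x within S)"
          by (rule DERIV_chain2[where f = P and g = "\<lambda>x. h * half_odd j + x", OF P(1)]) (use r[OF x] in \<open>auto intro!: derivative_eq_intros\<close>)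
        then show ?thesis by simp
      qed
      let ?F = "\<lambda>x. (- P (h * half_odd j - x) - (- 1) ^ m * P (h * half_odd j + x)) / h ^ m"
      have "((\<lambda>x. (fd_density m (h * half_odd j - x) - (- 1) ^ m * fd_density m (h * half_odd j + x)) / h ^ m) has_integral
         (?F (h / 2) - ?F (- h / 2))) {- h / 2..h / 2}"
        using h by (intro fundamental_theorem_of_calculus)
          (auto simp: has_real_derivative_iff_has_vector_derivative[symmetric] intro!: DERIV_cdivide DERIV_diff DERIV_cmult d1 d2)
      moreover have "?F (h / 2) - ?F (- h / 2) = ?c * (P (h * real (Suc j)) - P (h * real j))"
      proof -
        have e: "h * half_odd j - h / 2 = h * real j" "h * half_odd j - - h / 2 = h * real (Suc j)"
          "h * half_odd j + h / 2 = h * real (Suc j)" "h * half_odd j + - h / 2 = h * real j"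
          by (simp_all add: half_odd_def algebra_simps)
        show ?thesis unfolding e by (simp add: diff_divide_distrib[symmetric] algebra_simps)
      qed
      ultimately have "((\<lambda>x. (fd_density m (h * half_odd j - x) - (- 1) ^ m * fd_density m (h * half_odd j + x)) / h ^ m) has_integral
         (?c * (P (h * real (Suc j)) - P (h * real j)))) {- h / 2..h / 2}" by (simp only:)
      from has_integral_linear[OF this, of "of_real :: real \<Rightarrow> complex", OF bounded_linear_of_real]
      show ?thesis by (simp only: o_def shifted_term_real[OF h])
    qed
    have "((\<lambda>x. \<Sum>j<N. shifted_term h m j x) has_integral (\<Sum>j<N. of_real (?c * (P (h * real (Suc j)) - P (h * real j))))) {- h / 2..h / 2}"
      by (intro has_integral_sum 1) auto
    also have "(\<Sum>j<N. of_real (?c * (P (h * real (Suc j)) - P (h * real j)))) = (of_real (?c * (\<Sum>j<N. P (h * real (Suc j)) - P (h * real j))) :: complex)"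
      by (simp only: of_real_sum sum_distrib_left)
    also have "(\<Sum>j<N. P (h * real (Suc j)) - P (h * real j)) = P (h * real N) - P 0"
      using sum_lessThan_telescope[of "\<lambda>j. P (h * real j)" N] by simp
    also have "\<dots> = integral {0..h * real N} (fd_density m)"
      using h by (intro P(2)) auto
    finally show ?thesis by (simp only: I_def)
  qed
  moreover have "I \<longlonglongrightarrow> of_real (h * (fact m * zfrak (int m + 1) / h ^ (m + 1)))"
  proof (cases "even m")
    case True
    then show ?thesis by (simp add: I_def[abs_def] zfrak_odd)
  next
    case False
    have "I \<longlonglongrightarrow> of_real (?c * (fact m * zfrak (int m + 1) / 2))"
      unfolding I_def[abs_def] by (intro tendsto_intros fd_integral_limit False h)
    then show ?thesis using False h by simp
  qed
  ultimately show ?thesis by blast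
qed

lemma Ghat_series:
  assumes h: "h > 0"
  shows "fps_nth (fps_exp (- of_real x / of_real h) * (fps_X * Shat h (of_real x))) (Suc m)
     = (\<Sum>j. shifted_term h m j x) / fact m"
proof -
  let ?y = "- of_real x / of_real h :: complex"
  have "fps_exp ?y * (fps_X * Shat h (of_real x)) = fps_X * (Shat h (of_real x) * fps_exp ?y)" by (simp only: mult_ac)
  then have "fps_nth (fps_exp ?y * (fps_X * Shat h (of_real x))) (Suc m) = fps_nth (Shat h (of_real x) * fps_exp ?y) m"
    by (simp only:) (simp add: fps_X_mult_nth)
  also have "\<dots> = (\<Sum>i\<le>m. of_nat (m choose i) * ?y ^ (m - i) * (\<Sum>j. gterm h i j (of_real x))) / fact m"
    unfolding fps_mult_nth Shat_def sum_divide_distrib atLeast0AtMost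
  proof (intro sum.cong refl)
    fix i assume i: "i \<in> {..m}"
    then have "of_nat (m choose i) = (fact m / (fact i * fact (m - i)) :: complex)"
      by (intro binomial_fact) auto
    then show "fps_nth (Abs_fps (\<lambda>m. (\<Sum>j. gterm h m j (of_real x)) / fact m)) i * fps_nth (fps_exp ?y) (m - i) =
       of_nat (m choose i) * ?y ^ (m - i) * (\<Sum>j. gterm h i j (of_real x)) / fact m"
      by simp
  qed
  also have "(\<Sum>i\<le>m. of_nat (m choose i) * ?y ^ (m - i) * (\<Sum>j. gterm h i j (of_real x))) =
      (\<Sum>i\<le>m. \<Sum>j. of_nat (m choose i) * ?y ^ (m - i) * gterm h i j (of_real x))"
    by (intro sum.cong refl suminf_mult[symmetric] summable_norm_cancel[OF summable_gterm] h)
  also have "\<dots> = (\<Sum>j. \<Sum>i\<le>m. of_nat (m choose i) * ?y ^ (m - i) * gterm h i j (of_real x))"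
    by (intro suminf_sum[symmetric] summable_mult summable_norm_cancel[OF summable_gterm] h)
  also have "\<dots> = (\<Sum>j. shifted_term h m j x)"
  proof (intro arg_cong[where f = suminf] ext)
    fix j
    have b: "(c - of_real x / of_real h) ^ m = (\<Sum>i\<le>m. of_nat (m choose i) * c ^ i * ?y ^ (m - i))" for c :: complex
      using binomial_ring[of c ?y m] by simp
    show "(\<Sum>i\<le>m. of_nat (m choose i) * ?y ^ (m - i) * gterm h i j (of_real x)) = shifted_term h m j x"
      unfolding shifted_term_def b gterm_def right_diff_distrib sum_subtractf sum_distrib_right by (simp only: mult_ac)
  qed
  finally show ?thesis .
qed

text \<open>The integral of exp(- x t / h) over a period is h times 2 sinh(t/2) / t, and the second
  factor is the inverse of \<open>Chat\<close>, so only the coefficient of t^0 survives.\<close>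

lemma Chat_integral:
  assumes h: "h > 0"
  shows "((\<lambda>x. fps_nth (fps_exp (- of_real x / of_real h) * Chat) n) has_integral (if n = 0 then of_real h else 0)) {- h / 2..h / 2}"
proof -
  \<comment> \<open>The coefficients of 2 sinh(t/2) / t.\<close>
  define w :: "nat \<Rightarrow> real" where "w i = ((1 / 2) ^ Suc i - (- 1 / 2) ^ Suc i) / fact (Suc i)" for i :: nat
  define W where "W = Abs_fps (\<lambda>i. of_real (w i) :: complex)"
  have 1: "((\<lambda>x. (- of_real x / of_real h) ^ i / fact i :: complex) has_integral of_real (h * w i)) {- h / 2..h / 2}" for i
  proof -
    let ?F = "\<lambda>x. - h * ((- x / h) ^ Suc i / fact (Suc i))"
    have D: "(?F has_real_derivative (- x / h) ^ i / fact i) (at x within S)" for x S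
    proof -
      have "((\<lambda>x. (- x / h) ^ Suc i) has_real_derivative real (Suc i) * (- 1 / h * (- x / h) ^ (Suc i - 1))) (at x within S)"
        by (rule DERIV_power[THEN DERIV_cong]) (use h in \<open>auto intro!: derivative_eq_intros\<close>)
      then have "(?F has_real_derivative - h * (real (Suc i) * (- 1 / h * (- x / h) ^ (Suc i - 1)) / fact (Suc i))) (at x within S)"
        by (intro DERIV_cmult DERIV_cdivide)
      moreover have "- h * (real (Suc i) * (- 1 / h * (- x / h) ^ (Suc i - 1)) / fact (Suc i)) = (- x / h) ^ i / fact i"
      proof -
        have "- h * (S * (- 1 / h * p) / (S * f)) = p / f" if "S \<noteq> 0" "f \<noteq> 0" for S p f :: real
          using h that by (simp add: field_simps)
        from this[of "real (Suc i)" "fact i" "(- x / h) ^ i"] show ?thesis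
          by (simp only: fact_Suc diff_Suc_1) simp
      qed
      ultimately show ?thesis by simp
    qed
    have "((\<lambda>x. (- x / h) ^ i / fact i) has_integral (?F (h / 2) - ?F (- h / 2))) {- h / 2..h / 2}"
      using h by (intro fundamental_theorem_of_calculus D[unfolded has_real_derivative_iff_has_vector_derivative]) auto
    moreover have "?F (h / 2) - ?F (- h / 2) = h * w i"
    proof -
      have e: "- (h / 2) / h = - 1 / 2" "- (- h / 2) / h = 1 / 2" using h by simp_all
      show ?thesis unfolding e w_def by (simp add: diff_divide_distrib right_diff_distrib del: power_Suc fact_Suc)
    qed
    ultimately have "((\<lambda>x. (- x / h) ^ i / fact i) has_integral (h * w i)) {- h / 2..h / 2}" by (simp only:)
    from has_integral_linear[OF this, of "of_real :: real \<Rightarrow> complex", OF bounded_linear_of_real]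
    show ?thesis by (simp add: o_def)
  qed
  have "((\<lambda>x. \<Sum>i=0..n. (- of_real x / of_real h) ^ i / fact i * fps_nth Chat (n - i)) has_integral
      (\<Sum>i=0..n. of_real (h * w i) * fps_nth Chat (n - i))) {- h / 2..h / 2}"
    by (intro has_integral_sum has_integral_mult_left 1) auto
  also have "(\<lambda>x. \<Sum>i=0..n. (- of_real x / of_real h) ^ i / fact i * fps_nth Chat (n - i)) = (\<lambda>x. fps_nth (fps_exp (- of_real x / of_real h) * Chat) n)"
    by (simp add: fps_mult_nth)
  also have "(\<Sum>i=0..n. of_real (h * w i) * fps_nth Chat (n - i)) = of_real h * fps_nth (W * Chat) n"
    by (simp add: fps_mult_nth W_def sum_distrib_left mult.assoc)
  also have "W * Chat = 1"
  proof -
    have XW: "fps_X * W = fps_exp (1 / 2) - fps_exp (- 1 / 2)"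
    proof (rule fps_ext)
      fix k show "fps_nth (fps_X * W) k = fps_nth (fps_exp (1 / 2) - fps_exp (- 1 / 2)) k"
        by (cases k) (simp_all add: fps_X_mult_nth W_def w_def diff_divide_distrib del: fact_Suc power_Suc)
    qed
    have e: "fps_exp (- 1 / 2) * fps_exp (1 / 2) = (1 :: complex fps)" "fps_exp (- 1 / 2) * fps_exp 1 = (fps_exp (1 / 2) :: complex fps)"
      using fps_exp_add_mult[of "- 1 / 2 :: complex" "1 / 2"] fps_exp_add_mult[of "- 1 / 2 :: complex" 1] by simp_all
    have "fps_X * (W * Chat) = (fps_exp (1 / 2) - fps_exp (- 1 / 2)) * Chat"
      by (simp only: XW mult.assoc[symmetric])
    also have "fps_exp (1 / 2) - fps_exp (- 1 / 2) = (fps_exp (- 1 / 2) * (fps_exp 1 - 1) :: complex fps)"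
      by (simp only: right_diff_distrib e mult_1_right)
    also have "\<dots> * Chat = fps_exp (- 1 / 2) * (Chat * (fps_exp 1 - 1))" by (simp only: mult_ac)
    also have "\<dots> = fps_X * (fps_exp (- 1 / 2) * fps_exp (1 / 2))" by (simp only: Chat_mult mult_ac)
    also have "\<dots> = fps_X * 1" by (simp only: e)
    finally show ?thesis by (simp only: mult_left_cancel[OF fps_X_neq_zero])
  qed
  finally show ?thesis by (simp split: if_splits)
qed

lemma shifted_term_suminf_integral:
  assumes h: "h > 0"
  shows "((\<lambda>x. \<Sum>j. shifted_term h m j x) has_integral of_real (h * (fact m * zfrak (int m + 1) / h ^ (m + 1)))) {- h / 2..h / 2}"
proof -
  let ?S = "{- h / 2..h / 2}"
  let ?M = "\<lambda>j. 2 * (exp (h / 2) / (1 - exp (- 1)) * ((half_odd j + 1 / 2) ^ m * exp (- h * half_odd j)))"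
  have ul: "uniform_limit ?S (\<lambda>N x. \<Sum>j<N. shifted_term h m j x) (\<lambda>x. \<Sum>j. shifted_term h m j x) sequentially"
  proof (rule Weierstrass_m_test_ev)
    show "summable ?M" using h by (intro summable_mult summable_power_exp_half_odd) auto
    show "\<forall>\<^sub>F j in sequentially. \<forall>x\<in>?S. norm (shifted_term h m j x) \<le> ?M j"
      using eventually_half_odd_large[OF h, of "1 + h / 2"]
    proof (eventually_elim, intro ballI)
      fix j x assume j: "1 + h / 2 \<le> h * half_odd j" and x: "x \<in> ?S"
      have b: "norm ((of_real (half_odd j) + of_real (u / h)) ^ m * fermi (of_real (h * half_odd j) + of_real u) :: complex) \<le>
          exp (h / 2) / (1 - exp (- 1)) * ((half_odd j + 1 / 2) ^ m * exp (- h * half_odd j))" if u: "\<bar>u\<bar> \<le> h / 2" for u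
      proof -
        have "Re (of_real u) + h * half_odd j \<ge> 1" using j u by simp
        from norm_power_fermi_le[OF this, of "of_real (u / h)" m]
        have "norm ((of_real (half_odd j) + of_real (u / h)) ^ m * fermi (of_real (h * half_odd j) + of_real u) :: complex) \<le>
            exp (- u) / (1 - exp (- 1)) * ((half_odd j + \<bar>u / h\<bar>) ^ m * exp (- h * half_odd j))" by (simp del: of_real_divide)
        also have "\<dots> \<le> exp (h / 2) / (1 - exp (- 1)) * ((half_odd j + 1 / 2) ^ m * exp (- h * half_odd j))"
        proof (intro mult_mono divide_right_mono power_mono)
          show "half_odd j + \<bar>u / h\<bar> \<le> half_odd j + 1 / 2" using u h by (simp add: abs_divide field_simps)
        qed (use u half_odd_pos[of j] in auto)
        finally show ?thesis .
      qed
      have e: "shifted_term h m j x = (of_real (half_odd j) + of_real (- x / h)) ^ m * fermi (of_real (h * half_odd j) + of_real (- x))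
          - (- 1) ^ m * ((of_real (half_odd j) + of_real (x / h)) ^ m * fermi (of_real (h * half_odd j) + of_real x))"
      proof -
        have "(- of_real (half_odd j) - of_real x / of_real h :: complex) = (- 1) * (of_real (half_odd j) + of_real (x / h))" by simp
        then show ?thesis unfolding shifted_term_def by (simp only: power_mult_distrib mult.assoc) simp
      qed
      have "norm (shifted_term h m j x) \<le> norm ((of_real (half_odd j) + of_real (- x / h)) ^ m * fermi (of_real (h * half_odd j) + of_real (- x)) :: complex)
          + norm ((of_real (half_odd j) + of_real (x / h)) ^ m * fermi (of_real (h * half_odd j) + of_real x) :: complex)"
        unfolding e by (rule order_trans[OF norm_triangle_ineq4]) (simp add: norm_mult norm_power)
      also have "\<dots> \<le> exp (h / 2) / (1 - exp (- 1)) * ((half_odd j + 1 / 2) ^ m * exp (- h * half_odd j)) +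
          exp (h / 2) / (1 - exp (- 1)) * ((half_odd j + 1 / 2) ^ m * exp (- h * half_odd j))"
      proof -
        have "\<bar>x\<bar> \<le> h / 2" using x by auto
        then have "\<bar>- x / h\<bar> = \<bar>x / h\<bar>" "\<bar>- x\<bar> \<le> h / 2" "\<bar>x\<bar> \<le> h / 2" by auto
        then show ?thesis using b[of "- x"] b[of x] by (intro add_mono) blast+
      qed
      also have "\<dots> = ?M j" by simp
      finally show "norm (shifted_term h m j x) \<le> ?M j" .
    qed
  qed
  have c: "continuous_on ?S (\<lambda>x. \<Sum>j<N. shifted_term h m j x)" for N
    unfolding shifted_term_real[OF h] fd_density_def using h
    by (intro continuous_intros) (auto simp: exp_plus_1_nz)
  obtain I J where IJ: "\<And>N. ((\<lambda>x. \<Sum>j<N. shifted_term h m j x) has_integral I N) ?S"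
      "((\<lambda>x. \<Sum>j. shifted_term h m j x) has_integral J) ?S" "I \<longlonglongrightarrow> J"
    by (rule uniform_limit_integral[OF ul c]) auto
  obtain I' where I': "\<And>N. ((\<lambda>x. \<Sum>j<N. shifted_term h m j x) has_integral I' N) ?S"
      "I' \<longlonglongrightarrow> of_real (h * (fact m * zfrak (int m + 1) / h ^ (m + 1)))"
    using shifted_term_integral[OF h, of m] by blast
  have "I' = I" using IJ(1) I'(1) has_integral_unique by blast
  then show ?thesis using IJ I' LIMSEQ_unique by blast
qed

text \<open>The two parts of \<open>Ahat\<close> complement each other: the constants contribute for
  n = 0 only, the sums contribute the Fermi-Dirac integrals for n > 0. This is how zfrak
  enters.\<close>

lemma Ghat_integral:
  assumes h: "h > 0"
  shows "((\<lambda>x. Ghat n h (of_real x)) has_integral of_real (h * (zfrak (int n) / h ^ n))) {- h / 2..h / 2}"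
proof -
  have e: "Ghat n h (of_real x) = fps_nth (fps_exp (- of_real x / of_real h) * Chat) n
      + fps_nth (fps_exp (- of_real x / of_real h) * (fps_X * Shat h (of_real x))) n" for x n
    by (simp add: Ghat_def Ahat_eq[OF h] distrib_left)
  show ?thesis
  proof (cases n)
    case 0
    show ?thesis using Chat_integral[OF h, of 0] unfolding 0 e by (simp add: zfrak_0)
  next
    case (Suc m)
    have "((\<lambda>x. (\<Sum>j. shifted_term h m j x) / fact m) has_integral of_real (h * (fact m * zfrak (int m + 1) / h ^ (m + 1))) / fact m) {- h / 2..h / 2}"
      by (rule has_integral_divide[OF shifted_term_suminf_integral[OF h]])
    then have "((\<lambda>x. fps_nth (fps_exp (- of_real x / of_real h) * Chat) (Suc m) + (\<Sum>j. shifted_term h m j x) / fact m)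
       has_integral ((if Suc m = 0 then of_real h else 0) + of_real (h * (fact m * zfrak (int m + 1) / h ^ (m + 1))) / fact m)) {- h / 2..h / 2}"
      by (intro has_integral_add Chat_integral h)
    moreover have "(if Suc m = 0 then of_real h else 0) + of_real (h * (fact m * zfrak (int m + 1) / h ^ (m + 1))) / fact m =
        (of_real (h * (zfrak (int (Suc m)) / h ^ Suc m)) :: complex)"
      by (simp add: add.commute)
    ultimately show ?thesis by (simp only: Suc e Ghat_series[OF h])
  qed
qed

section \<open>Asymptotics of the Fermi-Dirac sums\<close>

definition poly_bounded :: "(real \<Rightarrow> 'x \<Rightarrow> bool) \<Rightarrow> (real \<Rightarrow> 'x \<Rightarrow> complex) \<Rightarrow> bool" where
  "poly_bounded X F \<longleftrightarrow> (\<exists>K N. \<forall>h x. 0 < h \<longrightarrow> h \<le> 1 \<longrightarrow> X h x \<longrightarrow> norm (F h x) \<le> K / h ^ N)"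

text \<open>Both notions are uniform over the points x that X admits at the parameter h, for h in
  (0, 1]. The exponentially small functions form an ideal among the polynomially bounded ones, and
  error terms are handled by this ideal calculus.\<close>

definition exp_small :: "(real \<Rightarrow> 'x \<Rightarrow> bool) \<Rightarrow> (real \<Rightarrow> 'x \<Rightarrow> complex) \<Rightarrow> bool" where
  "exp_small X F \<longleftrightarrow> (\<exists>K c. c > 0 \<and> (\<forall>h x. 0 < h \<longrightarrow> h \<le> 1 \<longrightarrow> X h x \<longrightarrow> norm (F h x) \<le> K * exp (- c / h)))"

lemma poly_bounded_E:
  assumes "poly_bounded X F"
  obtains K N where "K \<ge> 0" "\<And>h x. 0 < h \<Longrightarrow> h \<le> 1 \<Longrightarrow> X h x \<Longrightarrow> norm (F h x) \<le> K / h ^ N"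
proof -
  obtain K N where K: "\<And>h x. 0 < h \<Longrightarrow> h \<le> 1 \<Longrightarrow> X h x \<Longrightarrow> norm (F h x) \<le> K / h ^ N"
    using assms unfolding poly_bounded_def by blast
  show ?thesis
  proof (rule that[of "\<bar>K\<bar>" N])
    fix h x assume h: "0 < h" "h \<le> 1" "X h x"
    have "K / h ^ N \<le> \<bar>K\<bar> / h ^ N" using h by (intro divide_right_mono) auto
    with K[OF h] show "norm (F h x) \<le> \<bar>K\<bar> / h ^ N" by linarith
  qed simp
qed

lemma poly_bounded_I: "(\<And>h x. 0 < h \<Longrightarrow> h \<le> 1 \<Longrightarrow> X h x \<Longrightarrow> norm (F h x) \<le> K / h ^ N) \<Longrightarrow> poly_bounded X F"
  unfolding poly_bounded_def by blast

lemma exp_small_E: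
  assumes "exp_small X F"
  obtains K c where "K \<ge> 0" "c > 0" "\<And>h x. 0 < h \<Longrightarrow> h \<le> 1 \<Longrightarrow> X h x \<Longrightarrow> norm (F h x) \<le> K * exp (- c / h)"
proof -
  obtain K c where K: "c > 0" "\<And>h x. 0 < h \<Longrightarrow> h \<le> 1 \<Longrightarrow> X h x \<Longrightarrow> norm (F h x) \<le> K * exp (- c / h)"
    using assms unfolding exp_small_def by blast
  show ?thesis
  proof (rule that[of "\<bar>K\<bar>" c])
    fix h x assume h: "0 < h" "h \<le> 1" "X h x"
    have "K * exp (- c / h) \<le> \<bar>K\<bar> * exp (- c / h)" by (intro mult_right_mono) auto
    with K(2)[OF h] show "norm (F h x) \<le> \<bar>K\<bar> * exp (- c / h)" by linarith
  qed (use K in auto)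
qed

lemma exp_small_I: "c > 0 \<Longrightarrow> (\<And>h x. 0 < h \<Longrightarrow> h \<le> 1 \<Longrightarrow> X h x \<Longrightarrow> norm (F h x) \<le> K * exp (- c / h)) \<Longrightarrow> exp_small X F"
  unfolding exp_small_def by blast

lemma poly_bounded_mono: "poly_bounded X G \<Longrightarrow> (\<And>h x. 0 < h \<Longrightarrow> h \<le> 1 \<Longrightarrow> Y h x \<Longrightarrow> X h x \<and> norm (F h x) \<le> norm (G h x)) \<Longrightarrow> poly_bounded Y F"
  unfolding poly_bounded_def by (meson order_trans)

lemma exp_small_mono: "exp_small X G \<Longrightarrow> (\<And>h x. 0 < h \<Longrightarrow> h \<le> 1 \<Longrightarrow> Y h x \<Longrightarrow> X h x \<and> norm (F h x) \<le> norm (G h x)) \<Longrightarrow> exp_small Y F"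
  unfolding exp_small_def by (meson order_trans)

lemma power_inverse_mono: "0 < h \<Longrightarrow> h \<le> 1 \<Longrightarrow> N \<le> M \<Longrightarrow> 0 \<le> K \<Longrightarrow> K / h ^ N \<le> K / (h::real) ^ M"
  by (intro divide_left_mono power_decreasing mult_pos_pos) auto

lemma poly_bounded_const: "poly_bounded X (\<lambda>h x. c)"
  by (rule poly_bounded_I[where K = "norm c" and N = 0]) simp

lemma poly_bounded_inverse: "poly_bounded X (\<lambda>h x. 1 / of_real h)"
  by (rule poly_bounded_I[where K = 1 and N = 1]) (simp add: norm_divide)

lemma poly_bounded_add:
  assumes "poly_bounded X F" "poly_bounded X G"
  shows "poly_bounded X (\<lambda>h x. F h x + G h x)"
proof -
  obtain K N where K: "K \<ge> 0" "\<And>h x. 0 < h \<Longrightarrow> h \<le> 1 \<Longrightarrow> X h x \<Longrightarrow> norm (F h x) \<le> K / h ^ N"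
    using assms(1) by (rule poly_bounded_E) blast
  obtain L M where L: "L \<ge> 0" "\<And>h x. 0 < h \<Longrightarrow> h \<le> 1 \<Longrightarrow> X h x \<Longrightarrow> norm (G h x) \<le> L / h ^ M"
    using assms(2) by (rule poly_bounded_E) blast
  show ?thesis
  proof (rule poly_bounded_I)
    fix h x assume h: "0 < h" "h \<le> 1" "X h x"
    have "norm (F h x + G h x) \<le> K / h ^ N + L / h ^ M"
      using K(2)[OF h] L(2)[OF h] norm_triangle_ineq[of "F h x" "G h x"] by linarith
    also have "\<dots> \<le> K / h ^ (N + M) + L / h ^ (N + M)"
      using h K L by (intro add_mono power_inverse_mono) auto
    finally show "norm (F h x + G h x) \<le> (K + L) / h ^ (N + M)" by (simp add: add_divide_distrib)
  qed
qed

lemma poly_bounded_mult: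
  assumes "poly_bounded X F" "poly_bounded X G"
  shows "poly_bounded X (\<lambda>h x. F h x * G h x)"
proof -
  obtain K N where K: "K \<ge> 0" "\<And>h x. 0 < h \<Longrightarrow> h \<le> 1 \<Longrightarrow> X h x \<Longrightarrow> norm (F h x) \<le> K / h ^ N"
    using assms(1) by (rule poly_bounded_E) blast
  obtain L M where L: "L \<ge> 0" "\<And>h x. 0 < h \<Longrightarrow> h \<le> 1 \<Longrightarrow> X h x \<Longrightarrow> norm (G h x) \<le> L / h ^ M"
    using assms(2) by (rule poly_bounded_E) blast
  show ?thesis
  proof (rule poly_bounded_I)
    fix h x assume h: "0 < h" "h \<le> 1" "X h x"
    have "norm (F h x * G h x) \<le> (K / h ^ N) * (L / h ^ M)"
      unfolding norm_mult using K L h by (intro mult_mono) auto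
    then show "norm (F h x * G h x) \<le> (K * L) / h ^ (N + M)" by (simp add: power_add)
  qed
qed

lemma poly_bounded_power: "poly_bounded X F \<Longrightarrow> poly_bounded X (\<lambda>h x. F h x ^ n)"
  by (induction n) (auto intro: poly_bounded_const poly_bounded_mult)

lemma poly_bounded_sum: "(\<And>i. i \<in> I \<Longrightarrow> poly_bounded X (F i)) \<Longrightarrow> poly_bounded X (\<lambda>h x. \<Sum>i\<in>I. F i h x)"
  by (induction I rule: infinite_finite_induct) (auto intro: poly_bounded_const poly_bounded_add)

lemma poly_bounded_prod: "(\<And>i. i \<in> I \<Longrightarrow> poly_bounded X (F i)) \<Longrightarrow> poly_bounded X (\<lambda>h x. \<Prod>i\<in>I. F i h x)"
  by (induction I rule: infinite_finite_induct) (auto intro: poly_bounded_const poly_bounded_mult)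

lemma exp_small_0: "exp_small X (\<lambda>h x. 0)"
  by (rule exp_small_I[where c = 1 and K = 0]) auto

lemma exp_small_add:
  assumes "exp_small X F" "exp_small X G"
  shows "exp_small X (\<lambda>h x. F h x + G h x)"
proof -
  obtain K c where K: "K \<ge> 0" "c > 0" "\<And>h x. 0 < h \<Longrightarrow> h \<le> 1 \<Longrightarrow> X h x \<Longrightarrow> norm (F h x) \<le> K * exp (- c / h)"
    using assms(1) by (rule exp_small_E) blast
  obtain L d where L: "L \<ge> 0" "d > 0" "\<And>h x. 0 < h \<Longrightarrow> h \<le> 1 \<Longrightarrow> X h x \<Longrightarrow> norm (G h x) \<le> L * exp (- d / h)"
    using assms(2) by (rule exp_small_E) blast
  show ?thesis
  proof (rule exp_small_I[where c = "min c d" and K = "K + L"])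
    show "min c d > 0" using K L by simp
    fix h x assume h: "0 < h" "h \<le> 1" "X h x"
    have "norm (F h x + G h x) \<le> K * exp (- c / h) + L * exp (- d / h)"
      using K(3)[OF h] L(3)[OF h] norm_triangle_ineq[of "F h x" "G h x"] by linarith
    also have "\<dots> \<le> K * exp (- (min c d) / h) + L * exp (- (min c d) / h)"
    proof -
      have "- c / h \<le> - (min c d) / h" "- d / h \<le> - (min c d) / h"
        using h by (intro divide_right_mono; simp)+
      then show ?thesis using K L by (intro add_mono mult_left_mono) auto
    qed
    finally show "norm (F h x + G h x) \<le> (K + L) * exp (- (min c d) / h)" by (simp add: distrib_right)
  qed
qed

lemma exp_small_minus: "exp_small X F \<Longrightarrow> exp_small X (\<lambda>h x. - F h x)"
  by (rule exp_small_mono) auto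

lemma exp_small_diff: "exp_small X F \<Longrightarrow> exp_small X G \<Longrightarrow> exp_small X (\<lambda>h x. F h x - G h x)"
  using exp_small_add[of X F "\<lambda>h x. - G h x"] exp_small_minus[of X G] by simp

lemma exp_small_sum: "(\<And>i. i \<in> I \<Longrightarrow> exp_small X (F i)) \<Longrightarrow> exp_small X (\<lambda>h x. \<Sum>i\<in>I. F i h x)"
  by (induction I rule: infinite_finite_induct) (auto intro: exp_small_0 exp_small_add)

lemma exp_small_imp_poly_bounded: "exp_small X F \<Longrightarrow> poly_bounded X F"
proof -
  assume "exp_small X F"
  then obtain K c where K: "K \<ge> 0" "c > 0" "\<And>h x. 0 < h \<Longrightarrow> h \<le> 1 \<Longrightarrow> X h x \<Longrightarrow> norm (F h x) \<le> K * exp (- c / h)"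
    by (rule exp_small_E) blast
  show ?thesis
  proof (rule poly_bounded_I[where K = K and N = 0])
    fix h x assume h: "0 < h" "h \<le> 1" "X h x"
    have "K * exp (- c / h) \<le> K * 1" using K h by (intro mult_left_mono) auto
    with K(3)[OF h] show "norm (F h x) \<le> K / h ^ 0" by simp
  qed
qed

text \<open>Half of the exponent is spent on the power of 1 / h.\<close>

lemma exp_small_mult_poly_bounded:
  assumes "exp_small X F" "poly_bounded X G"
  shows "exp_small X (\<lambda>h x. F h x * G h x)"
proof -
  obtain K c where K: "K \<ge> 0" "c > 0" "\<And>h x. 0 < h \<Longrightarrow> h \<le> 1 \<Longrightarrow> X h x \<Longrightarrow> norm (F h x) \<le> K * exp (- c / h)"
    using assms(1) by (rule exp_small_E) blast
  obtain L N where L: "L \<ge> 0" "\<And>h x. 0 < h \<Longrightarrow> h \<le> 1 \<Longrightarrow> X h x \<Longrightarrow> norm (G h x) \<le> L / h ^ N"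
    using assms(2) by (rule poly_bounded_E) blast
  show ?thesis
  proof (rule exp_small_I[where c = "c / 2" and K = "K * L * (fact N * (2 / c) ^ N)"])
    show "c / 2 > 0" using K by simp
    fix h x assume h: "0 < h" "h \<le> 1" "X h x"
    have "(c / 2 / h) ^ N / fact N \<le> exp (c / 2 / h)" using K h by (intro power_fact_le_exp) auto
    then have "1 / h ^ N \<le> fact N * (2 / c) ^ N * exp (c / 2 / h)"
      using K h by (simp add: power_divide power_mult_distrib field_simps)
    then have *: "exp (- c / h) * (1 / h ^ N) \<le> exp (- c / h) * (fact N * (2 / c) ^ N * exp (c / 2 / h))"
      by (intro mult_left_mono) auto
    have e: "exp (- c / h) * exp (c / 2 / h) = exp (- (c / 2) / h)"
      by (subst exp_add[symmetric]) (simp add: add_divide_distrib[symmetric])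
    have "norm (F h x * G h x) \<le> (K * exp (- c / h)) * (L / h ^ N)"
      unfolding norm_mult using K L h by (intro mult_mono) auto
    also have "\<dots> = K * L * (exp (- c / h) * (1 / h ^ N))" by simp
    also have "\<dots> \<le> K * L * (exp (- c / h) * (fact N * (2 / c) ^ N * exp (c / 2 / h)))"
      by (rule mult_left_mono[OF *]) (use K L in simp)
    also have "\<dots> = K * L * (fact N * (2 / c) ^ N) * (exp (- c / h) * exp (c / 2 / h))" by (simp only: mult_ac)
    finally show "norm (F h x * G h x) \<le> K * L * (fact N * (2 / c) ^ N) * exp (- (c / 2) / h)"
      unfolding e .
  qed
qed

lemma poly_bounded_mult_exp_small: "poly_bounded X F \<Longrightarrow> exp_small X G \<Longrightarrow> exp_small X (\<lambda>h x. F h x * G h x)"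
  using exp_small_mult_poly_bounded[of X G F] by (simp add: mult.commute)

lemma exp_small_exp: "c > 0 \<Longrightarrow> exp_small X (\<lambda>h x. of_real (exp (- c / h)))"
  by (rule exp_small_I[where K = 1]) auto

lemma poly_bounded_cong_diff: "exp_small X (\<lambda>h x. F h x - G h x) \<Longrightarrow> poly_bounded X G \<Longrightarrow> poly_bounded X F"
  using poly_bounded_add[OF exp_small_imp_poly_bounded, of X "\<lambda>h x. F h x - G h x" G] by simp

text \<open>Telescoping: the factors are exchanged one at a time, the others staying polynomially
  bounded.\<close>

lemma exp_small_prod_diff:
  assumes "\<And>i. i \<in> I \<Longrightarrow> exp_small X (\<lambda>h x. F i h x - G i h x)" "\<And>i. i \<in> I \<Longrightarrow> poly_bounded X (G i)"
  shows "exp_small X (\<lambda>h x. (\<Prod>i\<in>I. F i h x) - (\<Prod>i\<in>I. G i h x))"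
  using assms
proof (induction I rule: infinite_finite_induct)
  case (insert i I)
  have "exp_small X (\<lambda>h x. (F i h x - G i h x) * (\<Prod>j\<in>I. F j h x) + G i h x * ((\<Prod>j\<in>I. F j h x) - (\<Prod>j\<in>I. G j h x)))"
    using insert by (intro exp_small_add exp_small_mult_poly_bounded poly_bounded_mult_exp_small poly_bounded_prod) (auto intro: poly_bounded_cong_diff)
  then show ?case using insert.hyps by (simp add: algebra_simps)
qed (auto intro: exp_small_0)

section \<open>The polynomial main terms of the sums and the size of the error\<close>

definition mainpoly :: "nat \<Rightarrow> real poly" where
  "mainpoly m = (\<Sum>j\<le>Suc m. monom (fact m * zfrak (int (Suc m) - int j) / fact j) j)"

abbreviation cpoly :: "real poly \<Rightarrow> complex poly" where
  "cpoly q \<equiv> map_poly of_real q"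

text \<open>Beyond the degree m + 1 the formula persists because zfrak vanishes at negative
  integers.\<close>

lemma coeff_mainpoly: "coeff (mainpoly m) j = fact m * zfrak (int (Suc m) - int j) / fact j"
  by (cases "j \<le> Suc m") (auto simp: mainpoly_def coeff_sum zfrak_neg)

lemma degree_mainpoly: "degree (mainpoly m) \<le> Suc m"
  by (intro degree_le allI impI) (simp add: coeff_mainpoly zfrak_neg)

lemma poly_cpoly_mainpoly:
  assumes h: "h > 0"
  shows "poly (cpoly (mainpoly m)) y / of_real h ^ Suc m =
    fact m * (\<Sum>i=0..Suc m. (y / of_real h) ^ i / fact i * of_real (zfrak (int (Suc m - i)) / h ^ (Suc m - i)))"
proof -
  have c: "cpoly (mainpoly m) = (\<Sum>j\<le>Suc m. monom (of_real (fact m * zfrak (int (Suc m) - int j) / fact j)) j)"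
    by (rule poly_eqI) (auto simp: coeff_map_poly coeff_sum mainpoly_def intro!: sum.cong)
  have "poly (cpoly (mainpoly m)) y / of_real h ^ Suc m =
     (\<Sum>j\<le>Suc m. of_real (fact m * zfrak (int (Suc m) - int j) / fact j) * y ^ j / of_real h ^ Suc m)"
    unfolding c poly_sum poly_monom by (simp only: sum_divide_distrib)
  also have "\<dots> = (\<Sum>j\<le>Suc m. fact m * ((y / of_real h) ^ j / fact j * of_real (zfrak (int (Suc m - j)) / h ^ (Suc m - j))))"
  proof (intro sum.cong refl)
    fix j assume j: "j \<in> {..Suc m}"
    have i: "int (Suc m - j) = int (Suc m) - int j" using j by (auto simp: of_nat_diff)
    have e: "(of_real h :: complex) ^ Suc m = of_real h ^ j * of_real h ^ (Suc m - j)"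
      using j by (subst power_add[symmetric]) (auto simp del: power_Suc)
    show "of_real (fact m * zfrak (int (Suc m) - int j) / fact j) * y ^ j / of_real h ^ Suc m =
       fact m * ((y / of_real h) ^ j / fact j * of_real (zfrak (int (Suc m - j)) / h ^ (Suc m - j)))"
      unfolding i e by (simp add: power_divide mult_ac)
  qed
  finally show ?thesis by (simp only: sum_distrib_left atLeast0AtMost)
qed

lemma poly_bounded_Ghat: "poly_bounded (\<lambda>h y. \<bar>Im y\<bar> \<le> 2 \<and> \<bar>Re y\<bar> \<le> h) (\<lambda>h y. Ghat n h y)"
proof -
  let ?X = "\<lambda>h y. \<bar>Im y\<bar> \<le> 2 \<and> \<bar>Re y\<bar> \<le> (h::real)"
  have pi: "2 \<le> 2 * pi / 3" using pi_gt3 by simp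
  have A: "poly_bounded ?X (\<lambda>h y. fps_nth (Ahat h y) k)" for k
  proof (cases k)
    case 0
    then show ?thesis by (simp add: Ahat_nth poly_bounded_const)
  next
    case (Suc m)
    obtain K where K: "\<And>h y. 0 < h \<Longrightarrow> h \<le> 1 \<Longrightarrow> \<bar>Im y\<bar> \<le> 2 * pi / 3 \<Longrightarrow> \<bar>Re y\<bar> \<le> h \<Longrightarrow> norm (fsum h m y) \<le> K / h ^ (m + 2)"
      by (rule fsum_bound[of m]) blast
    have "poly_bounded ?X (\<lambda>h y. fsum h m y)" by (rule poly_bounded_I, rule K) (use pi in auto)
    from poly_bounded_mult[OF this poly_bounded_const[of ?X "1 / fact m"]] show ?thesis by (simp add: Suc Ahat_nth)
  qed
  have Y: "poly_bounded ?X (\<lambda>h y. - y / of_real h)"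
  proof (rule poly_bounded_I[where K = 3 and N = 1])
    fix h :: real and y :: complex assume h: "0 < h" "h \<le> 1" "?X h y"
    have "norm y \<le> \<bar>Re y\<bar> + \<bar>Im y\<bar>" by (rule cmod_le)
    also have "\<dots> \<le> 3" using h by simp
    finally show "norm (- y / of_real h) \<le> 3 / h ^ 1" using h by (simp add: norm_divide divide_right_mono)
  qed
  have "poly_bounded ?X (\<lambda>h y. \<Sum>i=0..n. (- y / of_real h) ^ i * (1 / fact i) * fps_nth (Ahat h y) (n - i))"
    by (intro poly_bounded_sum poly_bounded_mult poly_bounded_power Y poly_bounded_const A)
  then show ?thesis by (simp add: Ghat_sum)
qed

text \<open>The Fourier bound is applied with lines at height 2 while |Im y| stays within 3/2: the
  gap 1/2 makes r at most exp(- pi / h), which absorbs the polynomial bound on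
  \<open>Ghat\<close>.\<close>

lemma exp_small_Ghat: "exp_small (\<lambda>h y. \<bar>Im y\<bar> \<le> 3 / 2 \<and> \<bar>Re y\<bar> \<le> h / 2) (\<lambda>h y. Ghat n h y - of_real (zfrak (int n) / h ^ n))"
proof -
  let ?Y = "\<lambda>h y. \<bar>Im y\<bar> \<le> 3 / 2 \<and> \<bar>Re y\<bar> \<le> (h::real) / 2"
  obtain K N where K: "K \<ge> 0" "\<And>h y. 0 < h \<Longrightarrow> h \<le> 1 \<Longrightarrow> \<bar>Im y\<bar> \<le> 2 \<and> \<bar>Re y\<bar> \<le> h \<Longrightarrow> norm (Ghat n h y) \<le> K / h ^ N"
    using poly_bounded_Ghat[of n] by (rule poly_bounded_E) blast
  have "exp_small ?Y (\<lambda>h y. of_real (8 * K) * (1 / of_real h) ^ N * of_real (exp (- 1 / h)))"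
    by (intro poly_bounded_mult_exp_small poly_bounded_mult poly_bounded_const poly_bounded_power poly_bounded_inverse exp_small_exp) simp
  then show ?thesis
  proof (rule exp_small_mono, intro conjI)
    fix h y assume h: "0 < h" "h \<le> 1" and y: "?Y h y"
    show "\<bar>Im y\<bar> \<le> 3 / 2" "\<bar>Re y\<bar> \<le> h / 2" using y by auto
    have pi: "2 < 2 * pi / 3" using pi_gt3 by simp
    define M where "M = K / h ^ N"
    define r where "r = exp (- 2 * pi * (2 - \<bar>Im y\<bar>) / h)"
    obtain k where k: "((\<lambda>x. Ghat n h (of_real x)) has_integral (of_real h * k)) {- h / 2..h / 2}"
      "\<And>y a M r. \<bar>Im y\<bar> < a \<Longrightarrow> a < 2 * pi / 3 \<Longrightarrow> \<bar>Re y\<bar> \<le> h / 2 \<Longrightarrow>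
         (\<And>z. \<bar>Im z\<bar> \<le> a \<Longrightarrow> \<bar>Re z\<bar> \<le> h \<Longrightarrow> norm (Ghat n h z) \<le> M) \<Longrightarrow>
         r = exp (- 2 * pi * (a - \<bar>Im y\<bar>) / h) \<Longrightarrow> norm (Ghat n h y - k) \<le> 4 * M * (r / (1 - r))"
    proof (rule periodic_strip[OF h(1) _ holomorphic_Ghat[OF h(1)]])
      show "0 < 2 * pi / 3" by simp
      show "Ghat n h (z + of_real h) = Ghat n h z" if "\<bar>Im z\<bar> < 2 * pi / 3" for z
        using that by (intro Ghat_periodic h) auto
      fix k
      assume 1: "((\<lambda>x. Ghat n h (of_real x)) has_integral (of_real h * k)) {- h / 2..h / 2}"
        and 2: "\<And>y a M r. \<bar>Im y\<bar> < a \<Longrightarrow> a < 2 * pi / 3 \<Longrightarrow> \<bar>Re y\<bar> \<le> h / 2 \<Longrightarrow>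
         (\<And>z. \<bar>Im z\<bar> \<le> a \<Longrightarrow> \<bar>Re z\<bar> \<le> h \<Longrightarrow> norm (Ghat n h z) \<le> M) \<Longrightarrow>
         r = exp (- 2 * pi * (a - \<bar>Im y\<bar>) / h) \<Longrightarrow> norm (Ghat n h y - k) \<le> 4 * M * (r / (1 - r))"
      show thesis by (rule that[OF 1 2])
    qed
    have "of_real h * k = of_real (h * (zfrak (int n) / h ^ n))"
      using has_integral_unique[OF k(1) Ghat_integral[OF h(1)]] .
    then have kz: "k = of_real (zfrak (int n) / h ^ n)" using h by (simp add: field_simps)
    have b: "norm (Ghat n h y - k) \<le> 4 * M * (r / (1 - r))"
      by (rule k(2)[OF _ pi _ _ r_def]) (use y h K(2)[of h] in \<open>auto simp: M_def\<close>)
    have M0: "M \<ge> 0" using K h by (simp add: M_def)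
    have "1 \<le> pi * 1" using pi_gt3 by simp
    also have "\<dots> \<le> 2 * pi * (2 - \<bar>Im y\<bar>)" using y mult_left_mono[of "1" "2 * (2 - \<bar>Im y\<bar>)" pi] by simp
    finally have "- 2 * pi * (2 - \<bar>Im y\<bar>) / h \<le> - 1 / h" using h by (intro divide_right_mono) auto
    then have r1: "r \<le> exp (- 1 / h)" by (simp add: r_def)
    have "exp (- 1 / h) \<le> exp (- 1 :: real)" using h by (simp add: field_simps)
    also have "exp (- 1 :: real) \<le> 1 / 2" using exp_ge_add_one_self[of "1::real"] by (simp add: exp_minus field_simps)
    finally have r2: "r \<le> 1 / 2" using r1 by simp
    have r0: "r > 0" by (simp add: r_def)
    have "r / (1 - r) \<le> r / (1 / 2)" using r0 r2 by (intro divide_left_mono) auto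
    also have "\<dots> \<le> 2 * exp (- 1 / h)" using r1 by simp
    finally have "4 * M * (r / (1 - r)) \<le> 4 * M * (2 * exp (- 1 / h))"
      using M0 by (intro mult_left_mono) auto
    also have "\<dots> = norm (of_real (8 * K) * (1 / of_real h) ^ N * of_real (exp (- 1 / h)) :: complex)"
      using K h by (simp add: M_def norm_mult norm_power norm_divide power_divide)
    finally show "norm (Ghat n h y - of_real (zfrak (int n) / h ^ n)) \<le> norm (of_real (8 * K) * (1 / of_real h) ^ N * of_real (exp (- 1 / h)) :: complex)"
      using b unfolding kz by linarith
  qed
qed

lemma fsum_exp_small:
  "exp_small (\<lambda>h y. \<bar>Im y\<bar> \<le> 3 / 2 \<and> \<bar>Re y\<bar> \<le> h / 2) (\<lambda>h y. fsum h m y - poly (cpoly (mainpoly m)) y / of_real h ^ Suc m)"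
proof -
  let ?Y = "\<lambda>h y. \<bar>Im y\<bar> \<le> 3 / 2 \<and> \<bar>Re y\<bar> \<le> (h::real) / 2"
  let ?g = "\<lambda>i h. of_real (zfrak (int (Suc m - i)) / h ^ (Suc m - i)) :: complex"
  have Y: "poly_bounded ?Y (\<lambda>h y. y / of_real h)"
  proof (rule poly_bounded_I[where K = 3 and N = 1])
    fix h :: real and y :: complex assume h: "0 < h" "h \<le> 1" "?Y h y"
    have "norm y \<le> \<bar>Re y\<bar> + \<bar>Im y\<bar>" by (rule cmod_le)
    also have "\<dots> \<le> 3" using h by simp
    finally show "norm (y / of_real h) \<le> 3 / h ^ 1" using h by (simp add: norm_divide divide_right_mono)
  qed
  have "exp_small ?Y (\<lambda>h y. fact m * (\<Sum>i=0..Suc m. ((y / of_real h) ^ i * (1 / fact i)) * (Ghat (Suc m - i) h y - ?g i h)))"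
    by (intro poly_bounded_mult_exp_small exp_small_sum poly_bounded_mult poly_bounded_power Y poly_bounded_const exp_small_Ghat)
  then show ?thesis
  proof (rule exp_small_mono)
    fix h :: real and y assume h: "0 < h" "h \<le> 1" "?Y h y"
    have "fsum h m y - poly (cpoly (mainpoly m)) y / of_real h ^ Suc m =
       fact m * (\<Sum>i=0..Suc m. ((y / of_real h) ^ i * (1 / fact i)) * (Ghat (Suc m - i) h y - ?g i h))"
      unfolding poly_cpoly_mainpoly[OF h(1)] fsum_Ghat
      by (simp only: right_diff_distrib sum_subtractf times_divide_eq_right mult_1_right)
    then show "?Y h y \<and> norm (fsum h m y - poly (cpoly (mainpoly m)) y / of_real h ^ Suc m) \<le>
       norm (fact m * (\<Sum>i=0..Suc m. ((y / of_real h) ^ i * (1 / fact i)) * (Ghat (Suc m - i) h y - ?g i h)))"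
      using h(3) by simp
  qed
qed

lemma pderiv_cpoly: "pderiv (cpoly q) = cpoly (pderiv q)"
  by (rule poly_eqI) (simp add: coeff_pderiv coeff_map_poly)

lemma higher_deriv_cpoly: "(deriv ^^ r) (\<lambda>y. poly (cpoly q) y / c) = (\<lambda>y. poly (cpoly ((pderiv ^^ r) q)) y / c)"
proof (induction r)
  case (Suc r)
  have "deriv (\<lambda>y. poly (cpoly q) y / c) = (\<lambda>y. poly (cpoly (pderiv q)) y / c)" for q
    by (intro ext DERIV_imp_deriv) (auto intro!: DERIV_cdivide poly_DERIV simp flip: pderiv_cpoly)
  then show ?case by (simp add: Suc)
qed simp

text \<open>Cauchy's estimate on discs of radius h / 2 costs one power of h per derivative. As h is
  at most 1, such a disc around \<i> \<theta> stays in the region where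
  \<open>fsum_exp_small\<close> holds.\<close>

lemma fsum_deriv_exp_small:
  "exp_small (\<lambda>h \<theta>. \<bar>\<theta>\<bar> \<le> 1) (\<lambda>h \<theta>. (deriv ^^ r) (fsum h m) (\<i> * of_real \<theta>)
     - poly (cpoly ((pderiv ^^ r) (mainpoly m))) (\<i> * of_real \<theta>) / of_real h ^ Suc m)"
proof -
  obtain K c where K: "K \<ge> 0" "c > 0" "\<And>h y. 0 < h \<Longrightarrow> h \<le> 1 \<Longrightarrow> \<bar>Im y\<bar> \<le> 3 / 2 \<and> \<bar>Re y\<bar> \<le> h / 2 \<Longrightarrow>
      norm (fsum h m y - poly (cpoly (mainpoly m)) y / of_real h ^ Suc m) \<le> K * exp (- c / h)"
    using fsum_exp_small[of m] by (rule exp_small_E) blast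
  let ?X = "\<lambda>(h::real) \<theta>. \<bar>\<theta>::real\<bar> \<le> 1"
  have "exp_small ?X (\<lambda>h \<theta>. of_real (fact r * K * 2 ^ r) * (1 / of_real h) ^ r * of_real (exp (- c / h)))"
    by (intro poly_bounded_mult_exp_small poly_bounded_mult poly_bounded_const poly_bounded_power poly_bounded_inverse exp_small_exp K)
  then show ?thesis
  proof (rule exp_small_mono, intro conjI)
    fix h \<theta> :: real assume h: "0 < h" "h \<le> 1" and t: "\<bar>\<theta>\<bar> \<le> 1"
    show "\<bar>\<theta>\<bar> \<le> 1" by fact
    let ?S = "{y. \<bar>Im y\<bar> < 2 * pi / 3}"
    let ?p = "\<lambda>y. poly (cpoly (mainpoly m)) y / of_real h ^ Suc m"
    have opS: "open ?S" by (intro open_Collect_less continuous_intros)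
    have hf: "fsum h m holomorphic_on ?S"
      by (rule holomorphic_on_subset[OF fsum_analytic(1)[OF h(1)]]) (auto simp: fdom_def)
    have hp: "?p holomorphic_on ?S" by (intro holomorphic_intros) (use h in auto)
    have z: "\<i> * of_real \<theta> \<in> ?S" using t pi_gt3 by simp
    have cb: "\<bar>Im y\<bar> \<le> 3 / 2 \<and> \<bar>Re y\<bar> \<le> h / 2" if "norm (\<i> * of_real \<theta> - y) \<le> h / 2" for y
    proof -
      have "\<bar>Re (\<i> * of_real \<theta> - y)\<bar> \<le> h / 2" "\<bar>Im (\<i> * of_real \<theta> - y)\<bar> \<le> h / 2"
        using that abs_Re_le_cmod abs_Im_le_cmod order_trans by blast+
      then have "\<bar>Re y\<bar> \<le> h / 2" "\<bar>\<theta> - Im y\<bar> \<le> h / 2" by simp_all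
      then show ?thesis using t h by (intro conjI; linarith)
    qed
    have sub: "cball (\<i> * of_real \<theta>) (h / 2) \<subseteq> ?S"
    proof
      fix y assume "y \<in> cball (\<i> * of_real \<theta>) (h / 2)"
      then have "\<bar>Im y\<bar> \<le> 3 / 2" using cb by (simp add: dist_norm)
      then show "y \<in> ?S" using pi_gt3 by simp
    qed
    have hd: "(\<lambda>y. fsum h m y - ?p y) holomorphic_on ?S" by (intro holomorphic_on_diff hf hp)
    have "norm ((deriv ^^ r) (\<lambda>y. fsum h m y - ?p y) (\<i> * of_real \<theta>)) \<le> fact r * (K * exp (- c / h)) / (h / 2) ^ r"
    proof (rule Cauchy_inequality)
      show "(\<lambda>y. fsum h m y - ?p y) holomorphic_on ball (\<i> * of_real \<theta>) (h / 2)"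
        using sub ball_subset_cball by (intro holomorphic_on_subset[OF hd]) blast
      show "continuous_on (cball (\<i> * of_real \<theta>) (h / 2)) (\<lambda>y. fsum h m y - ?p y)"
        by (rule holomorphic_on_imp_continuous_on[OF holomorphic_on_subset[OF hd sub]])
      show "norm (fsum h m y - ?p y) \<le> K * exp (- c / h)" if "norm (\<i> * of_real \<theta> - y) = h / 2" for y
        using cb[of y] that by (intro K h) auto
    qed (use h in simp)
    also have "(deriv ^^ r) (\<lambda>y. fsum h m y - ?p y) (\<i> * of_real \<theta>) = (deriv ^^ r) (fsum h m) (\<i> * of_real \<theta>) - (deriv ^^ r) ?p (\<i> * of_real \<theta>)"
      by (rule higher_deriv_diff[OF hf hp opS z])
    also have "fact r * (K * exp (- c / h)) / (h / 2) ^ r = norm (of_real (fact r * K * 2 ^ r) * (1 / of_real h) ^ r * of_real (exp (- c / h)) :: complex)"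
      using K h by (simp add: norm_mult norm_power norm_divide power_divide)
    finally show "norm ((deriv ^^ r) (fsum h m) (\<i> * of_real \<theta>) - poly (cpoly ((pderiv ^^ r) (mainpoly m))) (\<i> * of_real \<theta>) / of_real h ^ Suc m)
       \<le> norm (of_real (fact r * K * 2 ^ r) * (1 / of_real h) ^ r * of_real (exp (- c / h)) :: complex)"
      by (simp only: higher_deriv_cpoly)
  qed
qed

section \<open>Partial sums and their derivatives on the whole imaginary axis\<close>

definition gpart :: "real \<Rightarrow> nat \<Rightarrow> nat \<Rightarrow> complex \<Rightarrow> complex" where
  "gpart h m N y = of_real (pconst m) + (\<Sum>j<N. gterm h m j y)"

lemma holomorphic_gpart: "h > 0 \<Longrightarrow> gpart h m N holomorphic_on fdom h"
  unfolding gpart_def[abs_def] by (intro holomorphic_on_add holomorphic_on_const holomorphic_on_sum holomorphic_gterm)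

lemma imag_in_fdom: "h > 0 \<Longrightarrow> \<i> * of_real \<theta> \<in> fdom h"
  by (simp add: fdom_def)

lemma cball_imag_fdom: "h > 0 \<Longrightarrow> cball (\<i> * of_real \<theta>) (h / 4) \<subseteq> fdom h"
proof
  fix y assume h: "h > 0" and "y \<in> cball (\<i> * of_real \<theta>) (h / 4)"
  then have "\<bar>Re (\<i> * of_real \<theta> - y)\<bar> \<le> h / 4"
    using abs_Re_le_cmod[of "\<i> * of_real \<theta> - y"] by (simp add: dist_norm)
  then show "y \<in> fdom h" using h by (simp add: fdom_def)
qed

text \<open>All poles have |Re y| at least h / 2, so discs of radius h / 4 are safe for every real
  \<theta>, also for \<theta> near pi, where the wide strip ends.\<close>

lemma deriv_bound_imag:
  assumes h: "h > 0" and hol: "f holomorphic_on fdom h" and B: "\<And>y. \<bar>Re y\<bar> \<le> h / 4 \<Longrightarrow> norm (f y) \<le> B"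
  shows "norm ((deriv ^^ r) f (\<i> * of_real \<theta>)) \<le> fact r * B / (h / 4) ^ r"
proof (rule Cauchy_inequality)
  show "f holomorphic_on ball (\<i> * of_real \<theta>) (h / 4)"
    using cball_imag_fdom[OF h] ball_subset_cball by (intro holomorphic_on_subset[OF hol]) blast
  show "continuous_on (cball (\<i> * of_real \<theta>) (h / 4)) f"
    by (rule holomorphic_on_imp_continuous_on[OF holomorphic_on_subset[OF hol cball_imag_fdom[OF h]]])
  show "norm (f y) \<le> B" if "norm (\<i> * of_real \<theta> - y) = h / 4" for y
    using abs_Re_le_cmod[of "\<i> * of_real \<theta> - y"] that by (intro B) simp
qed (use h in simp)

lemma fsum_deriv_poly_bounded: "poly_bounded (\<lambda>h \<theta>. True) (\<lambda>h \<theta>. (deriv ^^ r) (fsum h m) (\<i> * of_real \<theta>))"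
proof -
  obtain K where K: "\<And>h y. 0 < h \<Longrightarrow> h \<le> 1 \<Longrightarrow> \<bar>Re y\<bar> \<le> h / 4 \<Longrightarrow> norm (fsum h m y) \<le> K / h ^ (m + 2)"
    by (rule fsum_bound[of m]) blast
  show ?thesis
  proof (rule poly_bounded_I[where K = "fact r * K * 4 ^ r" and N = "m + 2 + r"])
    fix h \<theta> :: real assume h: "0 < h" "h \<le> 1"
    have "norm ((deriv ^^ r) (fsum h m) (\<i> * of_real \<theta>)) \<le> fact r * (K / h ^ (m + 2)) / (h / 4) ^ r"
      by (rule deriv_bound_imag[OF h(1) fsum_analytic(1)[OF h(1)] K[OF h]])
    also have "\<dots> = fact r * K * 4 ^ r / h ^ (m + 2 + r)"
      by (simp add: power_divide power_add)
    finally show "norm ((deriv ^^ r) (fsum h m) (\<i> * of_real \<theta>)) \<le> fact r * K * 4 ^ r / h ^ (m + 2 + r)" .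
  qed
qed

lemma gpart_deriv_bounded:
  assumes h: "0 < h" "h \<le> 1"
  obtains K where "\<And>N \<theta>. norm ((deriv ^^ r) (gpart h m N) (\<i> * of_real \<theta>)) \<le> K"
proof -
  define B where "B = \<bar>pconst m\<bar> + (\<Sum>j. 32 / h * (half_odd j ^ m * exp (- h * half_odd j)))"
  have s: "summable (\<lambda>j. 32 / h * (half_odd j ^ m * exp (- h * half_odd j)))"
    using summable_power_exp_half_odd[of h 0 m] h by (intro summable_mult) auto
  have "norm (gpart h m N y) \<le> B" if y: "\<bar>Re y\<bar> \<le> h / 4" for N y
  proof -
    have "norm (gpart h m N y) \<le> \<bar>pconst m\<bar> + norm (\<Sum>j<N. gterm h m j y)"
      unfolding gpart_def by (rule order_trans[OF norm_triangle_ineq]) simp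
    also have "norm (\<Sum>j<N. gterm h m j y) \<le> (\<Sum>j<N. 32 / h * (half_odd j ^ m * exp (- h * half_odd j)))"
      by (intro sum_norm_le norm_gterm_re_le h y)
    also have "\<dots> \<le> (\<Sum>j. 32 / h * (half_odd j ^ m * exp (- h * half_odd j)))"
      using h half_odd_pos by (intro sum_le_suminf s) (auto intro!: mult_nonneg_nonneg less_imp_le)
    finally show ?thesis by (simp add: B_def)
  qed
  then have "norm ((deriv ^^ r) (gpart h m N) (\<i> * of_real \<theta>)) \<le> fact r * B / (h / 4) ^ r" for N \<theta>
    by (intro deriv_bound_imag h holomorphic_gpart)
  then show ?thesis by (rule that)
qed

lemma gpart_deriv_tendsto:
  "h > 0 \<Longrightarrow> (\<lambda>N. (deriv ^^ r) (gpart h m N) (\<i> * of_real \<theta>)) \<longlonglongrightarrow> (deriv ^^ r) (fsum h m) (\<i> * of_real \<theta>)"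
  using fsum_analytic(2)[OF _ imag_in_fdom] unfolding gpart_def[abs_def] by blast

section \<open>Finite systems of fermions\<close>

primrec bernoulli_cumulant :: "nat \<Rightarrow> complex poly" where
  "bernoulli_cumulant 0 = [:0, 1:]"
| "bernoulli_cumulant (Suc r) = [:0, 1, - 1:] * pderiv (bernoulli_cumulant r)"

text \<open>\<open>bernoulli_cumulant r\<close> is the cumulant of order \<open>Suc r\<close> of a Bernoulli variable, as a polynomial in its mean.\<close>

lemma pexp_bernoulli_cumulant: "finite B \<Longrightarrow> pexp (\<lambda>C. bernoulli_cumulant (card C - 1)) B = (if B = {} then 1 else [:0, 1:])"
proof (induction B rule: finite_induct)
  case (insert a B)
  let ?\<kappa> = "\<lambda>C. bernoulli_cumulant (card C - 1)"
  have "pexp ?\<kappa> (insert a B) = (\<Sum>A\<in>Pow B. bernoulli_cumulant (card A) * pexp ?\<kappa> (B - A))"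
    unfolding pexp_insert[OF insert.hyps] sconv_def
  proof (intro sum.cong refl)
    fix A assume "A \<in> Pow B"
    then have "finite A" "a \<notin> A" using insert.hyps finite_subset by auto
    then show "bernoulli_cumulant (card (insert a A) - 1) * pexp ?\<kappa> (B - A) = bernoulli_cumulant (card A) * pexp ?\<kappa> (B - A)" by simp
  qed
  also have "\<dots> = bernoulli_cumulant 0 * pexp ?\<kappa> B + (\<Sum>A\<in>Pow B - {{}}. bernoulli_cumulant (card A) * pexp ?\<kappa> (B - A))"
    using insert.hyps by (subst sum.remove[of _ "{}"]) auto
  also have "(\<Sum>A\<in>Pow B - {{}}. bernoulli_cumulant (card A) * pexp ?\<kappa> (B - A)) = [:0, 1, - 1:] * (\<Sum>A\<in>Pow B - {{}}. pderiv (?\<kappa> A) * pexp ?\<kappa> (B - A))"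
    unfolding sum_distrib_left
  proof (intro sum.cong refl)
    fix A assume A: "A \<in> Pow B - {{}}"
    then have "finite A" using insert.hyps finite_subset by auto
    then have "card A = Suc (card A - 1)" using A by (simp add: card_gt_0_iff)
    then have "bernoulli_cumulant (card A) = [:0, 1, - 1:] * pderiv (?\<kappa> A)" by (metis bernoulli_cumulant.simps(2))
    then show "bernoulli_cumulant (card A) * pexp ?\<kappa> (B - A) = [:0, 1, - 1:] * (pderiv (?\<kappa> A) * pexp ?\<kappa> (B - A))"
      by (simp only: mult.assoc)
  qed
  \<comment> \<open>The Leibniz rule collects the sum into the derivative of a moment, which is 1
    for nonempty B. The new moment is then p p + p (1 - p) = p: every moment of a Bernoulli variable
    equals its mean.\<close>
  also have "(\<Sum>A\<in>Pow B - {{}}. pderiv (?\<kappa> A) * pexp ?\<kappa> (B - A)) = pderiv (pexp ?\<kappa> B)"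
    by (rule pderiv_pexp[symmetric]) fact
  finally show ?case unfolding insert.IH by (cases "B = {}") (simp_all add: pderiv_pCons)
qed simp

lemma poly_pexp: "poly (pexp \<kappa> B) x = pexp (\<lambda>C. poly (\<kappa> C) x) B"
  by (simp add: pexp_def poly_sum poly_prod)

lemma prod_add_sconv:
  "finite B \<Longrightarrow> (\<Prod>i\<in>B. f i + g i :: 'a::comm_ring_1) = sconv (\<lambda>A. \<Prod>i\<in>A. f i) (\<lambda>A. \<Prod>i\<in>A. g i) B"
proof (induction B rule: finite_induct)
  case (insert a B)
  have fA: "finite A" "a \<notin> A" if "A \<subseteq> B" for A using that insert.hyps finite_subset by auto
  have "sconv (\<lambda>A. \<Prod>i\<in>insert a A. f i) (\<lambda>A. \<Prod>i\<in>A. g i) B = sconv (\<lambda>A. f a * (\<Prod>i\<in>A. f i)) (\<lambda>A. \<Prod>i\<in>A. g i) B"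
    by (intro sconv_cong refl) (simp add: fA)
  moreover have "sconv (\<lambda>A. \<Prod>i\<in>A. f i) (\<lambda>A. \<Prod>i\<in>insert a A. g i) B = sconv (\<lambda>A. \<Prod>i\<in>A. f i) (\<lambda>A. g a * (\<Prod>i\<in>A. g i)) B"
    by (intro sconv_cong refl) (simp add: fA)
  moreover have "sconv (\<lambda>A. f a * (\<Prod>i\<in>A. f i)) (\<lambda>A. \<Prod>i\<in>A. g i) B = f a * sconv (\<lambda>A. \<Prod>i\<in>A. f i) (\<lambda>A. \<Prod>i\<in>A. g i) B"
    by (simp add: sconv_def sum_distrib_left mult.assoc)
  moreover have "sconv (\<lambda>A. \<Prod>i\<in>A. f i) (\<lambda>A. g a * (\<Prod>i\<in>A. g i)) B = g a * sconv (\<lambda>A. \<Prod>i\<in>A. f i) (\<lambda>A. \<Prod>i\<in>A. g i) B"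
    by (simp add: sconv_def sum_distrib_left mult.left_commute)
  ultimately show ?case
    by (simp only: sconv_insert[OF insert.hyps] prod.insert[OF insert.hyps] insert.IH distrib_right)
qed (simp add: sconv_def)

text \<open>A constant has a cumulant of first order only.\<close>

lemma pexp_singletons: "finite B \<Longrightarrow> pexp (\<lambda>C. if card C = 1 then \<Prod>i\<in>C. f i else 0) B = (\<Prod>i\<in>B. f i :: 'a::comm_ring_1)"
proof (induction B rule: finite_induct)
  case (insert a B)
  let ?\<kappa> = "\<lambda>C. if card C = 1 then \<Prod>i\<in>C. f i else 0"
  have "pexp ?\<kappa> (insert a B) = (\<Sum>A\<in>Pow B. if A = {} then f a * pexp ?\<kappa> B else 0)"
    unfolding pexp_insert[OF insert.hyps] sconv_def
  proof (intro sum.cong refl)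
    fix A assume "A \<in> Pow B"
    then have A: "finite A" "a \<notin> A" using insert.hyps finite_subset by auto
    then show "(if card (insert a A) = 1 then \<Prod>i\<in>insert a A. f i else 0) * pexp ?\<kappa> (B - A) = (if A = {} then f a * pexp ?\<kappa> B else 0)"
      by (cases "A = {}") auto
  qed
  then show ?case using insert by simp
qed simp

text \<open>Under the weights w the sites are independent Bernoulli variables of mean w / (1 + w),
  so cumulants add up over sites: a new site contributes a factor 1 + w to the total weight and one
  summand to each cumulant. The identity is algebraic and allows complex weights.\<close>

lemma site_moments:
  fixes w :: "'s \<Rightarrow> complex" and a :: "'s \<Rightarrow> 'i \<Rightarrow> complex"
  assumes "finite K" "finite B" and nz: "\<And>s. s \<in> K \<Longrightarrow> 1 + w s \<noteq> 0"
  shows "(\<Sum>T\<in>Pow K. (\<Prod>s\<in>T. w s) * (\<Prod>i\<in>B. x0 i + (\<Sum>s\<in>T. a s i))) =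
    (\<Prod>s\<in>K. 1 + w s) * pexp (\<lambda>C. (if card C = 1 then \<Prod>i\<in>C. x0 i else 0) +
       (\<Sum>s\<in>K. (\<Prod>i\<in>C. a s i) * poly (bernoulli_cumulant (card C - 1)) (w s / (1 + w s)))) B"
  using assms(1,2) nz
proof (induction K arbitrary: B rule: finite_induct)
  case empty
  then show ?case using pexp_singletons[of B x0] by simp
next
  case (insert s K)
  define M where "M B = (\<Sum>T\<in>Pow K. (\<Prod>s\<in>T. w s) * (\<Prod>i\<in>B. x0 i + (\<Sum>s\<in>T. a s i)))" for B
  define \<kappa> where "\<kappa> C = (if card C = 1 then \<Prod>i\<in>C. x0 i else 0) +
       (\<Sum>s\<in>K. (\<Prod>i\<in>C. a s i) * poly (bernoulli_cumulant (card C - 1)) (w s / (1 + w s)))" for C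
  define \<kappa>s where "\<kappa>s C = (\<Prod>i\<in>C. a s i) * poly (bernoulli_cumulant (card C - 1)) (w s / (1 + w s))" for C
  have fB: "finite A" if "A \<subseteq> B" for A using insert.prems that finite_subset by blast
  have IH: "M A = (\<Prod>s\<in>K. 1 + w s) * pexp \<kappa> A" if "A \<subseteq> B" for A
    unfolding M_def \<kappa>_def[abs_def] using insert.IH[OF fB[OF that]] insert.prems by auto
  have nz: "1 + w s \<noteq> 0" using insert.prems by auto
  \<comment> \<open>The unnormalised moments of the new site alone: if empty it contributes only to
    the empty product, if occupied it contributes the product of its values.\<close>
  have one: "(1 + w s) * pexp \<kappa>s A = sone A + w s * (\<Prod>i\<in>A. a s i)" if "A \<subseteq> B" for A
  proof -
    have "pexp \<kappa>s A = (\<Prod>i\<in>A. a s i) * poly (pexp (\<lambda>C. bernoulli_cumulant (card C - 1)) A) (w s / (1 + w s))"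
      unfolding \<kappa>s_def[abs_def] pexp_scale[OF fB[OF that]] poly_pexp ..
    then show ?thesis using nz unfolding pexp_bernoulli_cumulant[OF fB[OF that]] by (auto simp: sone_def)
  qed
  have "(\<Sum>T\<in>Pow (insert s K). (\<Prod>s\<in>T. w s) * (\<Prod>i\<in>B. x0 i + (\<Sum>s\<in>T. a s i)))
     = M B + (\<Sum>T\<in>insert s ` Pow K. (\<Prod>s\<in>T. w s) * (\<Prod>i\<in>B. x0 i + (\<Sum>s\<in>T. a s i)))"
    unfolding Pow_insert M_def using insert.hyps by (intro sum.union_disjoint) auto
  also have "(\<Sum>T\<in>insert s ` Pow K. (\<Prod>s\<in>T. w s) * (\<Prod>i\<in>B. x0 i + (\<Sum>s\<in>T. a s i)))
     = (\<Sum>T\<in>Pow K. (\<Prod>s\<in>insert s T. w s) * (\<Prod>i\<in>B. x0 i + (\<Sum>s\<in>insert s T. a s i)))"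
    using insert.hyps by (subst sum.reindex) (auto simp: inj_on_def)
  also have "\<dots> = (\<Sum>T\<in>Pow K. w s * ((\<Prod>s\<in>T. w s) * sconv (\<lambda>A. \<Prod>i\<in>A. a s i) (\<lambda>A. \<Prod>i\<in>A. x0 i + (\<Sum>s\<in>T. a s i)) B))"
  proof (intro sum.cong refl)
    fix T assume "T \<in> Pow K"
    then have T: "finite T" "s \<notin> T" using insert.hyps finite_subset by auto
    have "(\<Prod>i\<in>B. x0 i + (\<Sum>s\<in>insert s T. a s i)) = (\<Prod>i\<in>B. a s i + (x0 i + (\<Sum>s\<in>T. a s i)))"
      using T by (simp add: algebra_simps)
    also have "\<dots> = sconv (\<lambda>A. \<Prod>i\<in>A. a s i) (\<lambda>A. \<Prod>i\<in>A. x0 i + (\<Sum>s\<in>T. a s i)) B"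
      by (rule prod_add_sconv) fact
    finally show "(\<Prod>s\<in>insert s T. w s) * (\<Prod>i\<in>B. x0 i + (\<Sum>s\<in>insert s T. a s i)) =
       w s * ((\<Prod>s\<in>T. w s) * sconv (\<lambda>A. \<Prod>i\<in>A. a s i) (\<lambda>A. \<Prod>i\<in>A. x0 i + (\<Sum>s\<in>T. a s i)) B)"
      using T by simp
  qed
  also have "\<dots> = sconv (\<lambda>A. w s * (\<Prod>i\<in>A. a s i)) M B"
    unfolding sconv_def M_def sum_distrib_left by (subst sum.swap) (simp only: mult_ac)
  also have "M B + \<dots> = sconv (\<lambda>A. sone A + w s * (\<Prod>i\<in>A. a s i)) M B"
    using sconv_sone_left[OF insert.prems(1), of M] by (simp add: sconv_def distrib_right sum.distrib)
  also have "\<dots> = sconv (\<lambda>A. (1 + w s) * pexp \<kappa>s A) (\<lambda>A. (\<Prod>s\<in>K. 1 + w s) * pexp \<kappa> A) B"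
    by (intro sconv_cong one[symmetric] IH)
  also have "\<dots> = ((1 + w s) * (\<Prod>s\<in>K. 1 + w s)) * sconv (pexp \<kappa>s) (pexp \<kappa>) B"
    by (simp add: sconv_def sum_distrib_left mult_ac)
  also have "sconv (pexp \<kappa>s) (pexp \<kappa>) B = pexp (\<lambda>C. \<kappa>s C + \<kappa> C) B"
    by (rule pexp_add[symmetric]) fact
  also have "(\<lambda>C. \<kappa>s C + \<kappa> C) = (\<lambda>C. (if card C = 1 then \<Prod>i\<in>C. x0 i else 0) +
       (\<Sum>s\<in>insert s K. (\<Prod>i\<in>C. a s i) * poly (bernoulli_cumulant (card C - 1)) (w s / (1 + w s))))"
    using insert.hyps by (intro ext) (simp add: \<kappa>_def \<kappa>s_def algebra_simps)
  finally show ?case using insert.hyps by simp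
qed

definition site_pos :: "int \<Rightarrow> real" where
  "site_pos s = of_int s + 1 / 2"

definition charge :: "int \<Rightarrow> real" where
  "charge s = (if s \<ge> 0 then 1 else - 1)"

text \<open>Charge times position is the distance from 0, so a particle or hole costs the energy h
  |\<open>site_pos s\<close>|, and y is conjugate to the charge.\<close>

definition site_weight :: "real \<Rightarrow> complex \<Rightarrow> int \<Rightarrow> complex" where
  "site_weight h y s = exp (of_real (charge s) * (y - of_real (h * site_pos s)))"

lemma fermi_deriv: "exp u + 1 \<noteq> 0 \<Longrightarrow> (fermi has_field_derivative - (fermi u * (1 - fermi u))) (at u)"
proof -
  assume u: "exp u + 1 \<noteq> 0"
  have "(fermi has_field_derivative - exp u / (exp u + 1)\<^sup>2) (at u)"
    unfolding fermi_def[abs_def] using u by (auto intro!: derivative_eq_intros simp: power2_eq_square)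
  moreover have "- exp u / (exp u + 1)\<^sup>2 = - (fermi u * (1 - fermi u))"
    using u by (simp add: fermi_def power2_eq_square field_simps)
  ultimately show ?thesis by simp
qed

text \<open>On a function of an occupation probability f a derivative in y acts as f (1 - f) d/df,
  up to the sign of the charge. This is the recursion of \<open>bernoulli_cumulant\<close>, so each
  derivative in y raises the order of the cumulant by one.\<close>

lemma higher_deriv_gpart:
  assumes h: "h > 0" and y: "y \<in> fdom h"
  shows "(deriv ^^ r) (gpart h m N) y = (if r = 0 then of_real (pconst m) else 0) +
    (\<Sum>j<N. of_real (half_odd j) ^ m * poly (bernoulli_cumulant r) (fermi (of_real (h * half_odd j) - y))
       + (- 1) ^ Suc r * (- of_real (half_odd j)) ^ m * poly (bernoulli_cumulant r) (fermi (of_real (h * half_odd j) + y)))"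
  using y
proof (induction r arbitrary: y)
  case 0
  then show ?case by (simp add: gpart_def gterm_def)
next
  case (Suc r)
  let ?G = "\<lambda>r y. \<Sum>j<N. of_real (half_odd j) ^ m * poly (bernoulli_cumulant r) (fermi (of_real (h * half_odd j) - y))
       + (- 1) ^ Suc r * (- of_real (half_odd j)) ^ m * poly (bernoulli_cumulant r) (fermi (of_real (h * half_odd j) + y))"
  have d1: "((\<lambda>y. poly (bernoulli_cumulant r) (fermi (of_real (h * half_odd j) - y))) has_field_derivative
      poly (bernoulli_cumulant (Suc r)) (fermi (of_real (h * half_odd j) - y))) (at y)" for j
  proof -
    let ?u = "of_real (h * half_odd j) - y"
    have "((\<lambda>y. of_real (h * half_odd j) - y) has_field_derivative - 1) (at y)"
      by (auto intro!: derivative_eq_intros)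
    from DERIV_chain2[where f = fermi and g = "\<lambda>y. of_real (h * half_odd j) - y", OF fermi_deriv[OF fdom_nz(1)[OF Suc.prems h]] this]
    have "((\<lambda>y. fermi (of_real (h * half_odd j) - y)) has_field_derivative fermi ?u * (1 - fermi ?u)) (at y)" by simp
    from DERIV_chain2[where f = "poly (bernoulli_cumulant r)" and g = "\<lambda>y. fermi (of_real (h * half_odd j) - y)", OF poly_DERIV this]
    show ?thesis by (simp add: algebra_simps)
  qed
  have d2: "((\<lambda>y. poly (bernoulli_cumulant r) (fermi (of_real (h * half_odd j) + y))) has_field_derivative
      - poly (bernoulli_cumulant (Suc r)) (fermi (of_real (h * half_odd j) + y))) (at y)" for j
  proof -
    let ?u = "of_real (h * half_odd j) + y"
    have "((\<lambda>y. of_real (h * half_odd j) + y) has_field_derivative 1) (at y)"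
      by (auto intro!: derivative_eq_intros)
    from DERIV_chain2[where f = fermi and g = "\<lambda>y. of_real (h * half_odd j) + y", OF fermi_deriv[OF fdom_nz(2)[OF Suc.prems h]] this]
    have "((\<lambda>y. fermi (of_real (h * half_odd j) + y)) has_field_derivative - (fermi ?u * (1 - fermi ?u))) (at y)" by simp
    from DERIV_chain2[where f = "poly (bernoulli_cumulant r)" and g = "\<lambda>y. fermi (of_real (h * half_odd j) + y)", OF poly_DERIV this]
    show ?thesis by (simp add: algebra_simps)
  qed
  have "((\<lambda>y. (if r = 0 then of_real (pconst m) else 0) + ?G r y) has_field_derivative
     0 + (\<Sum>j<N. of_real (half_odd j) ^ m * poly (bernoulli_cumulant (Suc r)) (fermi (of_real (h * half_odd j) - y))
       + (- 1) ^ Suc r * (- of_real (half_odd j)) ^ m * - poly (bernoulli_cumulant (Suc r)) (fermi (of_real (h * half_odd j) + y)))) (at y)"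
    by (intro DERIV_add DERIV_const DERIV_sum DERIV_cmult d1 d2)
  also have "0 + (\<Sum>j<N. of_real (half_odd j) ^ m * poly (bernoulli_cumulant (Suc r)) (fermi (of_real (h * half_odd j) - y))
       + (- 1) ^ Suc r * (- of_real (half_odd j)) ^ m * - poly (bernoulli_cumulant (Suc r)) (fermi (of_real (h * half_odd j) + y))) = ?G (Suc r) y"
    by simp
  finally have "((deriv ^^ r) (gpart h m N) has_field_derivative ?G (Suc r) y) (at y)"
    by (rule has_field_derivative_transform_within_open[OF _ open_fdom Suc.prems]) (simp only: Suc.IH)
  from DERIV_imp_deriv[OF this] show ?case by simp
qed

lemma sum_sites: "(\<Sum>s\<in>{- int N..<int N}. f s) = (\<Sum>j<N. f (int j) + f (- 1 - int j))"
proof (induction N)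
  case (Suc N)
  have "{- int (Suc N)..<int (Suc N)} = insert (int N) (insert (- 1 - int N) {- int N..<int N})" by auto
  then show ?case using Suc by (simp add: add_ac)
qed simp

lemma prod_sites: "(\<Prod>s\<in>{- int N..<int N}. f s :: 'a::comm_monoid_mult) = (\<Prod>j<N. f (int j) * f (- 1 - int j))"
proof (induction N)
  case (Suc N)
  have "{- int (Suc N)..<int (Suc N)} = insert (int N) (insert (- 1 - int N) {- int N..<int N})" by auto
  then show ?case using Suc by (simp add: mult_ac)
qed simp

lemma site_weight_particle: "site_weight h y (int j) = exp (- (of_real (h * half_odd j) - y))"
  by (simp add: site_weight_def charge_def site_pos_def half_odd_def algebra_simps)

lemma site_weight_hole: "site_weight h y (- 1 - int j) = exp (- (of_real (h * half_odd j) + y))"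
  by (simp add: site_weight_def charge_def site_pos_def half_odd_def algebra_simps)

lemma exp_minus_ratio:
  fixes u :: complex
  assumes "exp u + 1 \<noteq> 0"
  shows "1 + exp (- u) \<noteq> 0" "exp (- u) / (1 + exp (- u)) = fermi u"
proof -
  have e: "1 + exp (- u) = (exp u + 1) * exp (- u)" by (simp add: distrib_right exp_minus_inverse)
  then show "1 + exp (- u) \<noteq> 0" using assms by simp
  show "exp (- u) / (1 + exp (- u)) = fermi u" unfolding e fermi_def by simp
qed

text \<open>Since charges are 1 or - 1 and the observables are charge times a power of the position,
  a joint cumulant depends only on its order \<open>card C\<close> and on the sum of the exponents.
  It is therefore a derivative in y of a single sum.\<close>

lemma fermion_moments:
  fixes m :: "'i \<Rightarrow> nat"
  assumes h: "h > 0" and y: "y \<in> fdom h" and B: "finite B"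
  shows "(\<Sum>T\<in>Pow {- int N..<int N}. (\<Prod>s\<in>T. site_weight h y s) *
      (\<Prod>i\<in>B. of_real (pconst (m i)) + (\<Sum>s\<in>T. of_real (charge s * site_pos s ^ m i)))) =
    (\<Prod>s\<in>{- int N..<int N}. 1 + site_weight h y s) * pexp (\<lambda>C. (deriv ^^ (card C - 1)) (gpart h (\<Sum>i\<in>C. m i) N) y) B"
proof -
  have nz: "1 + site_weight h y s \<noteq> 0" for s
  proof (cases "s \<ge> 0")
    case True
    then have "s = int (nat s)" by simp
    then show ?thesis using exp_minus_ratio(1)[OF fdom_nz(1)[OF y h, of "nat s"]] site_weight_particle[of h y "nat s"] by metis
  next
    case False
    then have "s = - 1 - int (nat (- 1 - s))" by simp
    then show ?thesis using exp_minus_ratio(1)[OF fdom_nz(2)[OF y h, of "nat (- 1 - s)"]] site_weight_hole[of h y "nat (- 1 - s)"] by metis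
  qed
  let ?K = "{- int N..<int N}"
  have "(\<Sum>T\<in>Pow ?K. (\<Prod>s\<in>T. site_weight h y s) *
      (\<Prod>i\<in>B. of_real (pconst (m i)) + (\<Sum>s\<in>T. of_real (charge s * site_pos s ^ m i)))) =
    (\<Prod>s\<in>?K. 1 + site_weight h y s) * pexp (\<lambda>C. (if card C = 1 then \<Prod>i\<in>C. of_real (pconst (m i)) else 0) +
       (\<Sum>s\<in>?K. (\<Prod>i\<in>C. of_real (charge s * site_pos s ^ m i)) * poly (bernoulli_cumulant (card C - 1)) (site_weight h y s / (1 + site_weight h y s)))) B"
    by (rule site_moments) (use B nz in auto)
  also have "pexp (\<lambda>C. (if card C = 1 then \<Prod>i\<in>C. of_real (pconst (m i)) else 0) +
       (\<Sum>s\<in>?K. (\<Prod>i\<in>C. of_real (charge s * site_pos s ^ m i)) * poly (bernoulli_cumulant (card C - 1)) (site_weight h y s / (1 + site_weight h y s)))) B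
     = pexp (\<lambda>C. (deriv ^^ (card C - 1)) (gpart h (\<Sum>i\<in>C. m i) N) y) B"
  proof (rule pexp_cong)
    fix C assume C: "C \<subseteq> B" "C \<noteq> {}"
    have fC: "finite C" using C B finite_subset by blast
    have c1: "Suc (card C - 1) = card C" using fC C by (simp add: card_gt_0_iff)
    let ?M = "\<Sum>i\<in>C. m i" and ?b = "bernoulli_cumulant (card C - 1)"
    have a: "(if card C = 1 then \<Prod>i\<in>C. of_real (pconst (m i)) else 0) = (if card C - 1 = 0 then of_real (pconst ?M) else (0::complex))"
    proof (cases "card C = 1")
      case True
      then obtain i where "C = {i}" by (auto simp: card_1_singleton_iff)
      then show ?thesis by simp
    next
      case False
      then show ?thesis using c1 by auto
    qed
    have b: "(\<Sum>s\<in>?K. (\<Prod>i\<in>C. of_real (charge s * site_pos s ^ m i)) * poly ?b (site_weight h y s / (1 + site_weight h y s))) =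
      (\<Sum>j<N. of_real (half_odd j) ^ ?M * poly ?b (fermi (of_real (h * half_odd j) - y))
       + (- 1) ^ Suc (card C - 1) * (- of_real (half_odd j)) ^ ?M * poly ?b (fermi (of_real (h * half_odd j) + y)))"
      unfolding sum_sites
    proof (intro sum.cong refl arg_cong2[where f = "(+)"])
      fix j
      have "charge (int j) * site_pos (int j) ^ k = half_odd j ^ k" for k by (simp add: charge_def site_pos_def half_odd_def)
      then have "(\<Prod>i\<in>C. of_real (charge (int j) * site_pos (int j) ^ m i)) = (of_real (half_odd j) ^ ?M :: complex)"
        by (simp add: power_sum)
      then show "(\<Prod>i\<in>C. of_real (charge (int j) * site_pos (int j) ^ m i)) * poly ?b (site_weight h y (int j) / (1 + site_weight h y (int j))) =
        of_real (half_odd j) ^ ?M * poly ?b (fermi (of_real (h * half_odd j) - y))"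
        unfolding site_weight_particle exp_minus_ratio(2)[OF fdom_nz(1)[OF y h]] by simp
      have "site_pos (- 1 - int j) = - half_odd j" by (simp add: site_pos_def half_odd_def)
      then have "charge (- 1 - int j) * site_pos (- 1 - int j) ^ k = (- 1) * (- half_odd j) ^ k" for k by (simp add: charge_def)
      then have "(\<Prod>i\<in>C. of_real (charge (- 1 - int j) * site_pos (- 1 - int j) ^ m i)) = (\<Prod>i\<in>C. (- 1) * (- of_real (half_odd j)) ^ m i :: complex)"
        by simp
      also have "\<dots> = (- 1) ^ card C * (- of_real (half_odd j)) ^ ?M"
        by (simp only: prod.distrib prod_constant power_sum)
      finally show "(\<Prod>i\<in>C. of_real (charge (- 1 - int j) * site_pos (- 1 - int j) ^ m i)) * poly ?b (site_weight h y (- 1 - int j) / (1 + site_weight h y (- 1 - int j))) =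
        (- 1) ^ Suc (card C - 1) * (- of_real (half_odd j)) ^ ?M * poly ?b (fermi (of_real (h * half_odd j) + y))"
        unfolding site_weight_hole exp_minus_ratio(2)[OF fdom_nz(2)[OF y h]] c1 by (simp only:)
    qed
    show "(if card C = 1 then \<Prod>i\<in>C. of_real (pconst (m i)) else 0) +
       (\<Sum>s\<in>?K. (\<Prod>i\<in>C. of_real (charge s * site_pos s ^ m i)) * poly ?b (site_weight h y s / (1 + site_weight h y s)))
      = (deriv ^^ (card C - 1)) (gpart h ?M N) y"
      unfolding higher_deriv_gpart[OF h y] a b ..
  qed
  finally show ?thesis .
qed

section \<open>Partitions as neutral fermion configurations\<close>

text \<open>Half-integer sites are labelled by the integer below them. A partition becomes the set \<open>excitations lam\<close>
  of particles at sites \<open>\<ge> 0\<close> and holes at sites \<open>< 0\<close>.\<close>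

definition maya :: "(nat \<Rightarrow> nat) \<Rightarrow> int set" where
  "maya lam = range (\<lambda>i. int (lam i) - int i - 1)"

definition excitations :: "(nat \<Rightarrow> nat) \<Rightarrow> int set" where
  "excitations lam = {s. (s \<ge> 0) = (s \<in> maya lam)}"

definition neutral :: "int set set" where
  "neutral = {T. finite T \<and> (\<Sum>s\<in>T. charge s) = 0}"

definition energy :: "int set \<Rightarrow> real" where
  "energy T = (\<Sum>s\<in>T. \<bar>site_pos s\<bar>)"

lemma partitions_bound:
  assumes "lam \<in> partitions"
  obtains N where "\<And>i. i \<ge> N \<Longrightarrow> lam i = 0"
proof -
  have "finite {i. lam i \<noteq> 0}" using assms by (simp add: partitions_def)
  then obtain N where "\<forall>i\<in>{i. lam i \<noteq> 0}. i < N" using finite_nat_set_iff_bounded by blast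
  then show ?thesis by (intro that[of N]) (meson linorder_not_less mem_Collect_eq)
qed

context
  fixes lam :: "nat \<Rightarrow> nat" and s :: "nat \<Rightarrow> int"
  assumes lam: "lam \<in> partitions"
  defines "s \<equiv> \<lambda>i. int (lam i) - int i - 1"
begin

lemma maya_less: "i < j \<Longrightarrow> s j < s i"
proof -
  assume ij: "i < j"
  then have "lam j \<le> lam i" using lam by (auto simp: partitions_def antimono_def)
  then show ?thesis using ij by (simp add: s_def)
qed

lemma maya_inj: "inj s"
  by (metis injI linorder_neqE_nat maya_less order_less_irrefl)

lemma maya_above: "{x \<in> maya lam. x > s i} = s ` {..<i}"
proof -
  have "maya lam = range s" by (simp add: maya_def s_def)
  moreover have "s j > s i \<longleftrightarrow> j < i" for j
    by (metis linorder_neqE_nat maya_less order_less_asym order_less_irrefl)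
  ultimately show ?thesis by auto
qed

text \<open>An occupied site knows its index as the number of occupied sites above it, which makes
  the encoding injective.\<close>

lemma card_maya_above: "card {x \<in> maya lam. x > s i} = i"
  unfolding maya_above using maya_inj by (subst card_image) (auto intro: inj_on_subset)

lemma maya_split:
  assumes N: "\<And>i. i \<ge> N \<Longrightarrow> lam i = 0"
  shows "maya lam = s ` {..<N} \<union> {..<- int N}" "s ` {..<N} \<subseteq> {- int N..}"
proof -
  have "x \<in> range s" if "x < - int N" for x
  proof -
    have "nat (- x - 1) \<ge> N" using that by linarith
    then have "s (nat (- x - 1)) = x" using N that by (simp add: s_def)
    then show ?thesis by (metis rangeI)
  qed
  moreover have "s i < - int N" if "i \<ge> N" for i using N[OF that] that by (simp add: s_def)
  ultimately show "maya lam = s ` {..<N} \<union> {..<- int N}"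
    unfolding maya_def s_def[symmetric] by (auto simp: not_less image_iff) (metis lessThan_iff not_le)
  show "s ` {..<N} \<subseteq> {- int N..}" by (auto simp: s_def)
qed

lemma excitations_split:
  assumes N: "\<And>i. i \<ge> N \<Longrightarrow> lam i = 0"
  shows "excitations lam = (s ` {..<N} - {- int N..<0}) \<union> ({- int N..<0} - s ` {..<N})"
proof -
  have "maya lam = s ` {..<N} \<union> {..<- int N}" "s ` {..<N} \<subseteq> {- int N..}"
    by (rule maya_split, erule N)+
  then show ?thesis unfolding excitations_def by auto
qed

text \<open>The excitations are the symmetric difference of the occupied sites and the vacuum inside
  a finite window, signed by the charge, and common sites cancel. The choices 1, x and x^k for f
  give neutrality, the size and \<open>p k\<close>.\<close>

lemma excitations_sum:
  assumes N: "\<And>i. i \<ge> N \<Longrightarrow> lam i = 0"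
  shows "(\<Sum>x\<in>excitations lam. charge x * f (site_pos x)) = (\<Sum>i<N. f (real (lam i) - real i - 1 / 2) - f (- real i - 1 / 2))"
    and "finite (excitations lam)"
proof -
  let ?A = "s ` {..<N}" and ?B = "{- int N..<0}"
  have cs: "excitations lam = (?A - ?B) \<union> (?B - ?A)" by (rule excitations_split) (erule N)
  have ms: "?A \<subseteq> {- int N..}" by (rule maya_split) (erule N)
  show "finite (excitations lam)" unfolding cs by auto
  have e: "charge x = 1" if "x \<in> ?A - ?B" for x
    using that ms by (auto simp: charge_def)
  have "(\<Sum>x\<in>excitations lam. charge x * f (site_pos x)) = (\<Sum>x\<in>?A - ?B. charge x * f (site_pos x)) + (\<Sum>x\<in>?B - ?A. charge x * f (site_pos x))"
    unfolding cs by (intro sum.union_disjoint) auto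
  also have "(\<Sum>x\<in>?A - ?B. charge x * f (site_pos x)) = (\<Sum>x\<in>?A - ?B. f (site_pos x))"
    by (intro sum.cong refl) (simp add: e)
  also have "(\<Sum>x\<in>?B - ?A. charge x * f (site_pos x)) = - (\<Sum>x\<in>?B - ?A. f (site_pos x))"
    unfolding sum_negf[symmetric] by (intro sum.cong refl) (auto simp: charge_def)
  also have "(\<Sum>x\<in>?A - ?B. f (site_pos x)) + - (\<Sum>x\<in>?B - ?A. f (site_pos x)) = (\<Sum>x\<in>?A. f (site_pos x)) - (\<Sum>x\<in>?B. f (site_pos x))"
    using sum.Int_Diff[of ?A "\<lambda>x. f (site_pos x)" ?B] sum.Int_Diff[of ?B "\<lambda>x. f (site_pos x)" ?A] by (simp add: Int_commute)
  also have "(\<Sum>x\<in>?A. f (site_pos x)) = (\<Sum>i<N. f (real (lam i) - real i - 1 / 2))"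
    using maya_inj by (subst sum.reindex) (auto intro!: sum.cong arg_cong[where f = f] simp: s_def site_pos_def intro: inj_on_subset)
  also have "(\<Sum>x\<in>?B. f (site_pos x)) = (\<Sum>i<N. f (- real i - 1 / 2))"
    by (rule sum.reindex_bij_witness[where i = "\<lambda>i. - int i - 1" and j = "\<lambda>x. nat (- x - 1)"])
       (auto intro!: arg_cong[where f = f] simp: site_pos_def)
  finally show "(\<Sum>x\<in>excitations lam. charge x * f (site_pos x)) = (\<Sum>i<N. f (real (lam i) - real i - 1 / 2) - f (- real i - 1 / 2))"
    by (simp add: sum_subtractf)
qed

end

lemma charge_site_pos: "charge x * site_pos x = \<bar>site_pos x\<bar>"
  by (auto simp: charge_def site_pos_def)

lemma excitations_neutral: "lam \<in> partitions \<Longrightarrow> excitations lam \<in> neutral"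
proof -
  assume lam: "lam \<in> partitions"
  obtain N where N: "\<And>i. i \<ge> N \<Longrightarrow> lam i = 0" by (rule partitions_bound[OF lam]) blast
  show ?thesis using excitations_sum(1)[OF lam, of N "\<lambda>_. 1", OF N] excitations_sum(2)[OF lam, of N, OF N] by (simp add: neutral_def)
qed

lemma psize_eq:
  assumes "\<And>i. i \<ge> N \<Longrightarrow> lam i = 0"
  shows "psize lam = (\<Sum>i<N. lam i)"
  unfolding psize_def
proof (intro sum.mono_neutral_left)
  show "{i. lam i \<noteq> 0} \<subseteq> {..<N}"
  proof
    fix i assume "i \<in> {i. lam i \<noteq> 0}"
    then show "i \<in> {..<N}" using assms[of i] by (cases "i < N") auto
  qed
qed auto

lemma energy_excitations: "lam \<in> partitions \<Longrightarrow> energy (excitations lam) = real (psize lam)"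
proof -
  assume lam: "lam \<in> partitions"
  obtain N where N: "\<And>i. i \<ge> N \<Longrightarrow> lam i = 0" by (rule partitions_bound[OF lam]) blast
  show ?thesis using excitations_sum(1)[OF lam, of N "\<lambda>x. x", OF N]
    by (simp add: energy_def charge_site_pos psize_eq[of N lam, OF N])
qed

lemma p_excitations: "lam \<in> partitions \<Longrightarrow> p k lam = pconst k + (\<Sum>x\<in>excitations lam. charge x * site_pos x ^ k)"
proof -
  assume lam: "lam \<in> partitions"
  obtain N where N: "\<And>i. i \<ge> N \<Longrightarrow> lam i = 0" by (rule partitions_bound[OF lam]) blast
  have "(\<Sum>i. (real (lam i) - real i - 1/2) ^ k - (- real i - 1/2) ^ k) = (\<Sum>i<N. (real (lam i) - real i - 1/2) ^ k - (- real i - 1/2) ^ k)"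
    by (intro suminf_finite) (auto simp: N)
  then show ?thesis using excitations_sum(1)[OF lam, of N "\<lambda>x. x ^ k", OF N] by (simp add: p_def pconst_def)
qed

lemma excitations_inj: "inj_on excitations partitions"
proof (rule inj_onI)
  fix lam mu assume lam: "lam \<in> partitions" and mu: "mu \<in> partitions" and e: "excitations lam = excitations mu"
  have "maya l = {s. (s \<ge> 0) = (s \<in> excitations l)}" for l by (auto simp: excitations_def)
  then have m: "maya lam = maya mu" using e by simp
  show "lam = mu"
  proof
    fix i
    have "int (lam i) - int i - 1 \<in> maya mu" unfolding m[symmetric] by (simp add: maya_def)
    then obtain j where j: "int (lam i) - int i - 1 = int (mu j) - int j - 1" by (auto simp: maya_def)
    have "i = j" using card_maya_above[OF lam, of i] card_maya_above[OF mu, of j] unfolding m j by simp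
    then show "lam i = mu i" using j by simp
  qed
qed

lemma finite_int_sets_bounded:
  assumes "finite F" "\<And>T. T \<in> F \<Longrightarrow> finite (T :: int set)"
  shows "\<exists>N. \<forall>T\<in>F. T \<subseteq> {- int N..<int N}"
proof -
  have "finite (nat ` abs ` \<Union>F)" using assms by auto
  then obtain n where n: "\<forall>x\<in>nat ` abs ` \<Union>F. x < n" using finite_nat_set_iff_bounded by blast
  have "- int n \<le> s \<and> s < int n" if "s \<in> T" "T \<in> F" for s T
  proof -
    have "nat \<bar>s\<bar> < n" using n that by auto
    then show ?thesis by linarith
  qed
  then show ?thesis by (intro exI[of _ n]) auto
qed

text \<open>By neutrality exactly N of the sites from - N to N - 1 are occupied. In decreasing order
  they are the numbers lam i - i - 1; being distinct and at least - N, they yield nonnegative,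
  weakly decreasing parts.\<close>

lemma excitations_surj:
  assumes T: "T \<in> neutral"
  shows "\<exists>lam\<in>partitions. excitations lam = T"
proof -
  have fT: "finite T" and z: "(\<Sum>s\<in>T. charge s) = 0" using T by (auto simp: neutral_def)
  obtain N where "T \<subseteq> {- int N..<int N}"
    using finite_int_sets_bounded[of "{T}"] fT by auto
  then have TN: "- int N \<le> s" "s < int N" if "s \<in> T" for s using that by auto
  let ?P = "{s\<in>T. s \<ge> 0}" and ?H = "{s\<in>T. s < 0}" and ?B = "{- int N..<0}"
  have "(\<Sum>s\<in>T. charge s) = (\<Sum>s\<in>?P. charge s) + (\<Sum>s\<in>?H. charge s)"
    using fT by (subst sum.union_disjoint[symmetric]) (auto intro!: sum.cong)
  also have "\<dots> = real (card ?P) - real (card ?H)"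
    by (simp add: charge_def)
  finally have cPH: "card ?P = card ?H" using z by simp
  define A where "A = ?P \<union> (?B - ?H)"
  have fA: "finite A" using fT by (simp add: A_def)
  have "card A = card ?P + card (?B - ?H)"
    unfolding A_def using fT by (intro card_Un_disjoint) auto
  also have "card (?B - ?H) = card ?B - card ?H"
    using TN by (intro card_Diff_subset) (auto intro: finite_subset[OF _ fT])
  also have "card ?P + \<dots> = N"
  proof -
    have "card ?H \<le> card ?B" using TN by (intro card_mono) auto
    then show ?thesis by (simp add: cPH)
  qed
  finally have cA: "card A = N" .
  define L where "L = sorted_list_of_set A"
  have lenL: "length L = N" by (simp add: L_def cA)
  have setL: "set L = A" using fA by (simp add: L_def)
  have less: "L ! i < L ! j" if "i < j" "j < N" for i j
    using that lenL sorted_wrt_nth_less[OF strict_sorted_list_of_set[of A], of i j] by (simp add: L_def)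
  have low: "L ! k \<ge> - int N + int k" if "k < N" for k
    using that
  proof (induction k)
    case 0
    then have "L ! 0 \<in> A" using setL lenL nth_mem by blast
    then show ?case using TN by (auto simp: A_def)
  next
    case (Suc k)
    then show ?case using less[of k "Suc k"] by simp
  qed
  \<comment> \<open>The list is increasing, so the site of row i sits at index N - 1 - i.\<close>
  define lam where "lam i = (if i < N then nat (L ! (N - 1 - i) + int i + 1) else 0)" for i
  have s: "int (lam i) - int i - 1 = L ! (N - 1 - i)" if "i < N" for i
    using low[of "N - 1 - i"] that by (simp add: lam_def of_nat_diff)
  have N0: "lam i = 0" if "i \<ge> N" for i using that by (simp add: lam_def)
  have "lam (Suc i) \<le> lam i" for i
  proof (cases "Suc i < N")
    case True
    then have "L ! (N - 1 - Suc i) < L ! (N - 1 - i)" by (intro less) auto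
    then show ?thesis using s[OF True] s[of i] True by simp
  qed (simp add: lam_def)
  then have "antimono lam" by (rule decseq_SucI)
  moreover have "finite {i. lam i \<noteq> 0}" by (rule finite_subset[of _ "{..<N}"]) (auto simp: lam_def split: if_splits)
  ultimately have lam: "lam \<in> partitions" by (simp add: partitions_def)
  have "(\<lambda>i. int (lam i) - int i - 1) ` {..<N} = (\<lambda>i. L ! (N - 1 - i)) ` {..<N}"
    by (intro image_cong refl s) auto
  also have "\<dots> = (\<lambda>k. L ! k) ` {..<N}"
  proof -
    have "(\<lambda>i. N - 1 - i) ` {..<N} = {..<N}"
    proof (intro equalityI subsetI)
      fix k assume "k \<in> {..<N}"
      then have "k = N - 1 - (N - 1 - k)" "N - 1 - k \<in> {..<N}" by auto
      then show "k \<in> (\<lambda>i. N - 1 - i) ` {..<N}" by blast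
    qed auto
    then have "(\<lambda>k. L ! k) ` {..<N} = (\<lambda>k. L ! k) ` (\<lambda>i. N - 1 - i) ` {..<N}" by (simp only:)
    then show ?thesis by (simp only: image_image)
  qed
  also have "\<dots> = A" using setL lenL by (auto simp: set_conv_nth image_iff)
  finally have im: "(\<lambda>i. int (lam i) - int i - 1) ` {..<N} = A" .
  have "excitations lam = (A - ?B) \<union> (?B - A)" using excitations_split[OF lam, of N] N0 by (simp only: im)
  also have "\<dots> = T" using TN by (auto simp: A_def)
  finally show ?thesis using lam by blast
qed

lemma excitations_bij: "bij_betw excitations partitions neutral"
  unfolding bij_betw_def using excitations_inj excitations_neutral excitations_surj by blast

section \<open>Sums over neutral configurations as limits over finite windows\<close>

definition neutral_upto :: "nat \<Rightarrow> int set set" where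
  "neutral_upto N = {T \<in> Pow {- int N..<int N}. (\<Sum>s\<in>T. charge s) = 0}"

lemma neutral_upto_subset: "finite (neutral_upto N)" "neutral_upto N \<subseteq> neutral"
  by (auto simp: neutral_upto_def neutral_def finite_subset)

text \<open>Every finite family of configurations fits into some window, so unordered sums may be
  computed along windows.\<close>

lemma filterlim_neutral_upto: "filterlim neutral_upto (finite_subsets_at_top neutral) sequentially"
  unfolding filterlim_finite_subsets_at_top
proof (intro allI impI)
  fix X assume X: "finite X \<and> X \<subseteq> neutral"
  then obtain N where N: "\<forall>T\<in>X. T \<subseteq> {- int N..<int N}"
    using finite_int_sets_bounded[of X] by (auto simp: neutral_def)
  have "X \<subseteq> neutral_upto M" if "M \<ge> N" for M
  proof
    fix T assume T: "T \<in> X"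
    then have "T \<subseteq> {- int N..<int N}" using N by blast
    also have "\<dots> \<subseteq> {- int M..<int M}" using that by auto
    finally show "T \<in> neutral_upto M" using X T by (auto simp: neutral_upto_def neutral_def)
  qed
  then show "\<forall>\<^sub>F M in sequentially. finite (neutral_upto M) \<and> X \<subseteq> neutral_upto M \<and> neutral_upto M \<subseteq> neutral"
    using neutral_upto_subset by (auto simp: eventually_sequentially)
qed

text \<open>Admitting charged configurations only enlarges the sum, which then factorises over
  sites, and each factor 1 + x is at most e^x.\<close>

lemma summable_on_neutral_exp:
  assumes h: "h > 0"
  shows "(\<lambda>T. exp (- h * energy T)) summable_on neutral"
proof (rule nonneg_bdd_above_summable_on)
  let ?S = "\<Sum>j. exp (- h * half_odd j)"
  show "bdd_above (sum (\<lambda>T. exp (- h * energy T)) ` {F. F \<subseteq> neutral \<and> finite F})"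
  proof (rule bdd_aboveI2[where M = "exp (2 * ?S)"])
    fix F assume "F \<in> {F. F \<subseteq> neutral \<and> finite F}"
    then have F: "F \<subseteq> neutral" "finite F" by auto
    obtain N where N: "\<forall>T\<in>F. T \<subseteq> {- int N..<int N}"
      using finite_int_sets_bounded[OF F(2)] F(1) by (auto simp: neutral_def)
    have "(\<Sum>T\<in>F. exp (- h * energy T)) \<le> (\<Sum>T\<in>Pow {- int N..<int N}. exp (- h * energy T))"
      using N by (intro sum_mono2) auto
    also have "\<dots> = (\<Sum>T\<in>Pow {- int N..<int N}. \<Prod>s\<in>T. exp (- h * \<bar>site_pos s\<bar>))"
    proof (intro sum.cong refl)
      fix T assume "T \<in> Pow {- int N..<int N}"
      then have "finite T" by (auto intro: finite_subset)
      then show "exp (- h * energy T) = (\<Prod>s\<in>T. exp (- h * \<bar>site_pos s\<bar>))"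
        by (simp only: energy_def sum_distrib_left exp_sum)
    qed
    also have "\<dots> = (\<Prod>s\<in>{- int N..<int N}. exp (- h * \<bar>site_pos s\<bar>) + 1)"
      using prod_add_sconv[of "{- int N..<int N}" "\<lambda>s. exp (- h * \<bar>site_pos s\<bar>)" "\<lambda>_. 1"] by (simp add: sconv_def)
    also have "\<dots> \<le> (\<Prod>s\<in>{- int N..<int N}. exp (exp (- h * \<bar>site_pos s\<bar>)))"
      by (intro prod_mono) (auto simp: add.commute exp_ge_add_one_self add_nonneg_nonneg)
    also have "\<dots> = exp (\<Sum>s\<in>{- int N..<int N}. exp (- h * \<bar>site_pos s\<bar>))"
      by (simp add: exp_sum)
    also have "(\<Sum>s\<in>{- int N..<int N}. exp (- h * \<bar>site_pos s\<bar>)) = 2 * (\<Sum>j<N. exp (- h * half_odd j))"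
    proof -
      have "\<bar>site_pos (int j)\<bar> = half_odd j" "\<bar>site_pos (- 1 - int j)\<bar> = half_odd j" for j by (auto simp: site_pos_def half_odd_def)
      then show ?thesis unfolding sum_sites by (simp add: sum_distrib_left)
    qed
    also have "exp (2 * (\<Sum>j<N. exp (- h * half_odd j))) \<le> exp (2 * ?S)"
      using sum_le_suminf[OF summable_exp_half_odd[OF h], of "{..<N}"] by simp
    finally show "(\<Sum>T\<in>F. exp (- h * energy T)) \<le> exp (2 * ?S)" .
  qed
qed auto

definition pmoment :: "('i \<Rightarrow> nat) \<Rightarrow> 'i set \<Rightarrow> int set \<Rightarrow> real" where
  "pmoment m B T = (\<Prod>i\<in>B. pconst (m i) + (\<Sum>s\<in>T. charge s * site_pos s ^ m i))"

lemma energy_nonneg: "energy T \<ge> 0"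
  by (simp add: energy_def sum_nonneg)

lemma power_le_exp_const:
  assumes "d > 0"
  shows "\<exists>C\<ge>0. \<forall>x\<ge>0. x ^ n \<le> C * exp (d * (x::real))"
proof (intro exI conjI allI impI)
  show "fact n / d ^ n \<ge> 0" using assms by simp
  fix x :: real assume "x \<ge> 0"
  then have "(d * x) ^ n / fact n \<le> exp (d * x)" using assms by (intro power_fact_le_exp) auto
  then show "x ^ n \<le> fact n / d ^ n * exp (d * x)" using assms by (simp add: power_mult_distrib field_simps)
qed

text \<open>Every site is at distance at least 1/2 from 0, so a configuration of energy E has at
  most 2 E sites, each at distance at most E. The sum is thus at most 2 E^(k + 1), and exp(d E)
  dominates every power of E.\<close>

lemma pmoment_factor_bound:
  assumes d: "d > 0"
  shows "\<exists>C\<ge>0. \<forall>T. finite T \<longrightarrow> \<bar>c + (\<Sum>s\<in>T. charge s * site_pos s ^ k)\<bar> \<le> C * exp (d * energy T)"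
proof -
  obtain C where C: "C \<ge> 0" "\<And>x. x \<ge> 0 \<Longrightarrow> x ^ Suc k \<le> C * exp (d * x)"
    using power_le_exp_const[OF d, of "Suc k"] by blast
  show ?thesis
  proof (intro exI[of _ "\<bar>c\<bar> + 2 * C"] conjI allI impI)
    show "\<bar>c\<bar> + 2 * C \<ge> 0" using C by simp
    fix T :: "int set" assume T: "finite T"
    let ?E = "energy T"
    have half: "\<bar>site_pos s\<bar> \<ge> 1 / 2" for s
    proof -
      have "s \<ge> 0 \<or> s \<le> - 1" by linarith
      then show ?thesis by (auto simp: site_pos_def)
    qed
    have "\<bar>\<Sum>s\<in>T. charge s * site_pos s ^ k\<bar> \<le> (\<Sum>s\<in>T. 2 * \<bar>site_pos s\<bar> * ?E ^ k)"
    proof (rule order_trans[OF sum_abs], rule sum_mono)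
      fix s assume s: "s \<in> T"
      have "\<bar>site_pos s\<bar> \<le> ?E" unfolding energy_def using T s by (intro member_le_sum) auto
      then have "\<bar>site_pos s\<bar> ^ k \<le> ?E ^ k" by (intro power_mono) auto
      moreover have "1 * ?E ^ k \<le> 2 * \<bar>site_pos s\<bar> * ?E ^ k"
        using half[of s] energy_nonneg[of T] by (intro mult_right_mono) auto
      moreover have "\<bar>charge s * site_pos s ^ k\<bar> = \<bar>site_pos s\<bar> ^ k" by (simp add: charge_def abs_mult power_abs)
      ultimately show "\<bar>charge s * site_pos s ^ k\<bar> \<le> 2 * \<bar>site_pos s\<bar> * ?E ^ k" by simp
    qed
    also have "\<dots> = 2 * ?E ^ Suc k" by (simp add: energy_def sum_distrib_left sum_distrib_right mult_ac)
    also have "\<dots> \<le> 2 * (C * exp (d * ?E))" using C(2)[OF energy_nonneg] by simp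
    finally have 1: "\<bar>\<Sum>s\<in>T. charge s * site_pos s ^ k\<bar> \<le> 2 * C * exp (d * ?E)" by simp
    have "\<bar>c\<bar> * 1 \<le> \<bar>c\<bar> * exp (d * ?E)" using d energy_nonneg[of T] by (intro mult_left_mono) auto
    with 1 show "\<bar>c + (\<Sum>s\<in>T. charge s * site_pos s ^ k)\<bar> \<le> (\<bar>c\<bar> + 2 * C) * exp (d * ?E)"
      by (simp add: distrib_right)
  qed
qed

lemma pmoment_bound:
  assumes B: "finite B" and d: "d > 0"
  shows "\<exists>C\<ge>0. \<forall>T. finite T \<longrightarrow> \<bar>pmoment m B T\<bar> \<le> C * exp (d * energy T)"
  using B d
proof (induction B arbitrary: d rule: finite_induct)
  case empty
  show ?case
  proof (intro exI[of _ 1] conjI allI impI)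
    fix T show "\<bar>pmoment m {} T\<bar> \<le> 1 * exp (d * energy T)"
      using empty energy_nonneg[of T] by (simp add: pmoment_def)
  qed simp
next
  case (insert a B)
  obtain C where C: "C \<ge> 0" "\<And>T. finite T \<Longrightarrow> \<bar>pmoment m B T\<bar> \<le> C * exp (d / 2 * energy T)"
    using insert.IH[of "d / 2"] insert.prems by auto
  obtain D where D: "D \<ge> 0" "\<And>T. finite T \<Longrightarrow> \<bar>pconst (m a) + (\<Sum>s\<in>T. charge s * site_pos s ^ m a)\<bar> \<le> D * exp (d / 2 * energy T)"
    using pmoment_factor_bound[of "d / 2" "pconst (m a)" "m a"] insert.prems by auto
  show ?case
  proof (intro exI[of _ "D * C"] conjI allI impI)
    show "D * C \<ge> 0" using C D by simp
    fix T :: "int set" assume T: "finite T"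
    have "\<bar>pmoment m (insert a B) T\<bar> = \<bar>pconst (m a) + (\<Sum>s\<in>T. charge s * site_pos s ^ m a)\<bar> * \<bar>pmoment m B T\<bar>"
      using insert.hyps by (simp add: pmoment_def abs_mult)
    also have "\<dots> \<le> (D * exp (d / 2 * energy T)) * (C * exp (d / 2 * energy T))"
      using C D T by (intro mult_mono) auto
    also have "\<dots> = D * C * exp (d * energy T)" by (simp add: exp_add[symmetric] mult_ac)
    finally show "\<bar>pmoment m (insert a B) T\<bar> \<le> D * C * exp (d * energy T)" .
  qed
qed

lemma summable_on_pmoment:
  assumes B: "finite B" and h: "h > 0"
  shows "(\<lambda>T. exp (- h * energy T) * pmoment m B T) summable_on neutral"
proof -
  obtain C where C: "C \<ge> 0" "\<And>T. finite T \<Longrightarrow> \<bar>pmoment m B T\<bar> \<le> C * exp (h / 2 * energy T)"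
    using pmoment_bound[OF B, of "h / 2" m] h by auto
  have "(\<lambda>T. C * exp (- (h / 2) * energy T)) summable_on neutral"
    using h by (intro summable_on_cmult_right summable_on_neutral_exp) auto
  then have s: "(\<lambda>T. norm (C * exp (- (h / 2) * energy T))) summable_on neutral"
    using C by (simp add: abs_mult)
  have "norm (exp (- h * energy T) * pmoment m B T) \<le> norm (C * exp (- (h / 2) * energy T))" if "T \<in> neutral" for T
  proof -
  have "\<bar>pmoment m B T\<bar> \<le> C * exp (h / 2 * energy T)" using that by (intro C) (simp add: neutral_def)
  then have "exp (- h * energy T) * \<bar>pmoment m B T\<bar> \<le> exp (- h * energy T) * (C * exp (h / 2 * energy T))"
    by (intro mult_left_mono) auto
  also have "\<dots> = C * exp (- (h / 2) * energy T)" by (simp add: exp_add[symmetric] field_simps)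
  finally show ?thesis
    using C by (simp add: abs_mult)
  qed
  then have "(\<lambda>T. norm (exp (- h * energy T) * pmoment m B T)) summable_on neutral"
    by (rule Infinite_Sum.abs_summable_on_comparison_test[OF s])
  then show ?thesis by (rule abs_summable_summable)
qed

lemma infsum_partitions_limit:
  assumes B: "finite B" and h: "h > 0"
  shows "(\<lambda>N. \<Sum>T\<in>neutral_upto N. exp (- h * energy T) * pmoment m B T) \<longlonglongrightarrow>
    (\<Sum>\<^sub>\<infinity>lam\<in>partitions. exp (- h) ^ psize lam * (\<Prod>i\<in>B. p (m i) lam))"
    and "(\<lambda>lam. exp (- h) ^ psize lam * (\<Prod>i\<in>B. p (m i) lam)) summable_on partitions"
proof -
  let ?f = "\<lambda>T. exp (- h * energy T) * pmoment m B T"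
  have e: "exp (- h) ^ psize lam * (\<Prod>i\<in>B. p (m i) lam) = ?f (excitations lam)" if "lam \<in> partitions" for lam
    using that by (simp add: energy_excitations p_excitations pmoment_def exp_of_nat_mult[symmetric] mult.commute)
  have s: "?f summable_on neutral" by (rule summable_on_pmoment) fact+
  have "((\<lambda>N. \<Sum>T\<in>neutral_upto N. ?f T) \<longlongrightarrow> infsum ?f neutral) sequentially"
    by (rule filterlim_compose[OF _ filterlim_neutral_upto]) (use s in \<open>simp add: has_sum_def[symmetric]\<close>)
  also have "infsum ?f neutral = (\<Sum>\<^sub>\<infinity>lam\<in>partitions. ?f (excitations lam))"
    by (rule infsum_reindex_bij_betw[OF excitations_bij, symmetric])
  also have "\<dots> = (\<Sum>\<^sub>\<infinity>lam\<in>partitions. exp (- h) ^ psize lam * (\<Prod>i\<in>B. p (m i) lam))"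
    by (intro infsum_cong) (simp add: e)
  finally show "(\<lambda>N. \<Sum>T\<in>neutral_upto N. ?f T) \<longlonglongrightarrow> (\<Sum>\<^sub>\<infinity>lam\<in>partitions. exp (- h) ^ psize lam * (\<Prod>i\<in>B. p (m i) lam))" .
  have "(\<lambda>lam. ?f (excitations lam)) summable_on partitions"
    by (rule summable_on_reindex_bij_betw[OF excitations_bij, of ?f, THEN iffD2, OF s])
  then show "(\<lambda>lam. exp (- h) ^ psize lam * (\<Prod>i\<in>B. p (m i) lam)) summable_on partitions"
    by (rule summable_on_cong[THEN iffD1, rotated]) (simp add: e)
qed

section \<open>Partitions with at most N parts and Euler's product\<close>

definition bounded_length :: "nat \<Rightarrow> (nat \<Rightarrow> nat) set" where
  "bounded_length N = {lam \<in> partitions. \<forall>i\<ge>N. lam i = 0}"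

lemma bounded_lengthI: "antimono lam \<Longrightarrow> (\<And>i. i \<ge> N \<Longrightarrow> lam i = 0) \<Longrightarrow> lam \<in> bounded_length N"
proof -
  assume a: "antimono lam" and N: "\<And>i. i \<ge> N \<Longrightarrow> lam i = 0"
  have "{i. lam i \<noteq> 0} \<subseteq> {..<N}"
  proof
    fix i assume "i \<in> {i. lam i \<noteq> 0}"
    then show "i \<in> {..<N}" using N[of i] by (cases "i < N") auto
  qed
  then show ?thesis using a N by (auto simp: bounded_length_def partitions_def intro: finite_subset)
qed

text \<open>The smallest of the N + 1 parts, possibly 0, is subtracted from all of them; in the
  generating function this is the geometric series for the factor with exponent N + 1.\<close>

lemma bounded_length_Suc_bij:
  "bij_betw (\<lambda>(a, lam) i. if i \<le> N then lam i + a else 0) (UNIV \<times> bounded_length N) (bounded_length (Suc N))"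
proof (rule bij_betw_byWitness[where f' = "\<lambda>mu. (mu N, \<lambda>i. mu i - mu N)"])
  show "\<forall>x\<in>UNIV \<times> bounded_length N. (\<lambda>mu. (mu N, \<lambda>i. mu i - mu N)) ((\<lambda>(a, lam) i. if i \<le> N then lam i + a else 0) x) = x"
    by (auto simp: bounded_length_def fun_eq_iff)
  show "\<forall>mu\<in>bounded_length (Suc N). (\<lambda>(a, lam) i. if i \<le> N then lam i + a else 0) ((\<lambda>mu. (mu N, \<lambda>i. mu i - mu N)) mu) = mu"
    by (auto simp: bounded_length_def partitions_def antimono_def fun_eq_iff)
  show "(\<lambda>(a, lam) i. if i \<le> N then lam i + a else 0) ` (UNIV \<times> bounded_length N) \<subseteq> bounded_length (Suc N)"
  proof (rule image_subsetI)
    fix x :: "nat \<times> (nat \<Rightarrow> nat)" assume "x \<in> UNIV \<times> bounded_length N"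
    then obtain a lam where x: "x = (a, lam)" "lam \<in> bounded_length N" by auto
    then have "antimono lam" by (simp add: bounded_length_def partitions_def)
    then have "(\<lambda>i. if i \<le> N then lam i + a else 0) \<in> bounded_length (Suc N)"
      by (intro bounded_lengthI) (auto simp: antimono_def)
    then show "(\<lambda>(a, lam) i. if i \<le> N then lam i + a else 0) x \<in> bounded_length (Suc N)" by (simp add: x)
  qed
  show "(\<lambda>mu. (mu N, \<lambda>i. mu i - mu N)) ` bounded_length (Suc N) \<subseteq> UNIV \<times> bounded_length N"
  proof (rule image_subsetI)
    fix mu assume mu: "mu \<in> bounded_length (Suc N)"
    then have am: "antimono mu" by (simp add: bounded_length_def partitions_def)
    then have "mu i - mu N = 0" if "i \<ge> N" for i
      using that by (auto simp: antimono_def)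
    then have "(\<lambda>i. mu i - mu N) \<in> bounded_length N"
      using am by (intro bounded_lengthI) (auto simp: antimono_def intro: diff_le_mono)
    then show "(mu N, \<lambda>i. mu i - mu N) \<in> UNIV \<times> bounded_length N" by simp
  qed
qed

lemma has_sum_bounded_length:
  assumes q: "0 < q" "q < (1::real)"
  shows "((\<lambda>lam. q ^ psize lam) has_sum (\<Prod>i<N. 1 / (1 - q ^ Suc i))) (bounded_length N)"
proof (induction N)
  case 0
  have "bounded_length 0 = {\<lambda>_. 0}" by (auto simp: bounded_length_def partitions_def antimono_def)
  then show ?case using has_sum_finite[of "{\<lambda>_::nat. 0::nat}" "\<lambda>lam. q ^ psize lam"] by (simp add: psize_def)
next
  case (Suc N)
  let ?P = "\<Prod>i<N. 1 / (1 - q ^ Suc i)"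
  let ?f = "\<lambda>(a::nat, lam). (q ^ Suc N) ^ a * q ^ psize lam"
  have qN: "0 < q ^ Suc N" "q ^ Suc N < 1" using q by (simp, intro power_Suc_less_one) auto
  have P0: "?P \<ge> 0" using q by (intro prod_nonneg) (auto intro!: divide_nonneg_nonneg simp: power_le_one mult_le_one)
  have "(\<lambda>a. (q ^ Suc N) ^ a * ?P) sums (1 / (1 - q ^ Suc N) * ?P)"
    using qN by (intro sums_mult2 geometric_sums) auto
  then have g: "((\<lambda>a. (q ^ Suc N) ^ a * ?P) has_sum (1 / (1 - q ^ Suc N) * ?P)) UNIV"
    using qN P0 by (intro sums_nonneg_imp_has_sum) auto
  have f: "((\<lambda>lam. ?f (a, lam)) has_sum ((q ^ Suc N) ^ a * ?P)) (bounded_length N)" for a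
    using has_sum_cmult_right[OF Suc, of "(q ^ Suc N) ^ a"] by simp
  have "?f summable_on (UNIV \<times> bounded_length N)"
    by (rule summable_on_SigmaI[OF f has_sum_imp_summable[OF g]]) (use q in auto)
  then have S: "(?f has_sum (1 / (1 - q ^ Suc N) * ?P)) (UNIV \<times> bounded_length N)"
    using has_sum_SigmaI[OF f g] by blast
  have e: "q ^ psize ((\<lambda>(a, lam) i. if i \<le> N then lam i + a else 0) x) = ?f x" if x: "x \<in> UNIV \<times> bounded_length N" for x
  proof -
    obtain a lam where x': "x = (a, lam)" "lam \<in> bounded_length N" using x by auto
    have "psize (\<lambda>i. if i \<le> N then lam i + a else 0) = (\<Sum>i<Suc N. (if i \<le> N then lam i + a else 0))"
      by (rule psize_eq) auto
    also have "\<dots> = (\<Sum>i<Suc N. lam i + a)" by (intro sum.cong) auto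
    also have "\<dots> = (\<Sum>i<Suc N. lam i) + Suc N * a" by (simp add: sum.distrib)
    also have "(\<Sum>i<Suc N. lam i) = psize lam"
      using x'(2) by (intro psize_eq[symmetric]) (auto simp: bounded_length_def)
    finally have "psize (\<lambda>i. if i \<le> N then lam i + a else 0) = Suc N * a + psize lam" by simp
    then show ?thesis unfolding x' by (simp only: prod.case power_add power_mult)
  qed
  have "((\<lambda>x. q ^ psize ((\<lambda>(a, lam) i. if i \<le> N then lam i + a else 0) x)) has_sum (1 / (1 - q ^ Suc N) * ?P)) (UNIV \<times> bounded_length N)"
    using S by (subst has_sum_cong[OF e])
  then have "((\<lambda>lam. q ^ psize lam) has_sum (1 / (1 - q ^ Suc N) * ?P)) (bounded_length (Suc N))"
    by (rule has_sum_reindex_bij_betw[OF bounded_length_Suc_bij, of "\<lambda>lam. q ^ psize lam", THEN iffD1])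
  then show ?case by (simp add: mult.commute)
qed

text \<open>Each finite set of partitions has a common bound on the number of parts, so the finite
  products for bounded length converge to the full sum.\<close>

lemma euler_product:
  fixes h :: real
  assumes h: "h > 0"
  shows "(\<Prod>n. 1 - exp (- h) ^ Suc n) * (\<Sum>\<^sub>\<infinity>lam\<in>partitions. exp (- h) ^ psize lam) = 1"
proof -
  define q where "q = exp (- h)"
  have q: "0 < q" "q < 1" using h by (simp_all add: q_def)
  let ?f = "\<lambda>lam. q ^ psize lam"
  let ?P = "\<lambda>N. \<Prod>i<N. 1 / (1 - q ^ Suc i)"
  define S where "S = infsum ?f partitions"
  have summ: "?f summable_on partitions"
    using infsum_partitions_limit(2)[of "{}::nat set", OF _ h] by (simp add: q_def)
  then have S: "(?f has_sum S) partitions" unfolding S_def by (rule has_sum_infsum)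
  have PS: "?P N \<le> S" for N
    by (rule has_sum_mono2[OF has_sum_bounded_length[OF q] S]) (use q in \<open>auto simp: bounded_length_def\<close>)
  have "?P \<longlonglongrightarrow> S"
  proof (rule LIMSEQ_I)
    fix e :: real assume e: "e > 0"
    have "\<forall>\<^sub>F F in finite_subsets_at_top partitions. dist (sum ?f F) S < e"
      using S e unfolding has_sum_def tendsto_iff by blast
    then obtain F where F: "finite F" "F \<subseteq> partitions" "dist (sum ?f F) S < e"
      unfolding eventually_finite_subsets_at_top by blast
    have "\<exists>N. \<forall>lam\<in>F. \<forall>i\<ge>N. lam i = 0"
      using F(1,2)
    proof (induction F rule: finite_induct)
      case (insert lam F)
      obtain N where "\<forall>lam\<in>F. \<forall>i\<ge>N. lam i = 0" using insert by auto
      moreover obtain M where "\<And>i. i \<ge> M \<Longrightarrow> lam i = 0" using insert.prems partitions_bound[of lam] by auto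
      ultimately show ?case by (intro exI[of _ "max N M"]) auto
    qed simp
    then obtain N where N: "\<forall>lam\<in>F. \<forall>i\<ge>N. lam i = 0" by blast
    show "\<exists>N. \<forall>M\<ge>N. norm (?P M - S) < e"
    proof (intro exI allI impI)
      fix M assume M: "M \<ge> N"
      have "F \<subseteq> bounded_length M" using F(2) N M by (auto simp: bounded_length_def)
      then have "sum ?f F \<le> ?P M"
        using F(1) q by (intro finite_sum_le_has_sum[OF has_sum_bounded_length[OF q]]) auto
      then show "norm (?P M - S) < e" using F(3) PS[of M] by (simp add: dist_real_def abs_less_iff)
    qed
  qed
  moreover have "(\<lambda>N. \<Prod>i<N. 1 - q ^ Suc i) \<longlonglongrightarrow> (\<Prod>n. 1 - q ^ Suc n)"
  proof -
    have "summable (\<lambda>i. norm ((1 - q ^ Suc i) - 1))"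
      using q by (simp add: summable_mult summable_geometric)
    then have "abs_convergent_prod (\<lambda>i. 1 - q ^ Suc i)" by (simp only: abs_convergent_prod_conv_summable)
    then have "convergent_prod (\<lambda>i. 1 - q ^ Suc i)" by (rule abs_convergent_prod_imp_convergent_prod)
    from convergent_prod_LIMSEQ[OF this] show ?thesis by (simp only: lessThan_Suc_atMost[symmetric]) (rule LIMSEQ_imp_Suc)
  qed
  ultimately have "(\<lambda>N. (\<Prod>i<N. 1 - q ^ Suc i) * ?P N) \<longlonglongrightarrow> (\<Prod>n. 1 - q ^ Suc n) * S"
    by (intro tendsto_mult)
  moreover have "(\<Prod>i<N. 1 - q ^ Suc i) * ?P N = 1" for N
  proof -
    have "1 - q ^ Suc i \<noteq> 0" for i using power_Suc_less_one[OF q, of i] by simp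
    then show ?thesis by (simp add: prod.distrib[symmetric])
  qed
  ultimately have "(\<Prod>n. 1 - q ^ Suc n) * S = 1" by (simp add: LIMSEQ_const_iff)
  then show ?thesis by (simp add: S_def q_def)
qed

text \<open>By Euler's product the prefactor of \<open>q_bracket\<close> is the inverse of the total
  weight, so a bracket is an average.\<close>

lemma q_bracket_limit:
  assumes B: "finite B" and h: "h > 0"
  shows "(\<lambda>N. (\<Sum>T\<in>neutral_upto N. exp (- h * energy T) * pmoment m B T) / (\<Sum>T\<in>neutral_upto N. exp (- h * energy T)))
    \<longlonglongrightarrow> q_bracket (\<lambda>lam. \<Prod>i\<in>B. p (m i) lam) (exp (- h))"
proof -
  let ?S = "\<Sum>\<^sub>\<infinity>lam\<in>partitions. exp (- h) ^ psize lam" and ?P = "\<Prod>n. 1 - exp (- h) ^ Suc n"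
  have PS: "?P * ?S = 1" by (rule euler_product[OF h])
  then have S0: "?S \<noteq> 0" by auto
  have "(\<lambda>N. \<Sum>T\<in>neutral_upto N. exp (- h * energy T)) \<longlonglongrightarrow> ?S"
    using infsum_partitions_limit(1)[of "{}", OF _ h, of m] by (simp add: pmoment_def)
  then have "(\<lambda>N. (\<Sum>T\<in>neutral_upto N. exp (- h * energy T) * pmoment m B T) / (\<Sum>T\<in>neutral_upto N. exp (- h * energy T)))
    \<longlonglongrightarrow> (\<Sum>\<^sub>\<infinity>lam\<in>partitions. exp (- h) ^ psize lam * (\<Prod>i\<in>B. p (m i) lam)) / ?S"
    by (intro tendsto_divide infsum_partitions_limit(1)[OF B h] S0)
  also have "(\<Sum>\<^sub>\<infinity>lam\<in>partitions. exp (- h) ^ psize lam * (\<Prod>i\<in>B. p (m i) lam)) / ?S = q_bracket (\<lambda>lam. \<Prod>i\<in>B. p (m i) lam) (exp (- h))"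
    unfolding q_bracket_def using PS S0 by (simp add: field_simps)
  finally show ?thesis .
qed

section \<open>The bracket as an integral over the charge variable\<close>

text \<open>The squared absolute value of 1 + exp(- h \<open>half_odd j\<close> + \<i> \<theta>):
  the joint weight of the particle and the hole at level j.\<close>

definition zfac :: "real \<Rightarrow> nat \<Rightarrow> real \<Rightarrow> real" where
  "zfac h j \<theta> = 1 + 2 * exp (- h * half_odd j) * cos \<theta> + exp (- h * half_odd j) ^ 2"

definition zprod :: "real \<Rightarrow> nat \<Rightarrow> real \<Rightarrow> real" where
  "zprod h N \<theta> = (\<Prod>j<N. zfac h j \<theta>)"

lemma zfac_pos: "h > 0 \<Longrightarrow> zfac h j \<theta> > 0"
proof -
  assume h: "h > 0"
  let ?x = "exp (- h * half_odd j)"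
  have "- h * half_odd j < 0" using mult_pos_pos[OF h half_odd_pos[of j]] by linarith
  then have x: "0 < ?x" "?x < 1" by (simp_all only: exp_less_one_iff exp_gt_zero)
  have "zfac h j \<theta> = (1 - ?x)\<^sup>2 + 2 * ?x * (1 + cos \<theta>)"
    by (simp add: zfac_def power2_eq_square algebra_simps)
  moreover have "1 + cos \<theta> \<ge> 0" using cos_ge_minus_one[of \<theta>] by linarith
  moreover have "(1 - ?x)\<^sup>2 > 0" using x(2) by (intro zero_less_power) linarith
  ultimately show ?thesis using x by (simp add: add_pos_nonneg)
qed

lemma zprod_pos: "h > 0 \<Longrightarrow> zprod h N \<theta> > 0"
  unfolding zprod_def by (intro prod_pos zfac_pos) auto

lemma prod_site_weight_zprod: "(\<Prod>s\<in>{- int N..<int N}. 1 + site_weight h (\<i> * of_real \<theta>) s) = of_real (zprod h N \<theta>)"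
  unfolding prod_sites zprod_def of_real_prod
proof (intro prod.cong refl)
  fix j
  have "site_weight h (\<i> * of_real \<theta>) (int j) = exp (- of_real (h * half_odd j)) * exp (\<i> * of_real \<theta>)"
    by (simp add: site_weight_particle exp_add[symmetric])
  moreover have "site_weight h (\<i> * of_real \<theta>) (- 1 - int j) = exp (- of_real (h * half_odd j)) * exp (- (\<i> * of_real \<theta>))"
    by (simp add: site_weight_hole exp_add[symmetric])
  moreover have "exp (\<i> * of_real \<theta>) + exp (- (\<i> * of_real \<theta>)) = (of_real (2 * cos \<theta>) :: complex)"
    using cos_exp_eq[of "of_real \<theta>"] by (simp add: cos_of_real field_simps)
  moreover have "exp (\<i> * of_real \<theta>) * exp (- (\<i> * of_real \<theta>)) = (1::complex)" by (simp add: exp_minus_inverse)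
  moreover have "(1 + a * b) * (1 + a * c) = 1 + a * (b + c) + a ^ 2 * (b * c)" for a b c :: complex
    by (simp add: power2_eq_square algebra_simps)
  ultimately have "(1 + site_weight h (\<i> * of_real \<theta>) (int j)) * (1 + site_weight h (\<i> * of_real \<theta>) (- 1 - int j)) =
     1 + exp (- of_real (h * half_odd j)) * of_real (2 * cos \<theta>) + exp (- of_real (h * half_odd j)) ^ 2"
    by (simp only: mult_1_right)
  also have "exp (- of_real (h * half_odd j)) = (of_real (exp (- h * half_odd j)) :: complex)"
    by (simp add: exp_of_real[symmetric])
  finally show "(1 + site_weight h (\<i> * of_real \<theta>) (int j)) * (1 + site_weight h (\<i> * of_real \<theta>) (- 1 - int j)) = of_real (zfac h j \<theta>)"
    by (simp add: zfac_def)
qed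

lemma prod_site_weight_subset:
  assumes "finite T"
  shows "(\<Prod>s\<in>T. site_weight h (\<i> * of_real \<theta>) s) = of_real (exp (- h * energy T)) * exp (\<i> * of_real (\<theta> * (\<Sum>s\<in>T. charge s)))"
proof -
  have "site_weight h (\<i> * of_real \<theta>) s = exp (of_real (- h * \<bar>site_pos s\<bar>) + \<i> * of_real (\<theta> * charge s))" for s
    unfolding site_weight_def charge_site_pos[symmetric] by (simp add: algebra_simps)
  then have "(\<Prod>s\<in>T. site_weight h (\<i> * of_real \<theta>) s) = exp (\<Sum>s\<in>T. of_real (- h * \<bar>site_pos s\<bar>) + \<i> * of_real (\<theta> * charge s))"
    using assms by (simp add: exp_sum)
  also have "(\<Sum>s\<in>T. of_real (- h * \<bar>site_pos s\<bar>) + \<i> * of_real (\<theta> * charge s)) =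
      (of_real (- h * energy T) + \<i> * of_real (\<theta> * (\<Sum>s\<in>T. charge s)) :: complex)"
    by (simp add: sum.distrib energy_def sum_distrib_left sum_negf sum_subtractf)
  finally show ?thesis by (simp only: exp_add exp_of_real)
qed

lemma integral_exp_i:
  assumes "c \<in> \<int>"
  shows "((\<lambda>\<theta>. exp (\<i> * of_real (\<theta> * c))) has_integral (if c = 0 then of_real (2 * pi) else 0 :: complex)) {- pi..pi}"
proof (cases "c = 0")
  case True
  then show ?thesis using has_integral_const_real[of "1::complex" "- pi" pi] by (simp add: scaleR_conv_of_real)
next
  case False
  obtain n where n: "c = of_int n" using assms by (auto elim: Ints_cases)
  let ?F = "\<lambda>z::complex. exp (\<i> * of_real c * z) / (\<i> * of_real c)"
  have "(?F has_field_derivative exp (\<i> * of_real c * z)) (at z)" for z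
    using False by (auto intro!: derivative_eq_intros)
  then have "((\<lambda>\<theta>. exp (\<i> * of_real c * of_real \<theta>)) has_integral (?F (of_real pi) - ?F (of_real (- pi)))) {- pi..pi}"
    by (intro fundamental_theorem_of_calculus has_vector_derivative_real_field) auto
  moreover have "exp (\<i> * of_real c * of_real pi) = exp (\<i> * of_real c * of_real (- pi))"
  proof -
    have "\<i> * of_real c * of_real pi = \<i> * of_real c * of_real (- pi) + of_int n * (of_real (2 * pi) * \<i>)"
      by (simp add: n)
    moreover have "exp (of_int n * (of_real (2 * pi) * \<i>)) = (1::complex)"
      using exp_integer_2pi[of "of_int n"] by (simp add: mult_ac)
    ultimately show ?thesis by (simp only: exp_add mult_1_right)
  qed
  ultimately show ?thesis using False by (simp add: mult_ac)
qed

lemma charge_sum_Ints: "(\<Sum>s\<in>T. charge s) \<in> \<int>"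
  by (intro Ints_sum) (auto simp: charge_def)

definition kappaN :: "('i \<Rightarrow> nat) \<Rightarrow> real \<Rightarrow> nat \<Rightarrow> real \<Rightarrow> 'i set \<Rightarrow> complex" where
  "kappaN m h N \<theta> C = (deriv ^^ (card C - 1)) (gpart h (\<Sum>i\<in>C. m i) N) (\<i> * of_real \<theta>)"

definition kappa :: "('i \<Rightarrow> nat) \<Rightarrow> real \<Rightarrow> real \<Rightarrow> 'i set \<Rightarrow> complex" where
  "kappa m h \<theta> C = (deriv ^^ (card C - 1)) (fsum h (\<Sum>i\<in>C. m i)) (\<i> * of_real \<theta>)"

text \<open>A configuration of charge c carries the phase exp(\<i> \<theta> c), and integration over
  a full turn keeps c = 0 alone.\<close>

lemma fermion_integral:
  fixes m :: "'i \<Rightarrow> nat"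
  assumes h: "h > 0" and B: "finite B"
  shows "((\<lambda>\<theta>. of_real (zprod h N \<theta>) * pexp (kappaN m h N \<theta>) B) has_integral
     of_real (2 * pi * (\<Sum>T\<in>neutral_upto N. exp (- h * energy T) * pmoment m B T))) {- pi..pi}"
proof -
  let ?K = "Pow {- int N..<int N}"
  have fT: "finite T" if "T \<in> ?K" for T using that by (auto intro: finite_subset)
  have e: "of_real (zprod h N \<theta>) * pexp (kappaN m h N \<theta>) B =
     (\<Sum>T\<in>?K. of_real (exp (- h * energy T) * pmoment m B T) * exp (\<i> * of_real (\<theta> * (\<Sum>s\<in>T. charge s))))" for \<theta>
  proof -
    have "of_real (zprod h N \<theta>) * pexp (kappaN m h N \<theta>) B = (\<Sum>T\<in>?K. (\<Prod>s\<in>T. site_weight h (\<i> * of_real \<theta>) s) *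
      (\<Prod>i\<in>B. of_real (pconst (m i)) + (\<Sum>s\<in>T. of_real (charge s * site_pos s ^ m i))))"
      unfolding fermion_moments[OF h imag_in_fdom[OF h] B] prod_site_weight_zprod kappaN_def[abs_def] ..
    also have "\<dots> = (\<Sum>T\<in>?K. of_real (exp (- h * energy T) * pmoment m B T) * exp (\<i> * of_real (\<theta> * (\<Sum>s\<in>T. charge s))))"
    proof (intro sum.cong refl)
      fix T assume T: "T \<in> ?K"
      show "(\<Prod>s\<in>T. site_weight h (\<i> * of_real \<theta>) s) * (\<Prod>i\<in>B. of_real (pconst (m i)) + (\<Sum>s\<in>T. of_real (charge s * site_pos s ^ m i))) =
         of_real (exp (- h * energy T) * pmoment m B T) * exp (\<i> * of_real (\<theta> * (\<Sum>s\<in>T. charge s)))"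
        unfolding prod_site_weight_subset[OF fT[OF T]] by (simp add: pmoment_def)
    qed
    finally show ?thesis .
  qed
  have "((\<lambda>\<theta>. \<Sum>T\<in>?K. of_real (exp (- h * energy T) * pmoment m B T) * exp (\<i> * of_real (\<theta> * (\<Sum>s\<in>T. charge s)))) has_integral
     (\<Sum>T\<in>?K. of_real (exp (- h * energy T) * pmoment m B T) * (if (\<Sum>s\<in>T. charge s) = 0 then of_real (2 * pi) else 0))) {- pi..pi}"
    by (intro has_integral_sum has_integral_mult_right integral_exp_i charge_sum_Ints) auto
  also have "(\<Sum>T\<in>?K. of_real (exp (- h * energy T) * pmoment m B T) * (if (\<Sum>s\<in>T. charge s) = 0 then of_real (2 * pi) else 0 :: complex))
     = (\<Sum>T\<in>neutral_upto N. of_real (exp (- h * energy T) * pmoment m B T) * of_real (2 * pi))"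
    unfolding neutral_upto_def by (subst sum.inter_filter) (auto intro!: sum.cong)
  also have "\<dots> = of_real (2 * pi * (\<Sum>T\<in>neutral_upto N. exp (- h * energy T) * pmoment m B T))"
    by (simp add: sum_distrib_left mult_ac)
  finally show ?thesis unfolding e .
qed

text \<open>The imaginary axis \<open>y = \<i> \<theta>\<close> is where the neutral configurations are extracted; there the partition function
  ratio is the exponential of the integrated charge current.\<close>

definition ratioN :: "real \<Rightarrow> nat \<Rightarrow> real \<Rightarrow> real" where
  "ratioN h N \<theta> = zprod h N \<theta> / zprod h N 0"

text \<open>The derivative of ln \<open>zprod\<close> in \<theta>: \<open>gpart\<close> with
  exponent 0 is the mean charge, as \<open>pconst 0\<close> vanishes.\<close>

definition slopeN :: "real \<Rightarrow> nat \<Rightarrow> real \<Rightarrow> real" where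
  "slopeN h N t = Re (\<i> * gpart h 0 N (\<i> * of_real t))"

definition slope :: "real \<Rightarrow> real \<Rightarrow> real" where
  "slope h t = Re (\<i> * fsum h 0 (\<i> * of_real t))"

definition ratio :: "real \<Rightarrow> real \<Rightarrow> real" where
  "ratio h \<theta> = exp (integral {0..\<bar>\<theta>\<bar>} (slope h))"

text \<open>Every \<open>zfac\<close> increases with cos \<theta>, which gives all comparisons
  without any estimate of sums.\<close>

lemma ratioN_bounds:
  assumes h: "h > 0"
  shows "ratioN h N \<theta> > 0" "ratioN h N \<theta> \<le> 1" "ratioN h N (- \<theta>) = ratioN h N \<theta>"
    "1 \<le> \<bar>\<theta>\<bar> \<Longrightarrow> \<bar>\<theta>\<bar> \<le> pi \<Longrightarrow> ratioN h N \<theta> \<le> ratioN h N 1"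
proof -
  show "ratioN h N \<theta> > 0" using zprod_pos[OF h] by (simp add: ratioN_def)
  have mono: "zprod h N a \<le> zprod h N b" if "cos a \<le> cos b" for a b
    unfolding zprod_def using that zfac_pos[OF h] by (intro prod_mono) (auto simp: zfac_def less_imp_le)
  show "ratioN h N \<theta> \<le> 1" using mono[of \<theta> 0] zprod_pos[OF h, of N 0] by (simp add: ratioN_def)
  show "ratioN h N (- \<theta>) = ratioN h N \<theta>" by (simp add: ratioN_def zprod_def zfac_def)
  assume t: "1 \<le> \<bar>\<theta>\<bar>" "\<bar>\<theta>\<bar> \<le> pi"
  then have "cos \<bar>\<theta>\<bar> \<le> cos 1" by (intro cos_monotone_0_pi_le) auto
  then show "ratioN h N \<theta> \<le> ratioN h N 1"
    using mono[of \<theta> 1] zprod_pos[OF h, of N 0] by (simp add: ratioN_def divide_right_mono)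
qed

text \<open>Brought to a common denominator, the two \<open>fermi\<close> terms of a level have
  denominator \<open>zfac\<close>; the summand is the derivative of ln \<open>zfac\<close>.\<close>

lemma slopeN_eq:
  assumes h: "h > 0"
  shows "slopeN h N t = (\<Sum>j<N. - 2 * exp (- h * half_odd j) * sin t / zfac h j t)"
proof -
  have "\<i> * gterm h 0 j (\<i> * of_real t) = of_real (- 2 * exp (- h * half_odd j) * sin t / zfac h j t)" for j
  proof -
    define x where "x = exp (- h * half_odd j)"
    define E where "E = exp (\<i> * of_real t)"
    define F where "F = exp (- (\<i> * of_real t))"
    have EF: "E * F = 1" by (simp add: E_def F_def exp_minus_inverse)
    have x0: "x > 0" by (simp add: x_def)
    have X: "exp (of_real (h * half_odd j)) = (1 / of_real x :: complex)"
      by (simp add: x_def exp_of_real[symmetric] exp_minus field_simps)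
    have 1: "exp (of_real (h * half_odd j) - \<i> * of_real t) = F / of_real x"
      unfolding exp_diff X using EF by (simp add: E_def[symmetric] F_def exp_minus field_simps)
    have 2: "exp (of_real (h * half_odd j) + \<i> * of_real t) = E / of_real x"
      unfolding exp_add X by (simp add: E_def)
    have n1: "F / of_real x + 1 \<noteq> 0" and n2: "E / of_real x + 1 \<noteq> 0"
      using fdom_nz[OF imag_in_fdom[OF h] h, of j t] unfolding 1 2 by auto
    have s: "E - F = 2 * \<i> * of_real (sin t)"
      by (simp add: E_def F_def exp_Euler sin_of_real cos_of_real exp_minus_Euler)
    have c: "E + F = 2 * of_real (cos t)"
      by (simp add: E_def F_def exp_Euler sin_of_real cos_of_real exp_minus_Euler)
    have "fermi (of_real (h * half_odd j) - \<i> * of_real t) - fermi (of_real (h * half_odd j) + \<i> * of_real t)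
      = (E / of_real x - F / of_real x) / ((F / of_real x + 1) * (E / of_real x + 1))"
      unfolding fermi_def 1 2 using n1 n2 by (simp add: field_simps)
    also have "(F / of_real x + 1) * (E / of_real x + 1) = (E * F + of_real x * (E + F) + of_real x ^ 2) / of_real x ^ 2"
      using x0 by (simp add: field_simps power2_eq_square)
    also have "E * F + of_real x * (E + F) + of_real x ^ 2 = of_real (zfac h j t)"
      unfolding EF c by (simp add: zfac_def x_def)
    also have "(E / of_real x - F / of_real x) / (of_real (zfac h j t) / of_real x ^ 2) = (E - F) * of_real x / of_real (zfac h j t)"
    proof -
      have "(a / y - b / y) / (z / y ^ 2) = (a - b) * y / z" if "y \<noteq> 0" for a b y z :: complex
        using that by (cases "z = 0") (simp_all add: field_simps power2_eq_square)
      from this[of "of_real x" E F "of_real (zfac h j t)"] show ?thesis using x0 by (simp only: of_real_eq_0_iff)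
    qed
    finally show ?thesis unfolding s by (simp add: gterm_def x_def mult_ac)
  qed
  then have "\<i> * gpart h 0 N (\<i> * of_real t) = of_real (\<Sum>j<N. - 2 * exp (- h * half_odd j) * sin t / zfac h j t)"
    unfolding gpart_def pconst_0 by (simp add: sum_distrib_left)
  then show ?thesis unfolding slopeN_def by (simp only: Re_complex_of_real)
qed

lemma ratioN_exp:
  assumes h: "h > 0"
  shows "ratioN h N \<theta> = exp (integral {0..\<bar>\<theta>\<bar>} (slopeN h N))"
proof -
  have "((\<lambda>t. ln (zfac h j t)) has_real_derivative - 2 * exp (- h * half_odd j) * sin t / zfac h j t) (at t within S)" for j t S
    unfolding zfac_def using zfac_pos[OF h, of j t]
    by (auto intro!: derivative_eq_intros simp: zfac_def field_simps)
  then have D: "((\<lambda>t. \<Sum>j<N. ln (zfac h j t)) has_real_derivative slopeN h N t) (at t within S)" for t S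
    unfolding slopeN_eq[OF h] by (intro DERIV_sum)
  have "(slopeN h N has_integral ((\<Sum>j<N. ln (zfac h j \<bar>\<theta>\<bar>)) - (\<Sum>j<N. ln (zfac h j 0)))) {0..\<bar>\<theta>\<bar>}"
    by (intro fundamental_theorem_of_calculus) (auto intro: D[unfolded has_real_derivative_iff_has_vector_derivative])
  then have i: "integral {0..\<bar>\<theta>\<bar>} (slopeN h N) = (\<Sum>j<N. ln (zfac h j \<bar>\<theta>\<bar>)) - (\<Sum>j<N. ln (zfac h j 0))"
    by (rule integral_unique)
  have z: "exp (\<Sum>j<N. ln (zfac h j t)) = zprod h N t" for t
    using zfac_pos[OF h] by (simp add: exp_sum zprod_def)
  have "zprod h N \<bar>\<theta>\<bar> = zprod h N \<theta>" by (simp add: zprod_def zfac_def)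
  then show ?thesis by (simp add: i exp_diff z ratioN_def)
qed

lemma slopeN_integrable: "h > 0 \<Longrightarrow> slopeN h N integrable_on {a..b}"
proof -
  assume h: "h > 0"
  have "zfac h j t \<noteq> 0" for j t using zfac_pos[OF h, of j t] by simp
  then have "continuous_on {a..b} (\<lambda>t. \<Sum>j<N. - 2 * exp (- h * half_odd j) * sin t / zfac h j t)"
    unfolding zfac_def by (intro continuous_intros) auto
  then show ?thesis using slopeN_eq[OF h, of N] by (simp add: integrable_continuous_real cong: integrable_cong)
qed

text \<open>The limit of the ratio is taken through its logarithmic derivative, where
  \<open>gpart_deriv_bounded\<close> gives a bound uniform in N.\<close>

lemma slope_integral_limit:
  assumes h: "0 < h" "h \<le> 1"
  shows "slope h integrable_on {a..b}" "(\<lambda>N. integral {a..b} (slopeN h N)) \<longlonglongrightarrow> integral {a..b} (slope h)"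
proof -
  obtain K where K: "\<And>N \<theta>. norm ((deriv ^^ 0) (gpart h 0 N) (\<i> * of_real \<theta>)) \<le> K"
    by (rule gpart_deriv_bounded[OF h, of 0 0]) blast
  have le: "norm (slopeN h N t) \<le> K" for N t
  proof -
    have "\<bar>Re (\<i> * gpart h 0 N (\<i> * of_real t))\<bar> \<le> norm (\<i> * gpart h 0 N (\<i> * of_real t))" by (rule abs_Re_le_cmod)
    also have "\<dots> \<le> K" using K[of N t] by (simp add: norm_mult)
    finally show ?thesis by (simp add: slopeN_def)
  qed
  have lim: "(\<lambda>N. slopeN h N t) \<longlonglongrightarrow> slope h t" for t
    unfolding slopeN_def slope_def using gpart_deriv_tendsto[OF h(1), of 0 0 t] by (intro tendsto_intros) simp
  show "slope h integrable_on {a..b}"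
    by (rule dominated_convergence(1)[where f = "slopeN h" and h = "\<lambda>_. K"])
       (use slopeN_integrable[OF h(1)] le lim in auto)
  show "(\<lambda>N. integral {a..b} (slopeN h N)) \<longlonglongrightarrow> integral {a..b} (slope h)"
    by (rule dominated_convergence(2)[where h = "\<lambda>_. K"])
       (use slopeN_integrable[OF h(1)] le lim in auto)
qed

lemma ratioN_tendsto: "0 < h \<Longrightarrow> h \<le> 1 \<Longrightarrow> (\<lambda>N. ratioN h N \<theta>) \<longlonglongrightarrow> ratio h \<theta>"
  by (simp add: ratioN_exp ratio_def tendsto_exp slope_integral_limit(2))

lemma ratio_bounds:
  assumes h: "0 < h" "h \<le> 1"
  shows "ratio h \<theta> > 0" "ratio h \<theta> \<le> 1" "1 \<le> \<bar>\<theta>\<bar> \<Longrightarrow> \<bar>\<theta>\<bar> \<le> pi \<Longrightarrow> ratio h \<theta> \<le> ratio h 1"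
proof -
  show "ratio h \<theta> > 0" by (simp add: ratio_def)
  show "ratio h \<theta> \<le> 1"
    by (rule LIMSEQ_le_const2[OF ratioN_tendsto[OF h]]) (use ratioN_bounds(2)[OF h(1)] in auto)
  assume t: "1 \<le> \<bar>\<theta>\<bar>" "\<bar>\<theta>\<bar> \<le> pi"
  show "ratio h \<theta> \<le> ratio h 1"
    by (rule LIMSEQ_le[OF ratioN_tendsto[OF h] ratioN_tendsto[OF h]]) (use ratioN_bounds(4)[OF h(1) t] in auto)
qed

lemma pexp_kappaN_bounded:
  fixes m :: "'i \<Rightarrow> nat"
  assumes h: "0 < h" "h \<le> 1" and B: "finite B"
  obtains K where "\<And>N \<theta>. norm (pexp (kappaN m h N \<theta>) B) \<le> K"
proof -
  have "\<exists>K. \<forall>N \<theta>. norm (kappaN m h N \<theta> C) \<le> K" for C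
    unfolding kappaN_def using gpart_deriv_bounded[OF h] by metis
  then obtain K where K: "\<And>C N \<theta>. norm (kappaN m h N \<theta> C) \<le> K C" by metis
  show ?thesis
  proof (rule that)
    fix N \<theta>
    show "norm (pexp (kappaN m h N \<theta>) B) \<le> (\<Sum>\<pi> | partition_on B \<pi>. \<Prod>C\<in>\<pi>. K C)"
      unfolding pexp_def
      by (rule order_trans[OF norm_sum], rule sum_mono) (simp add: prod_norm[symmetric] prod_mono K)
  qed
qed

lemma pexp_kappaN_tendsto:
  assumes "h > 0"
  shows "(\<lambda>N. pexp (kappaN m h N \<theta>) B) \<longlonglongrightarrow> pexp (kappa m h \<theta>) B"
  unfolding pexp_def kappaN_def kappa_def by (intro tendsto_intros gpart_deriv_tendsto assms)

definition bracket_integral :: "('i \<Rightarrow> nat) \<Rightarrow> real \<Rightarrow> 'i set \<Rightarrow> complex" where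
  "bracket_integral m h B = integral {- pi..pi} (\<lambda>\<theta>. of_real (ratio h \<theta>) * pexp (kappa m h \<theta>) B)"

text \<open>Division by \<open>zprod h N 0\<close> keeps the weight below 1, and the cumulants are
  bounded uniformly in N and \<theta>, so dominated convergence applies.\<close>

lemma bracket_integral_limit:
  fixes m :: "'i \<Rightarrow> nat"
  assumes h: "0 < h" "h \<le> 1" and B: "finite B"
  shows "(\<lambda>\<theta>. of_real (ratio h \<theta>) * pexp (kappa m h \<theta>) B) integrable_on {- pi..pi}"
    and "(\<lambda>N. of_real (2 * pi * (\<Sum>T\<in>neutral_upto N. exp (- h * energy T) * pmoment m B T) / zprod h N 0)) \<longlonglongrightarrow> bracket_integral m h B"
proof -
  have I: "((\<lambda>\<theta>. of_real (ratioN h N \<theta>) * pexp (kappaN m h N \<theta>) B) has_integral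
     of_real (2 * pi * (\<Sum>T\<in>neutral_upto N. exp (- h * energy T) * pmoment m B T) / zprod h N 0)) {- pi..pi}" for N
    using has_integral_divide[OF fermion_integral[OF h(1) B, of N m], of "of_real (zprod h N 0)"]
    by (simp add: ratioN_def)
  obtain K where K: "\<And>N \<theta>. norm (pexp (kappaN m h N \<theta>) B) \<le> K"
    by (rule pexp_kappaN_bounded[OF h B, of m]) blast
  have le: "norm (of_real (ratioN h N \<theta>) * pexp (kappaN m h N \<theta>) B) \<le> K" for N \<theta>
  proof -
    have "norm (of_real (ratioN h N \<theta>) * pexp (kappaN m h N \<theta>) B) \<le> 1 * K"
      unfolding norm_mult using ratioN_bounds(1,2)[OF h(1), of N \<theta>] K by (intro mult_mono) auto
    then show ?thesis by simp
  qed
  have lim: "(\<lambda>N. of_real (ratioN h N \<theta>) * pexp (kappaN m h N \<theta>) B) \<longlonglongrightarrow> of_real (ratio h \<theta>) * pexp (kappa m h \<theta>) B" for \<theta>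
    by (intro tendsto_mult tendsto_of_real ratioN_tendsto h pexp_kappaN_tendsto)
  note dc = dominated_convergence[where f = "\<lambda>N \<theta>. of_real (ratioN h N \<theta>) * pexp (kappaN m h N \<theta>) B" and S = "{- pi..pi}"
     and g = "\<lambda>\<theta>. of_real (ratio h \<theta>) * pexp (kappa m h \<theta>) B" and h = "\<lambda>_. K"]
  show "(\<lambda>\<theta>. of_real (ratio h \<theta>) * pexp (kappa m h \<theta>) B) integrable_on {- pi..pi}"
    by (rule dc(1)) (use has_integral_integrable[OF I] le lim in auto)
  have "(\<lambda>N. integral {- pi..pi} (\<lambda>\<theta>. of_real (ratioN h N \<theta>) * pexp (kappaN m h N \<theta>) B)) \<longlonglongrightarrow> bracket_integral m h B"
    unfolding bracket_integral_def by (rule dc(2)) (use has_integral_integrable[OF I] le lim in auto)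
  then show "(\<lambda>N. of_real (2 * pi * (\<Sum>T\<in>neutral_upto N. exp (- h * energy T) * pmoment m B T) / zprod h N 0)) \<longlonglongrightarrow> bracket_integral m h B"
    unfolding integral_unique[OF I] .
qed

text \<open>The factors 2 pi / \<open>zprod h N 0\<close> are the same for B and for the empty set
  and cancel. The product form postpones the proof that the integral for the empty set does not
  vanish.\<close>

lemma q_bracket_bracket_integral:
  fixes m :: "'i \<Rightarrow> nat"
  assumes h: "0 < h" "h \<le> 1" and B: "finite B"
  shows "of_real (q_bracket (\<lambda>lam. \<Prod>i\<in>B. p (m i) lam) (exp (- h))) * bracket_integral m h {} = bracket_integral m h B"
proof (rule LIMSEQ_unique)
  let ?s = "\<lambda>N. \<Sum>T\<in>neutral_upto N. exp (- h * energy T) * pmoment m B T"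
  let ?t = "\<lambda>N. \<Sum>T\<in>neutral_upto N. exp (- h * energy T)"
  have t0: "?t N \<noteq> 0" for N
  proof -
    have "{} \<in> neutral_upto N" by (simp add: neutral_upto_def)
    then have "?t N > 0" using neutral_upto_subset(1) by (intro sum_pos) auto
    then show ?thesis by simp
  qed
  have "(\<lambda>N. of_real (?s N / ?t N) * of_real (2 * pi * ?t N / zprod h N 0)) \<longlonglongrightarrow>
     of_real (q_bracket (\<lambda>lam. \<Prod>i\<in>B. p (m i) lam) (exp (- h))) * bracket_integral m h {}"
    using bracket_integral_limit(2)[OF h, of "{}" m] by (intro tendsto_mult tendsto_of_real q_bracket_limit B h) (simp add: pmoment_def)
  moreover have "of_real (?s N / ?t N) * of_real (2 * pi * ?t N / zprod h N 0) = (of_real (2 * pi * ?s N / zprod h N 0) :: complex)" for N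
  proof -
    have "a / b * (c * b / d) = c * a / d" if "b \<noteq> 0" for a b c d :: real using that by simp
    from this[OF t0] show ?thesis by (simp only: of_real_mult[symmetric])
  qed
  ultimately show "(\<lambda>N. of_real (2 * pi * ?s N / zprod h N 0)) \<longlonglongrightarrow>
     of_real (q_bracket (\<lambda>lam. \<Prod>i\<in>B. p (m i) lam) (exp (- h))) * bracket_integral m h {}" by (simp only:)
  show "(\<lambda>N. of_real (2 * pi * ?s N / zprod h N 0)) \<longlonglongrightarrow> bracket_integral m h B" by (rule bracket_integral_limit(2)[OF h B])
qed

section \<open>Gaussian approximation of the integral\<close>

lemma exp_small_disj:
  assumes "exp_small X F" "exp_small Y F"
  shows "exp_small (\<lambda>h x. X h x \<or> Y h x) F"
proof -
  obtain K1 c1 where 1: "K1 \<ge> 0" "c1 > 0" "\<And>h x. 0 < h \<Longrightarrow> h \<le> 1 \<Longrightarrow> X h x \<Longrightarrow> norm (F h x) \<le> K1 * exp (- c1 / h)"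
    using assms(1) by (rule exp_small_E) blast
  obtain K2 c2 where 2: "K2 \<ge> 0" "c2 > 0" "\<And>h x. 0 < h \<Longrightarrow> h \<le> 1 \<Longrightarrow> Y h x \<Longrightarrow> norm (F h x) \<le> K2 * exp (- c2 / h)"
    using assms(2) by (rule exp_small_E) blast
  show ?thesis
  proof (rule exp_small_I[where c = "min c1 c2" and K = "max K1 K2"])
    fix h x assume h: "0 < h" "h \<le> 1" "X h x \<or> Y h x"
    have "K1 * exp (- c1 / h) \<le> max K1 K2 * exp (- min c1 c2 / h)"
      "K2 * exp (- c2 / h) \<le> max K1 K2 * exp (- min c1 c2 / h)"
      using h 1 2 by (intro mult_mono; simp add: divide_right_mono)+
    with h(3) 1(3)[OF h(1,2), of x] 2(3)[OF h(1,2), of x] show "norm (F h x) \<le> max K1 K2 * exp (- min c1 c2 / h)"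
      by linarith
  qed (use 1 2 in auto)
qed

lemma exp_small_integral:
  fixes a b :: real
  assumes "exp_small (\<lambda>h \<theta>. a \<le> \<theta> \<and> \<theta> \<le> b) F" "a \<le> b"
    and int: "\<And>h. 0 < h \<Longrightarrow> h \<le> 1 \<Longrightarrow> F h integrable_on {a..b}"
  shows "exp_small X (\<lambda>h x. integral {a..b} (F h))"
proof -
  obtain K c where K: "K \<ge> 0" "c > 0" "\<And>h x. 0 < h \<Longrightarrow> h \<le> 1 \<Longrightarrow> a \<le> x \<and> x \<le> b \<Longrightarrow> norm (F h x) \<le> K * exp (- c / h)"
    using assms(1) by (rule exp_small_E) blast
  show ?thesis
  proof (rule exp_small_I[OF K(2), where K = "K * (b - a)"])
    fix h :: real assume h: "0 < h" "h \<le> 1"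
    have "norm (integral {a..b} (F h)) \<le> K * exp (- c / h) * measure lborel {a..b}"
      using K(1) by (intro has_integral_bound_real[where f = "F h"] integrable_integral int h K(3)) auto
    then show "norm (integral {a..b} (F h)) \<le> K * (b - a) * exp (- c / h)"
      using \<open>a \<le> b\<close> by (simp add: mult_ac)
  qed
qed

section \<open>Comparison of the weight with the Gaussian\<close>

definition gauss :: "real \<Rightarrow> real \<Rightarrow> real" where
  "gauss h \<theta> = exp (- \<theta>\<^sup>2 / (2 * h))"

lemma gauss_bounds: "h > 0 \<Longrightarrow> 0 < gauss h \<theta> \<and> gauss h \<theta> \<le> 1"
  by (simp add: gauss_def)

lemma norm_gauss: "norm (complex_of_real (gauss h \<theta>)) = gauss h \<theta>"
  by (simp add: gauss_def)

lemma gauss_far: "h > 0 \<Longrightarrow> 1 \<le> \<bar>\<theta>\<bar> \<Longrightarrow> gauss h \<theta> \<le> exp (- (1 / 2) / h)"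
proof -
  assume "h > 0" "1 \<le> \<bar>\<theta>\<bar>"
  then have "1 \<le> \<theta>\<^sup>2" using power_mono[of 1 "\<bar>\<theta>\<bar>" 2] by simp
  then show "gauss h \<theta> \<le> exp (- (1 / 2) / h)" using \<open>h > 0\<close> by (simp add: gauss_def field_simps)
qed

lemma mainpoly_0: "mainpoly 0 = [:0, 1:]"
proof (rule poly_eqI)
  fix j
  show "coeff (mainpoly 0) j = coeff [:0, 1:] j"
  proof (cases "j \<le> 1")
    case True
    then show ?thesis using zfrak_odd[of 1] zfrak_0 by (auto simp: coeff_mainpoly le_Suc_eq)
  next
    case False
    then show ?thesis using degree_mainpoly[of 0] by (simp add: coeff_eq_0)
  qed
qed

lemma abs_exp_diff_le:
  fixes a b :: real
  assumes "a \<le> 0" "b \<le> 0"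
  shows "\<bar>exp a - exp b\<bar> \<le> \<bar>a - b\<bar>"
proof -
  have "exp a - exp b \<le> a - b" if "b \<le> a" "a \<le> 0" for a b :: real
  proof -
    have "1 - exp (b - a) \<le> a - b" using exp_ge_add_one_self[of "b - a"] by linarith
    moreover have "exp a - exp b = exp a * (1 - exp (b - a))" by (simp add: exp_diff algebra_simps)
    moreover have "exp a * (1 - exp (b - a)) \<le> 1 * (1 - exp (b - a))"
      using that by (intro mult_right_mono) auto
    ultimately show ?thesis by simp
  qed
  from this[of a b] this[of b a] show ?thesis using assms by (cases "a \<le> b") auto
qed

text \<open>As \<open>mainpoly 0\<close> is y, the slope is - t / h up to an exponentially small
  error, which is integrated in the exponent. Both exponents are nonpositive, where the exponential
  function is 1-Lipschitz.\<close>

lemma ratio_near_exp_small: "exp_small (\<lambda>h \<theta>. \<bar>\<theta>\<bar> \<le> 1) (\<lambda>h \<theta>. of_real (ratio h \<theta> - gauss h \<theta>))"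
proof -
  obtain K c where K: "K \<ge> 0" "c > 0" "\<And>h t. 0 < h \<Longrightarrow> h \<le> 1 \<Longrightarrow> \<bar>t\<bar> \<le> 1 \<Longrightarrow>
     norm ((deriv ^^ 0) (fsum h 0) (\<i> * of_real t)
     - poly (cpoly ((pderiv ^^ 0) (mainpoly 0))) (\<i> * of_real t) / of_real h ^ Suc 0) \<le> K * exp (- c / h)"
    using fsum_deriv_exp_small[of 0 0] by (rule exp_small_E) blast
  show ?thesis
  proof (rule exp_small_I[OF K(2), where K = K])
    fix h \<theta> :: real assume h: "0 < h" "h \<le> 1" and \<theta>: "\<bar>\<theta>\<bar> \<le> 1"
    have b: "norm (slope h t + t / h) \<le> K * exp (- c / h)" if "\<bar>t\<bar> \<le> 1" for t
    proof -
      have "slope h t + t / h = Re (\<i> * (fsum h 0 (\<i> * of_real t) - \<i> * of_real t / of_real h))"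
        by (simp add: slope_def right_diff_distrib)
      also have "norm \<dots> \<le> norm (\<i> * (fsum h 0 (\<i> * of_real t) - \<i> * of_real t / of_real h))"
        unfolding real_norm_def by (rule abs_Re_le_cmod)
      also have "\<dots> \<le> K * exp (- c / h)"
        using K(3)[OF h that] by (simp add: norm_mult mainpoly_0 map_poly_pCons)
      finally show ?thesis .
    qed
    have "((\<lambda>t. t / h) has_integral ((\<bar>\<theta>\<bar>)\<^sup>2 / (2 * h) - 0\<^sup>2 / (2 * h))) {0..\<bar>\<theta>\<bar>}"
      using h by (intro fundamental_theorem_of_calculus)
        (auto intro!: derivative_eq_intros simp: has_real_derivative_iff_has_vector_derivative[symmetric])
    from has_integral_add[OF integrable_integral[OF slope_integral_limit(1)[OF h]] this]
    have I: "((\<lambda>t. slope h t + t / h) has_integral (integral {0..\<bar>\<theta>\<bar>} (slope h) - (- \<theta>\<^sup>2 / (2 * h)))) {0..\<bar>\<theta>\<bar>}"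
      by simp
    have "\<bar>ratio h \<theta> - gauss h \<theta>\<bar> \<le> \<bar>integral {0..\<bar>\<theta>\<bar>} (slope h) - (- \<theta>\<^sup>2 / (2 * h))\<bar>"
      unfolding ratio_def gauss_def
    proof (rule abs_exp_diff_le)
      show "integral {0..\<bar>\<theta>\<bar>} (slope h) \<le> 0" using ratio_bounds(2)[OF h, of \<theta>] by (simp add: ratio_def)
    qed (use h in simp)
    also have "\<dots> = norm (integral {0..\<bar>\<theta>\<bar>} (slope h) - (- \<theta>\<^sup>2 / (2 * h)))" by simp
    also have "\<dots> \<le> K * exp (- c / h) * measure lborel {0..\<bar>\<theta>\<bar>}"
      using K(1) \<theta> by (intro has_integral_bound_real[OF _ finite.emptyI I] b) auto
    also have "\<dots> \<le> K * exp (- c / h) * 1" using K(1) \<theta> by (intro mult_left_mono) auto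
    finally show "norm (of_real (ratio h \<theta> - gauss h \<theta>) :: complex) \<le> K * exp (- c / h)"
      by (simp only: norm_of_real mult_1_right)
  qed
qed

text \<open>For |\<theta>| between 1 and pi monotonicity replaces the expansion: the ratio is at
  most its value at 1, which is close to the Gaussian there, and both weights are exponentially
  small.\<close>

lemma ratio_exp_small: "exp_small (\<lambda>h \<theta>. \<bar>\<theta>\<bar> \<le> pi) (\<lambda>h \<theta>. of_real (ratio h \<theta> - gauss h \<theta>))"
proof -
  let ?X = "\<lambda>h \<theta>. 1 \<le> \<bar>\<theta>::real\<bar> \<and> \<bar>\<theta>\<bar> \<le> pi"
  let ?E = "of_real :: real \<Rightarrow> complex"
  have "exp_small ?X (\<lambda>h \<theta>. ?E \<bar>ratio h 1 - gauss h 1\<bar> + (?E (exp (- (1 / 2) / h)) + ?E (exp (- (1 / 2) / h))))"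
  proof (intro exp_small_add exp_small_exp)
    show "exp_small ?X (\<lambda>h \<theta>. ?E \<bar>ratio h 1 - gauss h 1\<bar>)"
    proof -
      obtain K c where K: "K \<ge> 0" "c > 0" "\<And>h t. 0 < h \<Longrightarrow> h \<le> 1 \<Longrightarrow> \<bar>t\<bar> \<le> 1 \<Longrightarrow> norm (?E (ratio h t - gauss h t)) \<le> K * exp (- c / h)"
        using ratio_near_exp_small by (rule exp_small_E) blast
      show ?thesis by (rule exp_small_I[OF K(2), where K = K]) (use K(3)[of _ 1] in \<open>simp flip: of_real_diff\<close>)
    qed
  qed simp_all
  then have "exp_small ?X (\<lambda>h \<theta>. of_real (ratio h \<theta> - gauss h \<theta>))"
  proof (rule exp_small_mono, intro conjI)
    fix h \<theta> :: real assume h: "0 < h" "h \<le> 1" and X: "1 \<le> \<bar>\<theta>\<bar> \<and> \<bar>\<theta>\<bar> \<le> pi"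
    have "\<bar>ratio h \<theta> - gauss h \<theta>\<bar> \<le> \<bar>ratio h 1 - gauss h 1\<bar> + (exp (- (1 / 2) / h) + exp (- (1 / 2) / h))"
      using ratio_bounds(1,3)[OF h, of \<theta>] gauss_bounds[OF h(1), of \<theta>] gauss_far[OF h(1), of \<theta>] gauss_far[OF h(1), of 1] X by linarith
    also have "\<dots> = norm (?E (\<bar>ratio h 1 - gauss h 1\<bar> + (exp (- (1 / 2) / h) + exp (- (1 / 2) / h))))"
      by (simp only: norm_of_real) simp
    finally show "norm (?E (ratio h \<theta> - gauss h \<theta>)) \<le> norm (?E \<bar>ratio h 1 - gauss h 1\<bar> + (?E (exp (- (1 / 2) / h)) + ?E (exp (- (1 / 2) / h))))"
      by (simp only: norm_of_real of_real_add)
  qed auto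
  from exp_small_disj[OF ratio_near_exp_small this] show ?thesis
    by (rule exp_small_mono) auto
qed

text \<open>The main term of the joint cumulant of the observables in C, stripped of its power of
  h.\<close>

definition gpoly :: "('i \<Rightarrow> nat) \<Rightarrow> 'i set \<Rightarrow> real poly" where
  "gpoly m C = (pderiv ^^ (card C - 1)) (mainpoly (\<Sum>i\<in>C. m i))"

definition kmain :: "('i \<Rightarrow> nat) \<Rightarrow> real \<Rightarrow> real \<Rightarrow> 'i set \<Rightarrow> complex" where
  "kmain m h \<theta> C = poly (cpoly (gpoly m C)) (\<i> * of_real \<theta>) / of_real h ^ Suc (\<Sum>i\<in>C. m i)"

lemma kappa_exp_small: "exp_small (\<lambda>h \<theta>. \<bar>\<theta>\<bar> \<le> 1) (\<lambda>h \<theta>. kappa m h \<theta> C - kmain m h \<theta> C)"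
  unfolding kappa_def kmain_def gpoly_def by (rule fsum_deriv_exp_small)

lemma kappa_poly_bounded: "poly_bounded X (\<lambda>h \<theta>. kappa m h \<theta> C)"
  unfolding kappa_def by (rule poly_bounded_mono[OF fsum_deriv_poly_bounded[where r = "card C - 1" and m = "\<Sum>i\<in>C. m i"]]) simp

lemma poly_imag_poly_bounded: "poly_bounded (\<lambda>h \<theta>. \<bar>\<theta>\<bar> \<le> pi) (\<lambda>h \<theta>. poly q (\<i> * of_real \<theta>))"
proof -
  have "poly_bounded (\<lambda>h \<theta>. \<bar>\<theta>\<bar> \<le> pi) (\<lambda>h \<theta>. \<i> * of_real \<theta>)"
    by (rule poly_bounded_I[where K = pi and N = 0]) (simp add: norm_mult)
  then show ?thesis unfolding poly_altdef
    by (intro poly_bounded_sum) (rule poly_bounded_mult[OF poly_bounded_const poly_bounded_power])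
qed

lemma kmain_poly_bounded: "poly_bounded (\<lambda>h \<theta>. \<bar>\<theta>\<bar> \<le> pi) (\<lambda>h \<theta>. kmain m h \<theta> C)"
proof -
  have "kmain m = (\<lambda>h \<theta> C. poly (cpoly (gpoly m C)) (\<i> * of_real \<theta>) * (1 / of_real h) ^ Suc (\<Sum>i\<in>C. m i))"
    by (simp add: kmain_def[abs_def] power_one_over)
  then show ?thesis by (simp only:) (intro poly_bounded_mult poly_imag_poly_bounded poly_bounded_power poly_bounded_inverse)
qed

lemma poly_bounded_pexp: "(\<And>C. poly_bounded X (\<lambda>h x. \<kappa> h x C)) \<Longrightarrow> poly_bounded X (\<lambda>h x. pexp (\<kappa> h x) B)"
  unfolding pexp_def by (intro poly_bounded_sum poly_bounded_prod)

lemma exp_small_pexp_diff: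
  assumes "\<And>C. exp_small X (\<lambda>h x. \<kappa> h x C - \<mu> h x C)" "\<And>C. poly_bounded X (\<lambda>h x. \<mu> h x C)"
  shows "exp_small X (\<lambda>h x. pexp (\<kappa> h x) B - pexp (\<mu> h x) B)"
  unfolding pexp_def sum_subtractf[symmetric] by (intro exp_small_sum exp_small_prod_diff assms)

text \<open>Written as (ratio - gauss) P + gauss (P - Q): the first difference is small on the whole
  turn; P - Q is small for |\<theta>| at most 1 and polynomially bounded beyond, where the Gaussian
  itself is small.\<close>

lemma integrand_exp_small:
  "exp_small (\<lambda>h \<theta>. \<bar>\<theta>\<bar> \<le> pi) (\<lambda>h \<theta>. of_real (ratio h \<theta>) * pexp (kappa m h \<theta>) B - of_real (gauss h \<theta>) * pexp (kmain m h \<theta>) B)"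
proof -
  let ?P = "\<lambda>h \<theta>. pexp (kappa m h \<theta>) B" and ?Q = "\<lambda>h \<theta>. pexp (kmain m h \<theta>) B"
  let ?X = "\<lambda>(h::real) \<theta>. \<bar>\<theta>::real\<bar> \<le> pi"
  have near: "exp_small (\<lambda>h \<theta>. \<bar>\<theta>\<bar> \<le> 1) (\<lambda>h \<theta>. of_real (gauss h \<theta>) * (?P h \<theta> - ?Q h \<theta>))"
  proof (intro poly_bounded_mult_exp_small exp_small_pexp_diff kappa_exp_small)
    show "poly_bounded (\<lambda>h \<theta>. \<bar>\<theta>\<bar> \<le> 1) (\<lambda>h \<theta>. complex_of_real (gauss h \<theta>))"
      by (rule poly_bounded_I[where K = 1 and N = 0]) (simp add: norm_gauss gauss_bounds del: norm_of_real)
    show "poly_bounded (\<lambda>h \<theta>. \<bar>\<theta>\<bar> \<le> 1) (\<lambda>h \<theta>. kmain m h \<theta> C)" for C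
      by (rule poly_bounded_mono[OF kmain_poly_bounded]) (use pi_ge_two in auto)
  qed
  have far: "exp_small (\<lambda>h \<theta>. 1 \<le> \<bar>\<theta>\<bar> \<and> \<bar>\<theta>\<bar> \<le> pi) (\<lambda>h \<theta>. of_real (gauss h \<theta>) * (?P h \<theta> - ?Q h \<theta>))"
  proof (intro exp_small_mult_poly_bounded)
    show "exp_small (\<lambda>h \<theta>. 1 \<le> \<bar>\<theta>\<bar> \<and> \<bar>\<theta>\<bar> \<le> pi) (\<lambda>h \<theta>. complex_of_real (gauss h \<theta>))"
      by (rule exp_small_I[where K = 1 and c = "1 / 2"]) (use gauss_far in \<open>simp_all add: norm_gauss del: norm_of_real\<close>)
    have "poly_bounded ?X (\<lambda>h \<theta>. ?P h \<theta> + (- 1) * ?Q h \<theta>)"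
      by (intro poly_bounded_add poly_bounded_mult poly_bounded_const poly_bounded_pexp kappa_poly_bounded kmain_poly_bounded)
    then show "poly_bounded (\<lambda>h \<theta>. 1 \<le> \<bar>\<theta>\<bar> \<and> \<bar>\<theta>\<bar> \<le> pi) (\<lambda>h \<theta>. ?P h \<theta> - ?Q h \<theta>)"
      by (rule poly_bounded_mono) auto
  qed
  have "exp_small ?X (\<lambda>h \<theta>. of_real (ratio h \<theta> - gauss h \<theta>) * ?P h \<theta> + of_real (gauss h \<theta>) * (?P h \<theta> - ?Q h \<theta>))"
  proof (rule exp_small_add)
    show "exp_small ?X (\<lambda>h \<theta>. of_real (ratio h \<theta> - gauss h \<theta>) * ?P h \<theta>)"
      by (intro exp_small_mult_poly_bounded ratio_exp_small poly_bounded_pexp kappa_poly_bounded)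
    show "exp_small ?X (\<lambda>h \<theta>. of_real (gauss h \<theta>) * (?P h \<theta> - ?Q h \<theta>))"
      by (rule exp_small_mono[OF exp_small_disj[OF near far]]) auto
  qed
  then show ?thesis by (rule exp_small_mono) (simp add: algebra_simps)
qed

section \<open>Gaussian integrals truncated to one turn\<close>

definition gauss_integral :: "real \<Rightarrow> real poly \<Rightarrow> complex" where
  "gauss_integral h \<phi> = integral {- pi..pi} (\<lambda>\<theta>. of_real (gauss h \<theta>) * poly (cpoly \<phi>) (\<i> * of_real \<theta>))"

lemma gauss_integral_integrable: "h > 0 \<Longrightarrow> (\<lambda>\<theta>. of_real (gauss h \<theta>) * poly q (\<i> * of_real \<theta>)) integrable_on {a..b}"
  unfolding gauss_def by (intro integrable_continuous_real continuous_intros) auto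

lemma poly_cpoly_add: "poly (cpoly (a + b)) z = poly (cpoly a) z + poly (cpoly b) z"
  by (induction a b rule: poly_induct2) (auto simp: map_poly_pCons algebra_simps)

lemma poly_cpoly_smult: "poly (cpoly (smult c a)) z = of_real c * poly (cpoly a) z"
  by (induction a) (auto simp: map_poly_pCons algebra_simps)

lemma poly_cpoly_mult: "poly (cpoly (a * b)) z = poly (cpoly a) z * poly (cpoly b) z"
  by (induction a) (auto simp: map_poly_pCons poly_cpoly_add poly_cpoly_smult algebra_simps)

lemma poly_cpoly_prod: "poly (cpoly (\<Prod>x\<in>A. f x)) z = (\<Prod>x\<in>A. poly (cpoly (f x)) z)"
  by (induction A rule: infinite_finite_induct) (auto simp: poly_cpoly_mult)

lemma gauss_integral_add: "h > 0 \<Longrightarrow> gauss_integral h (a + b) = gauss_integral h a + gauss_integral h b"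
  unfolding gauss_integral_def poly_cpoly_add distrib_left by (intro integral_add gauss_integral_integrable)

lemma gauss_integral_smult: "gauss_integral h (smult c a) = of_real c * gauss_integral h a"
  unfolding gauss_integral_def poly_cpoly_smult integral_mult_right[symmetric] by (simp add: mult_ac)

text \<open>The integration by parts behind \<open>gauss_mean_pCons_0\<close>, now with boundary
  terms at - pi and pi that carry the small factor \<open>gauss h pi\<close>.\<close>

lemma gauss_integral_pCons_0:
  assumes h: "h > 0"
  shows "gauss_integral h (pCons 0 \<phi>) = - of_real h * gauss_integral h (pderiv \<phi>) - \<i> * of_real h * of_real (gauss h pi) *
     (poly (cpoly \<phi>) (\<i> * of_real pi) - poly (cpoly \<phi>) (- (\<i> * of_real pi)))"
proof -
  let ?f = "\<lambda>z::complex. - \<i> * of_real h * (exp (- z\<^sup>2 / (2 * of_real h)) * poly (cpoly \<phi>) (\<i> * z))"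
  let ?g = "\<lambda>z::complex. exp (- z\<^sup>2 / (2 * of_real h)) * poly (cpoly (pCons 0 \<phi>)) (\<i> * z) +
     of_real h * (exp (- z\<^sup>2 / (2 * of_real h)) * poly (cpoly (pderiv \<phi>)) (\<i> * z))"
  have ex: "exp (- (of_real \<theta>)\<^sup>2 / (2 * of_real h)) = (of_real (gauss h \<theta>) :: complex)" for \<theta>
    by (simp add: gauss_def flip: exp_of_real)
  have "(?f has_field_derivative ?g z) (at z)" for z
    using h by (auto intro!: derivative_eq_intros poly_DERIV[THEN DERIV_chain2] simp: map_poly_pCons pderiv_cpoly field_simps)
  then have "((\<lambda>\<theta>. ?g (of_real \<theta>)) has_integral (?f (of_real pi) - ?f (of_real (- pi)))) {- pi..pi}"
    by (intro fundamental_theorem_of_calculus has_vector_derivative_real_field) auto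
  moreover have "((\<lambda>\<theta>. ?g (of_real \<theta>)) has_integral (gauss_integral h (pCons 0 \<phi>) + of_real h * gauss_integral h (pderiv \<phi>))) {- pi..pi}"
    unfolding ex gauss_integral_def by (intro has_integral_add has_integral_mult_right integrable_integral gauss_integral_integrable h)
  ultimately have "gauss_integral h (pCons 0 \<phi>) + of_real h * gauss_integral h (pderiv \<phi>) = ?f (of_real pi) - ?f (of_real (- pi))"
    using has_integral_unique by blast
  also have "\<dots> = - \<i> * of_real h * of_real (gauss h pi) *
     (poly (cpoly \<phi>) (\<i> * of_real pi) - poly (cpoly \<phi>) (- (\<i> * of_real pi)))"
    unfolding ex by (simp add: gauss_def algebra_simps)
  finally show ?thesis by (simp add: algebra_simps)
qed

text \<open>Both functionals obey the same recursion up to the boundary terms, so they are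
  proportional up to a small error, with the integral of 1 as factor; this factor cancels in the
  brackets.\<close>

lemma gauss_integral_gauss_mean_exp_small: "exp_small X (\<lambda>h x. gauss_integral h \<phi> - of_real (gauss_mean h \<phi>) * gauss_integral h 1)"
proof (induction "degree \<phi>" arbitrary: \<phi> rule: less_induct)
  case less
  obtain a \<psi> where \<phi>: "\<phi> = pCons a \<psi>" by (cases \<phi>)
  show ?case
  proof (cases "\<psi> = 0")
    case True
    have "\<phi> = smult a 1" by (simp add: \<phi> True)
    then have "gauss_integral h \<phi> - of_real (gauss_mean h \<phi>) * gauss_integral h 1 = 0" for h
      by (simp only: gauss_integral_smult gauss_mean_smult gauss_mean_1) simp
    then show ?thesis by (simp add: exp_small_0)
  next
    case False
    then have "degree (pderiv \<psi>) < degree \<phi>" by (simp add: \<phi> degree_pderiv)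
    note IH = less[OF this]
    let ?D = "poly (cpoly \<psi>) (\<i> * of_real pi) - poly (cpoly \<psi>) (- (\<i> * of_real pi))"
    have "exp_small X (\<lambda>h x. - of_real h * (gauss_integral h (pderiv \<psi>) - of_real (gauss_mean h (pderiv \<psi>)) * gauss_integral h 1)
       - of_real h * of_real (gauss h pi) * (\<i> * ?D))"
    proof -
      have h: "poly_bounded X (\<lambda>h x. - complex_of_real h)" "poly_bounded X (\<lambda>h x. complex_of_real h)"
        by (rule poly_bounded_I[where K = 1 and N = 0], simp)+
      have g: "exp_small X (\<lambda>h x. complex_of_real (gauss h pi))"
        by (rule exp_small_I[where K = 1 and c = "1 / 2"])
           (use gauss_far[of _ pi] pi_ge_two in \<open>simp_all add: norm_gauss del: norm_of_real\<close>)
      show ?thesis by (rule exp_small_diff[OF poly_bounded_mult_exp_small[OF h(1) IH] exp_small_mult_poly_bounded[OF poly_bounded_mult_exp_small[OF h(2) g] poly_bounded_const]])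
    qed
    then show ?thesis
    proof (rule exp_small_mono, intro conjI)
      fix h x assume h: "0 < (h::real)" "h \<le> 1" "X h x"
      show "X h x" by fact
      have \<phi>': "\<phi> = smult a 1 + pCons 0 \<psi>" by (simp add: \<phi>)
      have "gauss_integral h \<phi> - of_real (gauss_mean h \<phi>) * gauss_integral h 1 = - of_real h * (gauss_integral h (pderiv \<psi>) - of_real (gauss_mean h (pderiv \<psi>)) * gauss_integral h 1)
       - of_real h * of_real (gauss h pi) * (\<i> * ?D)"
        unfolding \<phi>' gauss_integral_add[OF h(1)] gauss_mean_add gauss_integral_smult gauss_mean_smult gauss_integral_pCons_0[OF h(1)] gauss_mean_pCons_0 gauss_mean_1
        by (simp add: algebra_simps)
      then show "norm (gauss_integral h \<phi> - of_real (gauss_mean h \<phi>) * gauss_integral h 1) \<le> norm (- of_real h * (gauss_integral h (pderiv \<psi>) - of_real (gauss_mean h (pderiv \<psi>)) * gauss_integral h 1)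
       - of_real h * of_real (gauss h pi) * (\<i> * ?D))" by simp
    qed
  qed
qed

text \<open>On the interval from 0 to h one has \<theta>^2 \<le> h^2 \<le> h, so the weight is at
  least exp(- 1/2) there. The true order is the square root of h, but a bound by a power of h is
  enough for \<open>poly_bounded\<close>.\<close>

lemma gauss_integral_1_ge:
  assumes h: "0 < h" "h \<le> 1"
  shows "exp (- (1 / 2)) * h \<le> norm (gauss_integral h 1)"
proof -
  have i: "(gauss h) integrable_on {a..b}" for a b
    unfolding gauss_def by (intro integrable_continuous_real continuous_intros) (use h in auto)
  have "gauss_integral h 1 = integral {- pi..pi} (\<lambda>\<theta>. of_real (gauss h \<theta>))" by (simp add: gauss_integral_def)
  also have "\<dots> = of_real (integral {- pi..pi} (gauss h))"
    by (intro integral_unique has_integral_of_real integrable_integral i)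
  finally have g: "gauss_integral h 1 = of_real (integral {- pi..pi} (gauss h))" .
  have "exp (- (1 / 2)) * h = integral {0..h} (\<lambda>_. exp (- (1 / 2)))" using h by simp
  also have "\<dots> \<le> integral {0..h} (gauss h)"
  proof (intro integral_le i)
    fix \<theta> assume "\<theta> \<in> {0..h}"
    then have "\<theta> ^ 2 \<le> h * 1" unfolding power2_eq_square using h by (intro mult_mono) auto
    then show "exp (- (1 / 2)) \<le> gauss h \<theta>" using h by (simp add: gauss_def field_simps)
  qed auto
  also have "\<dots> \<le> integral {- pi..pi} (gauss h)"
    using h pi_ge_two by (intro integral_subset_le i) (auto simp: gauss_def)
  finally have le: "exp (- (1 / 2)) * h \<le> integral {- pi..pi} (gauss h)" .
  then show ?thesis using h by (simp add: g)
qed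

lemma gauss_integral_1_inverse_poly_bounded: "poly_bounded X (\<lambda>h x. 1 / gauss_integral h 1)"
proof (rule poly_bounded_I[where K = "exp (1 / 2)" and N = 1])
  fix h :: real assume h: "0 < h" "h \<le> 1"
  have p0: "0 < exp (- (1 / 2)) * h" using h by simp
  have "norm (1 / gauss_integral h 1) = 1 / norm (gauss_integral h 1)" by (simp add: norm_divide)
  also have "\<dots> \<le> 1 / (exp (- (1 / 2)) * h)"
    using gauss_integral_1_ge[OF h] p0 by (intro frac_le; linarith)
  also have "\<dots> = exp (1 / 2) / h ^ 1" by (simp add: exp_minus field_simps)
  finally show "norm (1 / gauss_integral h 1) \<le> exp (1 / 2) / h ^ 1" .
qed

section \<open>From integrals to brackets\<close>

definition qpoly :: "('i \<Rightarrow> nat) \<Rightarrow> real \<Rightarrow> 'i set \<Rightarrow> real poly" where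
  "qpoly m h = pexp (\<lambda>C. smult (1 / h ^ Suc (\<Sum>i\<in>C. m i)) (gpoly m C))"

lemma qpoly_altdef:
  "qpoly m h B = (\<Sum>\<pi> | partition_on B \<pi>. smult (\<Prod>C\<in>\<pi>. 1 / h ^ Suc (\<Sum>i\<in>C. m i)) (\<Prod>C\<in>\<pi>. gpoly m C))"
  unfolding qpoly_def pexp_def prod_smult ..

lemma pexp_kmain: "pexp (kmain m h \<theta>) B = poly (cpoly (qpoly m h B)) (\<i> * of_real \<theta>)"
proof -
  have s: "poly (cpoly (\<Sum>x\<in>A. f x)) z = (\<Sum>x\<in>A. poly (cpoly (f x)) z)" for A z and f :: "'z \<Rightarrow> real poly"
    by (induction A rule: infinite_finite_induct) (auto simp: poly_cpoly_add)
  show ?thesis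
    unfolding qpoly_def pexp_def kmain_def s poly_cpoly_prod poly_cpoly_smult by simp
qed

lemma gauss_integral_qpoly:
  assumes "h > 0"
  shows "gauss_integral h (qpoly m h B) = (\<Sum>\<pi> | partition_on B \<pi>. of_real (\<Prod>C\<in>\<pi>. 1 / h ^ Suc (\<Sum>i\<in>C. m i)) * gauss_integral h (\<Prod>C\<in>\<pi>. gpoly m C))"
proof -
  have "gauss_integral h 0 = 0" by (simp add: gauss_integral_def)
  then have s: "gauss_integral h (\<Sum>x\<in>A. f x) = (\<Sum>x\<in>A. gauss_integral h (f x))" for A and f :: "'z \<Rightarrow> real poly"
    by (induction A rule: infinite_finite_induct) (auto simp: gauss_integral_add[OF assms])
  show ?thesis unfolding qpoly_altdef s gauss_integral_smult ..
qed

lemma gauss_mean_qpoly: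
  "gauss_mean h (qpoly m h B) = (\<Sum>\<pi> | partition_on B \<pi>. (\<Prod>C\<in>\<pi>. 1 / h ^ Suc (\<Sum>i\<in>C. m i)) * gauss_mean h (\<Prod>C\<in>\<pi>. gpoly m C))"
  unfolding qpoly_altdef by (simp only: gauss_mean_sum gauss_mean_smult)

lemma weight_poly_bounded: "poly_bounded X (\<lambda>h x. of_real (\<Prod>C\<in>\<pi>. 1 / h ^ Suc (\<Sum>i\<in>C. m i)))"
proof -
  have e: "of_real (\<Prod>C\<in>\<pi>. 1 / h ^ Suc (\<Sum>i\<in>C. m i)) = (\<Prod>C\<in>\<pi>. (1 / complex_of_real h) ^ Suc (\<Sum>i\<in>C. m i))" for h
    by (simp add: power_one_over)
  show ?thesis unfolding e by (intro poly_bounded_prod poly_bounded_power poly_bounded_inverse)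
qed

lemma gauss_mean_qpoly_poly_bounded: "poly_bounded X (\<lambda>h x. of_real (gauss_mean h (qpoly m h B)))"
proof -
  have g: "poly_bounded X (\<lambda>h x. of_real (gauss_moment h j))" for j
  proof (induction j rule: gauss_moment.induct[where P = "\<lambda>_ j. poly_bounded X (\<lambda>h x. of_real (gauss_moment h j))" and ?a0.0 = "0::real"])
    case (3 h j)
    have "poly_bounded X (\<lambda>h x. complex_of_real h)"
      by (rule poly_bounded_I[where K = 1 and N = 0]) simp
    from poly_bounded_mult[OF poly_bounded_mult[OF this 3] poly_bounded_const] have "poly_bounded X (\<lambda>h x. of_real h * of_real (gauss_moment h j) * of_real (- real (Suc j)))" .
    moreover have "of_real (gauss_moment h (Suc (Suc j))) = complex_of_real h * of_real (gauss_moment h j) * of_real (- real (Suc j))" for h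
      by (simp add: algebra_simps)
    ultimately show ?case by (simp only:)
  qed (simp_all add: poly_bounded_const)
  have "poly_bounded X (\<lambda>h x. of_real (gauss_mean h \<phi>))" for \<phi>
    unfolding gauss_mean_def of_real_sum of_real_mult by (intro poly_bounded_sum poly_bounded_mult poly_bounded_const g)
  then show ?thesis unfolding gauss_mean_qpoly of_real_sum of_real_mult by (intro poly_bounded_sum poly_bounded_mult weight_poly_bounded)
qed

text \<open>As \<open>qpoly\<close> depends on h, the Gaussian comparison is made for each fixed
  product of \<open>gpoly\<close>, whose coefficients are powers of 1 / h.\<close>

lemma bracket_integral_exp_small:
  assumes B: "finite B"
  shows "exp_small X (\<lambda>h x. bracket_integral m h B - of_real (gauss_mean h (qpoly m h B)) * gauss_integral h 1)"
proof -
  have int: "(\<lambda>\<theta>. of_real (ratio h \<theta>) * pexp (kappa m h \<theta>) B) integrable_on {- pi..pi}"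
    "(\<lambda>\<theta>. of_real (gauss h \<theta>) * pexp (kmain m h \<theta>) B) integrable_on {- pi..pi}" if h: "0 < h" "h \<le> 1" for h
    using bracket_integral_limit(1)[OF h B, of m] gauss_integral_integrable[OF h(1)] by (simp_all only: pexp_kmain)
  have "exp_small X (\<lambda>h x. integral {- pi..pi} (\<lambda>\<theta>. of_real (ratio h \<theta>) * pexp (kappa m h \<theta>) B - of_real (gauss h \<theta>) * pexp (kmain m h \<theta>) B))"
    by (intro exp_small_integral integrable_diff int) (rule exp_small_mono[OF integrand_exp_small], auto)
  then have 1: "exp_small X (\<lambda>h x. bracket_integral m h B - gauss_integral h (qpoly m h B))"
  proof (rule exp_small_mono, intro conjI)
    fix h :: real and x assume h: "0 < h" "h \<le> 1" "X h x"
    show "X h x" by fact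
    show "norm (bracket_integral m h B - gauss_integral h (qpoly m h B)) \<le> norm (integral {- pi..pi} (\<lambda>\<theta>. of_real (ratio h \<theta>) * pexp (kappa m h \<theta>) B - of_real (gauss h \<theta>) * pexp (kmain m h \<theta>) B))"
      unfolding integral_diff[OF int[OF h(1,2)]] unfolding bracket_integral_def gauss_integral_def pexp_kmain by (rule order_refl)
  qed
  have "exp_small X (\<lambda>h x. \<Sum>\<pi> | partition_on B \<pi>. of_real (\<Prod>C\<in>\<pi>. 1 / h ^ Suc (\<Sum>i\<in>C. m i)) *
     (gauss_integral h (\<Prod>C\<in>\<pi>. gpoly m C) - of_real (gauss_mean h (\<Prod>C\<in>\<pi>. gpoly m C)) * gauss_integral h 1))"
    by (intro exp_small_sum poly_bounded_mult_exp_small weight_poly_bounded gauss_integral_gauss_mean_exp_small)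
  then have 2: "exp_small X (\<lambda>h x. gauss_integral h (qpoly m h B) - of_real (gauss_mean h (qpoly m h B)) * gauss_integral h 1)"
    by (rule exp_small_mono) (simp add: gauss_integral_qpoly gauss_mean_qpoly sum_subtractf sum_distrib_left right_diff_distrib mult_ac)
  show ?thesis by (rule exp_small_mono[OF exp_small_add[OF 1 2]]) simp
qed

text \<open>The integral for B is divided by the one for the empty set. The threshold h0 comes from
  the latter, which is the same for every m, so one h0 serves all blocks of all partitions.\<close>

lemma q_bracket_exp_small:
  obtains h0 where "h0 > 0" "\<And>(m :: 'i \<Rightarrow> nat) B. finite B \<Longrightarrow> exp_small (\<lambda>h (x::unit). h \<le> h0)
     (\<lambda>h x. of_real (q_bracket (\<lambda>lam. \<Prod>i\<in>B. p (m i) lam) (exp (- h)) - gauss_mean h (qpoly m h B)))"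
proof -
  define F where "F = (\<lambda>h. bracket_integral (\<lambda>_::'i. 0) h {})"
  have F: "bracket_integral m h {} = F h" for m :: "'i \<Rightarrow> nat" and h
    by (simp add: F_def bracket_integral_def pexp_def partition_on_empty)
  have q1: "qpoly (\<lambda>_::'i. 0) h {} = 1" for h by (simp add: qpoly_def pexp_def partition_on_empty)
  have F1: "exp_small (\<lambda>h (x::unit). True) (\<lambda>h x. F h - gauss_integral h 1)"
    using bracket_integral_exp_small[of "{}" "\<lambda>h (x::unit). True" "\<lambda>_::'i. 0"] by (simp add: F q1)
  obtain K c where K: "K \<ge> 0" "c > 0" "\<And>h. 0 < h \<Longrightarrow> h \<le> 1 \<Longrightarrow> norm ((F h - gauss_integral h 1) * (1 / gauss_integral h 1)) \<le> K * exp (- c / h)"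
    using exp_small_mult_poly_bounded[OF F1 gauss_integral_1_inverse_poly_bounded] by (rule exp_small_E) blast
  show ?thesis
  \<comment> \<open>For h below this bound K exp(- c / h) \<le> K h / c \<le> 1/2, so the quotient u
    stays at distance at least 1/2 from 0.\<close>
  proof (rule that[of "c / (2 * K + 1)"])
    show "c / (2 * K + 1) > 0" using K by simp
    fix m :: "'i \<Rightarrow> nat" and B :: "'i set" assume B: "finite B"
    let ?G = "\<lambda>h. complex_of_real (gauss_mean h (qpoly m h B))"
    have "exp_small (\<lambda>h (x::unit). h \<le> c / (2 * K + 1)) (\<lambda>h x. 2 * (((bracket_integral m h B - ?G h * gauss_integral h 1) - ?G h * (F h - gauss_integral h 1)) * (1 / gauss_integral h 1)))"
      by (intro poly_bounded_mult_exp_small exp_small_mult_poly_bounded exp_small_diff[OF bracket_integral_exp_small[OF B] poly_bounded_mult_exp_small[OF gauss_mean_qpoly_poly_bounded]] poly_bounded_const gauss_integral_1_inverse_poly_bounded)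
         (rule exp_small_mono[OF F1], simp)
    then show "exp_small (\<lambda>h (x::unit). h \<le> c / (2 * K + 1))
     (\<lambda>h x. of_real (q_bracket (\<lambda>lam. \<Prod>i\<in>B. p (m i) lam) (exp (- h)) - gauss_mean h (qpoly m h B)))"
    proof (rule exp_small_mono, intro conjI)
      fix h :: real assume h: "0 < h" "h \<le> 1" and hc: "h \<le> c / (2 * K + 1)"
      show "h \<le> c / (2 * K + 1)" by fact
      let ?q = "of_real (q_bracket (\<lambda>lam. \<Prod>i\<in>B. p (m i) lam) (exp (- h)) - gauss_mean h (qpoly m h B)) :: complex"
      define u where "u = F h / gauss_integral h 1"
      have J0: "gauss_integral h 1 \<noteq> 0"
      proof -
        have "0 < exp (- (1 / 2)) * h" using h by simp
        then show ?thesis using gauss_integral_1_ge[OF h] by auto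
      qed
      have "?q * u = (bracket_integral m h B - ?G h * F h) / gauss_integral h 1"
        using q_bracket_bracket_integral[OF h B, of m] by (simp add: u_def F left_diff_distrib diff_divide_distrib)
      also have "\<dots> = ((bracket_integral m h B - ?G h * gauss_integral h 1) - ?G h * (F h - gauss_integral h 1)) * (1 / gauss_integral h 1)"
        using J0 by (simp add: field_simps)
      finally have qu: "?q * u = \<dots>" .
      have "(F h - gauss_integral h 1) * (1 / gauss_integral h 1) = u - 1" using J0 by (simp add: u_def field_simps)
      then have "norm (u - 1) \<le> K * exp (- c / h)" using K(3)[OF h] by simp
      also have "\<dots> \<le> K * (h / c)"
      proof (intro mult_left_mono K(1))
        have "c / h \<le> exp (c / h)" using exp_ge_add_one_self[of "c / h"] by linarith
        then show "exp (- c / h) \<le> h / c" using h K(2) by (simp add: exp_minus field_simps)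
      qed
      also have "\<dots> \<le> 1 / 2"
      proof -
        have "h * (2 * K + 1) \<le> c" using hc K by (simp add: field_simps)
        then have "2 * (K * h) \<le> c" using h by (simp add: algebra_simps)
        then show ?thesis using K(2) by (simp add: field_simps)
      qed
      finally have "norm (u - 1) \<le> 1 / 2" .
      moreover have "1 \<le> norm u + norm (u - 1)" using norm_triangle_ineq4[of u "u - 1"] by simp
      ultimately have "1 / 2 \<le> norm u" by linarith
      then have "norm ?q * 1 \<le> norm ?q * (2 * norm u)" by (intro mult_left_mono) auto
      then have "norm ?q \<le> 2 * norm (?q * u)" by (simp add: norm_mult)
      then show "norm ?q \<le> norm (2 * (((bracket_integral m h B - ?G h * gauss_integral h 1) - ?G h * (F h - gauss_integral h 1)) * (1 / gauss_integral h 1)))"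
        unfolding qu by (simp only: norm_mult norm_numeral)
    qed
  qed
qed

section \<open>The elementary cumulants\<close>

lemma coeff_funpow_pderiv:
  fixes q :: "real poly"
  shows "coeff ((pderiv ^^ k) q) j = fact (j + k) / fact j * coeff q (j + k)"
proof (induction k arbitrary: j)
  case (Suc k)
  have "coeff ((pderiv ^^ Suc k) q) j = real (Suc j) * (fact (Suc j + k) / fact (Suc j) * coeff q (Suc j + k))"
    by (simp add: coeff_pderiv Suc del: fact_Suc)
  also have "\<dots> = fact (j + Suc k) / fact j * coeff q (j + Suc k)"
    unfolding fact_Suc[of j] by (simp del: fact_Suc of_nat_Suc)
  finally show ?case .
qed simp

lemma degree_funpow_pderiv_le: "degree ((pderiv ^^ k) q) \<le> degree (q :: real poly)"
  by (induction k) (auto simp: degree_pderiv)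

lemma degree_gpoly: "degree (gpoly m C) \<le> Suc (\<Sum>i\<in>C. m i)"
  unfolding gpoly_def by (rule order_trans[OF degree_funpow_pderiv_le degree_mainpoly])

text \<open>The outer derivative completes the \<open>card C\<close> - 1 inner ones to
  \<open>card C\<close>, which shifts the argument of zfrak by \<open>card C\<close> and turns 1 /
  (d + \<open>card C\<close>)! into 1 / d!.\<close>

lemma coeff_pderiv_gpoly:
  assumes "card C \<ge> 1"
  shows "coeff (pderiv (gpoly m C)) d = fact (\<Sum>i\<in>C. m i) * zfrak (int (\<Sum>i\<in>C. m i) - int (card C) - int d + 1) / fact d"
proof -
  obtain k where k: "card C = Suc k" using assms by (cases "card C") auto
  have "coeff (pderiv (gpoly m C)) d = coeff ((pderiv ^^ card C) (mainpoly (\<Sum>i\<in>C. m i))) d"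
    by (simp add: gpoly_def k)
  also have "\<dots> = fact (\<Sum>i\<in>C. m i) * zfrak (int (Suc (\<Sum>i\<in>C. m i)) - int (d + card C)) / fact d"
    by (simp add: coeff_funpow_pderiv coeff_mainpoly)
  also have "int (Suc (\<Sum>i\<in>C. m i)) - int (d + card C) = int (\<Sum>i\<in>C. m i) - int (card C) - int d + 1" by simp
  finally show ?thesis .
qed

lemma coeff_gpoly_0:
  assumes "card C \<ge> 1"
  shows "coeff (gpoly m C) 0 = fact (\<Sum>i\<in>C. m i) * zfrak (int (\<Sum>i\<in>C. m i) - int (card C) + 2)"
proof -
  have "int (Suc (\<Sum>i\<in>C. m i)) - int (card C - 1) = int (\<Sum>i\<in>C. m i) - int (card C) + 2" using assms by simp
  then show ?thesis by (simp add: gpoly_def coeff_funpow_pderiv coeff_mainpoly del: of_nat_Suc)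
qed

text \<open>The congruence says that the argument of zfrak is even; for all other tuples one factor
  is 0.\<close>

lemma coeff_prod_pderiv_gpoly:
  assumes \<alpha>: "finite \<alpha>" "\<And>C. C \<in> \<alpha> \<Longrightarrow> card C \<ge> 1"
  shows "coeff (\<Prod>C\<in>\<alpha>. pderiv (gpoly m C)) k =
    (\<Sum>d | d \<in> \<alpha> \<rightarrow>\<^sub>E UNIV \<and> (\<Sum>B\<in>\<alpha>. d B) = k \<and>
                (\<forall>B\<in>\<alpha>. [int (d B) = 1 + int (\<Sum>i\<in>B. m i) - int (card B)] (mod 2)).
            1 / (\<Prod>B\<in>\<alpha>. fact (d B)) *
            (\<Prod>B\<in>\<alpha>. fact (\<Sum>i\<in>B. m i) *
               zfrak (int (\<Sum>i\<in>B. m i) - int (card B) - int (d B) + 1)))"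
proof -
  let ?t = "\<lambda>d B. fact (\<Sum>i\<in>B. m i) * zfrak (int (\<Sum>i\<in>B. m i) - int (card B) - int (d B) + 1)"
  have "coeff (\<Prod>C\<in>\<alpha>. pderiv (gpoly m C)) k = (\<Sum>d | d \<in> \<alpha> \<rightarrow>\<^sub>E UNIV \<and> sum d \<alpha> = k. \<Prod>B\<in>\<alpha>. ?t d B / fact (d B))"
    unfolding coeff_prod_PiE[OF \<alpha>(1)] by (intro sum.cong prod.cong refl coeff_pderiv_gpoly \<alpha>(2))
  also have "\<dots> = (\<Sum>d | d \<in> \<alpha> \<rightarrow>\<^sub>E UNIV \<and> (\<Sum>B\<in>\<alpha>. d B) = k \<and>
                (\<forall>B\<in>\<alpha>. [int (d B) = 1 + int (\<Sum>i\<in>B. m i) - int (card B)] (mod 2)).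
            1 / (\<Prod>B\<in>\<alpha>. fact (d B)) * (\<Prod>B\<in>\<alpha>. ?t d B))"
  proof (rule sum.mono_neutral_cong_right)
    show "finite {d \<in> \<alpha> \<rightarrow>\<^sub>E UNIV. sum d \<alpha> = k}" by (rule finite_PiE_sum[OF \<alpha>(1)])
    show "\<forall>d\<in>{d \<in> \<alpha> \<rightarrow>\<^sub>E UNIV. sum d \<alpha> = k} - {d. d \<in> \<alpha> \<rightarrow>\<^sub>E UNIV \<and> (\<Sum>B\<in>\<alpha>. d B) = k \<and>
                (\<forall>B\<in>\<alpha>. [int (d B) = 1 + int (\<Sum>i\<in>B. m i) - int (card B)] (mod 2))}.
        (\<Prod>B\<in>\<alpha>. ?t d B / fact (d B)) = 0"
    proof
      fix d assume "d \<in> {d \<in> \<alpha> \<rightarrow>\<^sub>E UNIV. sum d \<alpha> = k} - {d. d \<in> \<alpha> \<rightarrow>\<^sub>E UNIV \<and> (\<Sum>B\<in>\<alpha>. d B) = k \<and>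
                (\<forall>B\<in>\<alpha>. [int (d B) = 1 + int (\<Sum>i\<in>B. m i) - int (card B)] (mod 2))}"
      then obtain B where B: "B \<in> \<alpha>" "\<not> [int (d B) = 1 + int (\<Sum>i\<in>B. m i) - int (card B)] (mod 2)" by blast
      then have "odd (1 + int (\<Sum>i\<in>B. m i) - int (card B) - int (d B))"
        by (metis cong_iff_dvd_diff cong_sym)
      also have "1 + int (\<Sum>i\<in>B. m i) - int (card B) - int (d B) = int (\<Sum>i\<in>B. m i) - int (card B) - int (d B) + 1" by simp
      finally have "?t d B / fact (d B) = 0" by (simp add: zfrak_odd)
      then show "(\<Prod>B\<in>\<alpha>. ?t d B / fact (d B)) = 0" using \<alpha>(1) B(1) by (meson prod_zero)
    qed
  qed (auto simp: prod_dividef)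
  finally show ?thesis .
qed

text \<open>In the weight of a block the powers of 1 / h given by m are one factor per index and can
  be pulled out; the remaining 1 / h per block is the scaling of \<open>tilt\<close>.\<close>

lemma gauss_mean_qpoly_gauss_mu:
  assumes "finite B"
  shows "gauss_mean h (qpoly m h B) = (\<Prod>i\<in>B. 1 / h ^ m i) * gauss_mu (gpoly m) h B"
proof -
  have c: "(\<Prod>i\<in>C. [:1 / h ^ m i:]) = [:\<Prod>i\<in>C. 1 / h ^ m i:]" for C
    by (induction C rule: infinite_finite_induct) auto
  have "(\<Prod>i\<in>C. 1 / h ^ m i) = 1 / h ^ (\<Sum>i\<in>C. m i)" for C
    by (simp add: prod_dividef power_sum)
  then have "(\<lambda>C. smult (1 / h ^ Suc (\<Sum>i\<in>C. m i)) (gpoly m C)) = (\<lambda>C. (\<Prod>i\<in>C. [:1 / h ^ m i:]) * smult (1 / h) (gpoly m C))"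
    by (simp add: c)
  then have "qpoly m h B = (\<Prod>i\<in>B. [:1 / h ^ m i:]) * tilt (gpoly m) h B"
    by (simp only: qpoly_def tilt_def pexp_scale[OF assms])
  then have "qpoly m h B = smult (\<Prod>i\<in>B. 1 / h ^ m i) (tilt (gpoly m) h B)" unfolding c by simp
  then show ?thesis by (simp only: gauss_mean_smult gauss_mu_def)
qed

text \<open>With w the polynomial of \<open>plog_gauss_mu_poly\<close>, the cumulant is w(h) /
  h^(|m| + 1). As w has degree at most |m| + 1, reversing its coefficients gives a polynomial in 1 /
  h, whose coefficient of that degree is w(0).\<close>

lemma plog_gauss_mean_qpoly:
  assumes B: "finite B" "B \<noteq> {}"
  obtains P where "\<And>h. h \<noteq> 0 \<Longrightarrow> plog (\<lambda>C. gauss_mean h (qpoly m h C)) B = poly P (1 / h)"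
    "coeff P (Suc (\<Sum>i\<in>B. m i)) = (\<Sum>\<alpha> | partition_on B \<alpha>. if card \<alpha> = 1 then coeff (gpoly m B) 0
        else (- 1) ^ (card \<alpha> - 1) * (fact (card \<alpha> - 2) * coeff (\<Prod>C\<in>\<alpha>. pderiv (gpoly m C)) (card \<alpha> - 2)))"
proof -
  let ?M = "\<Sum>i\<in>B. m i"
  obtain w where w: "\<And>h. h \<noteq> 0 \<Longrightarrow> h * plog (gauss_mu (gpoly m) h) B = poly w h" "degree w \<le> Suc ?M"
    "coeff w 0 = (\<Sum>\<alpha> | partition_on B \<alpha>. if card \<alpha> = 1 then coeff (gpoly m B) 0
        else (- 1) ^ (card \<alpha> - 1) * (fact (card \<alpha> - 2) * coeff (\<Prod>C\<in>\<alpha>. pderiv (gpoly m C)) (card \<alpha> - 2)))"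
    using plog_gauss_mu_poly[OF B degree_gpoly, of m] by blast
  define P where "P = (\<Sum>j\<le>Suc ?M. monom (coeff w j) (Suc ?M - j))"
  show thesis
  proof (rule that)
    have "coeff P (Suc ?M) = (\<Sum>j\<le>Suc ?M. if j = 0 then coeff w 0 else 0)"
      unfolding P_def coeff_sum by (intro sum.cong) auto
    then show "coeff P (Suc ?M) = (\<Sum>\<alpha> | partition_on B \<alpha>. if card \<alpha> = 1 then coeff (gpoly m B) 0
        else (- 1) ^ (card \<alpha> - 1) * (fact (card \<alpha> - 2) * coeff (\<Prod>C\<in>\<alpha>. pderiv (gpoly m C)) (card \<alpha> - 2)))"
      using w(3) by simp
    fix h :: real assume h: "h \<noteq> 0"
    have "plog (\<lambda>C. gauss_mean h (qpoly m h C)) B = plog (\<lambda>C. (\<Prod>i\<in>C. 1 / h ^ m i) * gauss_mu (gpoly m) h C) B"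
      using finite_subset[OF _ B(1)] by (intro plog_cong gauss_mean_qpoly_gauss_mu) auto
    also have "\<dots> = (\<Prod>i\<in>B. 1 / h ^ m i) * plog (gauss_mu (gpoly m) h) B" by (rule plog_scale[OF B(1)])
    also have "(\<Prod>i\<in>B. 1 / h ^ m i) = 1 / h ^ ?M" by (simp add: prod_dividef power_sum)
    also have "1 / h ^ ?M * plog (gauss_mu (gpoly m) h) B = poly w h / h ^ Suc ?M"
      using w(1)[OF h] h by (simp add: field_simps)
    also have "poly w h = (\<Sum>j\<le>Suc ?M. coeff w j * h ^ j)" 
      unfolding poly_altdef using w(2) by (intro sum.mono_neutral_left) (auto simp: coeff_eq_0)
    also have "\<dots> / h ^ Suc ?M = (\<Sum>j\<le>Suc ?M. coeff w j * (1 / h) ^ (Suc ?M - j))"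
      unfolding sum_divide_distrib
    proof (intro sum.cong refl)
      fix j assume "j \<in> {..Suc ?M}"
      then have "h ^ Suc ?M = h ^ j * h ^ (Suc ?M - j)" by (simp flip: power_add)
      then show "coeff w j * h ^ j / h ^ Suc ?M = coeff w j * (1 / h) ^ (Suc ?M - j)"
        using h by (simp add: power_one_over del: power_Suc)
    qed
    also have "\<dots> = poly P (1 / h)" by (simp add: P_def poly_sum poly_monom)
    finally show "plog (\<lambda>C. gauss_mean h (qpoly m h C)) B = poly P (1 / h)" .
  qed
qed

section \<open>Uniqueness of the asymptotic polynomial and conclusion\<close>

lemma poly_tendsto_0_imp_0:
  fixes Q :: "real poly"
  assumes "(poly Q \<longlongrightarrow> 0) at_top"
  shows "Q = 0"
proof (rule ccontr)
  assume "Q \<noteq> 0"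
  have *: False if pos: "lead_coeff Q > 0" and lim: "(poly Q \<longlongrightarrow> 0) at_top" for Q :: "real poly"
  proof -
    obtain n where n: "\<And>x. x \<ge> n \<Longrightarrow> lead_coeff Q \<le> poly Q x" using poly_pinfty_gt_lc[OF pos] by blast
    have "lead_coeff Q \<le> 0"
      by (rule tendsto_lowerbound[OF lim]) (auto intro: n eventually_mono[OF eventually_ge_at_top[of n]])
    then show False using pos by simp
  qed
  have "lead_coeff Q > 0 \<or> lead_coeff (- Q) > 0" using \<open>Q \<noteq> 0\<close> leading_coeff_0_iff[of Q]
    by (simp del: leading_coeff_0_iff) linarith
  moreover have "poly (- Q) = (\<lambda>x. - poly Q x)" by (rule ext) simp
  then have "(poly (- Q) \<longlongrightarrow> 0) at_top" using tendsto_minus[OF assms] by (simp only: minus_zero)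
  ultimately show False using *[of Q] *[of "- Q"] assms by blast
qed

lemma exp_small_tendsto_0:
  fixes f :: "real \<Rightarrow> real"
  assumes "c > 0" "f \<in> O[at_right 0](\<lambda>h. exp (- c / h) / h powr C)"
  shows "(f \<longlongrightarrow> 0) (at_right 0)"
proof -
  have "((\<lambda>h. exp (- c / h) / h powr C) \<longlongrightarrow> 0) (at_right 0)" using assms(1) by real_asymp
  then have "(\<lambda>h. exp (- c / h) / h powr C) \<in> o[at_right 0](\<lambda>_. 1)" by (intro smalloI_tendsto) auto
  with assms(2) have "f \<in> o[at_right 0](\<lambda>_. 1)" by (rule landau_o.big_small_trans)
  then show ?thesis by (simp add: smalloD_tendsto[where g = "\<lambda>_. 1::real", simplified])
qed

text \<open>The difference of two candidates tends to 0 with h, and a polynomial tending to 0 at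
  infinity is zero. This justifies the \<open>THE\<close> in
  \<open>connected_h_bracket\<close>.\<close>

lemma asymptotic_poly_unique:
  fixes F :: "real \<Rightarrow> real"
  assumes "c > 0" "(\<lambda>h. F h - poly P (1 / h)) \<in> O[at_right 0](\<lambda>h. exp (- c / h) / h powr C)"
    and "c' > 0" "(\<lambda>h. F h - poly P' (1 / h)) \<in> O[at_right 0](\<lambda>h. exp (- c' / h) / h powr C')"
  shows "P' = P"
proof -
  have "((\<lambda>h. poly (P' - P) (1 / h)) \<longlongrightarrow> 0 - 0) (at_right 0)"
    using tendsto_diff[OF exp_small_tendsto_0[OF assms(1,2)] exp_small_tendsto_0[OF assms(3,4)]] by simp
  moreover have "filterlim (\<lambda>x::real. 1 / x) (at_right 0) at_top" by real_asymp
  ultimately have "((\<lambda>x. poly (P' - P) (1 / (1 / x))) \<longlongrightarrow> 0) at_top"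
    by (simp only: diff_0_right) (rule filterlim_compose)
  moreover have "(\<lambda>x. poly (P' - P) (1 / (1 / x))) = poly (P' - P)" by (rule ext) simp
  ultimately have "P' - P = 0" by (intro poly_tendsto_0_imp_0) (simp only:)
  then show ?thesis by simp
qed

text \<open>Each bracket in the products over blocks is replaced by its Gaussian mean at an
  exponentially small cost, which turns the connected bracket into a \<open>plog\<close> of Gaussian
  means.\<close>

lemma connected_bracket_exp_small:
  obtains h0 where "h0 > 0" "exp_small (\<lambda>h (x::unit). h \<le> h0)
    (\<lambda>h x. of_real (connected_q_bracket n (\<lambda>i. p (m i)) (exp (- h)) - plog (\<lambda>C. gauss_mean h (qpoly m h C)) {1..n}))"
proof -
  obtain h0 where h0: "h0 > 0" "\<And>(m :: nat \<Rightarrow> nat) B. finite B \<Longrightarrow> exp_small (\<lambda>h (x::unit). h \<le> h0)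
     (\<lambda>h x. of_real (q_bracket (\<lambda>lam. \<Prod>i\<in>B. p (m i) lam) (exp (- h)) - gauss_mean h (qpoly m h B)))"
    by (rule q_bracket_exp_small) blast
  show thesis
  proof (rule that[OF h0(1)])
    let ?G = "\<lambda>h C. complex_of_real (gauss_mean h (qpoly m h C))"
    let ?K = "\<lambda>h C. complex_of_real (q_bracket (\<lambda>lam. \<Prod>i\<in>C. p (m i) lam) (exp (- h)))"
    have "exp_small (\<lambda>h (x::unit). h \<le> h0) (\<lambda>h x. \<Sum>\<alpha> | partition_on {1..n} \<alpha>. of_real ((- 1) ^ (card \<alpha> - 1) * fact (card \<alpha> - 1)) *
        ((\<Prod>C\<in>\<alpha>. ?K h C) - (\<Prod>C\<in>\<alpha>. ?G h C)))"
    proof (intro exp_small_sum poly_bounded_mult_exp_small poly_bounded_const exp_small_prod_diff gauss_mean_qpoly_poly_bounded)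
      fix \<alpha> C assume "\<alpha> \<in> {\<alpha>. partition_on {1..n} \<alpha>}" "C \<in> \<alpha>"
      then have "finite C" using finite_subset[of C "{1..n}"] by (auto simp: partition_on_def)
      from h0(2)[OF this, of m] show "exp_small (\<lambda>h (x::unit). h \<le> h0) (\<lambda>h x. ?K h C - ?G h C)" by simp
    qed
    then show "exp_small (\<lambda>h (x::unit). h \<le> h0)
      (\<lambda>h x. of_real (connected_q_bracket n (\<lambda>i. p (m i)) (exp (- h)) - plog (\<lambda>C. gauss_mean h (qpoly m h C)) {1..n}))"
      by (rule exp_small_mono) (simp add: connected_q_bracket_def plog_def set_partitions_def sum_subtractf right_diff_distrib)
  qed
qed

lemma connected_h_bracket_eq:
  assumes n: "n \<ge> 1"
  shows "coeff (connected_h_bracket n (\<lambda>i. p (m i))) (Suc (\<Sum>i=1..n. m i)) =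
    (\<Sum>\<alpha> | partition_on {1..n} \<alpha>. if card \<alpha> = 1 then coeff (gpoly m {1..n}) 0
        else (- 1) ^ (card \<alpha> - 1) * (fact (card \<alpha> - 2) * coeff (\<Prod>C\<in>\<alpha>. pderiv (gpoly m C)) (card \<alpha> - 2)))"
proof -
  obtain P where P: "\<And>h. h \<noteq> 0 \<Longrightarrow> plog (\<lambda>C. gauss_mean h (qpoly m h C)) {1..n} = poly P (1 / h)"
    "coeff P (Suc (\<Sum>i=1..n. m i)) = (\<Sum>\<alpha> | partition_on {1..n} \<alpha>. if card \<alpha> = 1 then coeff (gpoly m {1..n}) 0
        else (- 1) ^ (card \<alpha> - 1) * (fact (card \<alpha> - 2) * coeff (\<Prod>C\<in>\<alpha>. pderiv (gpoly m C)) (card \<alpha> - 2)))"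
    by (rule plog_gauss_mean_qpoly[of "{1..n}" m]) (use n in auto)
  let ?F = "\<lambda>h. connected_q_bracket n (\<lambda>i. p (m i)) (exp (- h))"
  obtain h0 where h0: "h0 > 0" "exp_small (\<lambda>h (x::unit). h \<le> h0)
    (\<lambda>h x. of_real (?F h - plog (\<lambda>C. gauss_mean h (qpoly m h C)) {1..n}))"
    by (rule connected_bracket_exp_small[of n m]) blast
  obtain K c where K: "c > 0" "\<And>h. 0 < h \<Longrightarrow> h \<le> 1 \<Longrightarrow> h \<le> h0 \<Longrightarrow>
     norm (complex_of_real (?F h - plog (\<lambda>C. gauss_mean h (qpoly m h C)) {1..n})) \<le> K * exp (- c / h)"
    using h0(2) by (rule exp_small_E) blast
  \<comment> \<open>The exponent of h can be 0 because \<open>exp_small\<close> has already absorbed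
    all powers of h into the exponential.\<close>
  have O: "(\<lambda>h. ?F h - poly P (1 / h)) \<in> O[at_right 0](\<lambda>h. exp (- c / h) / h powr 0)"
  proof (rule bigoI)
    have "\<forall>\<^sub>F h in at_right 0. h \<in> {0<..<min 1 h0}" using h0(1) by (intro eventually_at_right_real) auto
    then show "\<forall>\<^sub>F h in at_right 0. norm (?F h - poly P (1 / h)) \<le> K * norm (exp (- c / h) / h powr 0)"
    proof eventually_elim
      case (elim h)
      then show ?case using K(2)[of h] P(1)[of h] by (simp flip: of_real_diff)
    qed
  qed
  have "connected_h_bracket n (\<lambda>i. p (m i)) = P"
    unfolding connected_h_bracket_def
  proof (rule the_equality)
    show "\<exists>c>0. \<exists>C. (\<lambda>h. ?F h - poly P (1 / h)) \<in> O[at_right 0](\<lambda>h. exp (- c / h) / h powr C)"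
      using K(1) O by blast
    show "P' = P" if "\<exists>c>0. \<exists>C. (\<lambda>h. ?F h - poly P' (1 / h)) \<in> O[at_right 0](\<lambda>h. exp (- c / h) / h powr C)" for P'
      using that asymptotic_poly_unique[OF K(1) O] by blast
  qed
  then show ?thesis using P(2) by simp
qed

theorem theorem6p7:
  fixes n :: nat and m :: "nat \<Rightarrow> nat"
  assumes "n \<ge> 1"
    and "\<And>i. i \<in> {1..n} \<Longrightarrow> m i \<ge> 1"
  shows "elementary_cumulant n m =
    (\<Sum>\<alpha>\<in>set_partitions n.
       if card \<alpha> = 1
       then fact (\<Sum>i=1..n. m i) * zfrak (int (\<Sum>i=1..n. m i) - int n + 2)
       else (-1) ^ (card \<alpha> - 1) * fact (card \<alpha> - 2) *
         (\<Sum>d | d \<in> \<alpha> \<rightarrow>\<^sub>E UNIV \<and> (\<Sum>B\<in>\<alpha>. d B) = card \<alpha> - 2 \<and>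
                (\<forall>B\<in>\<alpha>. [int (d B) = 1 + int (\<Sum>i\<in>B. m i) - int (card B)] (mod 2)).
            1 / (\<Prod>B\<in>\<alpha>. fact (d B)) *
            (\<Prod>B\<in>\<alpha>. fact (\<Sum>i\<in>B. m i) *
               zfrak (int (\<Sum>i\<in>B. m i) - int (card B) - int (d B) + 1))))"
proof -
  have "elementary_cumulant n m = (\<Sum>\<alpha> | partition_on {1..n} \<alpha>. if card \<alpha> = 1 then coeff (gpoly m {1..n}) 0
        else (- 1) ^ (card \<alpha> - 1) * (fact (card \<alpha> - 2) * coeff (\<Prod>C\<in>\<alpha>. pderiv (gpoly m C)) (card \<alpha> - 2)))"
    using connected_h_bracket_eq[OF assms(1), of m] by (simp add: elementary_cumulant_def)
  also have "\<dots> = (\<Sum>\<alpha>\<in>set_partitions n.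
       if card \<alpha> = 1
       then fact (\<Sum>i=1..n. m i) * zfrak (int (\<Sum>i=1..n. m i) - int n + 2)
       else (-1) ^ (card \<alpha> - 1) * fact (card \<alpha> - 2) *
         (\<Sum>d | d \<in> \<alpha> \<rightarrow>\<^sub>E UNIV \<and> (\<Sum>B\<in>\<alpha>. d B) = card \<alpha> - 2 \<and>
                (\<forall>B\<in>\<alpha>. [int (d B) = 1 + int (\<Sum>i\<in>B. m i) - int (card B)] (mod 2)).
            1 / (\<Prod>B\<in>\<alpha>. fact (d B)) *
            (\<Prod>B\<in>\<alpha>. fact (\<Sum>i\<in>B. m i) *
               zfrak (int (\<Sum>i\<in>B. m i) - int (card B) - int (d B) + 1))))"
    unfolding set_partitions_def
  proof (intro sum.cong refl if_cong)
    show "coeff (gpoly m {1..n}) 0 = fact (\<Sum>i=1..n. m i) * zfrak (int (\<Sum>i=1..n. m i) - int n + 2)"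
      using coeff_gpoly_0[of "{1..n}" m] assms(1) by simp
    fix \<alpha> assume "\<alpha> \<in> {\<alpha>. partition_on {1..n} \<alpha>}"
    then have part: "partition_on {1..n} \<alpha>" by simp
    have fin: "finite \<alpha>" using part by (rule finite_elements[rotated]) simp
    have card: "card C \<ge> 1" if "C \<in> \<alpha>" for C
    proof -
      have "C \<subseteq> {1..n}" "C \<noteq> {}" using part that by (auto simp: partition_on_def)
      then show ?thesis using finite_subset[of C "{1..n}"] by (simp add: Suc_le_eq card_gt_0_iff)
    qed
    \<comment> \<open>Reading off the coefficient of degree \<open>card \<alpha>\<close> - 2 is what
      prescribes the sum of the tuple d.\<close>
    have c: "coeff (\<Prod>C\<in>\<alpha>. pderiv (gpoly m C)) (card \<alpha> - 2) =
         (\<Sum>d | d \<in> \<alpha> \<rightarrow>\<^sub>E UNIV \<and> (\<Sum>B\<in>\<alpha>. d B) = card \<alpha> - 2 \<and>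
                (\<forall>B\<in>\<alpha>. [int (d B) = 1 + int (\<Sum>i\<in>B. m i) - int (card B)] (mod 2)).
            1 / (\<Prod>B\<in>\<alpha>. fact (d B)) *
            (\<Prod>B\<in>\<alpha>. fact (\<Sum>i\<in>B. m i) *
               zfrak (int (\<Sum>i\<in>B. m i) - int (card B) - int (d B) + 1)))"
      by (rule coeff_prod_pderiv_gpoly[OF fin]) (rule card)
    show "(- 1) ^ (card \<alpha> - 1) * (fact (card \<alpha> - 2) * coeff (\<Prod>C\<in>\<alpha>. pderiv (gpoly m C)) (card \<alpha> - 2)) =
      (-1) ^ (card \<alpha> - 1) * fact (card \<alpha> - 2) *
         (\<Sum>d | d \<in> \<alpha> \<rightarrow>\<^sub>E UNIV \<and> (\<Sum>B\<in>\<alpha>. d B) = card \<alpha> - 2 \<and>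
                (\<forall>B\<in>\<alpha>. [int (d B) = 1 + int (\<Sum>i\<in>B. m i) - int (card B)] (mod 2)).
            1 / (\<Prod>B\<in>\<alpha>. fact (d B)) *
            (\<Prod>B\<in>\<alpha>. fact (\<Sum>i\<in>B. m i) *
               zfrak (int (\<Sum>i\<in>B. m i) - int (card B) - int (d B) + 1)))"
      unfolding c by (simp only: mult.assoc)
  qed
  finally show ?thesis .
qed

end
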